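(* Let $1\le p,q\le\infty$ with $\frac1p+\frac1q=1$. For $n=1,2$ let $\Psi_n\subset\mathcal{H}_n$ be an $\mathcal{A}_n$-localised frame and let $w_n$ be an $\mathcal{A}_n$-admissible weight. Then: (i) A linear operator $O:\mathcal{H}^1_{w_1}(\Psi_1)\to\mathcal{H}^p_{1/w_2}(\Psi_2)$ is bounded if and only if its kernel $K$ is contained in $\mathfrak{H}^{p,\infty}_{1/(w_1\otimes w_2)}(\Psi_1\otimes\Psi_2)$ or, alternatively, if and only if its Galerkin matrix $k$ belongs to $\mathfrak{l}^{p,\infty}_{1/(w_1\otimes w_2)}(I\times J)$; and in that case $$\|O\|_{\mathcal{H}^1_{w_1}(\Psi_1)\to\mathcal{H}^p_{1/w_2}(\Psi_2)}\asymp\|K\|_{\mathfrak{H}^{p,\infty}_{1/(w_1\otimes w_2)}(\Psi_1\otimes\Psi_2)}=\|k\|_{\mathfrak{l}^{p,\infty}_{1/(w_1\otimes w_2)}(I\times J)}.$$ (ii) A linear operator $O:\mathcal{H}^p_{w_1}(\Psi_1)\to\mathcal{H}^\infty_{1/w_2}(\Psi_2)$ is bounded if and only if its kernel $K$ is contained in $\mathcal{H}^{q,\infty}_{1/(w_1\otimes w_2)}(\Psi_1\otimes\Psi_2)$ or, alternatively, if and only if its Galerkin matrix $k$ belongs to $\ell^{q,\infty}_{1/(w_1\otimes w_2)}(I\times J)$; and in that case $$\|O\|_{\mathcal{H}^p_{w_1}(\Psi_1)\to\mathcal{H}^\infty_{1/w_2}(\Psi_2)}\asymp\|K\|_{\mathcal{H}^{q,\infty}_{1/(w_1\otimes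 w_2)}(\Psi_1\otimes\Psi_2)}=\|k\|_{\ell^{q,\infty}_{1/(w_1\otimes w_2)}(I\times J)}.$$
   Context: Conventions. $\mathcal{H},\mathcal{H}_1,\mathcal{H}_2$ are separable Hilbert spaces, with inner products linear in the first argument. $A\asymp B$ means $C^{-1}B\le A\le CB$ for some constant $C\ge1$ (independent of the operator $O$). $\|\cdot\|_{X\to Y}$ is the operator norm of operators from $X$ to $Y$. Frames. A countable family $\Psi=\{\psi_i\}_{i\in I}\subset\mathcal{H}$ is a frame if $A\|f\|^2\le\sum_i|\langle f,\psi_i\rangle|^2\le B\|f\|^2$ for all $f\in\mathcal{H}$ and some $A,B>0$. $C_\Psi f=\{\langle f,\psi_i\rangle\}_{i}$, $D_\Psi c=\sum_i c_i\psi_i$, $S_\Psi=D_\Psi C_\Psi$; the canonical dual frame is $\widetilde\Psi=\{\widetilde\psi_i\}=\{S_\Psi^{-1}\psi_i\}$. The Gram matrix is $G_\Psi=(\langle\psi_{i'},\psi_i\rangle)_{(i,i')\in I^2}$. Localisation. A spectral matrix algebra $\mathcal{A}$ is an involutive Banach algebra of infinite matrices indexed by $I\times I$ such that (a) every $A\in\mathcal{A}$ defines a bounded operator on $\ell^2(I)$; (b) if $A\in\mathcal{A}$ is invertible in $B(\ell^2(I))$ then $A^{-1}\in\mathcal{A}$; (c) $\mathcal{A}$ is solid: $A\in\mathcal{A}$ and $|b_{i,j}|\le|a_{i,j}|$ for all $i,j$ imply $B\in\mathcal{A}$ and $\|B\|_{\mathcal{A}}\le\|A\|_{\mathcal{A}}$.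 A frame $\Psi$ is $\mathcal{A}$-localised if $G_\Psi\in\mathcal{A}$. For a weight $w=\{w_i\}$, $w_i>0$, put $\|c\|_{\ell^p_w(I)}=\|c\cdot w\|_{\ell^p(I)}$; $w$ is $\mathcal{A}$-admissible if every $A\in\mathcal{A}$ defines a bounded operator on $\ell^p_w(I)$ for every $1\le p\le\infty$. Here $\mathcal{A}_1,\mathcal{A}_2$ are spectral matrix algebras over the index sets $I$ and $J$ of $\Psi_1=\{\psi_{1,i}\}_{i\in I}$ and $\Psi_2=\{\psi_{2,j}\}_{j\in J}$, which are frames for $\mathcal{H}_1$ and $\mathcal{H}_2$. Co-orbit spaces. $\mathcal{H}_{00}(\Psi)$ is the space of finite linear combinations of the $\psi_i$. For $1\le p<\infty$, $\mathcal{H}^p_w(\Psi)$ is the completion of $\mathcal{H}_{00}(\Psi)$ in the norm $\|f\|_{\mathcal{H}^p_w(\Psi)}=\|C_{\widetilde\Psi}f\|_{\ell^p_w}$. $\mathcal{H}^\infty_w(\Psi)$ is the space of equivalence classes of sequences $\{f_n\}\subset\mathcal{H}$ such that $(C_{\widetilde\Psi}f)_i:=\lim_n\langle f_n,\widetilde\psi_i\rangle$ exists for all $i$ and $\sup_n\|C_{\widetilde\Psi}f_n\|_{\ell^\infty_w}<\infty$, where $\{f_n\}\sim\{f_n'\}$ iff $\lim_n\langle f_n-f'_n,\widetilde\psi_i\rangle=0$ for all $i$, with norm $\|C_{\widetilde\Psi}f\|_{\ell^\infty_w}$. $C_{\widetilde\Psi}$ and $C_\Psi$ are extended to these spaces by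 continuity (respectively limits). Elements are identified through their coefficients $C_{\widetilde\Psi}f$; in this sense $\mathcal{H}^1_w(\Psi)\subset\mathcal{H}^p_w(\Psi)\subset\mathcal{H}^\infty_w(\Psi)$. The pairing of $\mathcal{H}^p_w(\Psi)$ and $\mathcal{H}^q_{1/w}(\Psi)$, $1/p+1/q=1$, is $\langle f,g\rangle=\sum_i(C_{\widetilde\Psi}f)_i\overline{(C_\Psi g)_i}$. Mixed norms. $\|c\|_{\ell^{p,q}_w(I\times J)}=\big(\sum_{j\in J}(\sum_{i\in I}|c_{i,j}|^pw_{i,j}^p)^{q/p}\big)^{1/q}$ and $\|c\|_{\mathfrak{l}^{p,q}_w(I\times J)}=\big(\sum_{i\in I}(\sum_{j\in J}|c_{i,j}|^pw_{i,j}^p)^{q/p}\big)^{1/q}$, with suprema when an exponent is $\infty$. $(w_1\otimes w_2)_{i,j}=w_{1,i}w_{2,j}$. Tensor products. $f_1\otimes f_2$ is the rank-one operator $f\mapsto\langle f,f_1\rangle f_2$ (antilinear in $f_1$); $\mathcal{H}_1\otimes\mathcal{H}_2$ is the Hilbert space completion of the span of simple tensors under $\langle f_1\otimes f_2,g_1\otimes g_2\rangle=\overline{\langle f_1,g_1\rangle}\langle f_2,g_2\rangle$. $\Psi_1\otimes\Psi_2=\{\psi_{1,i}\otimes\psi_{2,j}\}$ is a frame for it with canonical dual $\widetilde{\Psi_1\otimes\Psi_2}=\widetilde\Psi_1\otimes\widetilde\Psi_2$. $\mathcal{H}^{1,1}_w(\Psi_1\otimes\Psi_2)$ is the completion of the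 span of $\Psi_1\otimes\Psi_2$ in the norm $\|C_{\widetilde{\Psi_1\otimes\Psi_2}}F\|_{\ell^{1,1}_w}$. For $1\le r\le\infty$, $\mathcal{H}^{r,\infty}_w(\Psi_1\otimes\Psi_2)$ (resp. $\mathfrak{H}^{r,\infty}_w(\Psi_1\otimes\Psi_2)$) is the space of equivalence classes of sequences $\{F_n\}\subset\mathcal{H}_1\otimes\mathcal{H}_2$ such that $(C_{\widetilde{\Psi_1\otimes\Psi_2}}F)_{i,j}:=\lim_n\langle F_n,\widetilde\psi_{1,i}\otimes\widetilde\psi_{2,j}\rangle$ exists for all $(i,j)$ and $\sup_n\|C_{\widetilde{\Psi_1\otimes\Psi_2}}F_n\|<\infty$ in the norm of $\ell^{r,\infty}_w(I\times J)$ (resp. $\mathfrak{l}^{r,\infty}_w(I\times J)$); two sequences are equivalent iff $\lim_n\langle F_n-F'_n,\widetilde\psi_{1,i}\otimes\widetilde\psi_{2,j}\rangle=0$ for all $(i,j)$; the norm of $F$ is the $\ell^{r,\infty}_w$ (resp. $\mathfrak{l}^{r,\infty}_w$) norm of $C_{\widetilde{\Psi_1\otimes\Psi_2}}F$. The pairing of $\mathcal{H}^{\infty,\infty}_{1/w}$ and $\mathcal{H}^{1,1}_w$ is $\langle F,G\rangle=\sum_{i,j}(C_{\widetilde{\Psi_1\otimes\Psi_2}}F)_{i,j}\overline{(C_{\Psi_1\otimes\Psi_2}G)_{i,j}}$, with $C_{\Psi_1\otimes\Psi_2}$ extended by continuity. For $f_n\in\mathcal{H}^1_{w_n}(\Psi_n)$,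 $f_1\otimes f_2\in\mathcal{H}^{1,1}_{w_1\otimes w_2}(\Psi_1\otimes\Psi_2)$ has coefficients $\overline{(C_{\widetilde\Psi_1}f_1)_i}(C_{\widetilde\Psi_2}f_2)_j$. Kernel and Galerkin matrix. The kernel of $O$ is the $K\in\mathcal{H}^{\infty,\infty}_{1/(w_1\otimes w_2)}(\Psi_1\otimes\Psi_2)$ satisfying $\langle Of_1,f_2\rangle_{\mathcal{H}^\infty_{1/w_2}(\Psi_2),\mathcal{H}^1_{w_2}(\Psi_2)}=\langle K,f_1\otimes f_2\rangle_{\mathcal{H}^{\infty,\infty}_{1/(w_1\otimes w_2)}(\Psi_1\otimes\Psi_2),\mathcal{H}^{1,1}_{w_1\otimes w_2}(\Psi_1\otimes\Psi_2)}$ for all $f_1\in\mathcal{H}^1_{w_1}(\Psi_1)$, $f_2\in\mathcal{H}^1_{w_2}(\Psi_2)$; every bounded linear operator $\mathcal{H}^1_{w_1}(\Psi_1)\to\mathcal{H}^\infty_{1/w_2}(\Psi_2)$ has a unique kernel. The Galerkin matrix of $O$ is $k=(k_{i,j})_{(i,j)\in I\times J}$ with $k_{i,j}=\langle O\widetilde\psi_{1,i},\widetilde\psi_{2,j}\rangle_{\mathcal{H}^\infty_{1/w_2}(\Psi_2),\mathcal{H}^1_{w_2}(\Psi_2)}$.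
   Formalization: The algebras are unital; O must have a kernel; in (ii) "bounded" means that the restriction of O to H^1 has a bounded extension to H^p, and for p=∞ the upper bound on ||O|| is claimed only if O respects bounded coefficientwise limits. As literally stated, the claims fail. *)

theory Defs
  imports "HOL-Analysis.Analysis"
begin

section \<open>Complex Hilbert spaces\<close>

class complex_vector = real_vector +
  fixes scaleC :: "complex \<Rightarrow> 'a \<Rightarrow> 'a"  (infixr "*\<^sub>C" 75)
  assumes scaleC_add_right: "a *\<^sub>C (x + y) = a *\<^sub>C x + a *\<^sub>C y"
    and scaleC_add_left: "(a + b) *\<^sub>C x = a *\<^sub>C x + b *\<^sub>C x"
    and scaleC_scaleC: "a *\<^sub>C (b *\<^sub>C x) = (a * b) *\<^sub>C x"
    and scaleC_one: "1 *\<^sub>C x = x"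
    and scaleR_scaleC: "r *\<^sub>R x = complex_of_real r *\<^sub>C x"

text \<open>The inner product is linear in the first argument. Completeness is the
  one of \<^class>\<open>banach\<close>; separability is expressed, where it is needed, by
  \<^class>\<open>second_countable_topology\<close>.\<close>

class complex_hilbert = complex_vector + banach +
  fixes cinner :: "'a \<Rightarrow> 'a \<Rightarrow> complex"
  assumes cinner_commute: "cinner x y = cnj (cinner y x)"
    and cinner_add_left: "cinner (x + y) z = cinner x z + cinner y z"
    and cinner_scaleC_left: "cinner (a *\<^sub>C x) y = a * cinner x y"
    and norm_eq_sqrt_cinner: "norm x = sqrt (Re (cinner x x))"

instantiation complex :: complex_hilbert
begin

definition scaleC_complex :: "complex \<Rightarrow> complex \<Rightarrow> complex"
  where "scaleC_complex a x = a * x"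

definition cinner_complex :: "complex \<Rightarrow> complex \<Rightarrow> complex"
  where "cinner_complex x y = x * cnj y"

instance
proof
  fix x :: complex
  show "norm x = sqrt (Re (cinner x x))"
    by (simp add: cinner_complex_def cmod_def power2_eq_square)
qed (simp_all add: scaleC_complex_def cinner_complex_def algebra_simps scaleR_conv_of_real)

end

definition finite_combinations :: "('k \<Rightarrow> 'h::complex_hilbert) \<Rightarrow> 'h set" where
  "finite_combinations v = {\<Sum>k\<in>F. a k *\<^sub>C v k | F a. finite F}"

text \<open>\<open>hilbert_tensor tens\<close> says that the Hilbert space \<open>'t\<close>, together with the simple
  tensors \<open>tens f1 f2\<close>, is the completion of the span of the simple tensors under the
  inner product induced by the rank-one operators \<open>f \<mapsto> \<langle>f, f1\<rangle> f2\<close>. The completion is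
  unique up to a unitary map that fixes the simple tensors, so results are stated for every
  such pair. Antilinearity of \<open>tens\<close> in the first and linearity in the second argument
  follow from the inner product formula.\<close>

definition hilbert_tensor ::
  "('h1::complex_hilbert \<Rightarrow> 'h2::complex_hilbert \<Rightarrow> 't::complex_hilbert) \<Rightarrow> bool" where
  "hilbert_tensor tens \<longleftrightarrow>
     (\<forall>f1 f2 g1 g2. cinner (tens f1 f2) (tens g1 g2) = cnj (cinner f1 g1) * cinner f2 g2) \<and>
     closure (finite_combinations (\<lambda>(f1, f2). tens f1 f2)) = UNIV"


section \<open>Weighted sequence spaces with extended-valued norms\<close>

definition ennreal_powr :: "ennreal \<Rightarrow> real \<Rightarrow> ennreal" where
  "ennreal_powr x r = (if x = \<infinity> then \<infinity> else ennreal (enn2real x powr r))"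

definition lp_norm :: "ennreal \<Rightarrow> ('k \<Rightarrow> ennreal) \<Rightarrow> ennreal" where
  "lp_norm p a =
     (if p = \<infinity> then (SUP k. a k)
      else ennreal_powr (\<Sum>\<^sub>\<infinity>k. ennreal_powr (a k) (enn2real p)) (1 / enn2real p))"

definition wnorm :: "ennreal \<Rightarrow> ('k \<Rightarrow> real) \<Rightarrow> ('k \<Rightarrow> complex) \<Rightarrow> ennreal" where
  "wnorm p w c = lp_norm p (\<lambda>k. ennreal (cmod (c k) * w k))"

text \<open>The two mixed norms: \<open>mixed_norm p q\<close> has the inner \<open>p\<close>-norm over the first index and
  the outer \<open>q\<close>-norm over the second one; in \<open>mixed_norm_fr p q\<close> (fraktur in the usual notation)
  the inner \<open>p\<close>-norm is over the second index.\<close>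

definition mixed_norm ::
  "ennreal \<Rightarrow> ennreal \<Rightarrow> ('i \<Rightarrow> 'j \<Rightarrow> real) \<Rightarrow> ('i \<Rightarrow> 'j \<Rightarrow> complex) \<Rightarrow> ennreal" where
  "mixed_norm p q w c = lp_norm q (\<lambda>j. lp_norm p (\<lambda>i. ennreal (cmod (c i j) * w i j)))"

definition mixed_norm_fr ::
  "ennreal \<Rightarrow> ennreal \<Rightarrow> ('i \<Rightarrow> 'j \<Rightarrow> real) \<Rightarrow> ('i \<Rightarrow> 'j \<Rightarrow> complex) \<Rightarrow> ennreal" where
  "mixed_norm_fr p q w c = lp_norm q (\<lambda>i. lp_norm p (\<lambda>j. ennreal (cmod (c i j) * w i j)))"

definition lpq ::
  "ennreal \<Rightarrow> ennreal \<Rightarrow> ('i \<Rightarrow> 'j \<Rightarrow> real) \<Rightarrow> ('i \<Rightarrow> 'j \<Rightarrow> complex) set" where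
  "lpq p q w = {c. mixed_norm p q w c < \<infinity>}"

definition lpq_fr ::
  "ennreal \<Rightarrow> ennreal \<Rightarrow> ('i \<Rightarrow> 'j \<Rightarrow> real) \<Rightarrow> ('i \<Rightarrow> 'j \<Rightarrow> complex) set" where
  "lpq_fr p q w = {c. mixed_norm_fr p q w c < \<infinity>}"

definition recip :: "('k \<Rightarrow> real) \<Rightarrow> 'k \<Rightarrow> real" where
  "recip w = (\<lambda>k. 1 / w k)"

definition tensor_weight :: "('i \<Rightarrow> real) \<Rightarrow> ('j \<Rightarrow> real) \<Rightarrow> 'i \<Rightarrow> 'j \<Rightarrow> real" where
  "tensor_weight w1 w2 = (\<lambda>i j. w1 i * w2 j)"

definition recip2 :: "('i \<Rightarrow> 'j \<Rightarrow> real) \<Rightarrow> 'i \<Rightarrow> 'j \<Rightarrow> real" where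
  "recip2 w = (\<lambda>i j. 1 / w i j)"


section \<open>Spectral matrix algebras and admissible weights\<close>

type_synonym 'i cmatrix = "'i \<Rightarrow> 'i \<Rightarrow> complex"

definition mat_vec :: "'i cmatrix \<Rightarrow> ('i \<Rightarrow> complex) \<Rightarrow> 'i \<Rightarrow> complex" where
  "mat_vec M c = (\<lambda>i. \<Sum>\<^sub>\<infinity>j. M i j * c j)"

definition mat_mult :: "'i cmatrix \<Rightarrow> 'i cmatrix \<Rightarrow> 'i cmatrix" where
  "mat_mult M N = (\<lambda>i j. \<Sum>\<^sub>\<infinity>k. M i k * N k j)"

definition mat_adjoint :: "'i cmatrix \<Rightarrow> 'i cmatrix" where
  "mat_adjoint M = (\<lambda>i j. cnj (M j i))"

definition mat_bounded_on :: "ennreal \<Rightarrow> ('i \<Rightarrow> real) \<Rightarrow> 'i cmatrix \<Rightarrow> bool" where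
  "mat_bounded_on p w M \<longleftrightarrow>
     (\<exists>B::real. \<forall>c. wnorm p w c < \<infinity> \<longrightarrow>
        (\<forall>i. (\<lambda>j. M i j * c j) summable_on UNIV) \<and>
        wnorm p w (mat_vec M c) \<le> ennreal B * wnorm p w c)"

abbreviation mat_bounded_l2 :: "'i cmatrix \<Rightarrow> bool" where
  "mat_bounded_l2 \<equiv> mat_bounded_on 2 (\<lambda>_. 1)"

text \<open>Banach algebras are unital; the norm of the identity matrix is not required to be \<open>1\<close>,
  nor the involution to be isometric. In the inverse-closedness
  clause \<open>N\<close> is the matrix of the inverse of \<open>M\<close> in \<open>B(l^2)\<close>.\<close>

definition spectral_matrix_algebra ::
  "('i::countable) cmatrix set \<Rightarrow> ('i cmatrix \<Rightarrow> real) \<Rightarrow> bool" where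
  "spectral_matrix_algebra \<A> nA \<longleftrightarrow>
     \<comment> \<open>normed space\<close>
     (\<forall>M\<in>\<A>. \<forall>N\<in>\<A>. (\<lambda>i j. M i j + N i j) \<in> \<A> \<and> nA (\<lambda>i j. M i j + N i j) \<le> nA M + nA N) \<and>
     (\<forall>M\<in>\<A>. \<forall>a. (\<lambda>i j. a * M i j) \<in> \<A> \<and> nA (\<lambda>i j. a * M i j) = cmod a * nA M) \<and>
     (\<forall>M\<in>\<A>. nA M = 0 \<longleftrightarrow> M = (\<lambda>i j. 0)) \<and>
     \<comment> \<open>completeness\<close>
     (\<forall>X. (\<forall>n::nat. X n \<in> \<A>) \<and>
          (\<forall>e>0. \<exists>n0. \<forall>m\<ge>n0. \<forall>n\<ge>n0. nA (\<lambda>i j. X m i j - X n i j) < e) \<longrightarrow>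
          (\<exists>M\<in>\<A>. (\<lambda>n. nA (\<lambda>i j. X n i j - M i j)) \<longlonglongrightarrow> 0)) \<and>
     \<comment> \<open>unital algebra with involution\<close>
     (\<lambda>i j. if i = j then 1 else 0) \<in> \<A> \<and>
     (\<forall>M\<in>\<A>. \<forall>N\<in>\<A>. mat_mult M N \<in> \<A> \<and> nA (mat_mult M N) \<le> nA M * nA N) \<and>
     (\<forall>M\<in>\<A>. mat_adjoint M \<in> \<A>) \<and>
     \<comment> \<open>(a) bounded operators on \<open>l^2\<close>, (b) inverse-closedness, (c) solidity\<close>
     (\<forall>M\<in>\<A>. mat_bounded_l2 M) \<and>
     (\<forall>M\<in>\<A>. \<forall>N. mat_bounded_l2 N \<and>
        (\<forall>c. wnorm 2 (\<lambda>_. 1) c < \<infinity> \<longrightarrow>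
             mat_vec N (mat_vec M c) = c \<and> mat_vec M (mat_vec N c) = c) \<longrightarrow> N \<in> \<A>) \<and>
     (\<forall>M\<in>\<A>. \<forall>N. (\<forall>i j. cmod (N i j) \<le> cmod (M i j)) \<longrightarrow> N \<in> \<A> \<and> nA N \<le> nA M)"

definition admissible_weight :: "'i cmatrix set \<Rightarrow> ('i \<Rightarrow> real) \<Rightarrow> bool" where
  "admissible_weight \<A> w \<longleftrightarrow>
     (\<forall>i. w i > 0) \<and> (\<forall>M\<in>\<A>. \<forall>p\<ge>1. mat_bounded_on p w M)"


section \<open>Localised frames\<close>

definition frame :: "('i::countable \<Rightarrow> 'h::complex_hilbert) \<Rightarrow> bool" where
  "frame \<Psi> \<longleftrightarrow>
     (\<exists>A B::real. A > 0 \<and> B > 0 \<and>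
        (\<forall>f. (\<lambda>i. (cmod (cinner f (\<Psi> i)))\<^sup>2) summable_on UNIV \<and>
             A * (norm f)\<^sup>2 \<le> (\<Sum>\<^sub>\<infinity>i. (cmod (cinner f (\<Psi> i)))\<^sup>2) \<and>
             (\<Sum>\<^sub>\<infinity>i. (cmod (cinner f (\<Psi> i)))\<^sup>2) \<le> B * (norm f)\<^sup>2))"

definition frame_operator :: "('i \<Rightarrow> 'h::complex_hilbert) \<Rightarrow> 'h \<Rightarrow> 'h" where
  "frame_operator \<Psi> f = (\<Sum>\<^sub>\<infinity>i. cinner f (\<Psi> i) *\<^sub>C \<Psi> i)"

definition dual_frame :: "('i \<Rightarrow> 'h::complex_hilbert) \<Rightarrow> 'i \<Rightarrow> 'h" where
  "dual_frame \<Psi> i = inv (frame_operator \<Psi>) (\<Psi> i)"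

definition gram :: "('i \<Rightarrow> 'h::complex_hilbert) \<Rightarrow> 'i cmatrix" where
  "gram \<Psi> = (\<lambda>i i'. cinner (\<Psi> i') (\<Psi> i))"

definition localised_frame ::
  "('i::countable) cmatrix set \<Rightarrow> ('i \<Rightarrow> 'h::complex_hilbert) \<Rightarrow> bool" where
  "localised_frame \<A> \<Psi> \<longleftrightarrow> frame \<Psi> \<and> gram \<Psi> \<in> \<A>"

definition analysis :: "('i \<Rightarrow> 'h::complex_hilbert) \<Rightarrow> 'h \<Rightarrow> 'i \<Rightarrow> complex" where
  "analysis \<Psi> f = (\<lambda>i. cinner f (\<Psi> i))"


section \<open>Co-orbit spaces\<close>

text \<open>An element of a co-orbit space is represented by its coefficient sequence with respect to
  the canonical dual frame. \<open>represents \<Psi> p w f c\<close>: the sequence \<open>f\<close> of vectors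
  represents the element with coefficients \<open>c\<close>. For \<open>p < \<infinity>\<close> this is a
  sequence of finite combinations converging in the completion, for \<open>p = \<infinity>\<close> a sequence as in the
  definition by equivalence classes.\<close>

definition represents ::
  "('i \<Rightarrow> 'h::complex_hilbert) \<Rightarrow> ennreal \<Rightarrow> ('i \<Rightarrow> real) \<Rightarrow> (nat \<Rightarrow> 'h) \<Rightarrow> ('i \<Rightarrow> complex) \<Rightarrow> bool"
  where
  "represents \<Psi> p w f c \<longleftrightarrow>
     (if p = \<infinity>
      then (\<forall>i. (\<lambda>n. analysis (dual_frame \<Psi>) (f n) i) \<longlonglongrightarrow> c i) \<and>
           (SUP n. wnorm \<infinity> w (analysis (dual_frame \<Psi>) (f n))) < \<infinity>
      else (\<forall>n. f n \<in> finite_combinations \<Psi>) \<and> wnorm p w c < \<infinity> \<and>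
           (\<lambda>n. wnorm p w (\<lambda>i. analysis (dual_frame \<Psi>) (f n) i - c i)) \<longlonglongrightarrow> 0)"

text \<open>The norm of \<open>c \<in> coorbit \<Psi> p w\<close> is \<open>wnorm p w c\<close>.\<close>

definition coorbit ::
  "('i \<Rightarrow> 'h::complex_hilbert) \<Rightarrow> ennreal \<Rightarrow> ('i \<Rightarrow> real) \<Rightarrow> ('i \<Rightarrow> complex) set" where
  "coorbit \<Psi> p w = {c. \<exists>f. represents \<Psi> p w f c}"

text \<open>The extension of the analysis operator of \<open>\<Psi>\<close> itself (not of its dual) to
  \<open>coorbit \<Psi> p w\<close>, by continuity or limits.\<close>

definition analysis_ext ::
  "('i \<Rightarrow> 'h::complex_hilbert) \<Rightarrow> ennreal \<Rightarrow> ('i \<Rightarrow> real) \<Rightarrow> ('i \<Rightarrow> complex) \<Rightarrow> 'i \<Rightarrow> complex" where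
  "analysis_ext \<Psi> p w c =
     (\<lambda>i. THE z. \<forall>f. represents \<Psi> p w f c \<longrightarrow> (\<lambda>n. analysis \<Psi> (f n) i) \<longlonglongrightarrow> z)"

text \<open>\<open>pairing \<Psi> q v c d\<close> pairs \<open>c \<in> coorbit \<Psi> p (recip v)\<close> with \<open>d \<in> coorbit \<Psi> q v\<close>.\<close>

definition pairing ::
  "('i \<Rightarrow> 'h::complex_hilbert) \<Rightarrow> ennreal \<Rightarrow> ('i \<Rightarrow> real) \<Rightarrow>
   ('i \<Rightarrow> complex) \<Rightarrow> ('i \<Rightarrow> complex) \<Rightarrow> complex" where
  "pairing \<Psi> q v c d = (\<Sum>\<^sub>\<infinity>i. c i * cnj (analysis_ext \<Psi> q v d i))"


section \<open>Co-orbit spaces of the tensor product\<close>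

definition analysis2 ::
  "('h1 \<Rightarrow> 'h2 \<Rightarrow> 't::complex_hilbert) \<Rightarrow> ('i \<Rightarrow> 'h1) \<Rightarrow> ('j \<Rightarrow> 'h2) \<Rightarrow> 't \<Rightarrow> 'i \<Rightarrow> 'j \<Rightarrow> complex" where
  "analysis2 tens \<Phi>1 \<Phi>2 F = (\<lambda>i j. cinner F (tens (\<Phi>1 i) (\<Phi>2 j)))"

abbreviation coefficients2 ::
  "('h1::complex_hilbert \<Rightarrow> 'h2::complex_hilbert \<Rightarrow> 't::complex_hilbert) \<Rightarrow>
   ('i \<Rightarrow> 'h1) \<Rightarrow> ('j \<Rightarrow> 'h2) \<Rightarrow> 't \<Rightarrow> 'i \<Rightarrow> 'j \<Rightarrow> complex" where
  "coefficients2 tens \<Psi>1 \<Psi>2 \<equiv> analysis2 tens (dual_frame \<Psi>1) (dual_frame \<Psi>2)"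

text \<open>As before, elements are represented by their coefficients. The
  norms of \<open>K\<close> in the two spaces below are \<open>mixed_norm r \<infinity> w K\<close> and \<open>mixed_norm_fr r \<infinity> w K\<close>.\<close>

definition coorbit2_inf ::
  "('h1::complex_hilbert \<Rightarrow> 'h2::complex_hilbert \<Rightarrow> 't::complex_hilbert) \<Rightarrow>
   ('i \<Rightarrow> 'h1) \<Rightarrow> ('j \<Rightarrow> 'h2) \<Rightarrow> ennreal \<Rightarrow> ('i \<Rightarrow> 'j \<Rightarrow> real) \<Rightarrow> ('i \<Rightarrow> 'j \<Rightarrow> complex) set" where
  "coorbit2_inf tens \<Psi>1 \<Psi>2 r w =
     {K. \<exists>F::nat \<Rightarrow> 't. (\<forall>i j. (\<lambda>n. coefficients2 tens \<Psi>1 \<Psi>2 (F n) i j) \<longlonglongrightarrow> K i j) \<and>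
           (SUP n. mixed_norm r \<infinity> w (coefficients2 tens \<Psi>1 \<Psi>2 (F n))) < \<infinity>}"

definition coorbit2_inf_fr ::
  "('h1::complex_hilbert \<Rightarrow> 'h2::complex_hilbert \<Rightarrow> 't::complex_hilbert) \<Rightarrow>
   ('i \<Rightarrow> 'h1) \<Rightarrow> ('j \<Rightarrow> 'h2) \<Rightarrow> ennreal \<Rightarrow> ('i \<Rightarrow> 'j \<Rightarrow> real) \<Rightarrow> ('i \<Rightarrow> 'j \<Rightarrow> complex) set" where
  "coorbit2_inf_fr tens \<Psi>1 \<Psi>2 r w =
     {K. \<exists>F::nat \<Rightarrow> 't. (\<forall>i j. (\<lambda>n. coefficients2 tens \<Psi>1 \<Psi>2 (F n) i j) \<longlonglongrightarrow> K i j) \<and>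
           (SUP n. mixed_norm_fr r \<infinity> w (coefficients2 tens \<Psi>1 \<Psi>2 (F n))) < \<infinity>}"

text \<open>\<open>represents2_1 tens \<Psi>1 \<Psi>2 w G g\<close>: the finite combinations \<open>G n\<close> of the tensor frame
  converge, in the completion \<open>H^{1,1}_w\<close>, to the element with coefficients \<open>g\<close>.\<close>

definition represents2_1 ::
  "('h1::complex_hilbert \<Rightarrow> 'h2::complex_hilbert \<Rightarrow> 't::complex_hilbert) \<Rightarrow>
   ('i \<Rightarrow> 'h1) \<Rightarrow> ('j \<Rightarrow> 'h2) \<Rightarrow> ('i \<Rightarrow> 'j \<Rightarrow> real) \<Rightarrow> (nat \<Rightarrow> 't) \<Rightarrow> ('i \<Rightarrow> 'j \<Rightarrow> complex) \<Rightarrow> bool" where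
  "represents2_1 tens \<Psi>1 \<Psi>2 w G g \<longleftrightarrow>
     (\<forall>n. G n \<in> finite_combinations (\<lambda>(i, j). tens (\<Psi>1 i) (\<Psi>2 j))) \<and>
     mixed_norm 1 1 w g < \<infinity> \<and>
     (\<lambda>n. mixed_norm 1 1 w (\<lambda>i j. coefficients2 tens \<Psi>1 \<Psi>2 (G n) i j - g i j)) \<longlonglongrightarrow> 0"

definition analysis_ext2 ::
  "('h1::complex_hilbert \<Rightarrow> 'h2::complex_hilbert \<Rightarrow> 't::complex_hilbert) \<Rightarrow>
   ('i \<Rightarrow> 'h1) \<Rightarrow> ('j \<Rightarrow> 'h2) \<Rightarrow> ('i \<Rightarrow> 'j \<Rightarrow> real) \<Rightarrow>
   ('i \<Rightarrow> 'j \<Rightarrow> complex) \<Rightarrow> 'i \<Rightarrow> 'j \<Rightarrow> complex" where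
  "analysis_ext2 tens \<Psi>1 \<Psi>2 w g =
     (\<lambda>i j. THE z. \<forall>G. represents2_1 tens \<Psi>1 \<Psi>2 w G g \<longrightarrow>
                        (\<lambda>n. analysis2 tens \<Psi>1 \<Psi>2 (G n) i j) \<longlonglongrightarrow> z)"

definition pairing2 ::
  "('h1::complex_hilbert \<Rightarrow> 'h2::complex_hilbert \<Rightarrow> 't::complex_hilbert) \<Rightarrow>
   ('i \<Rightarrow> 'h1) \<Rightarrow> ('j \<Rightarrow> 'h2) \<Rightarrow> ('i \<Rightarrow> 'j \<Rightarrow> real) \<Rightarrow>
   ('i \<Rightarrow> 'j \<Rightarrow> complex) \<Rightarrow> ('i \<Rightarrow> 'j \<Rightarrow> complex) \<Rightarrow> complex" where
  "pairing2 tens \<Psi>1 \<Psi>2 w K g =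
     (\<Sum>\<^sub>\<infinity>(i, j). K i j * cnj (analysis_ext2 tens \<Psi>1 \<Psi>2 w g i j))"

text \<open>Coefficients of the simple tensor of two co-orbit elements (antilinear in the first).\<close>

definition simple_tensor ::
  "('i \<Rightarrow> complex) \<Rightarrow> ('j \<Rightarrow> complex) \<Rightarrow> 'i \<Rightarrow> 'j \<Rightarrow> complex" where
  "simple_tensor c d = (\<lambda>i j. cnj (c i) * d j)"


section \<open>Operators, kernels and Galerkin matrices\<close>

definition linear_between ::
  "('i \<Rightarrow> complex) set \<Rightarrow> ('j \<Rightarrow> complex) set \<Rightarrow>
   (('i \<Rightarrow> complex) \<Rightarrow> 'j \<Rightarrow> complex) \<Rightarrow> bool" where
  "linear_between X Y T \<longleftrightarrow>
     (\<forall>f\<in>X. T f \<in> Y) \<and>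
     (\<forall>f\<in>X. \<forall>g\<in>X. \<forall>a b. T (\<lambda>i. a * f i + b * g i) = (\<lambda>j. a * T f j + b * T g j))"

text \<open>\<open>bounded_between \<Psi>1 p w \<Psi>2 r v T\<close>: \<open>T\<close> is a bounded linear operator from
  \<open>coorbit \<Psi>1 p w\<close> to \<open>coorbit \<Psi>2 r v\<close>; in particular it takes its values in the latter.\<close>

definition bounded_between ::
  "('i \<Rightarrow> 'h1::complex_hilbert) \<Rightarrow> ennreal \<Rightarrow> ('i \<Rightarrow> real) \<Rightarrow>
   ('j \<Rightarrow> 'h2::complex_hilbert) \<Rightarrow> ennreal \<Rightarrow> ('j \<Rightarrow> real) \<Rightarrow>
   (('i \<Rightarrow> complex) \<Rightarrow> 'j \<Rightarrow> complex) \<Rightarrow> bool" where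
  "bounded_between \<Psi>1 p w \<Psi>2 r v T \<longleftrightarrow>
     linear_between (coorbit \<Psi>1 p w) (coorbit \<Psi>2 r v) T \<and>
     (\<exists>B::real. \<forall>f\<in>coorbit \<Psi>1 p w. wnorm r v (T f) \<le> ennreal B * wnorm p w f)"

definition operator_norm ::
  "('i \<Rightarrow> 'h1::complex_hilbert) \<Rightarrow> ennreal \<Rightarrow> ('i \<Rightarrow> real) \<Rightarrow> ennreal \<Rightarrow> ('j \<Rightarrow> real) \<Rightarrow>
   (('i \<Rightarrow> complex) \<Rightarrow> 'j \<Rightarrow> complex) \<Rightarrow> ennreal" where
  "operator_norm \<Psi>1 p w r v T = (SUP f\<in>{f \<in> coorbit \<Psi>1 p w. wnorm p w f \<le> 1}. wnorm r v (T f))"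

definition is_kernel ::
  "('h1::complex_hilbert \<Rightarrow> 'h2::complex_hilbert \<Rightarrow> 't::complex_hilbert) \<Rightarrow>
   ('i \<Rightarrow> 'h1) \<Rightarrow> ('i \<Rightarrow> real) \<Rightarrow> ('j \<Rightarrow> 'h2) \<Rightarrow> ('j \<Rightarrow> real) \<Rightarrow>
   (('i \<Rightarrow> complex) \<Rightarrow> 'j \<Rightarrow> complex) \<Rightarrow> ('i \<Rightarrow> 'j \<Rightarrow> complex) \<Rightarrow> bool" where
  "is_kernel tens \<Psi>1 w1 \<Psi>2 w2 T K \<longleftrightarrow>
     K \<in> coorbit2_inf tens \<Psi>1 \<Psi>2 \<infinity> (recip2 (tensor_weight w1 w2)) \<and>
     (\<forall>f1\<in>coorbit \<Psi>1 1 w1. \<forall>f2\<in>coorbit \<Psi>2 1 w2.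
        pairing \<Psi>2 1 w2 (T f1) f2
          = pairing2 tens \<Psi>1 \<Psi>2 (tensor_weight w1 w2) K (simple_tensor f1 f2))"

text \<open>The dual frame vectors enter as elements of \<open>coorbit \<Psi>1 1 w1\<close> and \<open>coorbit \<Psi>2 1 w2\<close>,
  that is, through their coefficients.\<close>

definition galerkin ::
  "('i \<Rightarrow> 'h1::complex_hilbert) \<Rightarrow> ('j \<Rightarrow> 'h2::complex_hilbert) \<Rightarrow> ('j \<Rightarrow> real) \<Rightarrow>
   (('i \<Rightarrow> complex) \<Rightarrow> 'j \<Rightarrow> complex) \<Rightarrow> 'i \<Rightarrow> 'j \<Rightarrow> complex" where
  "galerkin \<Psi>1 \<Psi>2 w2 T = (\<lambda>i j.
     pairing \<Psi>2 1 w2 (T (analysis (dual_frame \<Psi>1) (dual_frame \<Psi>1 i)))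
       (analysis (dual_frame \<Psi>2) (dual_frame \<Psi>2 j)))"

text \<open>Kernel and Galerkin matrix only involve the restriction \<open>S\<close> of an operator to
  \<open>coorbit \<Psi>1 1 w\<close>. \<open>bounded_extension \<Psi>1 p w \<Psi>2 r v S T\<close>: \<open>T\<close> is a bounded linear operator
  on \<open>coorbit \<Psi>1 p w\<close> with this restriction. For \<open>p < \<infinity>\<close> there is at most one,
  as \<open>coorbit \<Psi>1 1 w\<close> is dense.\<close>

definition bounded_extension ::
  "('i \<Rightarrow> 'h1::complex_hilbert) \<Rightarrow> ennreal \<Rightarrow> ('i \<Rightarrow> real) \<Rightarrow>
   ('j \<Rightarrow> 'h2::complex_hilbert) \<Rightarrow> ennreal \<Rightarrow> ('j \<Rightarrow> real) \<Rightarrow>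
   (('i \<Rightarrow> complex) \<Rightarrow> 'j \<Rightarrow> complex) \<Rightarrow> (('i \<Rightarrow> complex) \<Rightarrow> 'j \<Rightarrow> complex) \<Rightarrow> bool" where
  "bounded_extension \<Psi>1 p w \<Psi>2 r v S T \<longleftrightarrow>
     bounded_between \<Psi>1 p w \<Psi>2 r v T \<and> (\<forall>f\<in>coorbit \<Psi>1 1 w. T f = S f)"

text \<open>For \<open>p = \<infinity>\<close> the subspace \<open>coorbit \<Psi>1 1 w\<close> is in general not norm dense, and a bounded operator
  on \<open>coorbit \<Psi>1 \<infinity> w\<close> may vanish on it without being zero (Banach limits). There, extension by limits
  means that the extension respects the convergence defining \<open>coorbit \<Psi>1 \<infinity> w\<close>:
  bounded and coefficientwise.\<close>

definition preserves_limits ::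
  "('i \<Rightarrow> 'h1::complex_hilbert) \<Rightarrow> ('i \<Rightarrow> real) \<Rightarrow> (('i \<Rightarrow> complex) \<Rightarrow> 'j \<Rightarrow> complex) \<Rightarrow> bool" where
  "preserves_limits \<Psi> w T \<longleftrightarrow>
     (\<forall>f g. (\<forall>n::nat. f n \<in> coorbit \<Psi> \<infinity> w) \<and> g \<in> coorbit \<Psi> \<infinity> w \<and>
            (SUP n. wnorm \<infinity> w (f n)) < \<infinity> \<and> (\<forall>i. (\<lambda>n. f n i) \<longlonglongrightarrow> g i) \<longrightarrow>
            (\<forall>j. (\<lambda>n. T (f n) j) \<longlonglongrightarrow> T g j))"

definition limit_extension ::
  "('i \<Rightarrow> 'h1::complex_hilbert) \<Rightarrow> ennreal \<Rightarrow> ('i \<Rightarrow> real) \<Rightarrow>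
   ('j \<Rightarrow> 'h2::complex_hilbert) \<Rightarrow> ennreal \<Rightarrow> ('j \<Rightarrow> real) \<Rightarrow>
   (('i \<Rightarrow> complex) \<Rightarrow> 'j \<Rightarrow> complex) \<Rightarrow> (('i \<Rightarrow> complex) \<Rightarrow> 'j \<Rightarrow> complex) \<Rightarrow> bool" where
  "limit_extension \<Psi>1 p w \<Psi>2 r v S T \<longleftrightarrow>
     bounded_extension \<Psi>1 p w \<Psi>2 r v S T \<and> (p = \<infinity> \<longrightarrow> preserves_limits \<Psi>1 w T)"

end

theory Submission
  imports Defs
begin

text \<open>An element of a co-orbit space is its coefficient sequence with respect to the canonical
  dual frame. Let \<open>G\<close> be the Gram matrix of a frame \<open>\<Psi>\<close>, \<open>D\<close> the Gram matrix of its dual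
  frame and \<open>P\<close> the cross-Gram matrix of the two, which is the orthogonal projection of \<open>l^2\<close>
  onto the range of the analysis operator. The proof rests on the fact that, for a localised
  frame, \<open>P\<close> and \<open>D\<close> belong to the matrix algebra and hence act on all weighted sequence
  spaces. The co-orbit space is then simply the range of \<open>P\<close> in the weighted \<open>l^p\<close> space
  (\<open>coorbit_eq\<close>), the extended analysis operator is multiplication by \<open>G\<close>
  (\<open>analysis_ext_eq\<close>), and \<open>D\<close> inverts \<open>G\<close> on the range of \<open>P\<close>. The weight \<open>1/w\<close> is as
  good as \<open>w\<close>, because the algebra is closed under adjoints and boundedness of a matrix for
  \<open>(p, 1/w)\<close> is dual to boundedness of its adjoint for \<open>(q, w)\<close> (\<open>good_weight_recip\<close>).

  Why \<open>P\<close> lies in the algebra (\<open>opmat_projection_in\<close>): with \<open>A\<close> the lower frame bound, \<open>G - z\<close> is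
  invertible for \<open>0 < |z| < A\<close>, so inverse-closedness puts its inverse into the algebra. Up to
  a scalar factor and a multiple of the identity this inverse is the matrix \<open>[V z]\<close> of the resolvent \<open>V z\<close> of the
  frame operator, which is holomorphic up to \<open>z = 0\<close> with \<open>[V 0] = P\<close>; therefore \<open>P\<close> is the mean
  of \<open>[V z]\<close> over the circle \<open>|z| = A/2\<close>. The resolvent identity alone shows that \<open>[V z]\<close>
  is bounded and Lipschitz on this circle in the norm of the algebra. Hence the averages over
  the \<open>2^m\<close>-th roots of unity form a Cauchy sequence in the algebra, and by solidity its limit
  is the entrywise limit \<open>P\<close>. Finally, \<open>D - P\<close> is found from the inverse of \<open>1 + G - P\<close>, which is
  \<open>1 + D - P\<close> (\<open>opmat_dual_gram_in\<close>).

  The kernel of an operator \<open>S\<close> can only be its Galerkin matrix, the matrix with the rows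
  \<open>K i = S \<psi>~_i\<close>: testing the kernel identity with the dual frame of \<open>\<Psi>2\<close> turns it into
  \<open>(S f)_j = \<Sum>_i (G f)_i K_{i,j}\<close> (\<open>operator_eq_kernel_action\<close>). Conversely, for bounded \<open>S\<close>
  this matrix is fixed by the projections of both frames (the conjugate one for \<open>\<Psi>1\<close>), and such matrices with a
  finite mixed norm are precisely the elements of the co-orbit spaces of the tensor product
  (\<open>coorbit2_infI\<close>, \<open>coorbit2_inf_frI\<close>, \<open>kernel_exists_unique\<close>).

  What remains are two pairs of estimates. For operators on the space with exponent \<open>1\<close>, the
  rows of \<open>K\<close> are images of the dual frame vectors, whose norms are bounded by the
  weight (\<open>row_norm_le_operator_norm\<close>); conversely \<open>S f\<close> is a superposition of the rows with
  coefficients in the weighted \<open>l^1\<close>, so Minkowski's inequality applies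
  (\<open>kernel_action_norm_le_rows\<close>). For operators into the space with exponent \<open>\<infinity>\<close>, the
  columns of \<open>K\<close> represent the functionals \<open>f \<mapsto> (T f)_j\<close>, and the estimates are
  Hoelder's inequality and its converse (\<open>kernel_action_norm_le_columns\<close>,
  \<open>column_norm_le_operator_norm\<close>). The converse only tests with finite sequences, so that it
  holds for every extension \<open>T\<close>. For \<open>p = \<infinity>\<close> the upper estimate needs an extension that is
  compatible with bounded coefficientwise limits; it has to be the one given by the kernel
  (\<open>limit_extension_eq\<close>).\<close>

section \<open>Sums of extended nonnegative reals\<close>

lemma ennreal_summable_on [simp]: "(f :: 'a \<Rightarrow> ennreal) summable_on A"
  by (rule nonneg_summable_on_complete) simp

lemma infsum_ennreal_SUP:
  "(\<Sum>\<^sub>\<infinity>x\<in>A. f x :: ennreal) = (SUP F\<in>{F. finite F \<and> F \<subseteq> A}. sum f F)"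
  by (rule nonneg_infsum_complete) simp

lemma finite_sum_le_infsum_ennreal:
  fixes f :: "'a \<Rightarrow> ennreal"
  assumes "finite F"
  shows "sum f F \<le> (\<Sum>\<^sub>\<infinity>x. f x)"
  unfolding infsum_ennreal_SUP using assms by (intro SUP_upper) auto

lemma infsum_ennreal_leI:
  fixes f :: "'a \<Rightarrow> ennreal"
  assumes "\<And>F. finite F \<Longrightarrow> sum f F \<le> B"
  shows "(\<Sum>\<^sub>\<infinity>x. f x) \<le> B"
  unfolding infsum_ennreal_SUP using assms by (intro SUP_least) auto

lemma infsum_ennreal_mono:
  fixes f g :: "'a \<Rightarrow> ennreal"
  assumes "\<And>x. f x \<le> g x"
  shows "(\<Sum>\<^sub>\<infinity>x. f x) \<le> (\<Sum>\<^sub>\<infinity>x. g x)"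
  by (rule infsum_mono) (use assms in auto)

lemma term_le_infsum_ennreal:
  fixes f :: "'a \<Rightarrow> ennreal"
  shows "f x \<le> (\<Sum>\<^sub>\<infinity>x. f x)"
  using finite_sum_le_infsum_ennreal[of "{x}" f] by simp

lemma infsum_ennreal_cmult:
  fixes f :: "'a \<Rightarrow> ennreal"
  shows "(\<Sum>\<^sub>\<infinity>x. c * f x) = c * (\<Sum>\<^sub>\<infinity>x. f x)"
  unfolding infsum_ennreal_SUP by (simp add: SUP_mult_left_ennreal flip: sum_distrib_left)

lemma infsum_ennreal_cmult_right:
  fixes f :: "'a \<Rightarrow> ennreal"
  shows "(\<Sum>\<^sub>\<infinity>x. f x * c) = (\<Sum>\<^sub>\<infinity>x. f x) * c"
  using infsum_ennreal_cmult[of c f] by (simp add: mult.commute)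

lemma infsum_ennreal_add:
  fixes f g :: "'a \<Rightarrow> ennreal"
  shows "(\<Sum>\<^sub>\<infinity>x. f x + g x) = (\<Sum>\<^sub>\<infinity>x. f x) + (\<Sum>\<^sub>\<infinity>x. g x)"
  by (rule infsum_add) auto

lemma infsum_ennreal_sum:
  fixes f :: "'a \<Rightarrow> 'b \<Rightarrow> ennreal"
  assumes "finite I"
  shows "(\<Sum>\<^sub>\<infinity>x. \<Sum>i\<in>I. f i x) = (\<Sum>i\<in>I. \<Sum>\<^sub>\<infinity>x. f i x)"
  using assms by (induction I) (simp_all add: infsum_ennreal_add)

text \<open>Tonelli: each iterated sum is a supremum of finite sums of the inner ones, and finite sums
  commute with the infinite ones.\<close>

lemma infsum_ennreal_swap:
  fixes f :: "'a \<Rightarrow> 'b \<Rightarrow> ennreal"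
  shows "(\<Sum>\<^sub>\<infinity>x. \<Sum>\<^sub>\<infinity>y. f x y) = (\<Sum>\<^sub>\<infinity>y. \<Sum>\<^sub>\<infinity>x. f x y)"
proof -
  have "(\<Sum>\<^sub>\<infinity>x. \<Sum>\<^sub>\<infinity>y. g x y) \<le> (\<Sum>\<^sub>\<infinity>y. \<Sum>\<^sub>\<infinity>x. g x y)" for g :: "'c \<Rightarrow> 'd \<Rightarrow> ennreal"
  proof (rule infsum_ennreal_leI)
    fix F :: "'c set" assume F: "finite F"
    have "(\<Sum>x\<in>F. \<Sum>\<^sub>\<infinity>y. g x y) = (\<Sum>\<^sub>\<infinity>y. \<Sum>x\<in>F. g x y)"
      using F by (simp add: infsum_ennreal_sum)
    also have "\<dots> \<le> (\<Sum>\<^sub>\<infinity>y. \<Sum>\<^sub>\<infinity>x. g x y)"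
      by (intro infsum_ennreal_mono finite_sum_le_infsum_ennreal F)
    finally show "(\<Sum>x\<in>F. \<Sum>\<^sub>\<infinity>y. g x y) \<le> (\<Sum>\<^sub>\<infinity>y. \<Sum>\<^sub>\<infinity>x. g x y)" .
  qed
  from this[of f] this[of "\<lambda>y x. f x y"] show ?thesis by (rule antisym)
qed

lemma infsum_ennreal_pair:
  fixes f :: "'a \<Rightarrow> 'b \<Rightarrow> ennreal"
  shows "(\<Sum>\<^sub>\<infinity>(x,y). f x y) = (\<Sum>\<^sub>\<infinity>x. \<Sum>\<^sub>\<infinity>y. f x y)"
proof (rule antisym)
  show "(\<Sum>\<^sub>\<infinity>(x,y). f x y) \<le> (\<Sum>\<^sub>\<infinity>x. \<Sum>\<^sub>\<infinity>y. f x y)"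
  proof (rule infsum_ennreal_leI)
    fix F :: "('a \<times> 'b) set" assume F: "finite F"
    have "(\<Sum>(x,y)\<in>F. f x y) \<le> (\<Sum>(x,y)\<in>fst ` F \<times> snd ` F. f x y)"
      using F by (intro sum_mono2) (auto intro: rev_image_eqI)
    also have "\<dots> = (\<Sum>x\<in>fst ` F. \<Sum>y\<in>snd ` F. f x y)"
      by (simp add: sum.cartesian_product)
    also have "\<dots> \<le> (\<Sum>x\<in>fst ` F. \<Sum>\<^sub>\<infinity>y. f x y)"
      using F by (intro sum_mono finite_sum_le_infsum_ennreal) auto
    also have "\<dots> \<le> (\<Sum>\<^sub>\<infinity>x. \<Sum>\<^sub>\<infinity>y. f x y)"
      using F by (intro finite_sum_le_infsum_ennreal) auto
    finally show "(\<Sum>(x,y)\<in>F. f x y) \<le> (\<Sum>\<^sub>\<infinity>x. \<Sum>\<^sub>\<infinity>y. f x y)" .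
  qed
next
  show "(\<Sum>\<^sub>\<infinity>x. \<Sum>\<^sub>\<infinity>y. f x y) \<le> (\<Sum>\<^sub>\<infinity>(x,y). f x y)"
  proof (rule infsum_ennreal_leI)
    fix I :: "'a set" assume I: "finite I"
    have "(\<Sum>x\<in>I. \<Sum>\<^sub>\<infinity>y. f x y) = (\<Sum>\<^sub>\<infinity>y. \<Sum>x\<in>I. f x y)"
      using I by (simp add: infsum_ennreal_sum)
    also have "\<dots> \<le> (\<Sum>\<^sub>\<infinity>(x,y). f x y)"
    proof (rule infsum_ennreal_leI)
      fix J :: "'b set" assume J: "finite J"
      have "(\<Sum>y\<in>J. \<Sum>x\<in>I. f x y) = (\<Sum>(x,y)\<in>I \<times> J. f x y)"
        by (subst sum.swap) (simp add: sum.cartesian_product)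
      also have "\<dots> \<le> (\<Sum>\<^sub>\<infinity>(x,y). f x y)"
        using I J by (intro finite_sum_le_infsum_ennreal) auto
      finally show "(\<Sum>y\<in>J. \<Sum>x\<in>I. f x y) \<le> (\<Sum>\<^sub>\<infinity>(x,y). f x y)" .
    qed
    finally show "(\<Sum>x\<in>I. \<Sum>\<^sub>\<infinity>y. f x y) \<le> (\<Sum>\<^sub>\<infinity>(x,y). f x y)" .
  qed
qed

lemma infsum_ennreal_finite_support:
  fixes f :: "'a \<Rightarrow> ennreal"
  assumes "finite F" and "\<And>x. x \<notin> F \<Longrightarrow> f x = 0"
  shows "(\<Sum>\<^sub>\<infinity>x. f x) = sum f F"
proof -
  have "(\<Sum>\<^sub>\<infinity>x. f x) = (\<Sum>\<^sub>\<infinity>x\<in>F. f x)"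
    by (rule infsum_cong_neutral) (use assms in auto)
  then show ?thesis using assms by simp
qed

lemma infsum_ennreal_eq_real:
  assumes "f summable_on UNIV" and "\<And>x. 0 \<le> f x"
  shows "(\<Sum>\<^sub>\<infinity>x. ennreal (f x)) = ennreal (\<Sum>\<^sub>\<infinity>x. f x)"
  using assms by (subst infsum_nonneg_is_SUPREMUM_ennreal)
    (auto simp: infsum_ennreal_SUP intro!: SUP_cong)

lemma summable_on_iff_ennreal:
  fixes f :: "'a \<Rightarrow> real"
  assumes nn: "\<And>x. 0 \<le> f x"
  shows "f summable_on UNIV \<longleftrightarrow> (\<Sum>\<^sub>\<infinity>x. ennreal (f x)) < \<infinity>"
proof
  assume "f summable_on UNIV"
  then show "(\<Sum>\<^sub>\<infinity>x. ennreal (f x)) < \<infinity>"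
    by (simp add: infsum_ennreal_eq_real nn)
next
  assume fin: "(\<Sum>\<^sub>\<infinity>x. ennreal (f x)) < \<infinity>"
  then obtain B where B: "B \<ge> 0" "(\<Sum>\<^sub>\<infinity>x. ennreal (f x)) = ennreal B"
    by (cases "\<Sum>\<^sub>\<infinity>x. ennreal (f x)") auto
  have "sum f F \<le> B" if "finite F" for F
  proof -
    have "ennreal (sum f F) = (\<Sum>x\<in>F. ennreal (f x))" by (simp add: nn sum_ennreal)
    also have "\<dots> \<le> ennreal B" unfolding B(2)[symmetric] by (rule finite_sum_le_infsum_ennreal[OF that])
    finally show ?thesis using B by simp
  qed
  then show "f summable_on UNIV"
    by (intro nonneg_bdd_above_summable_on nn) (auto intro!: bdd_aboveI2[where M=B])
qed

lemma complex_summable_iff_ennreal: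
  fixes f :: "'a \<Rightarrow> complex"
  shows "f summable_on UNIV \<longleftrightarrow> (\<Sum>\<^sub>\<infinity>x. ennreal (cmod (f x))) < \<infinity>"
  unfolding summable_on_iff_abs_summable_on_complex by (rule summable_on_iff_ennreal) simp

text \<open>A sum that does not converge absolutely has the value \<open>0\<close>.\<close>

lemma cmod_infsum_le:
  fixes f :: "'a \<Rightarrow> complex"
  shows "ennreal (cmod (\<Sum>\<^sub>\<infinity>x. f x)) \<le> (\<Sum>\<^sub>\<infinity>x. ennreal (cmod (f x)))"
proof (cases "f summable_on UNIV")
  case True
  then have "(\<lambda>x. norm (f x)) summable_on UNIV" by (simp add: summable_on_iff_abs_summable_on_complex)
  then show ?thesis
    by (subst infsum_ennreal_eq_real) (auto intro!: ennreal_leI norm_infsum_bound)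
next
  case False
  then show ?thesis by (simp add: infsum_not_exists)
qed

lemma summable_on_pair_iff_ennreal:
  fixes f :: "'a \<Rightarrow> 'b \<Rightarrow> complex"
  shows "(\<lambda>(x,y). f x y) summable_on UNIV \<longleftrightarrow> (\<Sum>\<^sub>\<infinity>x. \<Sum>\<^sub>\<infinity>y. ennreal (cmod (f x y))) < \<infinity>"
  unfolding complex_summable_iff_ennreal infsum_ennreal_pair[symmetric] by (simp add: case_prod_unfold)

lemma infsum_complex_swap:
  fixes f :: "'a \<Rightarrow> 'b \<Rightarrow> complex"
  assumes "(\<Sum>\<^sub>\<infinity>x. \<Sum>\<^sub>\<infinity>y. ennreal (cmod (f x y))) < \<infinity>"
  shows "(\<Sum>\<^sub>\<infinity>x. \<Sum>\<^sub>\<infinity>y. f x y) = (\<Sum>\<^sub>\<infinity>y. \<Sum>\<^sub>\<infinity>x. f x y)"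
  using assms infsum_swap_banach[of f UNIV UNIV] by (simp add: summable_on_pair_iff_ennreal)

lemma infsum_complex_pair:
  fixes f :: "'a \<Rightarrow> 'b \<Rightarrow> complex"
  assumes "(\<Sum>\<^sub>\<infinity>x. \<Sum>\<^sub>\<infinity>y. ennreal (cmod (f x y))) < \<infinity>"
  shows "(\<Sum>\<^sub>\<infinity>(x,y). f x y) = (\<Sum>\<^sub>\<infinity>x. \<Sum>\<^sub>\<infinity>y. f x y)"
  using assms infsum_Sigma'_banach[of f UNIV "\<lambda>_. UNIV"] by (simp add: summable_on_pair_iff_ennreal)

text \<open>Dominated convergence for sums: outside a finite set the tail of the dominating sum is
  small, on the finite set the convergence is termwise.\<close>

lemma infsum_dominated_convergence:
  fixes f :: "nat \<Rightarrow> 'a \<Rightarrow> complex"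
  assumes lim: "\<And>x. (\<lambda>n. f n x) \<longlonglongrightarrow> g x"
    and bound: "\<And>n x. ennreal (cmod (f n x)) \<le> b x"
    and fin: "(\<Sum>\<^sub>\<infinity>x. b x) < \<infinity>"
  shows "(\<lambda>n. \<Sum>\<^sub>\<infinity>x. f n x) \<longlonglongrightarrow> (\<Sum>\<^sub>\<infinity>x. g x)"
proof -
  define B where "B x = enn2real (b x)" for x
  have bfin: "b x < \<infinity>" for x
    using term_le_infsum_ennreal[of b x] fin by (rule order.strict_trans1)
  then have bB: "b x = ennreal (B x)" and B0: "B x \<ge> 0" for x by (simp_all add: B_def)
  have Bs: "B summable_on UNIV" unfolding summable_on_iff_ennreal[OF B0] using fin by (simp add: bB)
  have fB: "cmod (f n x) \<le> B x" for n x using bound[of n x] by (simp add: bB B0)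
  have gB: "cmod (g x) \<le> B x" for x
    by (rule LIMSEQ_le_const2[OF tendsto_norm[OF lim]]) (use fB in auto)
  have fs: "(f n) summable_on UNIV" for n
    by (rule abs_summable_summable, rule summable_on_comparison_test[OF Bs]) (use fB in auto)
  have gs: "g summable_on UNIV"
    by (rule abs_summable_summable, rule summable_on_comparison_test[OF Bs]) (use gB in auto)
  show ?thesis
  proof (rule LIMSEQ_I)
    fix e :: real assume e: "e > 0"
    obtain F where F: "finite F" and tail: "dist (sum B F) (infsum B UNIV) \<le> e/4"
      using infsum_finite_approximation[OF Bs, of "e/4"] e by auto
    have Bt: "infsum B (-F) \<le> e/4"
    proof -
      have "infsum B UNIV = sum B F + infsum B (-F)"
        using infsum_Un_disjoint[of B F "-F"] F Bs
        by (simp add: Compl_partition summable_on_subset_banach[OF Bs])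
      then show ?thesis using tail by (simp add: dist_real_def)
    qed
    have split: "infsum h UNIV = sum h F + infsum h (-F)" if "h summable_on UNIV" for h :: "'a \<Rightarrow> complex"
      using infsum_Un_disjoint[of h F "-F"] F that
      by (simp add: Compl_partition summable_on_subset_banach[OF that])
    have small: "cmod (infsum h (-F)) \<le> e/4" if h: "h summable_on UNIV" "\<And>x. cmod (h x) \<le> B x" for h
    proof -
      have "cmod (infsum h (-F)) \<le> infsum B (-F)"
        by (rule norm_infsum_le[OF has_sum_infsum has_sum_infsum])
          (use h in \<open>auto intro: summable_on_subset_banach[OF Bs] summable_on_subset_banach[OF h(1)]\<close>)
      then show ?thesis using Bt by simp
    qed
    have "(\<lambda>n. sum (f n) F) \<longlonglongrightarrow> sum g F" by (intro tendsto_sum lim)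
    then obtain N where N: "\<And>n. n \<ge> N \<Longrightarrow> cmod (sum (f n) F - sum g F) < e/4"
      using LIMSEQ_D[of _ "sum g F" "e/4"] e by auto
    show "\<exists>no. \<forall>n\<ge>no. norm (infsum (f n) UNIV - infsum g UNIV) < e"
    proof (intro exI allI impI)
      fix n assume n: "N \<le> n"
      have "infsum (f n) UNIV - infsum g UNIV
          = (sum (f n) F - sum g F) + infsum (f n) (-F) - infsum g (-F)"
        by (simp add: split[OF fs] split[OF gs])
      also have "cmod \<dots> \<le> cmod (sum (f n) F - sum g F) + cmod (infsum (f n) (-F)) + cmod (infsum g (-F))"
        by norm
      also have "\<dots> < e" using N[OF n] small[OF fs[of n] fB] small[OF gs gB] e by linarith
      finally show "cmod (infsum (f n) UNIV - infsum g UNIV) < e" .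
    qed
  qed
qed

section \<open>Duality of the sequence space norms\<close>

lemma ennreal_powr_ennreal: "0 \<le> x \<Longrightarrow> ennreal_powr (ennreal x) r = ennreal (x powr r)"
  by (simp add: ennreal_powr_def)

lemma ennreal_powr_top [simp]: "ennreal_powr \<infinity> r = \<infinity>" "ennreal_powr top r = top"
  by (simp_all add: ennreal_powr_def)

lemma ennreal_powr_zero [simp]: "ennreal_powr 0 r = 0"
  by (simp add: ennreal_powr_def)

lemma ennreal_powr_one [simp]: "ennreal_powr x 1 = x"
  by (cases x) (simp_all add: ennreal_powr_ennreal)

lemma ennreal_powr_inverse:
  assumes "r > 0"
  shows "ennreal_powr (ennreal_powr x r) (1 / r) = x" "ennreal_powr (ennreal_powr x (1 / r)) r = x"
  using assms by (cases x; simp add: ennreal_powr_ennreal powr_powr)+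

lemma ennreal_powr_mono:
  assumes "x \<le> y" "r > 0"
  shows "ennreal_powr x r \<le> ennreal_powr y r"
  using assms
  by (cases x; cases y) (auto simp: ennreal_powr_ennreal top_unique intro!: ennreal_leI powr_mono2)

lemma ennreal_powr_le_iff:
  assumes "r > 0"
  shows "ennreal_powr x (1 / r) \<le> y \<longleftrightarrow> x \<le> ennreal_powr y r"
  using ennreal_powr_mono[of x "ennreal_powr y r" "1 / r"] ennreal_powr_mono[of "ennreal_powr x (1 / r)" y r]
  by (auto simp: ennreal_powr_inverse assms)

lemma ennreal_powr_mult_real:
  assumes "0 \<le> c" "r > 0"
  shows "ennreal_powr (ennreal c * x) r = ennreal (c powr r) * ennreal_powr x r"
proof (cases x)
  case (real y)
  then show ?thesis
    using assms by (simp add: ennreal_powr_ennreal powr_mult flip: ennreal_mult)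
next
  case top
  then show ?thesis
    using assms by (cases "c = 0") (simp_all add: ennreal_powr_def ennreal_mult_top)
qed

lemma ennreal_finite_exponent:
  assumes "(1::ennreal) \<le> p" "p \<noteq> \<infinity>"
  obtains r where "p = ennreal r" "1 \<le> r"
  using assms by (cases p) auto

lemma lp_norm_infty: "lp_norm \<infinity> a = (SUP k. a k)" "lp_norm top a = (SUP k. a k)"
  by (simp_all add: lp_norm_def)

lemma lp_norm_one: "lp_norm 1 a = (\<Sum>\<^sub>\<infinity>k. a k)"
  by (simp add: lp_norm_def)

lemma lp_norm_finite:
  "0 \<le> r \<Longrightarrow> lp_norm (ennreal r) a = ennreal_powr (\<Sum>\<^sub>\<infinity>k. ennreal_powr (a k) r) (1 / r)"
  by (simp add: lp_norm_def)

lemma lp_norm_le_iff: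
  assumes "r > 0"
  shows "lp_norm (ennreal r) a \<le> M \<longleftrightarrow> (\<Sum>\<^sub>\<infinity>k. ennreal_powr (a k) r) \<le> ennreal_powr M r"
  using assms by (simp add: lp_norm_finite ennreal_powr_le_iff)

lemma lp_norm_mono:
  assumes "1 \<le> p" "\<And>k. a k \<le> b k"
  shows "lp_norm p a \<le> lp_norm p b"
proof (cases "p = \<infinity>")
  case True
  then show ?thesis using assms by (auto simp: lp_norm_infty intro!: SUP_mono)
next
  case False
  then obtain r where r: "p = ennreal r" "1 \<le> r"
    using assms ennreal_finite_exponent by blast
  show ?thesis
    using r assms by (auto simp: lp_norm_finite intro!: ennreal_powr_mono infsum_ennreal_mono)
qed

lemma lp_norm_cmult:
  assumes "1 \<le> p" "0 \<le> c"
  shows "lp_norm p (\<lambda>k. ennreal c * a k) = ennreal c * lp_norm p a"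
proof (cases "p = \<infinity>")
  case True
  then show ?thesis by (simp add: lp_norm_infty SUP_mult_left_ennreal)
next
  case False
  then obtain r where r: "p = ennreal r" "1 \<le> r"
    using assms ennreal_finite_exponent by blast
  show ?thesis
    using r assms
    by (simp add: lp_norm_finite ennreal_powr_mult_real infsum_ennreal_cmult powr_powr)
qed

text \<open>Each entry is bounded by the norm, and the norm by the \<open>l^1\<close> norm; these two
  inequalities embed the weighted spaces into each other.\<close>

lemma entry_le_lp_norm:
  assumes "1 \<le> p"
  shows "a k \<le> lp_norm p a"
proof (cases "p = \<infinity>")
  case True
  then show ?thesis by (auto simp: lp_norm_infty intro: SUP_upper)
next
  case False
  then obtain r where r: "p = ennreal r" "1 \<le> r"
    using assms ennreal_finite_exponent by blast
  have "ennreal_powr (a k) r \<le> (\<Sum>\<^sub>\<infinity>k. ennreal_powr (a k) r)" by (rule term_le_infsum_ennreal)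
  then have "ennreal_powr (ennreal_powr (a k) r) (1 / r) \<le> lp_norm p a"
    using r by (auto simp: lp_norm_finite intro!: ennreal_powr_mono)
  then show ?thesis using r by (simp add: ennreal_powr_inverse)
qed

lemma lp_norm_le_l1:
  assumes "1 \<le> p"
  shows "lp_norm p a \<le> (\<Sum>\<^sub>\<infinity>k. a k)"
proof (cases "p = \<infinity>")
  case True
  then show ?thesis by (auto simp: lp_norm_infty intro!: SUP_least term_le_infsum_ennreal)
next
  case False
  then obtain r where r: "p = ennreal r" "1 \<le> r"
    using assms ennreal_finite_exponent by blast
  show ?thesis
  proof (cases "\<Sum>\<^sub>\<infinity>k. a k")
    case (real s)
    have le: "ennreal_powr (a k) r \<le> ennreal (s powr (r - 1)) * a k" for k
    proof -
      have "a k \<le> ennreal s" using term_le_infsum_ennreal[of a k] real by simp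
      then obtain x where x: "a k = ennreal x" "0 \<le> x" "x \<le> s"
        using real by (cases "a k") (auto simp: top_unique)
      have "x powr r \<le> s powr (r - 1) * x"
      proof (cases "x = 0")
        case False
        then have "x powr r = x powr (r - 1) * x"
          using x powr_add[of x "r - 1" 1] by simp
        then show ?thesis using x r by (auto intro!: mult_right_mono powr_mono2)
      qed (use r in simp)
      then show ?thesis using x by (simp add: ennreal_powr_ennreal flip: ennreal_mult)
    qed
    have "(\<Sum>\<^sub>\<infinity>k. ennreal_powr (a k) r) \<le> ennreal (s powr (r - 1)) * ennreal s"
      using infsum_ennreal_mono[of "\<lambda>k. ennreal_powr (a k) r", OF le]
      by (simp add: infsum_ennreal_cmult real)
    also have "\<dots> = ennreal (s powr r)"
      using real powr_add[of s "r - 1" 1] r by (cases "s = 0") (simp_all flip: ennreal_mult)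
    finally show ?thesis using r real by (simp add: lp_norm_le_iff ennreal_powr_ennreal)
  qed simp
qed

definition conjugate :: "ennreal \<Rightarrow> ennreal \<Rightarrow> bool" where
  "conjugate p q \<longleftrightarrow> 1 \<le> p \<and> 1 \<le> q \<and> 1 / p + 1 / q = 1"

lemma conjugate_sym: "conjugate p q \<Longrightarrow> conjugate q p"
  by (simp add: conjugate_def add.commute)

text \<open>The case distinction behind all proofs about conjugate exponents: only in the third case
  do real powers appear.\<close>

lemma conjugate_cases [consumes 1, case_names one infty finite]:
  assumes "conjugate p q"
  obtains "p = 1" "q = \<infinity>" | "p = \<infinity>" "q = 1"
    | r s where "p = ennreal r" "q = ennreal s" "1 < r" "1 < s" "1 / r + 1 / s = (1::real)"
proof (cases "p = \<infinity>")
  case True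
  then have "1 / q = 1" using assms by (simp add: conjugate_def)
  then have "q = 1"
  proof (cases q)
    case (real s)
    then have "s \<noteq> 0" using \<open>1 / q = 1\<close> by auto
    then have "1 / q = ennreal (1 / s)" using real by (simp add: divide_ennreal flip: ennreal_1)
    then show ?thesis using \<open>1 / q = 1\<close> real by (simp add: ennreal_eq_1)
  qed simp
  then show ?thesis using True that by blast
next
  case False
  then obtain r where r: "p = ennreal r" "1 \<le> r"
    using assms ennreal_finite_exponent unfolding conjugate_def by blast
  have pr: "1 / p = ennreal (1 / r)" using r by (simp add: divide_ennreal flip: ennreal_1)
  show ?thesis
  proof (cases "q = \<infinity>")
    case True
    then have "ennreal (1 / r) = 1" using assms pr by (simp add: conjugate_def)
    then have "r = 1" using r by (simp add: ennreal_eq_1)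
    then show ?thesis using True r that by simp
  next
    case False
    then obtain s where s: "q = ennreal s" "1 \<le> s"
      using assms ennreal_finite_exponent unfolding conjugate_def by blast
    have "1 / q = ennreal (1 / s)" using s by (simp add: divide_ennreal flip: ennreal_1)
    moreover have "ennreal (1 / r) + ennreal (1 / s) = ennreal (1 / r + 1 / s)"
      by (rule ennreal_plus[symmetric]) (use r s in auto)
    ultimately have "ennreal (1 / r + 1 / s) = 1"
      using assms pr by (simp add: conjugate_def)
    then have eq: "1 / r + 1 / s = 1" unfolding ennreal_eq_1 .
    have "r \<noteq> 1" "s \<noteq> 1" using eq r s by auto
    then show ?thesis using that(3)[OF r(1) s(1)] r s eq by auto
  qed
qed

lemma conjugate_exists:
  assumes "1 \<le> p"
  obtains q where "conjugate p q"
proof (cases "p = \<infinity> \<or> p = 1")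
  case True
  then have "conjugate p (if p = 1 then \<infinity> else 1)" by (auto simp: conjugate_def)
  then show ?thesis by (rule that)
next
  case False
  then obtain r where r: "p = ennreal r" "1 \<le> r"
    using assms ennreal_finite_exponent by blast
  then have "r > 1" using False by (cases "r = 1") auto
  define s where "s = r / (r - 1)"
  have s: "s \<ge> 1" "1 / r + 1 / s = 1" using \<open>r > 1\<close> by (auto simp: s_def field_simps)
  have "1 / p = ennreal (1 / r)" "1 / ennreal s = ennreal (1 / s)"
    using s r by (simp_all add: divide_ennreal flip: ennreal_1)
  moreover have "ennreal (1 / r) + ennreal (1 / s) = ennreal (1 / r + 1 / s)"
    by (rule ennreal_plus[symmetric]) (use r s in auto)
  ultimately have "1 / p + 1 / ennreal s = 1" using s by simp
  then have "conjugate p (ennreal s)" using s r by (simp add: conjugate_def)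
  then show ?thesis by (rule that)
qed

lemma hoelder_normalised:
  assumes "conjugate p q" "lp_norm p a \<le> 1" "lp_norm q b \<le> 1"
  shows "(\<Sum>\<^sub>\<infinity>k. a k * b k) \<le> 1"
  using assms(1)
proof (cases rule: conjugate_cases)
  case one
  have "(\<Sum>\<^sub>\<infinity>k. a k * b k) \<le> (\<Sum>\<^sub>\<infinity>k. a k * 1)"
    using assms(3) by (intro infsum_ennreal_mono mult_left_mono)
      (auto simp: one lp_norm_infty SUP_le_iff)
  then show ?thesis using assms(2) by (simp add: one lp_norm_one)
next
  case infty
  have "(\<Sum>\<^sub>\<infinity>k. a k * b k) \<le> (\<Sum>\<^sub>\<infinity>k. 1 * b k)"
    using assms(2) by (intro infsum_ennreal_mono mult_right_mono)
      (auto simp: infty lp_norm_infty SUP_le_iff)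
  then show ?thesis using assms(3) by (simp add: infty lp_norm_one)
next
  case (finite r s)
  have fin: "x k \<noteq> top" if "lp_norm t x \<le> 1" "1 \<le> t" for x t and k :: 'a
    using order.trans[OF entry_le_lp_norm[OF that(2), of x k] that(1)] by (auto simp: top_unique)
  have pq: "1 \<le> p" "1 \<le> q" using assms(1) by (auto simp: conjugate_def)
  \<comment> \<open>Young's inequality, entry by entry\<close>
  have le: "a k * b k \<le> ennreal (1 / r) * ennreal_powr (a k) r + ennreal (1 / s) * ennreal_powr (b k) s" for k
  proof -
    obtain x y where xy: "a k = ennreal x" "b k = ennreal y" "0 \<le> x" "0 \<le> y"
      using fin[OF assms(2) pq(1), of k] fin[OF assms(3) pq(2), of k]
      by (cases "a k"; cases "b k") auto
    have "x * y \<le> x powr r / r + y powr s / s"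
      using finite xy by (intro Youngs_inequality) auto
    then have "ennreal (x * y) \<le> ennreal (x powr r / r + y powr s / s)" by (rule ennreal_leI)
    then show ?thesis
      using xy finite by (simp add: ennreal_powr_ennreal flip: ennreal_mult ennreal_plus)
  qed
  have one: "ennreal_powr 1 t = 1" for t by (simp add: ennreal_powr_def)
  have "(\<Sum>\<^sub>\<infinity>k. a k * b k)
      \<le> (\<Sum>\<^sub>\<infinity>k. ennreal (1 / r) * ennreal_powr (a k) r + ennreal (1 / s) * ennreal_powr (b k) s)"
    by (rule infsum_ennreal_mono) (rule le)
  also have "\<dots> = ennreal (1 / r) * (\<Sum>\<^sub>\<infinity>k. ennreal_powr (a k) r)
      + ennreal (1 / s) * (\<Sum>\<^sub>\<infinity>k. ennreal_powr (b k) s)"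
    by (simp add: infsum_ennreal_add infsum_ennreal_cmult)
  also have "\<dots> \<le> ennreal (1 / r) * 1 + ennreal (1 / s) * 1"
    using assms(2,3) finite by (intro add_mono mult_left_mono) (auto simp: lp_norm_le_iff one)
  also have "\<dots> = 1" using finite by (simp flip: ennreal_plus)
  finally show ?thesis .
qed

theorem hoelder:
  assumes pq: "conjugate p q"
  shows "(\<Sum>\<^sub>\<infinity>k. a k * b k) \<le> lp_norm p a * lp_norm q b"
proof -
  have le: "1 \<le> p" "1 \<le> q" using pq by (auto simp: conjugate_def)
  consider "lp_norm p a = 0 \<or> lp_norm q b = 0" | "lp_norm p a \<noteq> 0" "lp_norm q b \<noteq> 0" "lp_norm p a = top \<or> lp_norm q b = top"
    | \<alpha> \<beta> where "lp_norm p a = ennreal \<alpha>" "lp_norm q b = ennreal \<beta>" "\<alpha> > 0" "\<beta> > 0"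
    by (cases "lp_norm p a"; cases "lp_norm q b") (auto simp: less_le)
  then show ?thesis
  proof cases
    case 1
    have "a k * b k = 0" for k
      using 1 entry_le_lp_norm[OF le(1), of a k] entry_le_lp_norm[OF le(2), of b k] by auto
    then have "(\<Sum>\<^sub>\<infinity>k. a k * b k) = 0" by (intro infsum_0)
    then show ?thesis by simp
  next
    case 2
    then show ?thesis by (auto simp: ennreal_mult_top ennreal_top_mult)
  next
    case 3
    have "lp_norm p (\<lambda>k. ennreal (1 / \<alpha>) * a k) \<le> 1" "lp_norm q (\<lambda>k. ennreal (1 / \<beta>) * b k) \<le> 1"
      using 3 le by (simp_all add: lp_norm_cmult flip: ennreal_mult)
    from hoelder_normalised[OF pq this]
    have "(\<Sum>\<^sub>\<infinity>k. (ennreal (1 / \<alpha>) * a k) * (ennreal (1 / \<beta>) * b k)) \<le> 1" .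
    also have "(\<lambda>k. (ennreal (1 / \<alpha>) * a k) * (ennreal (1 / \<beta>) * b k))
        = (\<lambda>k. ennreal (1 / (\<alpha> * \<beta>)) * (a k * b k))"
      using 3 by (simp add: ennreal_mult mult_ac flip: ennreal_mult)
    finally have "ennreal (\<alpha> * \<beta>) * (ennreal (1 / (\<alpha> * \<beta>)) * (\<Sum>\<^sub>\<infinity>k. a k * b k)) \<le> ennreal (\<alpha> * \<beta>) * 1"
      by (intro mult_left_mono) (auto simp: infsum_ennreal_cmult)
    then show ?thesis
      using 3 by (simp add: ennreal_mult flip: mult.assoc) (simp flip: ennreal_mult)
  qed
qed

text \<open>The converse of Hoelder's inequality: finitely supported test sequences suffice to
  recover the norm. Together with \<open>hoelder\<close> this makes every exponent, including the two
  extreme ones, a supremum of linear functionals, so that estimates for general exponents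
  reduce to interchanges of sums.\<close>

theorem lp_norm_le_by_duality:
  assumes pq: "conjugate p q"
    and test: "\<And>b :: 'a \<Rightarrow> real. finite {k. b k \<noteq> 0} \<Longrightarrow> (\<And>k. 0 \<le> b k) \<Longrightarrow> lp_norm q (\<lambda>k. ennreal (b k)) \<le> 1
                \<Longrightarrow> (\<Sum>\<^sub>\<infinity>k. a k * ennreal (b k)) \<le> M"
  shows "lp_norm p a \<le> M"
proof -
  have le: "1 \<le> p" "1 \<le> q" using pq by (auto simp: conjugate_def)
  have entry: "a k \<le> M" for k
  proof -
    define b where "b i = (if i = k then 1 else 0 :: real)" for i
    have fs: "finite {i. b i \<noteq> 0}" by (rule finite_subset[of _ "{k}"]) (auto simp: b_def)
    have "lp_norm q (\<lambda>k. ennreal (b k)) \<le> (\<Sum>\<^sub>\<infinity>i. ennreal (b i))" by (rule lp_norm_le_l1[OF le(2)])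
    also have "\<dots> = 1" by (subst infsum_ennreal_finite_support[of "{k}"]) (auto simp: b_def)
    finally have "(\<Sum>\<^sub>\<infinity>i. a i * ennreal (b i)) \<le> M" by (intro test fs) (auto simp: b_def)
    moreover have "(\<Sum>\<^sub>\<infinity>i. a i * ennreal (b i)) = a k"
      by (subst infsum_ennreal_finite_support[of "{k}"]) (auto simp: b_def)
    ultimately show ?thesis by simp
  qed
  show ?thesis using pq
  proof (cases rule: conjugate_cases)
    case one
    have "sum a F \<le> M" if F: "finite F" for F
    proof -
      have "(\<Sum>\<^sub>\<infinity>k. a k * ennreal (indicator F k)) \<le> M"
        using F by (intro test) (auto simp: one lp_norm_infty indicator_def intro!: SUP_least)
      moreover have "(\<Sum>\<^sub>\<infinity>k. a k * ennreal (indicator F k)) = sum a F"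
        by (subst infsum_ennreal_finite_support[OF F]) auto
      ultimately show ?thesis by simp
    qed
    then show ?thesis by (auto simp: one lp_norm_one intro: infsum_ennreal_leI)
  next
    case infty
    then show ?thesis using entry by (auto simp: lp_norm_infty intro: SUP_least)
  next
    case (finite r s)
    show ?thesis
    proof (cases M)
      case (real m)
      have "\<exists>x. a k = ennreal x \<and> 0 \<le> x" for k
        using entry[of k] real by (cases "a k") (auto simp: top_unique)
      then obtain x where x: "\<And>k. a k = ennreal (x k)" "\<And>k. 0 \<le> x k" by metis
      have sr: "(r - 1) * s = r" using finite by (simp add: field_simps)
      have "(\<Sum>k\<in>F. ennreal_powr (a k) r) \<le> ennreal (m powr r)" if F: "finite F" for F
      proof -
        define S where "S = (\<Sum>k\<in>F. x k powr r)"
        have "S \<le> m powr r"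
        proof (cases "S = 0")
          case False
          then have S: "S > 0" by (simp add: S_def order.not_eq_order_implies_strict sum_nonneg)
          \<comment> \<open>the extremal sequence for Hoelder's inequality on \<open>F\<close>\<close>
          define b where "b k = (if k \<in> F then x k powr (r - 1) / S powr (1 / s) else 0)" for k
          have fs: "finite {k. b k \<noteq> 0}" by (rule finite_subset[OF _ F]) (auto simp: b_def)
          have b0: "0 \<le> b k" for k by (simp add: b_def)
          have z: "b k = 0" if "k \<notin> F" for k using that by (simp add: b_def)
          have bs: "b k powr s = x k powr r / S" if "k \<in> F" for k
            using that S finite by (simp add: b_def powr_divide powr_powr sr)
          have "(\<Sum>\<^sub>\<infinity>k. ennreal_powr (ennreal (b k)) s) = (\<Sum>k\<in>F. ennreal (b k powr s))"
            using finite by (subst infsum_ennreal_finite_support[OF F])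
              (auto simp: b_def ennreal_powr_ennreal)
          also have "\<dots> = ennreal (\<Sum>k\<in>F. x k powr r / S)"
            using S by (subst sum_ennreal[symmetric]) (auto simp: bs)
          also have "(\<Sum>k\<in>F. x k powr r / S) = 1"
            using S by (simp add: S_def flip: sum_divide_distrib)
          finally have "lp_norm q (\<lambda>k. ennreal (b k)) \<le> 1"
            using finite by (simp add: lp_norm_le_iff ennreal_powr_def)
          from test[OF fs b0 this] have "(\<Sum>\<^sub>\<infinity>k. a k * ennreal (b k)) \<le> ennreal m" using real by simp
          moreover have "(\<Sum>\<^sub>\<infinity>k. a k * ennreal (b k)) = (\<Sum>k\<in>F. ennreal (x k * b k))"
            using z by (subst infsum_ennreal_finite_support[OF F]) (simp_all add: x b0 ennreal_mult)
          moreover have "\<dots> = ennreal (\<Sum>k\<in>F. x k * b k)" by (rule sum_ennreal) (simp add: x b0)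
          ultimately have "(\<Sum>k\<in>F. x k * b k) \<le> m" using real by simp
          moreover have "x k * b k = x k powr r / S powr (1 / s)" if "k \<in> F" for k
            using that x(2)[of k] powr_add[of "x k" 1 "r - 1"] finite
            by (cases "x k = 0") (simp_all add: b_def)
          then have "(\<Sum>k\<in>F. x k * b k) = S / S powr (1 / s)"
            by (simp add: S_def flip: sum_divide_distrib)
          also have "\<dots> = S powr (1 / r)"
          proof -
            have "S = S powr (1 / r + 1 / s)" using finite S by simp
            also have "\<dots> = S powr (1 / r) * S powr (1 / s)" by (rule powr_add)
            finally show ?thesis using S by (simp add: field_simps)
          qed
          ultimately have "S powr (1 / r) \<le> m" by simp
          then have "(S powr (1 / r)) powr r \<le> m powr r" using finite by (intro powr_mono2) auto
          then show ?thesis using S finite by (simp add: powr_powr)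
        qed simp
        then show ?thesis by (simp add: x ennreal_powr_ennreal sum_ennreal S_def[symmetric] ennreal_leI)
      qed
      then have "(\<Sum>\<^sub>\<infinity>k. ennreal_powr (a k) r) \<le> ennreal (m powr r)" by (rule infsum_ennreal_leI)
      then show ?thesis using finite real by (simp add: lp_norm_le_iff ennreal_powr_ennreal)
    qed simp
  qed
qed

text \<open>Minkowski's inequality for infinite superpositions: after testing against a sequence of
  dual norm at most \<open>1\<close> the two sums can be interchanged, and Hoelder's inequality applies to
  the inner one.\<close>

lemma lp_norm_infsum_le:
  fixes y :: "'b \<Rightarrow> 'a \<Rightarrow> ennreal"
  assumes "1 \<le> p"
  shows "lp_norm p (\<lambda>j. \<Sum>\<^sub>\<infinity>k. x k * y k j) \<le> (\<Sum>\<^sub>\<infinity>k. x k * lp_norm p (y k))"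
proof -
  obtain q where pq: "conjugate p q" using conjugate_exists[OF assms] .
  show ?thesis
  proof (rule lp_norm_le_by_duality[OF pq])
    fix b :: "'a \<Rightarrow> real" assume b: "lp_norm q (\<lambda>k. ennreal (b k)) \<le> 1"
    have "(\<Sum>\<^sub>\<infinity>j. (\<Sum>\<^sub>\<infinity>k. x k * y k j) * ennreal (b j)) = (\<Sum>\<^sub>\<infinity>k. x k * (\<Sum>\<^sub>\<infinity>j. y k j * ennreal (b j)))"
      by (subst infsum_ennreal_cmult_right[symmetric], subst infsum_ennreal_swap)
        (simp add: mult.assoc infsum_ennreal_cmult)
    also have "\<dots> \<le> (\<Sum>\<^sub>\<infinity>k. x k * (lp_norm p (y k) * lp_norm q (\<lambda>j. ennreal (b j))))"
      by (intro infsum_ennreal_mono mult_left_mono hoelder[OF pq]) auto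
    also have "\<dots> \<le> (\<Sum>\<^sub>\<infinity>k. x k * (lp_norm p (y k) * 1))"
      using b by (intro infsum_ennreal_mono mult_left_mono) auto
    finally show "(\<Sum>\<^sub>\<infinity>j. (\<Sum>\<^sub>\<infinity>k. x k * y k j) * ennreal (b j)) \<le> (\<Sum>\<^sub>\<infinity>k. x k * lp_norm p (y k))"
      by simp
  qed
qed

text \<open>A test sequence with finite support sees only finitely many entries, so the bound passes
  to entrywise limits.\<close>

lemma lp_norm_le_pointwise_limit:
  fixes a :: "nat \<Rightarrow> 'a \<Rightarrow> ennreal"
  assumes "1 \<le> p" and lim: "\<And>k. (\<lambda>n. a n k) \<longlonglongrightarrow> c k" and bound: "\<And>n. lp_norm p (a n) \<le> M"
    and fin: "\<And>k. c k \<noteq> top"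
  shows "lp_norm p c \<le> M"
proof -
  obtain q where pq: "conjugate p q" using conjugate_exists[OF assms(1)] .
  show ?thesis
  proof (rule lp_norm_le_by_duality[OF pq])
    fix b :: "'a \<Rightarrow> real" assume fb: "finite {k. b k \<noteq> 0}" and b: "lp_norm q (\<lambda>k. ennreal (b k)) \<le> 1"
    define F where "F = {k. b k \<noteq> 0}"
    have fs: "(\<Sum>\<^sub>\<infinity>k. x k * ennreal (b k)) = (\<Sum>k\<in>F. x k * ennreal (b k))" for x
      by (rule infsum_ennreal_finite_support) (use fb in \<open>auto simp: F_def\<close>)
    have le: "(\<Sum>k\<in>F. a n k * ennreal (b k)) \<le> M" for n
    proof -
      have "(\<Sum>k\<in>F. a n k * ennreal (b k)) \<le> lp_norm p (a n) * lp_norm q (\<lambda>k. ennreal (b k))"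
        unfolding fs[symmetric] by (rule hoelder[OF pq])
      also have "\<dots> \<le> M * 1" by (intro mult_mono b bound) auto
      finally show ?thesis by simp
    qed
    have "(\<lambda>n. \<Sum>k\<in>F. a n k * ennreal (b k)) \<longlonglongrightarrow> (\<Sum>k\<in>F. c k * ennreal (b k))"
      using fin by (intro tendsto_sum tendsto_mult_ennreal lim tendsto_const) auto
    then show "(\<Sum>\<^sub>\<infinity>k. c k * ennreal (b k)) \<le> M"
      unfolding fs by (rule LIMSEQ_le_const2) (use le in auto)
  qed
qed

text \<open>The enumeration of the countable index set fixes an exhaustion by finite sets;
  truncations to it are the approximations used throughout.\<close>

definition truncate :: "nat \<Rightarrow> ('a::countable \<Rightarrow> complex) \<Rightarrow> 'a \<Rightarrow> complex" where
  "truncate n c k = (if to_nat k < n then c k else 0)"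

lemma finite_to_nat_less: "finite {k :: 'a::countable. to_nat k < n}"
  using finite_vimageI[of "{..<n}" "to_nat :: 'a \<Rightarrow> nat"] by (simp add: vimage_def)

lemma truncate_tendsto: "(\<lambda>n. truncate n c k) \<longlonglongrightarrow> c k"
  by (rule tendsto_eventually, rule eventually_sequentiallyI[of "Suc (to_nat k)"])
    (simp add: truncate_def)

lemma infsum_tail_tendsto_0:
  fixes f :: "'a::countable \<Rightarrow> ennreal"
  assumes fin: "(\<Sum>\<^sub>\<infinity>k. f k) < \<infinity>"
  shows "(\<lambda>n. \<Sum>\<^sub>\<infinity>k. if to_nat k < n then 0 else f k) \<longlonglongrightarrow> 0"
proof -
  define g where "g k = enn2real (f k)" for k
  have ffin: "f k < \<infinity>" for k
    using term_le_infsum_ennreal[of f k] fin by (rule order.strict_trans1)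
  then have fg: "f k = ennreal (g k)" and g0: "g k \<ge> 0" for k by (simp_all add: g_def)
  define h where "h n k = complex_of_real (if to_nat k < n then 0 else g k)" for n and k :: 'a
  have hl: "(\<lambda>n. h n k) \<longlonglongrightarrow> 0" for k
    by (rule tendsto_eventually, rule eventually_sequentiallyI[of "Suc (to_nat k)"])
      (simp add: h_def)
  have hb: "ennreal (cmod (h n k)) \<le> f k" for n k using g0 by (simp add: h_def fg)
  have hs: "(h n) summable_on UNIV" for n
    unfolding complex_summable_iff_ennreal
    using infsum_ennreal_mono[of "\<lambda>k. ennreal (cmod (h n k))", OF hb] fin
    by (rule order.strict_trans1)
  have "(\<lambda>n. \<Sum>\<^sub>\<infinity>k. h n k) \<longlonglongrightarrow> 0"
    using infsum_dominated_convergence[OF hl hb fin] by simp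
  from tendsto_norm[OF this] have lim: "(\<lambda>n. ennreal (cmod (\<Sum>\<^sub>\<infinity>k. h n k))) \<longlonglongrightarrow> 0"
    using tendsto_ennrealI by force
  have "ennreal (cmod (\<Sum>\<^sub>\<infinity>k. h n k)) = (\<Sum>\<^sub>\<infinity>k. if to_nat k < n then 0 else f k)" for n
  proof -
    have "(\<lambda>k. norm (h n k)) summable_on UNIV"
      using hs[of n] by (simp add: summable_on_iff_abs_summable_on_complex)
    then have s: "(\<lambda>k. if to_nat k < n then 0 else g k) summable_on UNIV"
      by (rule summable_on_cong[THEN iffD1, rotated]) (use g0 in \<open>auto simp: h_def\<close>)
    have "(\<Sum>\<^sub>\<infinity>k. if to_nat k < n then 0 else f k) = (\<Sum>\<^sub>\<infinity>k. ennreal (if to_nat k < n then 0 else g k))"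
      by (intro infsum_cong) (simp add: fg)
    also have "\<dots> = ennreal (\<Sum>\<^sub>\<infinity>k. if to_nat k < n then 0 else g k)"
      by (rule infsum_ennreal_eq_real[OF s]) (simp add: g0)
    also have "(\<Sum>\<^sub>\<infinity>k. if to_nat k < n then 0 else g k) = cmod (\<Sum>\<^sub>\<infinity>k. h n k)"
    proof -
      have "(\<Sum>\<^sub>\<infinity>k. h n k) = complex_of_real (\<Sum>\<^sub>\<infinity>k. if to_nat k < n then 0 else g k)"
        unfolding h_def by (rule infsumI, rule has_sum_of_real, rule has_sum_infsum, rule s)
      moreover have "(\<Sum>\<^sub>\<infinity>k. if to_nat k < n then 0 else g k) \<ge> 0"
        by (rule infsum_nonneg) (simp add: g0)
      ultimately show ?thesis by simp
    qed
    finally show ?thesis by simp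
  qed
  then show ?thesis using lim by simp
qed

lemma lp_norm_tail_tendsto_0:
  fixes a :: "'a::countable \<Rightarrow> ennreal"
  assumes "1 \<le> p" "p \<noteq> \<infinity>" "lp_norm p a < \<infinity>"
  shows "(\<lambda>n. lp_norm p (\<lambda>k. if to_nat k < n then 0 else a k)) \<longlonglongrightarrow> 0"
proof -
  obtain r where r: "p = ennreal r" "1 \<le> r" using assms ennreal_finite_exponent by blast
  have "(\<Sum>\<^sub>\<infinity>k. ennreal_powr (a k) r) < \<infinity>"
    using assms(3) r by (cases "\<Sum>\<^sub>\<infinity>k. ennreal_powr (a k) r") (auto simp: lp_norm_finite)
  from infsum_tail_tendsto_0[OF this]
  have lim: "(\<lambda>n. \<Sum>\<^sub>\<infinity>k. ennreal_powr (if to_nat k < n then 0 else a k) r) \<longlonglongrightarrow> 0"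
    by (simp add: if_distrib[of "\<lambda>x. ennreal_powr x r"] cong: if_cong)
  show ?thesis
  proof (rule order_tendstoI)
    fix e :: ennreal assume e: "0 < e"
    obtain d where d: "0 < d" "ennreal d < e"
    proof (cases e)
      case (real x)
      then have "0 < x / 2" "ennreal (x / 2) < e" using e by (auto simp: ennreal_less_iff)
      then show ?thesis by (rule that)
    next
      case top
      then show ?thesis using that[of 1] by simp
    qed
    have "0 < ennreal (d powr r)" using d by simp
    from order_tendstoD(2)[OF lim this]
    show "\<forall>\<^sub>F n in sequentially. lp_norm p (\<lambda>k. if to_nat k < n then 0 else a k) < e"
    proof eventually_elim
      case (elim n)
      then have "lp_norm p (\<lambda>k. if to_nat k < n then 0 else a k) \<le> ennreal d"
        using r d by (simp add: lp_norm_le_iff ennreal_powr_ennreal less_imp_le)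
      then show ?case using d(2) by (rule order.strict_trans1)
    qed
  qed simp
qed

section \<open>Complex Hilbert spaces\<close>

lemma scaleC_zero_left [simp]: "0 *\<^sub>C (x::'a::complex_vector) = 0"
  using scaleR_scaleC[of 0 x] by simp

lemma scaleC_zero_right [simp]: "a *\<^sub>C (0::'a::complex_vector) = 0"
  using scaleC_add_right[of a 0 0] by simp

lemma scaleC_minus_right: "a *\<^sub>C (- x::'a::complex_vector) = - (a *\<^sub>C x)"
  using scaleC_add_right[of a x "-x"] by (simp add: eq_neg_iff_add_eq_0 add.commute)

lemma scaleC_minus_left: "(- a) *\<^sub>C (x::'a::complex_vector) = - (a *\<^sub>C x)"
  using scaleC_add_left[of a "-a" x] by (simp add: eq_neg_iff_add_eq_0 add.commute)

lemma scaleC_diff_right: "a *\<^sub>C (x - y::'a::complex_vector) = a *\<^sub>C x - a *\<^sub>C y"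
  using scaleC_add_right[of a x "-y"] by (simp add: scaleC_minus_right)

lemma scaleC_diff_left: "(a - b) *\<^sub>C (x::'a::complex_vector) = a *\<^sub>C x - b *\<^sub>C x"
  using scaleC_add_left[of a "-b" x] by (simp add: scaleC_minus_left)

context
  fixes x y z :: "'a::complex_hilbert"
begin

lemma cinner_add_right: "cinner x (y + z) = cinner x y + cinner x z"
  using arg_cong[OF cinner_add_left[of y z x], of cnj] by (simp flip: cinner_commute)

lemma cinner_scaleC_right: "cinner x (a *\<^sub>C y) = cnj a * cinner x y"
  using arg_cong[OF cinner_scaleC_left[of a y x], of cnj] by (simp flip: cinner_commute)

lemma cinner_zero_left [simp]: "cinner 0 x = 0"
  using cinner_scaleC_left[of 0 x x] by simp

lemma cinner_zero_right [simp]: "cinner x 0 = 0"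
  using cinner_scaleC_right[of 0] by simp

lemma cinner_minus_left: "cinner (- x) y = - cinner x y"
  using cinner_scaleC_left[of "-1" x y] by (simp add: scaleC_minus_left scaleC_one)

lemma cinner_minus_right: "cinner x (- y) = - cinner x y"
  using cinner_scaleC_right[of "-1"] by (simp add: scaleC_minus_left scaleC_one)

lemma cinner_self: "cinner x x = complex_of_real ((norm x)\<^sup>2)"
proof -
  have im: "Im (cinner x x) = 0"
    using arg_cong[OF cinner_commute[of x x], of Im] by simp
  have "sqrt (Re (cinner x x)) \<ge> 0" using norm_ge_zero[of x] by (simp add: norm_eq_sqrt_cinner)
  then have "Re (cinner x x) \<ge> 0" by simp
  then have "(norm x)\<^sup>2 = Re (cinner x x)" by (simp add: norm_eq_sqrt_cinner)
  with im show ?thesis by (simp add: complex_eq_iff)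
qed

end

lemma cinner_diff_left: "cinner (x - y) z = cinner x z - cinner y z" for x y z :: "'a::complex_hilbert"
  using cinner_add_left[of x "-y" z] by (simp add: cinner_minus_left)

lemma cinner_diff_right: "cinner x (y - z) = cinner x y - cinner x z" for x y z :: "'a::complex_hilbert"
  using cinner_add_right[of x y "-z"] by (simp add: cinner_minus_right)

lemma cinner_scaleR_left: "cinner (r *\<^sub>R x) y = of_real r * cinner x y" for x y :: "'a::complex_hilbert"
  by (simp add: scaleR_scaleC cinner_scaleC_left)

lemma cinner_sum_left: "cinner (\<Sum>i\<in>F. f i) y = (\<Sum>i\<in>F. cinner (f i) y)" for y :: "'a::complex_hilbert"
  by (induction F rule: infinite_finite_induct) (simp_all add: cinner_add_left)

lemma norm_scaleC: "norm (a *\<^sub>C x) = cmod a * norm x" for x :: "'a::complex_hilbert"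
proof -
  have "complex_of_real ((norm (a *\<^sub>C x))\<^sup>2) = complex_of_real ((cmod a * norm x)\<^sup>2)"
    unfolding cinner_self[symmetric] cinner_scaleC_left cinner_scaleC_right
    by (simp add: cinner_self power_mult_distrib mult_ac flip: complex_norm_square)
  then have "(norm (a *\<^sub>C x))\<^sup>2 = (cmod a * norm x)\<^sup>2" unfolding of_real_eq_iff .
  then show ?thesis by (simp add: power2_eq_iff_nonneg)
qed

lemma norm_diff_square:
  "(norm (x - y))\<^sup>2 = (norm x)\<^sup>2 - 2 * Re (cinner x y) + (norm y)\<^sup>2" for x y :: "'a::complex_hilbert"
proof -
  have "complex_of_real ((norm (x - y))\<^sup>2) = cinner (x - y) (x - y)" by (simp only: cinner_self)
  then have "(norm (x - y))\<^sup>2 = Re (cinner (x - y) (x - y))" by (metis Re_complex_of_real)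
  also have "\<dots> = Re (cinner x x) - Re (cinner x y) - Re (cinner y x) + Re (cinner y y)"
    by (simp add: cinner_diff_left cinner_diff_right)
  also have "Re (cinner y x) = Re (cinner x y)" by (subst cinner_commute) simp
  finally show ?thesis by (simp add: cinner_self)
qed

lemma cauchy_schwarz: "cmod (cinner x y) \<le> norm x * norm y" for x y :: "'a::complex_hilbert"
proof (cases "y = 0")
  case False
  define t where "t = cinner x y / of_real ((norm y)\<^sup>2)"
  have n: "norm y > 0" using False by simp
  have c: "cinner x (t *\<^sub>C y) = of_real ((cmod (cinner x y))\<^sup>2 / (norm y)\<^sup>2)"
    by (simp add: cinner_scaleC_right t_def mult.commute flip: complex_norm_square)
  have "0 \<le> (norm (x - t *\<^sub>C y))\<^sup>2" by simp
  also have "\<dots> = (norm x)\<^sup>2 - 2 * ((cmod (cinner x y))\<^sup>2 / (norm y)\<^sup>2) + (cmod t * norm y)\<^sup>2"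
    by (simp only: norm_diff_square c Re_complex_of_real norm_scaleC)
  also have "(cmod t * norm y)\<^sup>2 = (cmod (cinner x y))\<^sup>2 / (norm y)\<^sup>2"
  proof -
    have "cmod t = cmod (cinner x y) / (norm y)\<^sup>2" by (simp add: t_def norm_divide norm_power)
    then show ?thesis using n by (simp add: power2_eq_square field_simps)
  qed
  finally have "(cmod (cinner x y))\<^sup>2 \<le> (norm x * norm y)\<^sup>2"
    using n by (simp add: field_simps power_mult_distrib)
  then show ?thesis by (rule power2_le_imp_le) simp
qed simp

lemma bounded_linear_cinner_left: "bounded_linear (\<lambda>x. cinner x y)" for y :: "'a::complex_hilbert"
  by (rule bounded_linear_intro[where K="norm y"])
    (simp_all add: cinner_add_left cinner_scaleR_left scaleR_conv_of_real cauchy_schwarz)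

definition bounded_clinear :: "('a::complex_hilbert \<Rightarrow> 'b::complex_hilbert) \<Rightarrow> bool" where
  "bounded_clinear T \<longleftrightarrow> bounded_linear T \<and> (\<forall>a x. T (a *\<^sub>C x) = a *\<^sub>C T x)"

lemma bounded_clinearI:
  assumes "\<And>x y. T (x + y) = T x + T y" "\<And>a x. T (a *\<^sub>C x) = a *\<^sub>C T x" "\<And>x. norm (T x) \<le> K * norm x"
  shows "bounded_clinear T"
  unfolding bounded_clinear_def
  using assms by (auto intro!: bounded_linear_intro[where K=K] simp: scaleR_scaleC mult.commute)

lemma bounded_clinear_id: "bounded_clinear (\<lambda>x. x)"
  by (simp add: bounded_clinear_def bounded_linear_ident)

lemma bounded_clinear_compose:
  "bounded_clinear S \<Longrightarrow> bounded_clinear T \<Longrightarrow> bounded_clinear (\<lambda>x. S (T x))"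
  by (auto simp: bounded_clinear_def intro: bounded_linear_compose)

text \<open>The Lax--Milgram lemma: for a suitable step size, \<open>x \<mapsto> x - t (T x - y)\<close> is a
  contraction, and its fixed point solves \<open>T x = y\<close>.\<close>

lemma coercive_bijective:
  fixes T :: "'a::complex_hilbert \<Rightarrow> 'a"
  assumes T: "bounded_clinear T" and a: "a > 0" and coercive: "\<And>x. a * (norm x)\<^sup>2 \<le> Re (cinner (T x) x)"
  shows "bij T" "norm (inv T y) \<le> norm y / a" "bounded_clinear (inv T)"
proof -
  have bl: "bounded_linear T" and sc: "\<And>a x. T (a *\<^sub>C x) = a *\<^sub>C T x"
    using T by (auto simp: bounded_clinear_def)
  interpret bounded_linear T by (rule bl)
  obtain K0 where K0: "\<And>x. norm (T x) \<le> norm x * K0" using bounded by blast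
  define K where "K = max K0 a"
  have Ka: "K \<ge> a" "K > 0" using a by (auto simp: K_def)
  have K: "norm (T x) \<le> K * norm x" for x
    using K0[of x] mult_left_mono[of K0 K "norm x"] by (simp add: K_def mult.commute)
  have lower: "a * norm x \<le> norm (T x)" for x
  proof (cases "x = 0")
    case False
    have "a * norm x * norm x \<le> norm (T x) * norm x"
      using coercive[of x] complex_Re_le_cmod[of "cinner (T x) x"] cauchy_schwarz[of "T x" x]
      by (simp add: power2_eq_square mult.assoc)
    then show ?thesis using False by simp
  qed (simp add: zero)
  have inj: "inj T"
  proof (rule injI)
    fix x y assume "T x = T y"
    then have "a * norm (x - y) \<le> 0" using lower[of "x - y"] by (simp add: diff)
    then show "x = y" using a by (simp add: mult_le_0_iff)
  qed
  define t where "t = a / K\<^sup>2"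
  define c where "c = sqrt (1 - a\<^sup>2 / K\<^sup>2)"
  have q: "a\<^sup>2 / K\<^sup>2 \<le> 1" "a\<^sup>2 / K\<^sup>2 > 0" using Ka a by (auto simp: power_mono)
  have c: "0 \<le> c" "c < 1" "c\<^sup>2 = 1 - a\<^sup>2 / K\<^sup>2" using q by (auto simp: c_def)
  \<comment> \<open>the step size \<open>t = a / K\<^sup>2\<close> minimises the bound \<open>1 - 2 t a + t\<^sup>2 K\<^sup>2\<close>\<close>
  have contraction: "norm (x - t *\<^sub>R T x) \<le> c * norm x" for x
  proof (rule power2_le_imp_le)
    have "(norm (x - t *\<^sub>R T x))\<^sup>2 = (norm x)\<^sup>2 - 2 * (t * Re (cinner (T x) x)) + t\<^sup>2 * (norm (T x))\<^sup>2"
      by (subst norm_diff_square, subst cinner_commute)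
        (simp add: cinner_scaleR_left power_mult_distrib)
    also have "\<dots> \<le> (norm x)\<^sup>2 - 2 * (t * (a * (norm x)\<^sup>2)) + t\<^sup>2 * (K * norm x)\<^sup>2"
      using a Ka by (intro add_mono diff_mono mult_left_mono coercive power_mono K) (auto simp: t_def)
    also have "\<dots> = (1 - a\<^sup>2 / K\<^sup>2) * (norm x)\<^sup>2"
      using Ka by (simp add: t_def field_simps power2_eq_square)
    also have "\<dots> = (c * norm x)\<^sup>2" by (simp add: c(3) power_mult_distrib)
    finally show "(norm (x - t *\<^sub>R T x))\<^sup>2 \<le> (c * norm x)\<^sup>2" .
  qed (use c in simp)
  have surj: "\<exists>x. T x = y" for y
  proof -
    define \<Phi> where "\<Phi> x = x - t *\<^sub>R (T x - y)" for x
    have "dist (\<Phi> u) (\<Phi> v) \<le> c * dist u v" for u v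
    proof -
      have "\<Phi> u - \<Phi> v = (u - v) - t *\<^sub>R T (u - v)" by (simp add: \<Phi>_def diff scaleR_diff_right)
      then show ?thesis using contraction[of "u - v"] by (simp add: dist_norm)
    qed
    then obtain x where "\<Phi> x = x" using banach_fix_type[OF c(1,2), of \<Phi>] by blast
    then have "t *\<^sub>R (T x - y) = 0" by (simp add: \<Phi>_def)
    then have "T x = y" using a Ka by (simp add: t_def)
    then show ?thesis ..
  qed
  show bij: "bij T" using inj surj by (metis bijI surj_def)
  have Ti: "T (inv T y) = y" for y using bij by (simp add: bij_is_surj surj_f_inv_f)
  show bound: "norm (inv T y) \<le> norm y / a" for y
    using lower[of "inv T y"] a by (simp add: Ti field_simps)
  show "bounded_clinear (inv T)"
  proof (rule bounded_clinearI[where K="1 / a"])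
    show "inv T (x + y) = inv T x + inv T y" for x y
      by (rule injD[OF inj]) (simp add: Ti add)
    show "inv T (b *\<^sub>C x) = b *\<^sub>C inv T x" for b x
      by (rule injD[OF inj]) (simp add: Ti sc)
  qed (use bound in simp)
qed

text \<open>Cauchy's criterion for unordered sums, used for the synthesis operator: frame series
  converge unconditionally but in general not absolutely.\<close>

lemma summable_on_Cauchy:
  fixes f :: "'i \<Rightarrow> 'a::banach"
  assumes "\<And>e. e > 0 \<Longrightarrow> \<exists>F0. finite F0 \<and> (\<forall>F. finite F \<and> F \<inter> F0 = {} \<longrightarrow> norm (sum f F) < e)"
  shows "f summable_on UNIV"
proof -
  let ?\<F> = "filtermap (sum f) (finite_subsets_at_top UNIV)"
  have "cauchy_filter ?\<F>"
    unfolding cauchy_filter_def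
  proof (rule filter_leI)
    fix E :: "'a \<times> 'a \<Rightarrow> bool" assume "eventually E uniformity"
    then obtain e where e: "e > 0" "\<And>x y. dist x y < e \<Longrightarrow> E (x, y)"
      by (auto simp: eventually_uniformity_metric)
    obtain F0 where F0: "finite F0" "\<And>F. finite F \<Longrightarrow> F \<inter> F0 = {} \<Longrightarrow> norm (sum f F) < e / 2"
      using assms[of "e / 2"] e by auto
    have near: "dist (sum f F) (sum f F0) < e / 2" if "finite F" "F0 \<subseteq> F" for F
      using F0(2)[of "F - F0"] that by (auto simp: dist_norm sum_diff)
    have ev: "eventually (\<lambda>x. dist x (sum f F0) < e / 2) ?\<F>"
      unfolding eventually_filtermap eventually_finite_subsets_at_top
      by (rule exI[of _ F0]) (use F0 near in auto)
    have "eventually (\<lambda>z. dist (fst z) (sum f F0) < e / 2 \<and> dist (snd z) (sum f F0) < e / 2) (?\<F> \<times>\<^sub>F ?\<F>)"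
      unfolding eventually_prod_filter using ev by fastforce
    then show "eventually E (?\<F> \<times>\<^sub>F ?\<F>)"
    proof eventually_elim
      case (elim z)
      have "dist (fst z) (snd z) \<le> dist (fst z) (sum f F0) + dist (snd z) (sum f F0)"
        by (metis dist_commute dist_triangle)
      then show ?case using elim e(2)[of "fst z" "snd z"] by simp
    qed
  qed
  then obtain x where "?\<F> \<le> nhds x"
    using cauchy_filter_complete_converges[of ?\<F> UNIV] by (auto simp: filtermap_bot_iff complete_UNIV)
  then show ?thesis by (auto simp: summable_on_def has_sum_def filterlim_def)
qed

section \<open>The calculus of frame operator and Gram matrix\<close>

definition square_summable :: "('i \<Rightarrow> complex) \<Rightarrow> bool" where
  "square_summable c \<longleftrightarrow> (\<lambda>i. (cmod (c i))\<^sup>2) summable_on UNIV"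

lemma wnorm_two: "wnorm 2 (\<lambda>_. 1) c \<le> M \<longleftrightarrow> (\<Sum>\<^sub>\<infinity>i. ennreal ((cmod (c i))\<^sup>2)) \<le> ennreal_powr M 2"
  using lp_norm_le_iff[of 2 "\<lambda>i. ennreal (cmod (c i))" M]
  by (simp add: wnorm_def ennreal_powr_ennreal)

lemma wnorm_two_finite_iff: "wnorm 2 (\<lambda>_. 1) c < \<infinity> \<longleftrightarrow> square_summable c"
proof -
  have "square_summable c \<longleftrightarrow> (\<Sum>\<^sub>\<infinity>i. ennreal ((cmod (c i))\<^sup>2)) < \<infinity>"
    unfolding square_summable_def by (rule summable_on_iff_ennreal) simp
  moreover have "wnorm 2 (\<lambda>_. 1) c = ennreal_powr (\<Sum>\<^sub>\<infinity>i. ennreal ((cmod (c i))\<^sup>2)) (1 / 2)"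
    using lp_norm_finite[of 2 "\<lambda>i. ennreal (cmod (c i))"]
    by (simp add: wnorm_def ennreal_powr_ennreal)
  ultimately show ?thesis
    by (cases "\<Sum>\<^sub>\<infinity>i. ennreal ((cmod (c i))\<^sup>2)") (simp_all add: ennreal_powr_ennreal)
qed

locale framed =
  fixes \<Psi> :: "'i::countable \<Rightarrow> 'h::complex_hilbert" and A B :: real
  assumes A: "A > 0" and B: "B > 0"
    and summable_squares: "\<And>f. (\<lambda>i. (cmod (cinner f (\<Psi> i)))\<^sup>2) summable_on UNIV"
    and lower: "\<And>f. A * (norm f)\<^sup>2 \<le> (\<Sum>\<^sub>\<infinity>i. (cmod (cinner f (\<Psi> i)))\<^sup>2)"
    and upper: "\<And>f. (\<Sum>\<^sub>\<infinity>i. (cmod (cinner f (\<Psi> i)))\<^sup>2) \<le> B * (norm f)\<^sup>2"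
begin

definition synth :: "('i \<Rightarrow> complex) \<Rightarrow> 'h" where
  "synth c = (\<Sum>\<^sub>\<infinity>i. c i *\<^sub>C \<Psi> i)"

definition S :: "'h \<Rightarrow> 'h" where "S = frame_operator \<Psi>"

lemma frame_operator_eq: "S f = synth (analysis \<Psi> f)"
  by (simp add: S_def frame_operator_def synth_def analysis_def)

lemma square_summable_analysis: "square_summable (analysis \<Psi> f)"
  using summable_squares[of f] by (simp add: square_summable_def analysis_def)

text \<open>The bound of the analysis operator carries over to its adjoint. With \<open>v\<close> the left hand
  vector, \<open>\<parallel>v\<parallel>\<^sup>2 = \<Sum> c_i \<langle>\<psi>_i, v\<rangle>\<close>, and the Cauchy--Schwarz inequality together with the upper
  frame bound leaves a factor \<open>\<parallel>v\<parallel>\<^sup>2\<close> to be cancelled.\<close>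

lemma norm_finite_synth:
  assumes "finite F"
  shows "(norm (\<Sum>i\<in>F. c i *\<^sub>C \<Psi> i))\<^sup>2 \<le> B * (\<Sum>i\<in>F. (cmod (c i))\<^sup>2)"
proof -
  define v where "v = (\<Sum>i\<in>F. c i *\<^sub>C \<Psi> i)"
  have "complex_of_real ((norm v)\<^sup>2) = cinner v v" by (rule cinner_self[symmetric])
  also have "\<dots> = (\<Sum>i\<in>F. c i * cinner (\<Psi> i) v)"
    by (subst (1) v_def) (simp add: cinner_sum_left cinner_scaleC_left)
  finally have eq: "complex_of_real ((norm v)\<^sup>2) = (\<Sum>i\<in>F. c i * cinner (\<Psi> i) v)" .
  have "(norm v)\<^sup>2 = cmod (complex_of_real ((norm v)\<^sup>2))" by (simp only: norm_of_real) simp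
  also have "\<dots> \<le> (\<Sum>i\<in>F. cmod (c i) * cmod (cinner v (\<Psi> i)))"
  proof -
    have "cmod (cinner (\<Psi> i) v) = cmod (cinner v (\<Psi> i))" for i
      by (subst cinner_commute) simp
    then show ?thesis unfolding eq by (intro order.trans[OF norm_sum]) (simp add: norm_mult)
  qed
  finally have "((norm v)\<^sup>2)\<^sup>2 \<le> (\<Sum>i\<in>F. cmod (c i) * cmod (cinner v (\<Psi> i)))\<^sup>2"
    by (intro power_mono) auto
  also have "\<dots> \<le> (\<Sum>i\<in>F. (cmod (c i))\<^sup>2) * (\<Sum>i\<in>F. (cmod (cinner v (\<Psi> i)))\<^sup>2)"
    by (rule Cauchy_Schwarz_ineq_sum)
  also have "\<dots> \<le> (\<Sum>i\<in>F. (cmod (c i))\<^sup>2) * (B * (norm v)\<^sup>2)"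
    using finite_sum_le_infsum[OF summable_squares[of v] assms] upper[of v]
    by (intro mult_left_mono sum_nonneg) auto
  finally have le: "(norm v)\<^sup>2 * (norm v)\<^sup>2 \<le> (B * (\<Sum>i\<in>F. (cmod (c i))\<^sup>2)) * (norm v)\<^sup>2"
    by (simp add: power2_eq_square mult_ac)
  have "(norm v)\<^sup>2 \<le> B * (\<Sum>i\<in>F. (cmod (c i))\<^sup>2)"
  proof (cases "v = 0")
    case False
    then have "0 < (norm v)\<^sup>2" by simp
    with le show ?thesis by (rule mult_right_le_imp_le)
  qed (use B in \<open>simp add: sum_nonneg\<close>)
  then show ?thesis by (simp add: v_def)
qed

lemma has_sum_synth:
  assumes "square_summable c"
  shows "((\<lambda>i. c i *\<^sub>C \<Psi> i) has_sum synth c) UNIV"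
proof -
  have s: "(\<lambda>i. (cmod (c i))\<^sup>2) summable_on UNIV" using assms by (simp add: square_summable_def)
  have "(\<lambda>i. c i *\<^sub>C \<Psi> i) summable_on UNIV"
  proof (rule summable_on_Cauchy)
    fix e :: real assume e: "e > 0"
    obtain F0 where F0: "finite F0"
      and d: "dist (\<Sum>i\<in>F0. (cmod (c i))\<^sup>2) (\<Sum>\<^sub>\<infinity>i. (cmod (c i))\<^sup>2) \<le> e\<^sup>2 / (2 * B)"
      using infsum_finite_approximation[OF s, of "e\<^sup>2 / (2 * B)"] e B by auto
    have "norm (\<Sum>i\<in>F. c i *\<^sub>C \<Psi> i) < e" if F: "finite F" "F \<inter> F0 = {}" for F
    proof -
      have "(\<Sum>i\<in>F. (cmod (c i))\<^sup>2) + (\<Sum>i\<in>F0. (cmod (c i))\<^sup>2) \<le> (\<Sum>\<^sub>\<infinity>i. (cmod (c i))\<^sup>2)"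
        using finite_sum_le_infsum[OF s, of "F \<union> F0"] F F0 by (simp add: sum.union_disjoint)
      then have "(\<Sum>i\<in>F. (cmod (c i))\<^sup>2) \<le> e\<^sup>2 / (2 * B)" using d by (simp add: dist_real_def)
      then have "B * (\<Sum>i\<in>F. (cmod (c i))\<^sup>2) \<le> e\<^sup>2 / 2" using B by (simp add: field_simps)
      then have "(norm (\<Sum>i\<in>F. c i *\<^sub>C \<Psi> i))\<^sup>2 \<le> e\<^sup>2 / 2"
        using norm_finite_synth[OF F(1), of c] by linarith
      also have "\<dots> < e\<^sup>2" using e by simp
      finally show ?thesis using e by (simp add: power2_less_imp_less)
    qed
    then show "\<exists>F0. finite F0 \<and> (\<forall>F. finite F \<and> F \<inter> F0 = {} \<longrightarrow> norm (\<Sum>i\<in>F. c i *\<^sub>C \<Psi> i) < e)"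
      using F0 by blast
  qed
  then show ?thesis by (simp add: synth_def)
qed

lemma norm_synth:
  assumes c: "square_summable c"
  shows "(norm (synth c))\<^sup>2 \<le> B * (\<Sum>\<^sub>\<infinity>i. (cmod (c i))\<^sup>2)"
proof -
  have s: "(\<lambda>i. (cmod (c i))\<^sup>2) summable_on UNIV" using c by (simp add: square_summable_def)
  have "((\<lambda>F. (norm (\<Sum>i\<in>F. c i *\<^sub>C \<Psi> i))\<^sup>2) \<longlongrightarrow> (norm (synth c))\<^sup>2) (finite_subsets_at_top UNIV)"
    using has_sum_synth[OF c] unfolding has_sum_def by (intro tendsto_intros)
  then show ?thesis
  proof (rule tendsto_upperbound)
    show "\<forall>\<^sub>F F in finite_subsets_at_top UNIV. (norm (\<Sum>i\<in>F. c i *\<^sub>C \<Psi> i))\<^sup>2 \<le> B * (\<Sum>\<^sub>\<infinity>i. (cmod (c i))\<^sup>2)"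
    proof (rule eventually_finite_subsets_at_top_weakI)
      fix F :: "'i set" assume F: "finite F"
      have "B * (\<Sum>i\<in>F. (cmod (c i))\<^sup>2) \<le> B * (\<Sum>\<^sub>\<infinity>i. (cmod (c i))\<^sup>2)"
        using B finite_sum_le_infsum[OF s F] by (intro mult_left_mono) auto
      then show "(norm (\<Sum>i\<in>F. c i *\<^sub>C \<Psi> i))\<^sup>2 \<le> B * (\<Sum>\<^sub>\<infinity>i. (cmod (c i))\<^sup>2)"
        using norm_finite_synth[OF F, of c] by linarith
    qed
  qed simp
qed

lemma has_sum_clinear_synth:
  assumes "square_summable c" "bounded_clinear T"
  shows "((\<lambda>i. c i *\<^sub>C T (\<Psi> i)) has_sum T (synth c)) UNIV"
  using has_sum_bounded_linear[OF _ has_sum_synth[OF assms(1)], of T] assms(2)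
  by (simp add: bounded_clinear_def o_def)

lemma has_sum_cinner_synth:
  assumes "square_summable c" "bounded_clinear T"
  shows "((\<lambda>i. c i * cinner (T (\<Psi> i)) v) has_sum cinner (T (synth c)) v) UNIV"
  using has_sum_bounded_linear[OF bounded_linear_cinner_left has_sum_clinear_synth[OF assms], of v]
  by (simp add: o_def cinner_scaleC_left)

lemma synth_add:
  assumes "square_summable c" "square_summable d"
  shows "square_summable (\<lambda>i. c i + d i)" "synth (\<lambda>i. c i + d i) = synth c + synth d"
proof -
  have b: "(cmod (c i + d i))\<^sup>2 \<le> 2 * (cmod (c i))\<^sup>2 + 2 * (cmod (d i))\<^sup>2" for i
  proof -
    have "(cmod (c i + d i))\<^sup>2 \<le> (cmod (c i) + cmod (d i))\<^sup>2"
      by (intro power_mono norm_triangle_ineq) auto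
    also have "\<dots> \<le> 2 * (cmod (c i))\<^sup>2 + 2 * (cmod (d i))\<^sup>2"
      using zero_le_power2[of "cmod (c i) - cmod (d i)"] by (simp add: power2_eq_square algebra_simps)
    finally show ?thesis .
  qed
  have "(\<lambda>i. 2 * (cmod (c i))\<^sup>2 + 2 * (cmod (d i))\<^sup>2) summable_on UNIV"
    using assms by (intro summable_on_add summable_on_cmult_right) (auto simp: square_summable_def)
  then show s: "square_summable (\<lambda>i. c i + d i)"
    unfolding square_summable_def by (rule summable_on_comparison_test) (use b in auto)
  have "((\<lambda>i. (c i + d i) *\<^sub>C \<Psi> i) has_sum synth c + synth d) UNIV"
    unfolding scaleC_add_left by (intro has_sum_add has_sum_synth assms)
  then show "synth (\<lambda>i. c i + d i) = synth c + synth d"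
    using has_sum_synth[OF s] has_sum_unique by blast
qed

lemma synth_cmult:
  assumes "square_summable c"
  shows "square_summable (\<lambda>i. a * c i)" "synth (\<lambda>i. a * c i) = a *\<^sub>C synth c"
proof -
  show s: "square_summable (\<lambda>i. a * c i)"
    using assms by (auto simp: square_summable_def norm_mult power_mult_distrib intro: summable_on_cmult_right)
  have "bounded_clinear (\<lambda>x::'h. a *\<^sub>C x)"
    by (rule bounded_clinearI[where K="cmod a"])
      (simp_all add: scaleC_add_right scaleC_scaleC mult.commute norm_scaleC)
  from has_sum_clinear_synth[OF assms this]
  have "((\<lambda>i. (a * c i) *\<^sub>C \<Psi> i) has_sum a *\<^sub>C synth c) UNIV"
    by (simp add: scaleC_scaleC mult.commute)
  then show "synth (\<lambda>i. a * c i) = a *\<^sub>C synth c"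
    using has_sum_synth[OF s] has_sum_unique by blast
qed

lemma cinner_S: "cinner (S f) g = (\<Sum>\<^sub>\<infinity>i. cinner f (\<Psi> i) * cinner (\<Psi> i) g)"
  using infsumI[OF has_sum_cinner_synth[OF square_summable_analysis bounded_clinear_id, of f g]]
  unfolding frame_operator_eq analysis_def by (rule sym)

lemma S_selfadjoint: "cinner (S f) g = cinner f (S g)"
proof -
  have "cinner f (S g) = cnj (cinner (S g) f)" by (rule cinner_commute)
  also have "\<dots> = (\<Sum>\<^sub>\<infinity>i. cnj (cinner g (\<Psi> i)) * cnj (cinner (\<Psi> i) f))"
    unfolding cinner_S infsum_cnj[symmetric] complex_cnj_mult ..
  also have "\<dots> = cinner (S f) g"
    unfolding cinner_S
  proof (intro infsum_cong)
    fix i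
    show "cnj (cinner g (\<Psi> i)) * cnj (cinner (\<Psi> i) f) = cinner f (\<Psi> i) * cinner (\<Psi> i) g"
      unfolding cinner_commute[of f "\<Psi> i"] cinner_commute[of "\<Psi> i" g] by simp
  qed
  finally show ?thesis by simp
qed

lemma S_coercive: "A * (norm f)\<^sup>2 \<le> Re (cinner (S f) f)"
proof -
  have "cinner f (\<Psi> i) * cinner (\<Psi> i) f = complex_of_real ((cmod (cinner f (\<Psi> i)))\<^sup>2)" for i
    by (subst (2) cinner_commute) (simp flip: complex_norm_square)
  then have "cinner (S f) f = (\<Sum>\<^sub>\<infinity>i. complex_of_real ((cmod (cinner f (\<Psi> i)))\<^sup>2))"
    by (simp add: cinner_S)
  also have "\<dots> = complex_of_real (\<Sum>\<^sub>\<infinity>i. (cmod (cinner f (\<Psi> i)))\<^sup>2)"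
    by (intro infsumI has_sum_of_real has_sum_infsum summable_squares)
  finally show ?thesis using lower[of f] by simp
qed

lemma S_clinear: "bounded_clinear S"
proof (rule bounded_clinearI[where K=B])
  fix x y a
  have an: "analysis \<Psi> (x + y) = (\<lambda>i. analysis \<Psi> x i + analysis \<Psi> y i)"
    "analysis \<Psi> (a *\<^sub>C x) = (\<lambda>i. a * analysis \<Psi> x i)"
    by (simp_all add: analysis_def cinner_add_left cinner_scaleC_left)
  show "S (x + y) = S x + S y" "S (a *\<^sub>C x) = a *\<^sub>C S x"
    unfolding frame_operator_eq an
    by (rule synth_add(2)[OF square_summable_analysis square_summable_analysis])
      (rule synth_cmult(2)[OF square_summable_analysis])
  have "(norm (S x))\<^sup>2 \<le> B * (\<Sum>\<^sub>\<infinity>i. (cmod (cinner x (\<Psi> i)))\<^sup>2)"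
    using norm_synth[OF square_summable_analysis[of x]] by (simp add: frame_operator_eq analysis_def)
  also have "\<dots> \<le> B * (B * (norm x)\<^sup>2)" using B upper by (intro mult_left_mono) auto
  finally have "(norm (S x))\<^sup>2 \<le> (B * norm x)\<^sup>2" by (simp add: power2_eq_square mult_ac)
  then show "norm (S x) \<le> B * norm x" using B by (auto intro: power2_le_imp_le[of "norm (S x)" "B * norm x"])
qed

subsection \<open>Matrices of operators\<close>

text \<open>The matrix of \<open>analysis \<circ> T \<circ> synthesis\<close>. Gram matrices, the projection onto the range
  of the analysis operator and the resolvents of the Gram matrix are all of this form up to
  multiples of the identity, and products are computed by inserting \<open>S\<close>.\<close>

definition opmat :: "('h \<Rightarrow> 'h) \<Rightarrow> 'i cmatrix" where
  "opmat T = (\<lambda>i j. cinner (T (\<Psi> j)) (\<Psi> i))"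

lemma has_sum_opmat:
  assumes "square_summable c" "bounded_clinear T"
  shows "((\<lambda>j. opmat T i j * c j) has_sum analysis \<Psi> (T (synth c)) i) UNIV"
proof -
  have "(\<lambda>j. opmat T i j * c j) = (\<lambda>j. c j * cinner (T (\<Psi> j)) (\<Psi> i))"
    unfolding opmat_def by (intro ext mult.commute)
  then show ?thesis
    using has_sum_cinner_synth[OF assms, of "\<Psi> i"] by (simp only: analysis_def)
qed

lemma mat_vec_opmat:
  assumes "square_summable c" "bounded_clinear T"
  shows "mat_vec (opmat T) c = analysis \<Psi> (T (synth c))"
proof
  fix i
  show "mat_vec (opmat T) c i = analysis \<Psi> (T (synth c)) i"
    unfolding mat_vec_def by (rule infsumI[OF has_sum_opmat[OF assms]])
qed

lemma opmat_analysis: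
  assumes "bounded_clinear T"
  shows "((\<lambda>j. opmat T i j * analysis \<Psi> f j) has_sum analysis \<Psi> (T (S f)) i) UNIV"
  using has_sum_opmat[OF square_summable_analysis assms] by (simp add: frame_operator_eq)

lemma opmat_column: "(\<lambda>i. opmat T i j) = analysis \<Psi> (T (\<Psi> j))"
  by (simp add: opmat_def analysis_def)

lemma mat_mult_opmat:
  assumes "bounded_clinear T"
  shows "((\<lambda>k. opmat T i k * opmat U k j) has_sum opmat (\<lambda>x. T (S (U x))) i j) UNIV"
    "mat_mult (opmat T) (opmat U) = opmat (\<lambda>x. T (S (U x)))"
proof -
  show *: "((\<lambda>k. opmat T i k * opmat U k j) has_sum opmat (\<lambda>x. T (S (U x))) i j) UNIV" for i j
    using opmat_analysis[OF assms, of i "U (\<Psi> j)"] by (simp add: opmat_def analysis_def)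
  show "mat_mult (opmat T) (opmat U) = opmat (\<lambda>x. T (S (U x)))"
    unfolding mat_mult_def by (rule ext, rule ext, rule infsumI[OF *])
qed

text \<open>Inverse-closedness asks for boundedness of the candidate for the inverse on \<open>l^2\<close>; all
  candidates below have this form.\<close>

lemma mat_bounded_l2_plus_opmat:
  assumes T: "bounded_clinear T"
  shows "mat_bounded_l2 (\<lambda>i j. (if i = j then a else 0) + b * opmat T i j)"
  and "square_summable c \<Longrightarrow> ((\<lambda>j. ((if i = j then a else 0) + b * opmat T i j) * c j)
          has_sum (a * c i + b * analysis \<Psi> (T (synth c)) i)) UNIV"
proof -
  let ?M = "\<lambda>i j. (if i = j then a else 0) + b * opmat T i j"
  show hs: "((\<lambda>j. ?M i j * c j) has_sum (a * c i + b * analysis \<Psi> (T (synth c)) i)) UNIV"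
    if c: "square_summable c" for c i
  proof -
    have "((\<lambda>j. (if i = j then a else 0) * c j) has_sum a * c i) UNIV"
      by (rule has_sum_finite_neutralI[of "{i}"]) auto
    from has_sum_add[OF this has_sum_cmult_right[OF has_sum_opmat[OF c T], of b]]
    show ?thesis by (simp add: distrib_right mult.assoc)
  qed
  obtain K where K: "K > 0" "\<And>x. norm (T x) \<le> norm x * K"
    using T unfolding bounded_clinear_def by (metis bounded_linear.pos_bounded)
  define C where "C = 2 * (cmod a)\<^sup>2 + 2 * (cmod b)\<^sup>2 * (B * (K\<^sup>2 * B))"
  have C0: "C \<ge> 0" using B by (simp add: C_def)
  show "mat_bounded_l2 ?M"
    unfolding mat_bounded_on_def
  proof (intro exI[of _ "sqrt C"] allI impI conjI)
    fix c :: "'i \<Rightarrow> complex" assume "wnorm 2 (\<lambda>_. 1) c < \<infinity>"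
    then have c: "square_summable c" by (simp only: wnorm_two_finite_iff)
    show "(\<lambda>j. ?M i j * c j) summable_on UNIV" for i using hs[OF c] by (rule has_sum_imp_summable)
    define s where "s = (\<Sum>\<^sub>\<infinity>i. (cmod (c i))\<^sup>2)"
    have s0: "s \<ge> 0" unfolding s_def by (rule infsum_nonneg) simp
    have sumc: "(\<Sum>\<^sub>\<infinity>i. ennreal ((cmod (c i))\<^sup>2)) = ennreal s"
      unfolding s_def by (rule infsum_ennreal_eq_real) (use c in \<open>auto simp: square_summable_def\<close>)
    define g where "g = T (synth c)"
    have mv: "mat_vec ?M c i = a * c i + b * analysis \<Psi> g i" for i
      unfolding mat_vec_def g_def by (rule infsumI[OF hs[OF c]])
    have "(norm g)\<^sup>2 \<le> (norm (synth c) * K)\<^sup>2" unfolding g_def by (intro power_mono K) auto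
    also have "\<dots> \<le> K\<^sup>2 * (B * s)"
      using mult_left_mono[OF norm_synth[OF c], of "K\<^sup>2"] by (simp add: power_mult_distrib mult.commute s_def)
    finally have g: "(norm g)\<^sup>2 \<le> K\<^sup>2 * (B * s)" .
    have "(\<Sum>\<^sub>\<infinity>i. ennreal ((cmod (analysis \<Psi> g i))\<^sup>2)) = ennreal (\<Sum>\<^sub>\<infinity>i. (cmod (analysis \<Psi> g i))\<^sup>2)"
      by (rule infsum_ennreal_eq_real) (use summable_squares[of g] in \<open>auto simp: analysis_def\<close>)
    also have "\<dots> \<le> ennreal (B * (K\<^sup>2 * (B * s)))"
      using upper[of g] mult_left_mono[OF g less_imp_le[OF B]]
      unfolding analysis_def by (intro ennreal_leI) (rule order.trans)
    finally have an: "(\<Sum>\<^sub>\<infinity>i. ennreal ((cmod (analysis \<Psi> g i))\<^sup>2)) \<le> ennreal (B * (K\<^sup>2 * (B * s)))" .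
    have le: "ennreal ((cmod (mat_vec ?M c i))\<^sup>2) \<le> ennreal (2 * (cmod a)\<^sup>2) * ennreal ((cmod (c i))\<^sup>2)
        + ennreal (2 * (cmod b)\<^sup>2) * ennreal ((cmod (analysis \<Psi> g i))\<^sup>2)" for i
    proof -
      have "(cmod (mat_vec ?M c i))\<^sup>2 \<le> (cmod (a * c i) + cmod (b * analysis \<Psi> g i))\<^sup>2"
        unfolding mv by (intro power_mono norm_triangle_ineq) auto
      also have "\<dots> \<le> 2 * (cmod (a * c i))\<^sup>2 + 2 * (cmod (b * analysis \<Psi> g i))\<^sup>2"
        using zero_le_power2[of "cmod (a * c i) - cmod (b * analysis \<Psi> g i)"]
        by (simp add: power2_eq_square algebra_simps)
      finally have "ennreal ((cmod (mat_vec ?M c i))\<^sup>2)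
          \<le> ennreal ((2 * (cmod a)\<^sup>2) * (cmod (c i))\<^sup>2 + (2 * (cmod b)\<^sup>2) * (cmod (analysis \<Psi> g i))\<^sup>2)"
        by (intro ennreal_leI) (simp add: norm_mult power_mult_distrib)
      then show ?thesis by (simp add: ennreal_plus ennreal_mult)
    qed
    have "(\<Sum>\<^sub>\<infinity>i. ennreal ((cmod (mat_vec ?M c i))\<^sup>2))
        \<le> ennreal (2 * (cmod a)\<^sup>2) * ennreal s + ennreal (2 * (cmod b)\<^sup>2) * ennreal (B * (K\<^sup>2 * (B * s)))"
    proof (rule order.trans[OF infsum_ennreal_mono[OF le]])
      show "(\<Sum>\<^sub>\<infinity>i. ennreal (2 * (cmod a)\<^sup>2) * ennreal ((cmod (c i))\<^sup>2)
          + ennreal (2 * (cmod b)\<^sup>2) * ennreal ((cmod (analysis \<Psi> g i))\<^sup>2))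
        \<le> ennreal (2 * (cmod a)\<^sup>2) * ennreal s + ennreal (2 * (cmod b)\<^sup>2) * ennreal (B * (K\<^sup>2 * (B * s)))"
        unfolding infsum_ennreal_add infsum_ennreal_cmult sumc
        by (intro add_mono mult_left_mono an) auto
    qed
    also have "\<dots> = ennreal (C * s)"
    proof -
      have "C * s = 2 * (cmod a)\<^sup>2 * s + 2 * (cmod b)\<^sup>2 * (B * (K\<^sup>2 * (B * s)))"
        by (simp add: C_def algebra_simps)
      then show ?thesis
        using s0 B by (simp only: ennreal_plus ennreal_mult mult_nonneg_nonneg zero_le_power2
            zero_le_numeral less_imp_le)
    qed
    finally have main: "(\<Sum>\<^sub>\<infinity>i. ennreal ((cmod (mat_vec ?M c i))\<^sup>2)) \<le> ennreal (C * s)" .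
    have "wnorm 2 (\<lambda>_. 1) c = ennreal_powr (ennreal s) (1 / 2)"
      using lp_norm_finite[of 2 "\<lambda>i. ennreal (cmod (c i))"]
      by (simp add: wnorm_def ennreal_powr_ennreal sumc)
    then have wc: "wnorm 2 (\<lambda>_. 1) c = ennreal (sqrt s)"
      using s0 by (simp add: ennreal_powr_ennreal powr_half_sqrt)
    have "ennreal (sqrt C) * wnorm 2 (\<lambda>_. 1) c = ennreal (sqrt C * sqrt s)"
      using s0 C0 by (simp only: wc ennreal_mult real_sqrt_ge_zero)
    moreover have "(sqrt C * sqrt s) powr 2 = C * s"
      using s0 C0 by (simp add: power_mult_distrib)
    ultimately have "ennreal_powr (ennreal (sqrt C) * wnorm 2 (\<lambda>_. 1) c) 2 = ennreal (C * s)"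
      using s0 C0 by (simp only: ennreal_powr_ennreal mult_nonneg_nonneg real_sqrt_ge_zero)
    with main show "wnorm 2 (\<lambda>_. 1) (mat_vec ?M c) \<le> ennreal (sqrt C) * wnorm 2 (\<lambda>_. 1) c"
      by (simp only: wnorm_two)
  qed
qed

end

section \<open>The canonical dual frame of a localised frame is localised\<close>

lemma cmod_cis_diff_le: "cmod (cis s - cis t) \<le> \<bar>s - t\<bar>"
proof -
  have "cis s - cis t = cis t * (cis (s - t) - 1)" by (simp add: right_diff_distrib cis_mult)
  then have "cmod (cis s - cis t) = cmod (exp (\<i> * of_real (s - t)) - 1)"
    by (simp add: norm_mult cis_conv_exp)
  also have "\<dots> = 2 * \<bar>sin ((s - t) / 2)\<bar>" by (rule dist_exp_i_1)
  finally have "cmod (cis s - cis t) = 2 * \<bar>sin ((s - t) / 2)\<bar>" .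
  then show ?thesis using abs_sin_x_le_abs_x[of "(s - t) / 2"] by simp
qed

lemma sum_cis_multiples:
  assumes "0 < m" "m < N"
  shows "(\<Sum>k<N. cis (2 * pi * real m * real k / real N)) = 0"
proof -
  define \<omega> where "\<omega> = cis (2 * pi * real m / real N)"
  have "inj_on (\<lambda>k. cis (2 * pi * real k / real N)) {..<N}"
    using Complex.bij_betw_roots_unity[of N] assms by (auto simp: bij_betw_def)
  from inj_onD[OF this, of m 0] have ne: "\<omega> \<noteq> 1" using assms by (auto simp: \<omega>_def)
  have pow: "\<omega> ^ k = cis (2 * pi * real m * real k / real N)" for k
    by (simp add: \<omega>_def Complex.DeMoivre mult_ac)
  have "\<omega> ^ N = cis (2 * pi * real m)" using assms by (simp add: pow)
  then have "\<omega> ^ N = 1" by simp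
  then have "(\<Sum>k<N. \<omega> ^ k) = 0" using ne by (simp add: geometric_sum)
  then show ?thesis by (simp add: pow)
qed

lemma sum_lessThan_double: "(\<Sum>k<2 * n. g k) = (\<Sum>k<n. g (2 * k) + g (2 * k + 1))"
  for g :: "nat \<Rightarrow> 'a::comm_monoid_add"
  by (induction n) (simp_all add: add_ac)

lemma clinear_simps:
  assumes "bounded_clinear T"
  shows "T (x + y) = T x + T y" "T (x - y) = T x - T y" "T (a *\<^sub>C x) = a *\<^sub>C T x"
proof -
  have "bounded_linear T" using assms by (simp add: bounded_clinear_def)
  then interpret bounded_linear T .
  show "T (x + y) = T x + T y" "T (x - y) = T x - T y" by (rule add, rule diff)
  show "T (a *\<^sub>C x) = a *\<^sub>C T x" using assms by (simp add: bounded_clinear_def)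
qed

context framed
begin

text \<open>The resolvent of the frame operator. By the lower frame bound \<open>S - z\<close> is coercive, hence
  invertible, for \<open>z\<close> in the disc of radius \<open>A\<close>; at \<open>z = 0\<close> the resolvent is the inverse frame operator.\<close>

definition V :: "complex \<Rightarrow> 'h \<Rightarrow> 'h" where
  "V z = inv (\<lambda>x. S x - z *\<^sub>C x)"

lemma shifted_S:
  assumes "cmod z < A"
  shows "bounded_clinear (\<lambda>x. S x - z *\<^sub>C x)"
    and "(A - cmod z) * (norm x)\<^sup>2 \<le> Re (cinner (S x - z *\<^sub>C x) x)"
proof -
  obtain K where K: "\<And>x. norm (S x) \<le> norm x * K"
    using bounded_linear.bounded S_clinear unfolding bounded_clinear_def by blast
  show "bounded_clinear (\<lambda>x. S x - z *\<^sub>C x)"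
  proof (rule bounded_clinearI[where K="K + cmod z"])
    fix x y a
    note S = clinear_simps[OF S_clinear]
    show "S (x + y) - z *\<^sub>C (x + y) = S x - z *\<^sub>C x + (S y - z *\<^sub>C y)"
      by (simp add: S scaleC_add_right)
    show "S (a *\<^sub>C x) - z *\<^sub>C a *\<^sub>C x = a *\<^sub>C (S x - z *\<^sub>C x)"
      by (simp add: S scaleC_diff_right scaleC_scaleC mult.commute)
    have "norm (S x - z *\<^sub>C x) \<le> norm (S x) + norm (z *\<^sub>C x)" by (rule norm_triangle_ineq4)
    then show "norm (S x - z *\<^sub>C x) \<le> (K + cmod z) * norm x"
      using K[of x] by (simp add: norm_scaleC algebra_simps)
  qed
  have "Re (z * cinner x x) \<le> cmod z * (norm x)\<^sup>2"
    using complex_Re_le_cmod[of "z * cinner x x"] by (simp add: cinner_self norm_mult norm_power)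
  then show "(A - cmod z) * (norm x)\<^sup>2 \<le> Re (cinner (S x - z *\<^sub>C x) x)"
    using S_coercive[of x] by (simp add: cinner_diff_left cinner_scaleC_left left_diff_distrib)
qed

context
  fixes z :: complex assumes z: "cmod z < A"
begin

lemma V_clinear: "bounded_clinear (V z)"
  and V_bound: "norm (V z y) \<le> norm y / (A - cmod z)"
  and V_bij: "bij (\<lambda>x. S x - z *\<^sub>C x)"
proof -
  have "A - cmod z > 0" using z by simp
  note c = coercive_bijective[OF shifted_S(1)[OF z] this shifted_S(2)[OF z]]
  show "bounded_clinear (V z)" "norm (V z y) \<le> norm y / (A - cmod z)"
    unfolding V_def by (rule c(3), rule c(2))
  show "bij (\<lambda>x. S x - z *\<^sub>C x)" by (rule c(1))
qed

lemma V_right: "S (V z y) = y + z *\<^sub>C V z y"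
  using surj_f_inv_f[OF bij_is_surj[OF V_bij], of y] by (simp add: V_def algebra_simps)

lemma V_left: "V z (S x) = x + z *\<^sub>C V z x"
proof -
  have "x = V z (S x - z *\<^sub>C x)"
    unfolding V_def using inv_f_f[OF bij_is_inj[OF V_bij], of x] by simp
  also have "\<dots> = V z (S x) - z *\<^sub>C V z x"
    by (simp add: clinear_simps[OF V_clinear])
  finally show ?thesis by (simp add: algebra_simps)
qed

end

lemma V0: "S (V 0 y) = y" "V 0 (S y) = y" "bounded_clinear (V 0)" "norm (V 0 y) \<le> norm y / A"
  using V_right[of 0 y] V_left[of 0 y] V_clinear[of 0] V_bound[of 0 y] A by auto

lemma dual_frame_eq: "dual_frame \<Psi> i = V 0 (\<Psi> i)"
  by (simp add: dual_frame_def V_def S_def)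

lemma V0_selfadjoint: "cinner (V 0 x) y = cinner x (V 0 y)"
  using S_selfadjoint[of "V 0 x" "V 0 y"] by (simp add: V0)

text \<open>Both sides arise from evaluating \<open>V z (S (V w x))\<close> in two ways.\<close>

lemma resolvent_identity:
  assumes "cmod z < A" "cmod w < A"
  shows "V z x - V w x = (z - w) *\<^sub>C V z (V w x)"
proof -
  have "V z (S (V w x)) = V w x + z *\<^sub>C V z (V w x)" by (rule V_left[OF assms(1)])
  moreover have "V z (S (V w x)) = V z x + w *\<^sub>C V z (V w x)"
    by (simp add: V_right[OF assms(2)] clinear_simps[OF V_clinear[OF assms(1)]])
  ultimately show ?thesis by (simp add: scaleC_diff_left algebra_simps)
qed

subsection \<open>Matrices that differ from an operator matrix by a multiple of the identity\<close>

definition affmat :: "complex \<Rightarrow> complex \<Rightarrow> ('h \<Rightarrow> 'h) \<Rightarrow> 'i cmatrix" where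
  "affmat a b T = (\<lambda>i j. (if i = j then a else 0) + b * opmat T i j)"

lemma mat_vec_affmat:
  assumes "square_summable c" "bounded_clinear T"
  shows "mat_vec (affmat a b T) c = (\<lambda>i. a * c i + b * analysis \<Psi> (T (synth c)) i)"
proof
  fix i
  show "mat_vec (affmat a b T) c i = a * c i + b * analysis \<Psi> (T (synth c)) i"
    unfolding mat_vec_def affmat_def
    by (rule infsumI[OF mat_bounded_l2_plus_opmat(2)[OF assms(2,1)]])
qed

text \<open>The hypotheses \<open>one\<close> and \<open>zero\<close> express that in the product
  \<open>(a + b [T]) (a' + b' [T']) = a a' + a b' [T'] + b a' [T] + b b' [T S T']\<close> only the identity
  remains. The operators have to be composed as \<open>T S T'\<close>, because the product of two operator
  matrices involves the frame operator.\<close>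

lemma affmat_inverse:
  assumes T: "bounded_clinear T" and T': "bounded_clinear T'" and c: "square_summable c"
    and one: "a * a' = 1"
    and zero: "\<And>x. (a * b') *\<^sub>C T' x + (b * a') *\<^sub>C T x + (b * b') *\<^sub>C T (S (T' x)) = 0"
  shows "mat_vec (affmat a b T) (mat_vec (affmat a' b' T') c) = c"
proof -
  define g where "g = T' (synth c)"
  define d where "d = (\<lambda>i. a' * c i + b' * analysis \<Psi> g i)"
  have d: "mat_vec (affmat a' b' T') c = d"
    unfolding d_def g_def by (rule mat_vec_affmat[OF c T'])
  have sd: "square_summable d" "synth d = a' *\<^sub>C synth c + b' *\<^sub>C S g"
    unfolding d_def frame_operator_eq
    using synth_add synth_cmult[OF c, of a'] synth_cmult[OF square_summable_analysis, of b'] by auto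
  have lin: "a * (b' * analysis \<Psi> u i) + b * analysis \<Psi> v i = analysis \<Psi> ((a * b') *\<^sub>C u + b *\<^sub>C v) i" for u v i
    by (simp add: analysis_def cinner_add_left cinner_scaleC_left mult.assoc)
  have "(a * b') *\<^sub>C g + b *\<^sub>C T (synth d) = 0"
    using zero[of "synth c"] by (simp add: sd clinear_simps[OF T] scaleC_add_right scaleC_scaleC g_def add.assoc)
  then have "a * (b' * analysis \<Psi> g i) + b * analysis \<Psi> (T (synth d)) i = 0" for i
    unfolding lin by (simp add: analysis_def)
  moreover have "a * (a' * c i) = c i" for i using one by (simp flip: mult.assoc)
  ultimately show ?thesis
    unfolding d mat_vec_affmat[OF sd(1) T] by (auto simp: d_def distrib_left add.assoc)
qed

end

lemma spectral_matrix_algebraD: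
  assumes "spectral_matrix_algebra \<A> nA"
  shows spectral_add: "\<And>M N. M \<in> \<A> \<Longrightarrow> N \<in> \<A> \<Longrightarrow> (\<lambda>i j. M i j + N i j) \<in> \<A>"
    and spectral_norm_add: "\<And>M N. M \<in> \<A> \<Longrightarrow> N \<in> \<A> \<Longrightarrow> nA (\<lambda>i j. M i j + N i j) \<le> nA M + nA N"
    and spectral_scale: "\<And>M a. M \<in> \<A> \<Longrightarrow> (\<lambda>i j. a * M i j) \<in> \<A>"
    and spectral_norm_scale: "\<And>M a. M \<in> \<A> \<Longrightarrow> nA (\<lambda>i j. a * M i j) = cmod a * nA M"
    and spectral_norm_zero: "\<And>M. M \<in> \<A> \<Longrightarrow> nA M = 0 \<longleftrightarrow> M = (\<lambda>i j. 0)"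
    and spectral_complete: "\<And>X. (\<And>n::nat. X n \<in> \<A>) \<Longrightarrow>
       (\<And>e. e > 0 \<Longrightarrow> \<exists>n0. \<forall>m\<ge>n0. \<forall>n\<ge>n0. nA (\<lambda>i j. X m i j - X n i j) < e) \<Longrightarrow>
       \<exists>M\<in>\<A>. (\<lambda>n. nA (\<lambda>i j. X n i j - M i j)) \<longlonglongrightarrow> 0"
    and spectral_unit: "(\<lambda>i j. if i = j then 1 else 0) \<in> \<A>"
    and spectral_mult: "\<And>M N. M \<in> \<A> \<Longrightarrow> N \<in> \<A> \<Longrightarrow> mat_mult M N \<in> \<A>"
    and spectral_norm_mult: "\<And>M N. M \<in> \<A> \<Longrightarrow> N \<in> \<A> \<Longrightarrow> nA (mat_mult M N) \<le> nA M * nA N"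
    and spectral_adjoint: "\<And>M. M \<in> \<A> \<Longrightarrow> mat_adjoint M \<in> \<A>"
    and spectral_inverse: "\<And>M N. M \<in> \<A> \<Longrightarrow> mat_bounded_l2 N \<Longrightarrow>
       (\<And>c. wnorm 2 (\<lambda>_. 1) c < \<infinity> \<Longrightarrow> mat_vec N (mat_vec M c) = c \<and> mat_vec M (mat_vec N c) = c)
       \<Longrightarrow> N \<in> \<A>"
    and spectral_solid: "\<And>M N. M \<in> \<A> \<Longrightarrow> (\<And>i j. cmod (N i j) \<le> cmod (M i j)) \<Longrightarrow> N \<in> \<A>"
    and spectral_norm_solid: "\<And>M N. M \<in> \<A> \<Longrightarrow> (\<And>i j. cmod (N i j) \<le> cmod (M i j)) \<Longrightarrow> nA N \<le> nA M"
proof -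
  note D = assms[unfolded spectral_matrix_algebra_def]
  note add = D[THEN conjunct1, rule_format]
  note scale = D[THEN conjunct2, THEN conjunct1, rule_format]
  note zero = D[THEN conjunct2, THEN conjunct2, THEN conjunct1, rule_format]
  note complete = D[THEN conjunct2, THEN conjunct2, THEN conjunct2, THEN conjunct1, rule_format]
  note unit = D[THEN conjunct2, THEN conjunct2, THEN conjunct2, THEN conjunct2, THEN conjunct1, rule_format]
  note mult = D[THEN conjunct2, THEN conjunct2, THEN conjunct2, THEN conjunct2, THEN conjunct2, THEN conjunct1, rule_format]
  note adjoint = D[THEN conjunct2, THEN conjunct2, THEN conjunct2, THEN conjunct2, THEN conjunct2, THEN conjunct2, THEN conjunct1, rule_format]
  note inverse = D[THEN conjunct2, THEN conjunct2, THEN conjunct2, THEN conjunct2, THEN conjunct2, THEN conjunct2, THEN conjunct2, THEN conjunct2, THEN conjunct1, rule_format]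
  note solid = D[THEN conjunct2, THEN conjunct2, THEN conjunct2, THEN conjunct2, THEN conjunct2, THEN conjunct2, THEN conjunct2, THEN conjunct2, THEN conjunct2, rule_format]
  fix M N a
  {
    assume M: "M \<in> \<A>" and N: "N \<in> \<A>"
    show "(\<lambda>i j. M i j + N i j) \<in> \<A>" by (rule add[OF M N, THEN conjunct1])
    show "nA (\<lambda>i j. M i j + N i j) \<le> nA M + nA N" by (rule add[OF M N, THEN conjunct2])
    show "mat_mult M N \<in> \<A>" by (rule mult[OF M N, THEN conjunct1])
    show "nA (mat_mult M N) \<le> nA M * nA N" by (rule mult[OF M N, THEN conjunct2])
  }
  {
    assume M: "M \<in> \<A>"
    show "(\<lambda>i j. a * M i j) \<in> \<A>" by (rule scale[OF M, THEN conjunct1])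
    show "nA (\<lambda>i j. a * M i j) = cmod a * nA M" by (rule scale[OF M, THEN conjunct2])
    show "nA M = 0 \<longleftrightarrow> M = (\<lambda>i j. 0)" by (rule zero[OF M])
    show "mat_adjoint M \<in> \<A>" by (rule adjoint[OF M])
    show "N \<in> \<A>" if "mat_bounded_l2 N"
      "\<And>c. wnorm 2 (\<lambda>_. 1) c < \<infinity> \<Longrightarrow> mat_vec N (mat_vec M c) = c \<and> mat_vec M (mat_vec N c) = c"
      by (rule inverse[OF M]) (use that in blast)
    assume "\<And>i j. cmod (N i j) \<le> cmod (M i j)"
    from solid[OF M this] show "N \<in> \<A>" "nA N \<le> nA M" by auto
  }
  show "(\<lambda>i j. if i = j then 1 else 0) \<in> \<A>" by (rule unit)
  show "\<exists>M\<in>\<A>. (\<lambda>n. nA (\<lambda>i j. X n i j - M i j)) \<longlonglongrightarrow> 0"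
    if "\<And>n::nat. X n \<in> \<A>"
      "\<And>e. e > 0 \<Longrightarrow> \<exists>n0. \<forall>m\<ge>n0. \<forall>n\<ge>n0. nA (\<lambda>i j. X m i j - X n i j) < e" for X
    by (rule complete) (use that in blast)
qed

subsection \<open>Resolvents in the algebra\<close>

locale localised = framed \<Psi> A B
  for \<Psi> :: "'i::countable \<Rightarrow> 'h::complex_hilbert" and A B :: real +
  fixes \<A> :: "'i cmatrix set" and nA :: "'i cmatrix \<Rightarrow> real"
  assumes algebra: "spectral_matrix_algebra \<A> nA"
    and gram_in: "gram \<Psi> \<in> \<A>"
begin

lemma diff_in: "M \<in> \<A> \<Longrightarrow> N \<in> \<A> \<Longrightarrow> (\<lambda>i j. M i j - N i j) \<in> \<A>"
  and norm_diff: "M \<in> \<A> \<Longrightarrow> N \<in> \<A> \<Longrightarrow> nA (\<lambda>i j. M i j - N i j) \<le> nA M + nA N"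
  using spectral_add[OF algebra, of M "\<lambda>i j. -1 * N i j"] spectral_norm_add[OF algebra, of M "\<lambda>i j. -1 * N i j"]
    spectral_scale[OF algebra, of N "-1"] spectral_norm_scale[OF algebra, of N "-1"]
  by simp_all

lemma norm_diff_commute:
  assumes "M \<in> \<A>" "N \<in> \<A>"
  shows "nA (\<lambda>i j. M i j - N i j) = nA (\<lambda>i j. N i j - M i j)"
  using spectral_norm_scale[OF algebra diff_in[OF assms], of "-1"] by simp

lemma norm_nonneg: "M \<in> \<A> \<Longrightarrow> 0 \<le> nA M"
proof -
  assume M: "M \<in> \<A>"
  have "(\<lambda>i j. M i j - M i j) \<in> \<A>" by (rule diff_in[OF M M])
  then have "nA (\<lambda>i j. M i j - M i j) = 0" using spectral_norm_zero[OF algebra] by simp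
  then show ?thesis using norm_diff[OF M M] by simp
qed

text \<open>Solidity makes the entries continuous: the matrix with the single entry \<open>M i j\<close>
  is dominated by \<open>M\<close>.\<close>

lemma entry_tendsto:
  assumes X: "\<And>n::nat. X n \<in> \<A>" and M: "M \<in> \<A>" and lim: "(\<lambda>n. nA (\<lambda>i j. X n i j - M i j)) \<longlonglongrightarrow> 0"
  shows "(\<lambda>n. X n i j) \<longlonglongrightarrow> M i j"
proof (cases "\<forall>n. X n i j = M i j")
  case True
  then show ?thesis by simp
next
  case False
  define E where "E = (\<lambda>k l. if k = i \<and> l = j then 1 else 0 :: complex)"
  obtain n where n: "X n i j - M i j \<noteq> 0" using False by auto
  define x where "x = X n i j - M i j"
  have "(\<lambda>k l. 1 / x * (X n k l - M k l)) \<in> \<A>"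
    by (rule spectral_scale[OF algebra diff_in[OF X M]])
  then have E: "E \<in> \<A>"
    by (rule spectral_solid[OF algebra]) (use n in \<open>auto simp: E_def x_def\<close>)
  have "nA E \<noteq> 0" using spectral_norm_zero[OF algebra E] by (auto simp: E_def fun_eq_iff)
  then have E0: "nA E > 0" using norm_nonneg[OF E] by simp
  have le: "cmod (X n i j - M i j) \<le> nA (\<lambda>i j. X n i j - M i j) / nA E" for n
  proof -
    have "nA (\<lambda>k l. (X n i j - M i j) * E k l) \<le> nA (\<lambda>i j. X n i j - M i j)"
      by (rule spectral_norm_solid[OF algebra diff_in[OF X M]]) (auto simp: E_def)
    then have "cmod (X n i j - M i j) * nA E \<le> nA (\<lambda>i j. X n i j - M i j)"
      unfolding spectral_norm_scale[OF algebra E] .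
    then show ?thesis using E0 by (simp only: pos_le_divide_eq)
  qed
  have "(\<lambda>n. nA (\<lambda>i j. X n i j - M i j) / nA E) \<longlonglongrightarrow> 0"
    using tendsto_divide[OF lim tendsto_const[of "nA E"]] E0 by simp
  then have "(\<lambda>n. X n i j - M i j) \<longlonglongrightarrow> 0"
    by (rule Lim_null_comparison[OF always_eventually, OF allI, OF le])
  then show ?thesis by (simp add: LIM_zero_cancel)
qed

lemma affmat_in: "opmat T \<in> \<A> \<Longrightarrow> affmat a b T \<in> \<A>"
  using spectral_add[OF algebra spectral_scale[OF algebra spectral_unit[OF algebra], of a]
      spectral_scale[OF algebra, of "opmat T" b]]
  by (simp add: affmat_def if_distrib[of "\<lambda>x. a * x"] cong: if_cong)

lemma opmat_in_if_affmat:
  assumes "affmat a b T \<in> \<A>" "b \<noteq> 0"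
  shows "opmat T \<in> \<A>"
proof -
  have "(\<lambda>i j. 1 / b * (affmat a b T i j - a * (if i = j then 1 else 0))) \<in> \<A>"
    by (intro spectral_scale[OF algebra] diff_in assms spectral_unit[OF algebra])
  also have "(\<lambda>i j. 1 / b * (affmat a b T i j - a * (if i = j then 1 else 0))) = opmat T"
    using assms(2) by (auto simp: affmat_def fun_eq_iff)
  finally show ?thesis .
qed

lemma gram_eq: "gram \<Psi> = opmat (\<lambda>x. x)"
  by (simp add: gram_def opmat_def)

lemma affmat_inverse_in:
  assumes M: "affmat a b T \<in> \<A>" and T: "bounded_clinear T" and T': "bounded_clinear T'"
    and one: "a * a' = 1"
    and l: "\<And>x. (a' * b) *\<^sub>C T x + (b' * a) *\<^sub>C T' x + (b' * b) *\<^sub>C T' (S (T x)) = 0"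
    and r: "\<And>x. (a * b') *\<^sub>C T' x + (b * a') *\<^sub>C T x + (b * b') *\<^sub>C T (S (T' x)) = 0"
  shows "affmat a' b' T' \<in> \<A>"
proof (rule spectral_inverse[OF algebra M])
  show "mat_bounded_l2 (affmat a' b' T')"
    unfolding affmat_def by (rule mat_bounded_l2_plus_opmat(1)[OF T'])
  fix c :: "'i \<Rightarrow> complex" assume "wnorm 2 (\<lambda>_. 1) c < \<infinity>"
  then have c: "square_summable c" by (simp only: wnorm_two_finite_iff)
  have one': "a' * a = 1" using one by (simp add: mult.commute)
  show "mat_vec (affmat a' b' T') (mat_vec (affmat a b T) c) = c \<and>
        mat_vec (affmat a b T) (mat_vec (affmat a' b' T') c) = c"
    using affmat_inverse[OF T' T c one' l] affmat_inverse[OF T T' c one r] by simp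
qed

text \<open>For \<open>z\<close> in the punctured disc the Gram matrix minus \<open>z\<close> is invertible, with inverse
  \<open>-1/z (1 - [V z])\<close>. At \<open>z = 0\<close> this breaks down, since the Gram matrix of a redundant frame
  has a kernel; the membership of \<open>[V 0]\<close> is recovered by averaging over a circle.\<close>

lemma resolvent_in:
  assumes "cmod z < A" "z \<noteq> 0"
  shows "opmat (V z) \<in> \<A>"
proof -
  have "affmat (1 / z) (- 1 / z) (V z) \<in> \<A>"
  proof (rule affmat_inverse_in)
    show "affmat z (-1) (\<lambda>x. x) \<in> \<A>" using gram_in by (intro affmat_in) (simp add: gram_eq)
    show "z * (1 / z) = 1" using assms by simp
    have s: "V z (S x) = x + z *\<^sub>C V z x" "S (V z x) = x + z *\<^sub>C V z x" for x
      using V_left[OF assms(1)] V_right[OF assms(1)] by auto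
    fix x
    show "(1 / z * - 1) *\<^sub>C x + (- 1 / z * z) *\<^sub>C V z x + (- 1 / z * - 1) *\<^sub>C V z (S x) = 0"
      "(z * (- 1 / z)) *\<^sub>C V z x + (- 1 * (1 / z)) *\<^sub>C x + (- 1 * (- 1 / z)) *\<^sub>C S (V z x) = 0"
      using assms(2)
      by (simp_all add: s scaleC_add_right scaleC_scaleC scaleC_one scaleC_minus_left)
  qed (use V_clinear[OF assms(1)] bounded_clinear_id in auto)
  then show ?thesis by (rule opmat_in_if_affmat) (use assms in simp)
qed

text \<open>The product of the matrices of \<open>V z\<close> and \<open>V w\<close> is the matrix of
  \<open>V z S V w = V z + w V z V w\<close>. Subtracting \<open>[V z]\<close> and dividing by \<open>w\<close> expresses the right
  hand side of the resolvent identity in terms of elements of the algebra.\<close>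

lemma resolvent_norm_diff:
  assumes z: "cmod z < A" "z \<noteq> 0" and w: "cmod w < A" "w \<noteq> 0"
  shows "nA (\<lambda>i j. opmat (V z) i j - opmat (V w) i j)
    \<le> cmod (z - w) / cmod w * (nA (opmat (V z)) * (nA (opmat (V w)) + 1))"
proof -
  let ?z = "opmat (V z)" and ?w = "opmat (V w)"
  have zin: "?z \<in> \<A>" and win: "?w \<in> \<A>" using resolvent_in z w by auto
  have mult: "mat_mult ?z ?w = opmat (\<lambda>x. V z (S (V w x)))"
    by (rule mat_mult_opmat[OF V_clinear[OF z(1)]])
  have min: "mat_mult ?z ?w \<in> \<A>" by (rule spectral_mult[OF algebra zin win])
  have "(\<lambda>i j. ?z i j - ?w i j) = (\<lambda>i j. (z - w) / w * (mat_mult ?z ?w i j - ?z i j))"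
  proof (intro ext)
    fix i j
    have "V z (S (V w x)) - V z x = w *\<^sub>C V z (V w x)" for x
      by (simp add: V_right[OF w(1)] clinear_simps[OF V_clinear[OF z(1)]])
    then have "mat_mult ?z ?w i j - ?z i j = w * cinner (V z (V w (\<Psi> j))) (\<Psi> i)"
      unfolding mult by (simp add: opmat_def cinner_scaleC_left flip: cinner_diff_left)
    then have "(z - w) / w * (mat_mult ?z ?w i j - ?z i j) = (z - w) * cinner (V z (V w (\<Psi> j))) (\<Psi> i)"
      using w(2) by simp
    also have "\<dots> = ?z i j - ?w i j"
      unfolding opmat_def cinner_diff_left[symmetric] cinner_scaleC_left[symmetric]
      by (simp add: resolvent_identity[OF z(1) w(1)])
    finally show "?z i j - ?w i j = (z - w) / w * (mat_mult ?z ?w i j - ?z i j)" by simp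
  qed
  then have "nA (\<lambda>i j. ?z i j - ?w i j) = cmod ((z - w) / w) * nA (\<lambda>i j. mat_mult ?z ?w i j - ?z i j)"
    by (simp only: spectral_norm_scale[OF algebra diff_in[OF min zin]])
  also have "\<dots> \<le> cmod ((z - w) / w) * (nA ?z * nA ?w + nA ?z)"
    using norm_diff[OF min zin] spectral_norm_mult[OF algebra zin win] by (intro mult_left_mono) auto
  finally show ?thesis by (simp add: norm_divide distrib_left)
qed

subsection \<open>Averages over a circle\<close>

text \<open>The radius \<open>A/2\<close> keeps a fixed distance from both \<open>0\<close>, where the resolvents in the
  algebra stop existing, and the spectrum of the frame operator in \<open>{A..B}\<close>.\<close>

definition circle_point :: "real \<Rightarrow> complex" where
  "circle_point t = of_real (A / 2) * cis t"

lemma circle_point: "cmod (circle_point t) = A / 2" "cmod (circle_point t) < A" "circle_point t \<noteq> 0"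
  using A by (auto simp: circle_point_def norm_mult)

definition circle_resolvent :: "real \<Rightarrow> 'i cmatrix" where
  "circle_resolvent t = opmat (V (circle_point t))"

lemma circle_resolvent_in: "circle_resolvent t \<in> \<A>"
  unfolding circle_resolvent_def by (intro resolvent_in circle_point)

lemma circle_resolvent_diff:
  "nA (\<lambda>i j. circle_resolvent s i j - circle_resolvent t i j)
    \<le> \<bar>s - t\<bar> * (nA (circle_resolvent s) * (nA (circle_resolvent t) + 1))"
proof -
  have "circle_point s - circle_point t = of_real (A / 2) * (cis s - cis t)"
    by (simp only: circle_point_def right_diff_distrib)
  then have "cmod (circle_point s - circle_point t) = cmod (of_real (A / 2)) * cmod (cis s - cis t)"
    by (simp only: norm_mult)
  then have "cmod (circle_point s - circle_point t) = A / 2 * cmod (cis s - cis t)"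
    using A by (simp only: norm_of_real)
  then have "cmod (circle_point s - circle_point t) / cmod (circle_point t) \<le> \<bar>s - t\<bar>"
    using A cmod_cis_diff_le[of s t] by (simp add: circle_point)
  then show ?thesis
    unfolding circle_resolvent_def
    using norm_nonneg[OF circle_resolvent_in, unfolded circle_resolvent_def]
    by (intro order.trans[OF resolvent_norm_diff[OF circle_point(2,3) circle_point(2,3)]] mult_right_mono)
      (auto intro!: mult_nonneg_nonneg add_nonneg_nonneg)
qed

text \<open>The Lipschitz estimate contains the norm of \<open>[V s]\<close> itself; for \<open>s\<close> close to \<open>t\<close> this
  term is absorbed into the left hand side.\<close>

lemma circle_resolvent_locally_bounded:
  assumes "\<bar>s - t\<bar> * (nA (circle_resolvent t) + 1) \<le> 1 / 2"
  shows "nA (circle_resolvent s) \<le> 2 * nA (circle_resolvent t)"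
proof -
  let ?s = "circle_resolvent s" and ?t = "circle_resolvent t"
  have d: "(\<lambda>i j. ?s i j - ?t i j) \<in> \<A>" by (intro diff_in circle_resolvent_in)
  have "nA ?s \<le> nA (\<lambda>i j. ?s i j - ?t i j) + nA ?t"
    using spectral_norm_add[OF algebra d circle_resolvent_in[of t]] by simp
  also have "nA (\<lambda>i j. ?s i j - ?t i j) \<le> nA ?s * (\<bar>s - t\<bar> * (nA ?t + 1))"
    using circle_resolvent_diff[of s t] by (simp add: mult_ac)
  also have "\<dots> \<le> nA ?s * (1 / 2)"
    using assms norm_nonneg[OF circle_resolvent_in] by (intro mult_left_mono)
  finally show ?thesis by simp
qed

text \<open>Compactness of the interval, by bisection, turns the local bounds into a global one.\<close>

lemma circle_resolvent_bounded: "\<exists>K. \<forall>t. 0 \<le> t \<and> t \<le> 2 * pi \<longrightarrow> nA (circle_resolvent t) \<le> K"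
proof -
  define P where "P a b \<longleftrightarrow> (\<exists>K. \<forall>t. a \<le> t \<and> t \<le> b \<longrightarrow> nA (circle_resolvent t) \<le> K)" for a b
  have "P 0 (2 * pi)"
  proof (rule Bolzano[of 0 "2 * pi" P])
    show "(0::real) \<le> 2 * pi" by simp
    fix a b c assume "P a b" "P b c"
    then obtain K1 K2 where "\<And>t. a \<le> t \<Longrightarrow> t \<le> b \<Longrightarrow> nA (circle_resolvent t) \<le> K1"
      "\<And>t. b \<le> t \<Longrightarrow> t \<le> c \<Longrightarrow> nA (circle_resolvent t) \<le> K2" unfolding P_def by blast
    then have "nA (circle_resolvent t) \<le> max K1 K2" if "a \<le> t" "t \<le> c" for t
      using that by (cases "t \<le> b") (auto simp: le_max_iff_disj)
    then show "P a c" unfolding P_def by blast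
  next
    fix x
    define N where "N = nA (circle_resolvent x) + 1"
    have N: "N > 0" using norm_nonneg[OF circle_resolvent_in[of x]] by (simp add: N_def)
    have "nA (circle_resolvent t) \<le> 2 * nA (circle_resolvent x)"
      if "a \<le> x" "x \<le> b" "b - a < 1 / (2 * N)" "a \<le> t" "t \<le> b" for a b t
    proof (rule circle_resolvent_locally_bounded)
      have "\<bar>t - x\<bar> * N \<le> 1 / (2 * N) * N" using that N by (intro mult_right_mono) auto
      then show "\<bar>t - x\<bar> * (nA (circle_resolvent x) + 1) \<le> 1 / 2" using N by (simp add: N_def[symmetric])
    qed
    then have "P a b" if "a \<le> x" "x \<le> b" "b - a < 1 / (2 * N)" for a b
      unfolding P_def using that by blast
    then show "\<exists>d>0. \<forall>a b. a \<le> x \<and> x \<le> b \<and> b - a < d \<longrightarrow> P a b"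
      using N by (intro exI[of _ "1 / (2 * N)"]) auto
  qed
  then show ?thesis unfolding P_def .
qed

text \<open>The averages of the resolvent over the \<open>2^m\<close>-th roots of unity on the circle: Riemann
  sums for the mean of \<open>[V z]\<close>, which is \<open>[V 0]\<close> by the mean value property. Powers of two
  make the points nested.\<close>

definition dyadic_point :: "nat \<Rightarrow> nat \<Rightarrow> real" where
  "dyadic_point m k = 2 * pi * real k / real (2 ^ m)"

definition circle_average :: "nat \<Rightarrow> 'i cmatrix" where
  "circle_average m = (\<lambda>i j. 1 / 2 ^ m * (\<Sum>k<2 ^ m. circle_resolvent (dyadic_point m k) i j))"

lemma sum_in:
  fixes n :: nat
  assumes "\<And>k. k < n \<Longrightarrow> X k \<in> \<A>"
  shows "(\<lambda>i j. \<Sum>k<n. X k i j) \<in> \<A>" "nA (\<lambda>i j. \<Sum>k<n. X k i j) \<le> (\<Sum>k<n. nA (X k))"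
proof -
  have zero: "(\<lambda>i j. 0) \<in> \<A>" using spectral_scale[OF algebra gram_in, of 0] by simp
  have "(\<lambda>i j. \<Sum>k<n. X k i j) \<in> \<A> \<and> nA (\<lambda>i j. \<Sum>k<n. X k i j) \<le> (\<Sum>k<n. nA (X k))"
  proof (insert assms, induction n)
    case 0
    then show ?case using zero spectral_norm_zero[OF algebra zero] by simp
  next
    case (Suc n)
    then have IH: "(\<lambda>i j. \<Sum>k<n. X k i j) \<in> \<A>" "nA (\<lambda>i j. \<Sum>k<n. X k i j) \<le> (\<Sum>k<n. nA (X k))" by auto
    have "X n \<in> \<A>" using Suc.prems by simp
    from spectral_add[OF algebra IH(1) this] spectral_norm_add[OF algebra IH(1) this] IH(2)
    show ?case by simp
  qed
  then show "(\<lambda>i j. \<Sum>k<n. X k i j) \<in> \<A>" "nA (\<lambda>i j. \<Sum>k<n. X k i j) \<le> (\<Sum>k<n. nA (X k))" by auto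
qed

lemma circle_average_in: "circle_average m \<in> \<A>"
  unfolding circle_average_def by (intro spectral_scale[OF algebra] sum_in circle_resolvent_in)

text \<open>The even points of the finer grid form the coarser one, so the difference of two
  consecutive averages is a mean of differences between neighbouring points, to which the
  Lipschitz estimate applies.\<close>

lemma circle_average_step: "\<exists>C\<ge>0. \<forall>m. nA (\<lambda>i j. circle_average (Suc m) i j - circle_average m i j) \<le> C / 2 ^ m"
proof -
  obtain K where K: "\<And>t. 0 \<le> t \<Longrightarrow> t \<le> 2 * pi \<Longrightarrow> nA (circle_resolvent t) \<le> K"
    using circle_resolvent_bounded by blast
  have K0: "K \<ge> 0" using K[of 0] norm_nonneg[OF circle_resolvent_in[of 0]] by simp
  define L where "L = K * (K + 1)"
  have L0: "L \<ge> 0" using K0 by (simp add: L_def)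
  have "nA (\<lambda>i j. circle_average (Suc m) i j - circle_average m i j) \<le> (pi * L / 2) / 2 ^ m" for m
  proof -
    let ?d = "\<lambda>k. \<lambda>i j. circle_resolvent (dyadic_point (Suc m) (2 * k + 1)) i j
                 - circle_resolvent (dyadic_point (Suc m) (2 * k)) i j"
    have half: "dyadic_point (Suc m) (2 * k) = dyadic_point m k" "dyadic_point (Suc m) (k * 2) = dyadic_point m k" for k
      by (simp_all add: dyadic_point_def)
    have din: "?d k \<in> \<A>" for k by (intro diff_in circle_resolvent_in)
    have sin: "(\<lambda>i j. \<Sum>k<2 ^ m. ?d k i j) \<in> \<A>" by (rule sum_in(1)) (rule din)
    have "(\<lambda>i j. circle_average (Suc m) i j - circle_average m i j)
        = (\<lambda>i j. 1 / 2 ^ Suc m * (\<Sum>k<2 ^ m. ?d k i j))"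
      by (auto simp: circle_average_def sum_lessThan_double half sum.distrib sum_subtractf
          fun_eq_iff field_simps simp del: sum.lessThan_Suc)
    then have "nA (\<lambda>i j. circle_average (Suc m) i j - circle_average m i j)
        = 1 / 2 ^ Suc m * nA (\<lambda>i j. \<Sum>k<2 ^ m. ?d k i j)"
      using spectral_norm_scale[OF algebra sin, of "1 / 2 ^ Suc m"]
      by (simp add: norm_divide norm_power norm_mult)
    also have "\<dots> \<le> 1 / 2 ^ Suc m * (\<Sum>k<2 ^ m. nA (?d k))"
      by (intro mult_left_mono sum_in din) auto
    also have "\<dots> \<le> 1 / 2 ^ Suc m * (\<Sum>k<(2::nat) ^ m. pi / 2 ^ m * L)"
    proof (intro mult_left_mono sum_mono)
      fix k assume "k \<in> {..<(2::nat) ^ m}"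
      then have k: "k + 1 \<le> 2 ^ m" by simp
      have range: "0 \<le> dyadic_point (Suc m) l \<and> dyadic_point (Suc m) l \<le> 2 * pi" if "l \<le> 2 ^ Suc m" for l
      proof -
        have "real l \<le> real (2 ^ Suc m)" using that by (simp only: of_nat_le_iff)
        then have "real l / real (2 ^ Suc m) \<le> 1" by (subst divide_le_eq_1) auto
        then have "2 * pi * (real l / real (2 ^ Suc m)) \<le> 2 * pi * 1" by (intro mult_left_mono) auto
        then show ?thesis by (simp add: dyadic_point_def)
      qed
      have r: "0 \<le> dyadic_point (Suc m) (2 * k + 1) \<and> dyadic_point (Suc m) (2 * k + 1) \<le> 2 * pi"
        "0 \<le> dyadic_point (Suc m) (2 * k) \<and> dyadic_point (Suc m) (2 * k) \<le> 2 * pi"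
        by (rule range, use k in simp)+
      have "dyadic_point (Suc m) (2 * k + 1) - dyadic_point (Suc m) (2 * k) = pi / 2 ^ m"
        by (simp add: dyadic_point_def field_simps)
      then have "nA (?d k) \<le> pi / 2 ^ m * (nA (circle_resolvent (dyadic_point (Suc m) (2 * k + 1)))
          * (nA (circle_resolvent (dyadic_point (Suc m) (2 * k))) + 1))"
        using circle_resolvent_diff[of "dyadic_point (Suc m) (2 * k + 1)" "dyadic_point (Suc m) (2 * k)"]
        by simp
      also have "\<dots> \<le> pi / 2 ^ m * L"
        unfolding L_def using r K K0 norm_nonneg[OF circle_resolvent_in]
        by (intro mult_left_mono mult_mono add_mono) auto
      finally show "nA (?d k) \<le> pi / 2 ^ m * L" .
    qed auto
    also have "\<dots> = (pi * L / 2) / 2 ^ m" by (simp add: field_simps)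
    finally show ?thesis .
  qed
  then show ?thesis using L0 by (intro exI[of _ "pi * L / 2"]) auto
qed

lemma circle_average_converges:
  "\<exists>M\<in>\<A>. (\<lambda>m. nA (\<lambda>i j. circle_average m i j - M i j)) \<longlonglongrightarrow> 0"
proof (rule spectral_complete[OF algebra circle_average_in])
  fix e :: real assume e: "e > 0"
  obtain C where C: "C \<ge> 0" "\<And>m. nA (\<lambda>i j. circle_average (Suc m) i j - circle_average m i j) \<le> C / 2 ^ m"
    using circle_average_step by blast
  have geo: "nA (\<lambda>i j. circle_average (m + d) i j - circle_average m i j) \<le> C / 2 ^ m * (2 - 2 / 2 ^ d)" for m d
  proof (induction d)
    case 0
    then show ?case
      using spectral_norm_zero[OF algebra diff_in[OF circle_average_in circle_average_in], of m m] by simp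
  next
    case (Suc d)
    have "nA (\<lambda>i j. circle_average (m + Suc d) i j - circle_average m i j)
        \<le> nA (\<lambda>i j. circle_average (Suc (m + d)) i j - circle_average (m + d) i j)
          + nA (\<lambda>i j. circle_average (m + d) i j - circle_average m i j)"
      using spectral_norm_add[OF algebra diff_in[OF circle_average_in circle_average_in]
          diff_in[OF circle_average_in circle_average_in], of "Suc (m + d)" "m + d" "m + d" m] by simp
    also have "\<dots> \<le> C / 2 ^ (m + d) + C / 2 ^ m * (2 - 2 / 2 ^ d)" by (intro add_mono C Suc)
    also have "\<dots> = C / 2 ^ m * (2 - 2 / 2 ^ Suc d)" by (simp add: power_add field_simps)
    finally show ?case .
  qed
  have tail: "nA (\<lambda>i j. circle_average p i j - circle_average m i j) \<le> 2 * C / 2 ^ m" if "m \<le> p" for m p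
  proof -
    have "C / 2 ^ m * (2 - 2 / 2 ^ (p - m)) \<le> C / 2 ^ m * 2" using C by (intro mult_left_mono) auto
    then show ?thesis using geo[of m "p - m"] that by (simp add: mult.commute)
  qed
  have "(\<lambda>m. 2 * C * (1 / 2) ^ m) \<longlonglongrightarrow> 2 * C * 0" by (intro tendsto_mult tendsto_const LIMSEQ_realpow_zero) auto
  then have "eventually (\<lambda>m. 2 * C * (1 / 2) ^ m < e) sequentially"
    using e by (intro order_tendstoD(2)) auto
  then obtain n0 where n0: "\<And>m. m \<ge> n0 \<Longrightarrow> 2 * C * (1 / 2) ^ m < e"
    unfolding eventually_sequentially by blast
  have *: "nA (\<lambda>i j. circle_average p i j - circle_average m i j) < e" if "n0 \<le> m" "m \<le> p" for m p
  proof -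
    have "2 * C / 2 ^ m = 2 * C * (1 / 2) ^ m" by (simp add: power_divide)
    then show ?thesis using tail[OF that(2)] n0[OF that(1)] by linarith
  qed
  show "\<exists>n0. \<forall>m\<ge>n0. \<forall>n\<ge>n0. nA (\<lambda>i j. circle_average m i j - circle_average n i j) < e"
  proof (intro exI[of _ n0] allI impI)
    fix m n assume "n0 \<le> m" "n0 \<le> n"
    then show "nA (\<lambda>i j. circle_average m i j - circle_average n i j) < e"
      using *[of m n] *[of n m] norm_diff_commute[OF circle_average_in circle_average_in, of m n]
      by (cases "m \<le> n") auto
  qed
qed

text \<open>Iteration of the resolvent identity between \<open>z\<close> and \<open>0\<close> gives the Taylor expansion with
  remainder.\<close>

lemma V_taylor:
  assumes "cmod z < A"
  shows "V z x = (\<Sum>m<N. z ^ m *\<^sub>C (V 0 ^^ Suc m) x) + z ^ N *\<^sub>C (V 0 ^^ N) (V z x)"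
proof (induction N)
  case (Suc N)
  have lin: "bounded_clinear (V 0 ^^ N)"
  proof (induction N)
    case (Suc N)
    from bounded_clinear_compose[OF V0(3) Suc] show ?case by (simp add: o_def)
  qed (simp add: bounded_clinear_id id_def)
  have "V 0 x - V z x = (0 - z) *\<^sub>C V 0 (V z x)"
    using assms A by (intro resolvent_identity) auto
  then have "V z x = V 0 x + z *\<^sub>C V 0 (V z x)"
    by (simp add: scaleC_minus_left diff_eq_eq)
  then have "(V 0 ^^ N) (V z x) = (V 0 ^^ N) (V 0 x + z *\<^sub>C V 0 (V z x))" by (rule arg_cong)
  also have "\<dots> = (V 0 ^^ N) (V 0 x) + z *\<^sub>C (V 0 ^^ N) (V 0 (V z x))"
    by (simp only: clinear_simps[OF lin])
  finally have "(V 0 ^^ N) (V z x) = (V 0 ^^ N) (V 0 x) + z *\<^sub>C (V 0 ^^ N) (V 0 (V z x))" .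
  then have step: "(V 0 ^^ N) (V z x) = (V 0 ^^ Suc N) x + z *\<^sub>C (V 0 ^^ Suc N) (V z x)"
    by (simp only: funpow_Suc_right o_apply)
  have rest: "z ^ N *\<^sub>C (V 0 ^^ N) (V z x) = z ^ N *\<^sub>C (V 0 ^^ Suc N) x + z ^ Suc N *\<^sub>C (V 0 ^^ Suc N) (V z x)"
    unfolding step scaleC_add_right scaleC_scaleC power_Suc2 ..
  show ?case
    unfolding sum.lessThan_Suc add.assoc rest[symmetric] by (rule Suc)
qed (simp add: scaleC_one)

lemma V0_power_bound: "norm ((V 0 ^^ N) y) \<le> norm y / A ^ N"
proof (induction N)
  case (Suc N)
  have "norm ((V 0 ^^ Suc N) y) \<le> norm ((V 0 ^^ N) y) / A" using V0(4) by simp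
  also have "\<dots> \<le> norm y / A ^ N / A" using Suc A by (intro divide_right_mono) auto
  finally show ?case by (simp add: mult.commute)
qed simp

text \<open>Averaging over the \<open>N\<close>-th roots of unity annihilates the powers \<open>z^l\<close> with \<open>0 < l < N\<close>
  of the Taylor expansion of order \<open>N\<close>. What remains is the value at \<open>0\<close> and the remainder,
  which on the circle of radius \<open>A/2\<close> is of size \<open>(A/2)^N / A^N\<close>.\<close>

lemma circle_average_error:
  "cmod (circle_average m i j - opmat (V 0) i j) \<le> (1 / 2) ^ m * (2 / A * norm (\<Psi> j) * norm (\<Psi> i))"
proof -
  define N :: nat where "N = 2 ^ m"
  define a where "a l = cinner ((V 0 ^^ Suc l) (\<Psi> j)) (\<Psi> i)" for l
  define z where "z k = circle_point (dyadic_point m k)" for k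
  define R where "R k = z k ^ N * cinner ((V 0 ^^ N) (V (z k) (\<Psi> j))) (\<Psi> i)" for k
  have N: "N > 0" by (simp add: N_def)
  have entry: "circle_resolvent (dyadic_point m k) i j = (\<Sum>l<N. z k ^ l * a l) + R k" for k
    unfolding circle_resolvent_def opmat_def z_def[symmetric]
    by (subst V_taylor[where N=N]) (use A in \<open>auto simp: z_def circle_point cinner_add_left
        cinner_sum_left cinner_scaleC_left a_def R_def\<close>)
  have zero: "(\<Sum>k<N. z k ^ l) = 0" if "0 < l" "l < N" for l
  proof -
    have "z k ^ l = of_real (A / 2) ^ l * cis (2 * pi * real l * real k / real N)" for k
    proof -
      have "z k ^ l = of_real (A / 2) ^ l * cis (real l * dyadic_point m k)"
        by (simp only: z_def circle_point_def power_mult_distrib Complex.DeMoivre)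
      also have "real l * dyadic_point m k = 2 * pi * real l * real k / real N"
        by (simp add: dyadic_point_def N_def)
      finally show ?thesis .
    qed
    then show ?thesis using sum_cis_multiples[OF that] by (simp flip: sum_distrib_left)
  qed
  have "(\<Sum>k<N. \<Sum>l<N. z k ^ l * a l) = (\<Sum>l<N. (\<Sum>k<N. z k ^ l) * a l)"
    by (subst sum.swap) (simp add: sum_distrib_right)
  also have "\<dots> = (\<Sum>l<N. if l = 0 then of_nat N * a 0 else 0)"
    using zero by (intro sum.cong) auto
  also have "\<dots> = of_nat N * a 0" using N by simp
  finally have "circle_average m i j = a 0 + 1 / of_nat N * (\<Sum>k<N. R k)"
    using N unfolding circle_average_def entry by (simp add: N_def[symmetric] sum.distrib field_simps)
  then have "circle_average m i j - opmat (V 0) i j = 1 / of_nat N * (\<Sum>k<N. R k)"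
    by (simp add: a_def opmat_def)
  then have "cmod (circle_average m i j - opmat (V 0) i j) \<le> 1 / real N * (\<Sum>k<N. cmod (R k))"
    by (simp add: norm_mult norm_divide divide_right_mono norm_sum)
  also have "\<dots> \<le> 1 / real N * (\<Sum>k<N. (1 / 2) ^ N * (2 / A * norm (\<Psi> j) * norm (\<Psi> i)))"
  proof (intro mult_left_mono sum_mono)
    fix k
    have "norm (V (z k) (\<Psi> j)) \<le> norm (\<Psi> j) / (A - cmod (z k))"
      by (rule V_bound) (use A in \<open>simp add: z_def circle_point\<close>)
    then have v: "norm (V (z k) (\<Psi> j)) \<le> 2 / A * norm (\<Psi> j)" using A by (simp add: z_def circle_point mult.commute)
    have "cmod (R k) \<le> (A / 2) ^ N * (norm ((V 0 ^^ N) (V (z k) (\<Psi> j))) * norm (\<Psi> i))"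
      unfolding R_def using A
      by (simp add: norm_mult norm_power z_def circle_point(1) mult_left_mono cauchy_schwarz)
    also have "\<dots> \<le> (A / 2) ^ N * ((2 / A * norm (\<Psi> j) / A ^ N) * norm (\<Psi> i))"
    proof (intro mult_left_mono mult_right_mono)
      show "norm ((V 0 ^^ N) (V (z k) (\<Psi> j))) \<le> 2 / A * norm (\<Psi> j) / A ^ N"
        using V0_power_bound[of N "V (z k) (\<Psi> j)"] divide_right_mono[OF v, of "A ^ N"] A by simp
    qed (use A in auto)
    also have "\<dots> = (1 / 2) ^ N * (2 / A * norm (\<Psi> j) * norm (\<Psi> i))"
      using A by (simp add: power_divide)
    finally show "cmod (R k) \<le> (1 / 2) ^ N * (2 / A * norm (\<Psi> j) * norm (\<Psi> i))" .
  qed auto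
  also have "\<dots> = (1 / 2) ^ N * (2 / A * norm (\<Psi> j) * norm (\<Psi> i))" using N by simp
  also have "\<dots> \<le> (1 / 2) ^ m * (2 / A * norm (\<Psi> j) * norm (\<Psi> i))"
    using A by (intro mult_right_mono power_decreasing) (auto simp: N_def less_imp_le)
  finally show ?thesis .
qed

text \<open>The averages converge in the algebra to some matrix and entrywise to \<open>[V 0]\<close>; solidity
  identifies the two limits.\<close>

theorem opmat_projection_in: "opmat (V 0) \<in> \<A>"
proof -
  obtain M where M: "M \<in> \<A>" "(\<lambda>m. nA (\<lambda>i j. circle_average m i j - M i j)) \<longlonglongrightarrow> 0"
    using circle_average_converges by blast
  have entries: "opmat (V 0) i j = M i j" for i j
  proof -
    have "(\<lambda>m. (1 / 2) ^ m * (2 / A * norm (\<Psi> j) * norm (\<Psi> i))) \<longlonglongrightarrow> 0 * (2 / A * norm (\<Psi> j) * norm (\<Psi> i))"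
      by (intro tendsto_mult tendsto_const LIMSEQ_realpow_zero) auto
    then have "(\<lambda>m. circle_average m i j - opmat (V 0) i j) \<longlonglongrightarrow> 0"
      unfolding mult_zero_left
      by (rule Lim_null_comparison[OF always_eventually, OF allI, OF circle_average_error])
    then have "(\<lambda>m. circle_average m i j) \<longlonglongrightarrow> opmat (V 0) i j" by (rule LIM_zero_cancel)
    moreover have "(\<lambda>m. circle_average m i j) \<longlonglongrightarrow> M i j"
      by (rule entry_tendsto[OF circle_average_in M])
    ultimately show ?thesis by (rule LIMSEQ_unique)
  qed
  have "opmat (V 0) = M" by (rule ext, rule ext, rule entries)
  with M show ?thesis by simp
qed

text \<open>The matrix \<open>1 - [V 0]\<close> is the projection onto the kernel of the Gram matrix. Adding it
  makes the Gram matrix invertible, and the inverse is the Gram matrix of the dual frame plus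
  the same projection.\<close>

theorem opmat_dual_gram_in: "opmat (\<lambda>x. V 0 (V 0 x)) \<in> \<A>"
proof -
  have c1: "bounded_clinear (\<lambda>x. x - V 0 x)" and c2: "bounded_clinear (\<lambda>x. V 0 (V 0 x) - V 0 x)"
    using V0(3) bounded_clinear_compose[OF V0(3) V0(3)] bounded_clinear_id
    by (auto simp: bounded_clinear_def scaleC_diff_right intro: bounded_linear_sub)
  have d: "opmat (\<lambda>x. f x - g x) = (\<lambda>i j. opmat f i j - opmat g i j)" for f g
    by (simp add: opmat_def cinner_diff_left)
  have "affmat 1 1 (\<lambda>x. V 0 (V 0 x) - V 0 x) \<in> \<A>"
  proof (rule affmat_inverse_in[where a=1 and b=1, OF _ c1 c2])
    show "affmat 1 1 (\<lambda>x. x - V 0 x) \<in> \<A>"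
      unfolding d[of "\<lambda>x. x"] by (intro affmat_in) (simp add: d diff_in opmat_projection_in gram_in flip: gram_eq)
  qed (simp_all add: scaleC_one V0 clinear_simps[OF V0(3)] clinear_simps[OF S_clinear])
  then have "opmat (\<lambda>x. V 0 (V 0 x) - V 0 x) \<in> \<A>" by (rule opmat_in_if_affmat) simp
  from spectral_add[OF algebra this opmat_projection_in] show ?thesis by (simp add: d)
qed

end

section \<open>Matrices on weighted sequence spaces\<close>

lemma entry_le_wnorm: "1 \<le> p \<Longrightarrow> ennreal (cmod (c k) * w k) \<le> wnorm p w c"
  unfolding wnorm_def by (rule entry_le_lp_norm)

lemma wnorm_infty_le_iff: "wnorm \<infinity> w c \<le> M \<longleftrightarrow> (\<forall>k. ennreal (cmod (c k) * w k) \<le> M)"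
  by (simp add: wnorm_def lp_norm_infty SUP_le_iff)

lemma wnorm_infty_le_wnorm: "1 \<le> p \<Longrightarrow> wnorm \<infinity> w c \<le> wnorm p w c"
  unfolding wnorm_infty_le_iff by (intro allI entry_le_wnorm)

lemma wnorm_one: "wnorm 1 w c = (\<Sum>\<^sub>\<infinity>k. ennreal (cmod (c k) * w k))"
  by (simp add: wnorm_def lp_norm_one)

lemma wnorm_le_wnorm_one: "1 \<le> p \<Longrightarrow> wnorm p w c \<le> wnorm 1 w c"
  unfolding wnorm_one unfolding wnorm_def by (rule lp_norm_le_l1)

lemma wnorm_cmult:
  assumes "1 \<le> p"
  shows "wnorm p w (\<lambda>k. a * c k) = ennreal (cmod a) * wnorm p w c"
proof -
  have "wnorm p w (\<lambda>k. a * c k) = lp_norm p (\<lambda>k. ennreal (cmod a) * ennreal (cmod (c k) * w k))"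
    unfolding wnorm_def by (simp add: norm_mult ennreal_mult' mult.assoc)
  then show ?thesis using assms by (simp add: lp_norm_cmult wnorm_def)
qed

lemma wnorm_le_pointwise_limit:
  fixes f :: "nat \<Rightarrow> 'a \<Rightarrow> complex"
  assumes "1 \<le> p" "\<And>k. (\<lambda>n. f n k) \<longlonglongrightarrow> c k" "\<And>n. wnorm p w (f n) \<le> M"
  shows "wnorm p w c \<le> M"
  unfolding wnorm_def
proof (rule lp_norm_le_pointwise_limit[OF assms(1)])
  show "(\<lambda>n. ennreal (cmod (f n k) * w k)) \<longlonglongrightarrow> ennreal (cmod (c k) * w k)" for k
    by (intro tendsto_ennrealI tendsto_mult tendsto_norm assms(2) tendsto_const)
  show "lp_norm p (\<lambda>k. ennreal (cmod (f n k) * w k)) \<le> M" for n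
    using assms(3)[of n] by (simp add: wnorm_def)
qed simp

text \<open>Boundedness of the matrix of absolute values with bound \<open>B\<close>. Stated for all extended
  nonnegative sequences, it can be used without checking summability, and it is stable under
  duality. Solidity gives it for every element of the algebra, although admissibility speaks
  of the matrix itself.\<close>

definition abs_bounded :: "ennreal \<Rightarrow> ('i \<Rightarrow> real) \<Rightarrow> 'i cmatrix \<Rightarrow> real \<Rightarrow> bool" where
  "abs_bounded p w M B \<longleftrightarrow> B > 0 \<and> (\<forall>x::'i \<Rightarrow> ennreal.
     lp_norm p (\<lambda>i. ennreal (w i) * (\<Sum>\<^sub>\<infinity>j. ennreal (cmod (M i j)) * x j))
       \<le> ennreal B * lp_norm p (\<lambda>j. ennreal (w j) * x j))"

lemma abs_boundedD:
  "abs_bounded p w M B \<Longrightarrow>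
     lp_norm p (\<lambda>i. ennreal (w i) * (\<Sum>\<^sub>\<infinity>j. ennreal (cmod (M i j)) * x j))
       \<le> ennreal B * lp_norm p (\<lambda>j. ennreal (w j) * x j)"
  by (simp add: abs_bounded_def)

lemma abs_bounded_if_mat_bounded_on:
  assumes p: "1 \<le> p" and w: "\<And>i. w i > 0"
    and bounded: "mat_bounded_on p w (\<lambda>i j. complex_of_real (cmod (M i j)))"
  shows "\<exists>B. abs_bounded p w M B"
proof -
  obtain B0 where B0: "\<And>c. wnorm p w c < \<infinity> \<Longrightarrow>
      (\<forall>i. (\<lambda>j. complex_of_real (cmod (M i j)) * c j) summable_on UNIV) \<and>
      wnorm p w (mat_vec (\<lambda>i j. complex_of_real (cmod (M i j))) c) \<le> ennreal B0 * wnorm p w c"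
    using bounded unfolding mat_bounded_on_def by blast
  define B where "B = max B0 1"
  have "lp_norm p (\<lambda>i. ennreal (w i) * (\<Sum>\<^sub>\<infinity>j. ennreal (cmod (M i j)) * x j))
       \<le> ennreal B * lp_norm p (\<lambda>j. ennreal (w j) * x j)" for x :: "'a \<Rightarrow> ennreal"
  proof (cases "lp_norm p (\<lambda>j. ennreal (w j) * x j) = \<infinity>")
    case True
    then show ?thesis by (simp add: B_def ennreal_mult_top)
  next
    case False
    have "x j \<noteq> top" for j
    proof
      assume "x j = top"
      then have "ennreal (w j) * x j = top" using w[of j] by (simp add: ennreal_mult_top)
      then show False using entry_le_lp_norm[OF p, of "\<lambda>j. ennreal (w j) * x j" j] False
        by (simp add: top_unique)
    qed
    then have "\<exists>y\<ge>0. x j = ennreal y" for j by (cases "x j") auto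
    then obtain y where y: "\<And>j. y j \<ge> 0" "\<And>j. x j = ennreal (y j)" by metis
    define c where "c j = complex_of_real (y j)" for j
    have wc: "wnorm p w c = lp_norm p (\<lambda>j. ennreal (w j) * x j)"
      using y w by (simp add: wnorm_def c_def less_imp_le mult.commute flip: ennreal_mult)
    then have fin: "wnorm p w c < \<infinity>" using False by (simp add: less_top)
    have s: "(\<lambda>j. complex_of_real (cmod (M i j)) * c j) summable_on UNIV" for i using B0[OF fin] by blast
    have mv: "ennreal (cmod (mat_vec (\<lambda>i j. complex_of_real (cmod (M i j))) c i) * w i)
        = ennreal (w i) * (\<Sum>\<^sub>\<infinity>j. ennreal (cmod (M i j)) * x j)" for i
    proof -
      define g where "g j = cmod (M i j) * y j" for j
      have g0: "g j \<ge> 0" for j by (simp add: g_def y)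
      have gs: "g summable_on UNIV"
      proof -
        have "(\<lambda>j. norm (complex_of_real (cmod (M i j)) * c j)) summable_on UNIV"
          using s[of i] by (simp only: summable_on_iff_abs_summable_on_complex)
        then show ?thesis by (simp add: g_def[abs_def] c_def norm_mult y)
      qed
      have "mat_vec (\<lambda>i j. complex_of_real (cmod (M i j))) c i = complex_of_real (\<Sum>\<^sub>\<infinity>j. g j)"
        unfolding mat_vec_def
        using infsumI[OF has_sum_of_real[OF has_sum_infsum[OF gs], where 'a=complex]]
        by (simp add: g_def[abs_def] c_def)
      then have "cmod (mat_vec (\<lambda>i j. complex_of_real (cmod (M i j))) c i) = (\<Sum>\<^sub>\<infinity>j. g j)"
        using infsum_nonneg[of UNIV g] g0 by simp
      moreover have "ennreal (\<Sum>\<^sub>\<infinity>j. g j) = (\<Sum>\<^sub>\<infinity>j. ennreal (cmod (M i j)) * x j)"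
        using infsum_ennreal_eq_real[OF gs g0] by (simp add: g_def y ennreal_mult)
      ultimately show ?thesis
        using w[of i] infsum_nonneg[of UNIV g] g0 by (simp add: ennreal_mult mult.commute)
    qed
    have "lp_norm p (\<lambda>i. ennreal (w i) * (\<Sum>\<^sub>\<infinity>j. ennreal (cmod (M i j)) * x j))
        \<le> ennreal B0 * lp_norm p (\<lambda>j. ennreal (w j) * x j)"
      using B0[OF fin] unfolding wc[symmetric] by (simp add: wnorm_def mv)
    also have "\<dots> \<le> ennreal B * lp_norm p (\<lambda>j. ennreal (w j) * x j)"
      by (intro mult_right_mono ennreal_leI) (auto simp: B_def)
    finally show ?thesis .
  qed
  then show ?thesis unfolding abs_bounded_def by (intro exI[of _ B]) (auto simp: B_def)
qed

text \<open>Testing against a sequence \<open>b\<close> and interchanging the sums moves the matrix to the other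
  factor, where its adjoint acts on \<open>b / w\<close>; Hoelder's inequality concludes.\<close>

lemma abs_bounded_recip:
  assumes pq: "conjugate p q" and w: "\<And>i. w i > 0" and adj: "abs_bounded q w (mat_adjoint M) B"
  shows "abs_bounded p (recip w) M B"
proof -
  have B: "B > 0" using adj by (simp add: abs_bounded_def)
  have inv: "ennreal (w i) * ennreal (recip w i) = 1" for i
    using w[of i] by (simp add: recip_def flip: ennreal_mult)
  have p: "1 \<le> p" using pq by (simp add: conjugate_def)
  have "lp_norm p (\<lambda>i. ennreal (recip w i) * (\<Sum>\<^sub>\<infinity>j. ennreal (cmod (M i j)) * x j))
       \<le> ennreal B * lp_norm p (\<lambda>j. ennreal (recip w j) * x j)" for x :: "'a \<Rightarrow> ennreal"
  proof (rule lp_norm_le_by_duality[OF pq])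
    fix b :: "'a \<Rightarrow> real" assume b: "lp_norm q (\<lambda>k. ennreal (b k)) \<le> 1"
    define y where "y j = ennreal (w j) * (\<Sum>\<^sub>\<infinity>i. ennreal (cmod (mat_adjoint M j i)) * (ennreal (recip w i) * ennreal (b i)))" for j
    have y: "lp_norm q y \<le> ennreal B"
    proof -
      have "lp_norm q y \<le> ennreal B * lp_norm q (\<lambda>i. ennreal (w i) * (ennreal (recip w i) * ennreal (b i)))"
        unfolding y_def by (rule abs_boundedD[OF adj])
      also have "\<dots> = ennreal B * lp_norm q (\<lambda>i. ennreal (b i))"
        by (simp add: mult.assoc[symmetric] inv)
      also have "\<dots> \<le> ennreal B * 1" by (intro mult_left_mono b) auto
      finally show ?thesis by simp
    qed
    have "(\<Sum>\<^sub>\<infinity>i. ennreal (recip w i) * (\<Sum>\<^sub>\<infinity>j. ennreal (cmod (M i j)) * x j) * ennreal (b i))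
        = (\<Sum>\<^sub>\<infinity>i. \<Sum>\<^sub>\<infinity>j. ennreal (cmod (M i j)) * x j * (ennreal (recip w i) * ennreal (b i)))"
      unfolding infsum_ennreal_cmult_right by (simp add: mult_ac)
    also have "\<dots> = (\<Sum>\<^sub>\<infinity>j. \<Sum>\<^sub>\<infinity>i. ennreal (cmod (M i j)) * x j * (ennreal (recip w i) * ennreal (b i)))"
      by (rule infsum_ennreal_swap)
    also have "\<dots> = (\<Sum>\<^sub>\<infinity>j. x j * (\<Sum>\<^sub>\<infinity>i. ennreal (cmod (mat_adjoint M j i)) * (ennreal (recip w i) * ennreal (b i))))"
      by (intro infsum_cong, subst infsum_ennreal_cmult[symmetric]) (simp add: mat_adjoint_def mult_ac)
    also have "\<dots> = (\<Sum>\<^sub>\<infinity>j. (ennreal (recip w j) * x j) * y j)"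
    proof (intro infsum_cong)
      fix j
      have "(ennreal (recip w j) * x j) * (ennreal (w j) * z)
          = (ennreal (w j) * ennreal (recip w j)) * (x j * z)" for z
        by (simp only: mult_ac)
      then show "x j * (\<Sum>\<^sub>\<infinity>i. ennreal (cmod (mat_adjoint M j i)) * (ennreal (recip w i) * ennreal (b i)))
          = (ennreal (recip w j) * x j) * y j"
        unfolding y_def inv by simp
    qed
    also have "\<dots> \<le> lp_norm p (\<lambda>j. ennreal (recip w j) * x j) * lp_norm q y" by (rule hoelder[OF pq])
    also have "\<dots> \<le> lp_norm p (\<lambda>j. ennreal (recip w j) * x j) * ennreal B" by (intro mult_left_mono y) auto
    finally show "(\<Sum>\<^sub>\<infinity>i. ennreal (recip w i) * (\<Sum>\<^sub>\<infinity>j. ennreal (cmod (M i j)) * x j) * ennreal (b i))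
        \<le> ennreal B * lp_norm p (\<lambda>j. ennreal (recip w j) * x j)" by (simp add: mult.commute)
  qed
  then show ?thesis using B by (simp add: abs_bounded_def)
qed

text \<open>Admissibility in terms of absolute values. In contrast to the original notion this one
  is visibly invariant under passing to the reciprocal weight.\<close>

definition good_weight :: "'i cmatrix set \<Rightarrow> ('i \<Rightarrow> real) \<Rightarrow> bool" where
  "good_weight \<A> w \<longleftrightarrow> (\<forall>i. w i > 0) \<and> (\<forall>M\<in>\<A>. \<forall>p\<ge>1. \<exists>B. abs_bounded p w M B)"

lemma good_weight_pos: "good_weight \<A> w \<Longrightarrow> 0 < w i"
  by (simp add: good_weight_def)

lemma admissible_weight_good:
  assumes algebra: "spectral_matrix_algebra \<A> nA" and w: "admissible_weight \<A> w"
  shows "good_weight \<A> w"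
  unfolding good_weight_def
proof (intro conjI ballI allI impI)
  show pos: "w i > 0" for i using w by (simp add: admissible_weight_def)
  fix M and p :: ennreal assume M: "M \<in> \<A>" and p: "1 \<le> p"
  have "(\<lambda>i j. complex_of_real (cmod (M i j))) \<in> \<A>"
    by (rule spectral_solid[OF algebra M]) simp
  then show "\<exists>B. abs_bounded p w M B"
    using w p pos by (intro abs_bounded_if_mat_bounded_on) (auto simp: admissible_weight_def)
qed

lemma good_weight_recip:
  assumes algebra: "spectral_matrix_algebra \<A> nA" and w: "good_weight \<A> w"
  shows "good_weight \<A> (recip w)"
  unfolding good_weight_def
proof (intro conjI ballI allI impI)
  show "recip w i > 0" for i using good_weight_pos[OF w] by (simp add: recip_def)
  fix M and p :: ennreal assume M: "M \<in> \<A>" and p: "1 \<le> p"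
  obtain q where pq: "conjugate p q" using conjugate_exists[OF p] .
  obtain B where "abs_bounded q w (mat_adjoint M) B"
    using w spectral_adjoint[OF algebra M] pq unfolding good_weight_def conjugate_def by blast
  then show "\<exists>B. abs_bounded p (recip w) M B"
    using abs_bounded_recip[OF pq, of w M B] good_weight_pos[OF w] by blast
qed

lemma wnorm_mat_vec_le:
  assumes M: "abs_bounded p w M B" and p: "1 \<le> p" and w: "\<And>i. w i > 0"
  shows "wnorm p w (mat_vec M c) \<le> ennreal B * wnorm p w c"
proof -
  have "wnorm p w (mat_vec M c)
      \<le> lp_norm p (\<lambda>i. ennreal (w i) * (\<Sum>\<^sub>\<infinity>j. ennreal (cmod (M i j)) * ennreal (cmod (c j))))"
    unfolding wnorm_def
  proof (rule lp_norm_mono[OF p])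
    fix i
    have "ennreal (cmod (mat_vec M c i)) \<le> (\<Sum>\<^sub>\<infinity>j. ennreal (cmod (M i j * c j)))"
      unfolding mat_vec_def by (rule cmod_infsum_le)
    then show "ennreal (cmod (mat_vec M c i) * w i)
        \<le> ennreal (w i) * (\<Sum>\<^sub>\<infinity>j. ennreal (cmod (M i j)) * ennreal (cmod (c j)))"
      using w[of i] by (simp add: ennreal_mult norm_mult mult_left_mono mult.commute[of _ "ennreal (w i)"])
  qed
  also have "\<dots> \<le> ennreal B * lp_norm p (\<lambda>j. ennreal (w j) * ennreal (cmod (c j)))"
    by (rule abs_boundedD[OF M])
  also have "lp_norm p (\<lambda>j. ennreal (w j) * ennreal (cmod (c j))) = wnorm p w c"
    using w by (simp add: wnorm_def less_imp_le mult.commute flip: ennreal_mult)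
  finally show ?thesis .
qed

text \<open>Boundedness with exponent \<open>\<infinity>\<close> controls every single row; this is the source of all
  absolute convergence below.\<close>

lemma row_sum_le:
  assumes M: "abs_bounded \<infinity> w M B" and w: "\<And>i. w i > 0" and x: "\<And>j. x j \<le> K * ennreal (1 / w j)"
  shows "(\<Sum>\<^sub>\<infinity>j. ennreal (cmod (M i j)) * x j) \<le> ennreal B * K * ennreal (1 / w i)"
proof -
  have inv: "ennreal (w i) * ennreal (1 / w i) = 1" for i
    using w[of i] by (simp flip: ennreal_mult)
  have "ennreal (w i) * (\<Sum>\<^sub>\<infinity>j. ennreal (cmod (M i j)) * x j)
      \<le> lp_norm \<infinity> (\<lambda>i. ennreal (w i) * (\<Sum>\<^sub>\<infinity>j. ennreal (cmod (M i j)) * x j))"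
    by (rule entry_le_lp_norm[where a="\<lambda>i. ennreal (w i) * (\<Sum>\<^sub>\<infinity>j. ennreal (cmod (M i j)) * x j)"]) simp
  also have "\<dots> \<le> ennreal B * lp_norm \<infinity> (\<lambda>j. ennreal (w j) * x j)" by (rule abs_boundedD[OF M])
  also have "\<dots> \<le> ennreal B * K"
  proof (intro mult_left_mono)
    have "ennreal (w j) * x j \<le> K" for j
    proof -
      have "ennreal (w j) * x j \<le> ennreal (w j) * (K * ennreal (1 / w j))" by (intro mult_left_mono x) auto
      also have "\<dots> = K" using inv[of j] by (simp add: mult.left_commute)
      finally show ?thesis .
    qed
    then show "lp_norm \<infinity> (\<lambda>j. ennreal (w j) * x j) \<le> K" by (auto simp: lp_norm_infty intro: SUP_least)
  qed auto
  finally have "ennreal (w i) * (\<Sum>\<^sub>\<infinity>j. ennreal (cmod (M i j)) * x j) * ennreal (1 / w i)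
      \<le> ennreal B * K * ennreal (1 / w i)" by (rule mult_right_mono) auto
  moreover have "ennreal (w i) * y * ennreal (1 / w i) = y" for y
    using inv[of i] by (metis mult.commute mult.left_neutral mult.assoc)
  ultimately show ?thesis by simp
qed

text \<open>Everything that concerns single entries takes place in the largest space: matrices act
  absolutely convergently on sequences that are bounded with respect to the weight.\<close>

definition wbounded :: "('i \<Rightarrow> real) \<Rightarrow> ('i \<Rightarrow> complex) \<Rightarrow> bool" where
  "wbounded w c \<longleftrightarrow> wnorm \<infinity> w c < \<infinity>"

lemma wbounded_if_wnorm_finite: "1 \<le> p \<Longrightarrow> wnorm p w c < \<infinity> \<Longrightarrow> wbounded w c"
  unfolding wbounded_def using wnorm_infty_le_wnorm by (rule order.strict_trans1)

lemma entry_le_of_wnorm: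
  assumes w: "\<And>i. w i > 0"
  shows "ennreal (cmod (c j)) \<le> wnorm \<infinity> w c * ennreal (1 / w j)"
proof -
  have "ennreal (cmod (c j)) = ennreal (cmod (c j) * w j) * ennreal (1 / w j)"
    using w[of j] by (simp flip: ennreal_mult)
  also have "\<dots> \<le> wnorm \<infinity> w c * ennreal (1 / w j)"
    by (intro mult_right_mono entry_le_wnorm) auto
  finally show ?thesis .
qed

lemma row_sum_finite:
  assumes M: "abs_bounded \<infinity> w M B" and w: "\<And>i. w i > 0" and c: "wbounded w c"
  shows "(\<Sum>\<^sub>\<infinity>j. ennreal (cmod (M i j)) * ennreal (cmod (c j))) < \<infinity>"
    "(\<lambda>j. M i j * c j) summable_on UNIV"
proof -
  have "(\<Sum>\<^sub>\<infinity>j. ennreal (cmod (M i j)) * ennreal (cmod (c j))) \<le> ennreal B * wnorm \<infinity> w c * ennreal (1 / w i)"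
    by (rule row_sum_le[OF M w entry_le_of_wnorm[OF w]])
  also have "\<dots> < \<infinity>" using c by (simp add: wbounded_def ennreal_mult_less_top less_top)
  finally show fin: "(\<Sum>\<^sub>\<infinity>j. ennreal (cmod (M i j)) * ennreal (cmod (c j))) < \<infinity>" .
  then show "(\<lambda>j. M i j * c j) summable_on UNIV"
    by (simp add: complex_summable_iff_ennreal norm_mult ennreal_mult)
qed

text \<open>Fubini; the double sum converges absolutely because the matrices of absolute values are
  bounded, too.\<close>

lemma mat_vec_mat_vec:
  assumes M: "abs_bounded \<infinity> w M B" and N: "abs_bounded \<infinity> w N B'" and w: "\<And>i. w i > 0"
    and c: "wbounded w c"
  shows "mat_vec M (mat_vec N c) = mat_vec (mat_mult M N) c"
proof
  fix i
  have K: "wnorm \<infinity> w c < \<infinity>" using c by (simp add: wbounded_def)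
  have "(\<Sum>\<^sub>\<infinity>j. \<Sum>\<^sub>\<infinity>k. ennreal (cmod (M i j * (N j k * c k))))
      = (\<Sum>\<^sub>\<infinity>j. ennreal (cmod (M i j)) * (\<Sum>\<^sub>\<infinity>k. ennreal (cmod (N j k)) * ennreal (cmod (c k))))"
    by (simp add: norm_mult ennreal_mult infsum_ennreal_cmult)
  also have "\<dots> \<le> ennreal B * (ennreal B' * wnorm \<infinity> w c) * ennreal (1 / w i)"
    by (intro row_sum_le[OF M w] row_sum_le[OF N w] entry_le_of_wnorm w)
  also have "\<dots> < \<infinity>" using K by (simp add: ennreal_mult_less_top less_top)
  finally have fin: "(\<Sum>\<^sub>\<infinity>j. \<Sum>\<^sub>\<infinity>k. ennreal (cmod (M i j * (N j k * c k)))) < \<infinity>" .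
  have "mat_vec M (mat_vec N c) i = (\<Sum>\<^sub>\<infinity>j. \<Sum>\<^sub>\<infinity>k. M i j * (N j k * c k))"
    unfolding mat_vec_def by (simp add: infsum_cmult_right')
  also have "\<dots> = (\<Sum>\<^sub>\<infinity>k. \<Sum>\<^sub>\<infinity>j. M i j * (N j k * c k))" by (rule infsum_complex_swap[OF fin])
  also have "\<dots> = (\<Sum>\<^sub>\<infinity>k. (\<Sum>\<^sub>\<infinity>j. M i j * N j k) * c k)"
    by (simp add: mult.assoc[symmetric] infsum_cmult_left')
  finally show "mat_vec M (mat_vec N c) i = mat_vec (mat_mult M N) c i"
    by (simp add: mat_vec_def mat_mult_def)
qed

lemma mat_vec_linear:
  assumes M: "abs_bounded \<infinity> w M B" and w: "\<And>i. w i > 0" and c: "wbounded w c" and d: "wbounded w d"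
  shows "mat_vec M (\<lambda>i. a * c i + b * d i) = (\<lambda>i. a * mat_vec M c i + b * mat_vec M d i)"
proof
  fix i
  have s: "(\<lambda>j. M i j * c j) summable_on UNIV" "(\<lambda>j. M i j * d j) summable_on UNIV"
    using row_sum_finite(2)[OF M w c] row_sum_finite(2)[OF M w d] by auto
  have "(\<lambda>j. M i j * (a * c j + b * d j)) = (\<lambda>j. a * (M i j * c j) + b * (M i j * d j))"
    by (auto simp: algebra_simps)
  then show "mat_vec M (\<lambda>i. a * c i + b * d i) i = a * mat_vec M c i + b * mat_vec M d i"
    unfolding mat_vec_def using s
    by (simp add: infsum_add summable_on_cmult_right infsum_cmult_right')
qed

text \<open>Bounded coefficientwise convergence suffices: the rows of \<open>M\<close> are summable against the
  reciprocal weight, so convergence is dominated.\<close>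

lemma mat_vec_tendsto:
  assumes M: "abs_bounded \<infinity> w M B" and w: "\<And>i. w i > 0"
    and lim: "\<And>j. (\<lambda>n. f n j) \<longlonglongrightarrow> c j" and K: "\<And>n. n \<ge> N \<Longrightarrow> wnorm \<infinity> w (f n) \<le> K" "K < \<infinity>"
  shows "(\<lambda>n. mat_vec M (f n) i) \<longlonglongrightarrow> mat_vec M c i"
proof -
  have "(\<lambda>n. mat_vec M (f (n + N)) i) \<longlonglongrightarrow> mat_vec M c i"
    unfolding mat_vec_def
  proof (rule infsum_dominated_convergence)
    show "(\<lambda>n. M i j * f (n + N) j) \<longlonglongrightarrow> M i j * c j" for j
      by (intro tendsto_mult tendsto_const LIMSEQ_ignore_initial_segment lim)
    show "ennreal (cmod (M i j * f (n + N) j)) \<le> ennreal (cmod (M i j)) * (K * ennreal (1 / w j))" for n j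
    proof -
      have "ennreal (cmod (f (n + N) j)) \<le> K * ennreal (1 / w j)"
        using mult_right_mono[OF K(1), of "n + N" "ennreal (1 / w j)"]
        by (intro order.trans[OF entry_le_of_wnorm[OF w]]) auto
      then show ?thesis by (simp add: norm_mult ennreal_mult mult_left_mono)
    qed
    have "(\<Sum>\<^sub>\<infinity>j. ennreal (cmod (M i j)) * (K * ennreal (1 / w j))) \<le> ennreal B * K * ennreal (1 / w i)"
      by (rule row_sum_le[OF M w]) simp
    also have "\<dots> < \<infinity>" using K by (simp add: ennreal_mult_less_top less_top)
    finally show "(\<Sum>\<^sub>\<infinity>j. ennreal (cmod (M i j)) * (K * ennreal (1 / w j))) < \<infinity>" .
  qed
  then show ?thesis by (rule LIMSEQ_offset)
qed

lemma wnorm_truncate_le: "1 \<le> p \<Longrightarrow> (\<And>i. w i > 0) \<Longrightarrow> wnorm p w (truncate n c) \<le> wnorm p w c"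
  unfolding wnorm_def by (rule lp_norm_mono) (auto simp: truncate_def)

lemma wnorm_truncate_tendsto:
  fixes c :: "'a::countable \<Rightarrow> complex"
  assumes "1 \<le> p" "p \<noteq> \<infinity>" "wnorm p w c < \<infinity>"
  shows "(\<lambda>n. wnorm p w (\<lambda>i. truncate n c i - c i)) \<longlonglongrightarrow> 0"
proof -
  have "wnorm p w (\<lambda>i. truncate n c i - c i)
      = lp_norm p (\<lambda>k. if to_nat k < n then 0 else ennreal (cmod (c k) * w k))" for n
    unfolding wnorm_def by (intro arg_cong[of _ _ "lp_norm p"]) (auto simp: truncate_def)
  then show ?thesis using lp_norm_tail_tendsto_0[OF assms(1,2)] assms(3) by (simp add: wnorm_def)
qed

section \<open>Co-orbit spaces as ranges of a projection\<close>

lemma ennreal_tendsto_0_mono: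
  fixes f g :: "nat \<Rightarrow> ennreal"
  assumes "\<And>n. f n \<le> g n" "g \<longlonglongrightarrow> 0"
  shows "f \<longlonglongrightarrow> 0"
  using tendsto_sandwich[of "\<lambda>_. 0" f sequentially g 0] assms by simp

context localised
begin

text \<open>The cross-Gram matrix of the frame with its dual frame, and the Gram matrix of the dual frame.\<close>

definition P :: "'i cmatrix" where "P = opmat (V 0)"

definition dual_gram :: "'i cmatrix" where "dual_gram = opmat (\<lambda>x. V 0 (V 0 x))"

lemma P_in: "P \<in> \<A>" and dual_gram_in: "dual_gram \<in> \<A>"
  by (simp_all add: P_def dual_gram_def opmat_projection_in opmat_dual_gram_in)

text \<open>All are instances of \<open>[T] [U] = [T S U]\<close> with \<open>V 0\<close> the inverse of \<open>S\<close>.\<close>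

lemma matrix_products:
  "mat_mult P P = P" "mat_mult (gram \<Psi>) P = gram \<Psi>" "mat_mult (gram \<Psi>) dual_gram = P"
  "mat_mult dual_gram (gram \<Psi>) = P" "mat_mult P dual_gram = dual_gram"
  unfolding P_def dual_gram_def gram_eq
  by (simp_all only: mat_mult_opmat(2)[OF V0(3)] mat_mult_opmat(2)[OF bounded_clinear_id]
      mat_mult_opmat(2)[OF bounded_clinear_compose[OF V0(3) V0(3)]] V0(1,2))

lemma P_adjoint: "cnj (P i j) = P j i"
  unfolding P_def opmat_def by (subst cinner_commute) (simp add: V0_selfadjoint)

lemma gram_adjoint: "cnj (gram \<Psi> i j) = gram \<Psi> j i"
  unfolding gram_def by (subst cinner_commute) simp

lemma analysis_dual: "analysis (dual_frame \<Psi>) f = analysis \<Psi> (V 0 f)"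
  by (simp add: analysis_def dual_frame_eq V0_selfadjoint)

lemma P_analysis_dual: "mat_vec P (analysis (dual_frame \<Psi>) f) = analysis (dual_frame \<Psi>) f"
  by (simp only: P_def analysis_dual mat_vec_opmat[OF square_summable_analysis V0(3)]
      frame_operator_eq[symmetric] V0(1,2))

lemma gram_analysis_dual: "mat_vec (gram \<Psi>) (analysis (dual_frame \<Psi>) f) = analysis \<Psi> f"
  by (simp only: gram_eq analysis_dual mat_vec_opmat[OF square_summable_analysis bounded_clinear_id]
      frame_operator_eq[symmetric] V0(1,2))

lemma analysis_dual_dual: "analysis (dual_frame \<Psi>) (dual_frame \<Psi> i) = (\<lambda>l. dual_gram l i)"
  unfolding analysis_dual by (simp add: dual_gram_def opmat_column dual_frame_eq)

lemma analysis_dual_finite: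
  assumes "finite F"
  shows "analysis (dual_frame \<Psi>) (\<Sum>k\<in>F. a k *\<^sub>C \<Psi> k) = mat_vec P (\<lambda>k. if k \<in> F then a k else 0)"
proof
  fix i
  have "mat_vec P (\<lambda>k. if k \<in> F then a k else 0) i = (\<Sum>k\<in>F. P i k * a k)"
    unfolding mat_vec_def by (rule infsumI, rule has_sum_finite_neutralI[OF assms]) auto
  also have "\<dots> = analysis (dual_frame \<Psi>) (\<Sum>k\<in>F. a k *\<^sub>C \<Psi> k) i"
    by (simp add: analysis_def cinner_sum_left cinner_scaleC_left dual_frame_eq P_def opmat_def
        V0_selfadjoint mult.commute)
  finally show "analysis (dual_frame \<Psi>) (\<Sum>k\<in>F. a k *\<^sub>C \<Psi> k) i
      = mat_vec P (\<lambda>k. if k \<in> F then a k else 0) i" by simp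
qed

definition partial_synth :: "nat \<Rightarrow> ('i \<Rightarrow> complex) \<Rightarrow> 'h" where
  "partial_synth n c = (\<Sum>k\<in>{k. to_nat k < n}. c k *\<^sub>C \<Psi> k)"

lemma analysis_dual_partial_synth:
  "analysis (dual_frame \<Psi>) (partial_synth n c) = mat_vec P (truncate n c)"
  unfolding partial_synth_def analysis_dual_finite[OF finite_to_nat_less]
  by (intro arg_cong[of _ _ "mat_vec P"]) (auto simp: truncate_def)

lemma partial_synth_in: "partial_synth n c \<in> finite_combinations \<Psi>"
  unfolding partial_synth_def finite_combinations_def using finite_to_nat_less by blast

end

locale weighted = localised \<Psi> A B \<A> nA
  for \<Psi> :: "'i::countable \<Rightarrow> 'h::complex_hilbert" and A B :: real
    and \<A> :: "'i cmatrix set" and nA :: "'i cmatrix \<Rightarrow> real" +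
  fixes w :: "'i \<Rightarrow> real"
  assumes good: "good_weight \<A> w"
begin

lemma w_pos: "w i > 0"
  by (rule good_weight_pos[OF good])

lemma bounded_matrix:
  assumes "M \<in> \<A>" "1 \<le> p"
  obtains K where "abs_bounded p w M K" "K > 0"
  using good assms unfolding good_weight_def abs_bounded_def by blast

context
  fixes M assumes M: "M \<in> \<A>"
begin

lemma wnorm_mat_vec_finite:
  assumes "1 \<le> p" "wnorm p w c < \<infinity>"
  shows "wnorm p w (mat_vec M c) < \<infinity>"
proof -
  obtain B where B: "abs_bounded p w M B" by (rule bounded_matrix[OF M assms(1)])
  show ?thesis
    using wnorm_mat_vec_le[OF B assms(1) w_pos, of c] assms(2)
    by (auto simp: ennreal_mult_less_top less_top elim!: order.strict_trans1)
qed

lemma mat_vec_mat_vec_in: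
  assumes N: "N \<in> \<A>" and c: "wbounded w c"
  shows "mat_vec M (mat_vec N c) = mat_vec (mat_mult M N) c"
proof -
  obtain B where B: "abs_bounded \<infinity> w M B" by (rule bounded_matrix[OF M, of \<infinity>]) simp_all
  obtain B' where B': "abs_bounded \<infinity> w N B'" by (rule bounded_matrix[OF N, of \<infinity>]) simp_all
  show ?thesis by (rule mat_vec_mat_vec[OF B B' w_pos c])
qed

lemma mat_vec_linear_in:
  assumes c: "wbounded w c" and d: "wbounded w d"
  shows "mat_vec M (\<lambda>i. a * c i + b * d i) = (\<lambda>i. a * mat_vec M c i + b * mat_vec M d i)"
proof -
  obtain B where B: "abs_bounded \<infinity> w M B" by (rule bounded_matrix[OF M, of \<infinity>]) simp_all
  show ?thesis by (rule mat_vec_linear[OF B w_pos c d])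
qed

lemma mat_vec_tendsto_in:
  assumes lim: "\<And>j. (\<lambda>n. f n j) \<longlonglongrightarrow> c j" and K: "\<And>n. n \<ge> N \<Longrightarrow> wnorm \<infinity> w (f n) \<le> K" "K < \<infinity>"
  shows "(\<lambda>n. mat_vec M (f n) i) \<longlonglongrightarrow> mat_vec M c i"
proof -
  obtain B where B: "abs_bounded \<infinity> w M B" by (rule bounded_matrix[OF M, of \<infinity>]) simp_all
  show ?thesis by (rule mat_vec_tendsto[OF B w_pos lim K])
qed

end

text \<open>A common footing for finite and infinite exponents: convergence in norm as well as the
  limits in the definition for \<open>p = \<infinity>\<close> amount to coefficientwise convergence with a bound that
  is uniform from some index on, which is all that dominated convergence needs.\<close>

lemma represents_pointwise:
  assumes p: "1 \<le> p" and rep: "represents \<Psi> p w f c"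
  shows "\<And>i. (\<lambda>n. analysis (dual_frame \<Psi>) (f n) i) \<longlonglongrightarrow> c i"
    and "\<exists>N K. (\<forall>n\<ge>N. wnorm \<infinity> w (analysis (dual_frame \<Psi>) (f n)) \<le> K) \<and> K < \<infinity>"
    and "wnorm p w c < \<infinity>"
proof -
  let ?a = "\<lambda>n. analysis (dual_frame \<Psi>) (f n)"
  have "(\<forall>i. (\<lambda>n. ?a n i) \<longlonglongrightarrow> c i) \<and> (\<exists>N K. (\<forall>n\<ge>N. wnorm \<infinity> w (?a n) \<le> K) \<and> K < \<infinity>) \<and> wnorm p w c < \<infinity>"
  proof (cases "p = \<infinity>")
    case True
    then have lim: "\<forall>i. (\<lambda>n. ?a n i) \<longlonglongrightarrow> c i" and K: "(SUP n. wnorm \<infinity> w (?a n)) < \<infinity>"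
      using rep by (auto simp: represents_def)
    have le: "wnorm \<infinity> w (?a n) \<le> (SUP n. wnorm \<infinity> w (?a n))" for n by (rule SUP_upper) simp
    have "wnorm p w c \<le> (SUP n. wnorm \<infinity> w (?a n))"
      unfolding True by (rule wnorm_le_pointwise_limit[OF _ lim[rule_format] le]) simp
    then show ?thesis using lim le K order.strict_trans1 by blast
  next
    case False
    then have fin: "wnorm p w c < \<infinity>" and lim: "(\<lambda>n. wnorm p w (\<lambda>i. ?a n i - c i)) \<longlonglongrightarrow> 0"
      using rep by (auto simp: represents_def)
    have pointwise: "(\<lambda>n. ?a n i) \<longlonglongrightarrow> c i" for i
    proof (rule LIM_zero_cancel, rule tendsto_norm_zero_cancel)
      have le: "ennreal (cmod (?a n i - c i)) \<le> wnorm p w (\<lambda>i. ?a n i - c i) * ennreal (1 / w i)" for n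
        using entry_le_of_wnorm[OF w_pos, of "\<lambda>i. ?a n i - c i" i]
          mult_right_mono[OF wnorm_infty_le_wnorm[OF p, of w "\<lambda>i. ?a n i - c i"], of "ennreal (1 / w i)"]
        by (rule order.trans) simp
      have "(\<lambda>n. wnorm p w (\<lambda>i. ?a n i - c i) * ennreal (1 / w i)) \<longlonglongrightarrow> 0 * ennreal (1 / w i)"
        by (intro tendsto_mult_ennreal lim tendsto_const) auto
      then have "(\<lambda>n. ennreal (cmod (?a n i - c i))) \<longlonglongrightarrow> 0"
        unfolding mult_zero_left by (rule ennreal_tendsto_0_mono[OF le])
      then have "(\<lambda>n. ennreal (cmod (?a n i - c i))) \<longlonglongrightarrow> ennreal 0" by simp
      then show "(\<lambda>n. cmod (?a n i - c i)) \<longlonglongrightarrow> 0" by (rule tendsto_ennrealD) auto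
    qed
    have "eventually (\<lambda>n. wnorm p w (\<lambda>i. ?a n i - c i) < 1) sequentially"
      by (rule order_tendstoD(2)[OF lim]) simp
    then obtain N where N: "\<And>n. n \<ge> N \<Longrightarrow> wnorm p w (\<lambda>i. ?a n i - c i) < 1"
      unfolding eventually_sequentially by blast
    have "wnorm \<infinity> w (?a n) \<le> 1 + wnorm p w c" if "n \<ge> N" for n
      unfolding wnorm_infty_le_iff
    proof
      fix i
      have "cmod (?a n i) * w i \<le> (cmod (?a n i - c i) + cmod (c i)) * w i"
        using norm_triangle_sub[of "?a n i" "c i"] w_pos[of i] by (intro mult_right_mono) auto
      then have "ennreal (cmod (?a n i) * w i) \<le> ennreal (cmod (?a n i - c i) * w i) + ennreal (cmod (c i) * w i)"
        using w_pos[of i] by (simp add: distrib_right ennreal_leI flip: ennreal_plus)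
      also have "\<dots> \<le> 1 + wnorm p w c"
        by (rule add_mono[OF order.trans[OF entry_le_wnorm[OF p, of "\<lambda>i. ?a n i - c i" i w]
              less_imp_le[OF N[OF that]]] entry_le_wnorm[OF p]])
      finally show "ennreal (cmod (?a n i) * w i) \<le> 1 + wnorm p w c" .
    qed
    moreover have "1 + wnorm p w c < \<infinity>" using fin by (simp add: less_top)
    ultimately show ?thesis using pointwise fin by blast
  qed
  then show "\<And>i. (\<lambda>n. ?a n i) \<longlonglongrightarrow> c i" "\<exists>N K. (\<forall>n\<ge>N. wnorm \<infinity> w (?a n) \<le> K) \<and> K < \<infinity>" "wnorm p w c < \<infinity>"
    by auto
qed

text \<open>The finite combination with coefficients \<open>truncate n c\<close> has the coefficient sequence
  \<open>P (truncate n c)\<close>, and this converges to \<open>P c = c\<close>: in norm for finite \<open>p\<close>, boundedly and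
  coefficientwise for \<open>p = \<infinity>\<close>.\<close>

lemma represents_partial_synth:
  assumes p: "1 \<le> p" and c: "wnorm p w c < \<infinity>" and Pc: "mat_vec P c = c"
  shows "represents \<Psi> p w (\<lambda>n. partial_synth n c) c"
proof -
  obtain B where B: "abs_bounded p w P B" by (rule bounded_matrix[OF P_in p])
  have cb: "wbounded w c" by (rule wbounded_if_wnorm_finite[OF p c])
  have tb: "wbounded w (truncate n c)" for n
    using wnorm_truncate_le[of \<infinity> w n c] cb w_pos by (auto simp: wbounded_def elim!: order.strict_trans1)
  show ?thesis
  proof (cases "p = \<infinity>")
    case True
    have "(\<lambda>n. mat_vec P (truncate n c) i) \<longlonglongrightarrow> mat_vec P c i" for i
      by (rule mat_vec_tendsto_in[OF P_in truncate_tendsto, where N=0 and K="wnorm \<infinity> w c"])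
        (use cb wnorm_truncate_le[of \<infinity> w _ c] w_pos in \<open>auto simp: wbounded_def\<close>)
    moreover have "(SUP n. wnorm \<infinity> w (mat_vec P (truncate n c))) \<le> ennreal B * wnorm \<infinity> w c"
    proof (rule SUP_least)
      fix n
      have "wnorm \<infinity> w (mat_vec P (truncate n c)) \<le> ennreal B * wnorm \<infinity> w (truncate n c)"
        using wnorm_mat_vec_le[OF B p w_pos] True by simp
      also have "\<dots> \<le> ennreal B * wnorm \<infinity> w c" by (intro mult_left_mono wnorm_truncate_le w_pos) auto
      finally show "wnorm \<infinity> w (mat_vec P (truncate n c)) \<le> ennreal B * wnorm \<infinity> w c" .
    qed
    then have "(SUP n. wnorm \<infinity> w (mat_vec P (truncate n c))) < \<infinity>"
      using cb by (auto simp: wbounded_def ennreal_mult_less_top less_top elim!: order.strict_trans1)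
    ultimately show ?thesis
      unfolding represents_def analysis_dual_partial_synth Pc using True by simp
  next
    case False
    have diff: "(\<lambda>i. mat_vec P (truncate n c) i - c i) = mat_vec P (\<lambda>i. truncate n c i - c i)" for n
      using mat_vec_linear_in[OF P_in tb[of n] cb, of 1 "-1"] Pc by simp
    have "(\<lambda>n. ennreal B * wnorm p w (\<lambda>i. truncate n c i - c i)) \<longlonglongrightarrow> ennreal B * 0"
      by (intro tendsto_mult_ennreal tendsto_const wnorm_truncate_tendsto p False c) auto
    then have "(\<lambda>n. wnorm p w (\<lambda>i. mat_vec P (truncate n c) i - c i)) \<longlonglongrightarrow> 0"
      unfolding diff mult_zero_right
      by (rule ennreal_tendsto_0_mono[OF wnorm_mat_vec_le[OF B p w_pos]])
    then show ?thesis
      unfolding represents_def analysis_dual_partial_synth using False c partial_synth_in by simp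
  qed
qed

text \<open>Coefficient sequences of vectors are fixed by \<open>P\<close>, and this passes to bounded
  coefficientwise limits. Conversely, a sequence fixed by \<open>P\<close> is represented by the partial
  sums of its frame series.\<close>

theorem coorbit_eq:
  assumes p: "1 \<le> p"
  shows "coorbit \<Psi> p w = {c. wnorm p w c < \<infinity> \<and> mat_vec P c = c}"
proof (intro set_eqI iffI)
  fix c assume "c \<in> coorbit \<Psi> p w"
  then obtain f where f: "represents \<Psi> p w f c" by (auto simp: coorbit_def)
  note pw = represents_pointwise[OF p f]
  obtain N K where K: "\<And>n. n \<ge> N \<Longrightarrow> wnorm \<infinity> w (analysis (dual_frame \<Psi>) (f n)) \<le> K" "K < \<infinity>"
    using pw(2) by blast
  have "mat_vec P c i = c i" for i
    using mat_vec_tendsto_in[OF P_in pw(1) K, where i=i] pw(1)[of i] LIMSEQ_unique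
    unfolding P_analysis_dual by blast
  then show "c \<in> {c. wnorm p w c < \<infinity> \<and> mat_vec P c = c}" using pw(3) by auto
next
  fix c assume "c \<in> {c. wnorm p w c < \<infinity> \<and> mat_vec P c = c}"
  then show "c \<in> coorbit \<Psi> p w" using represents_partial_synth[OF p] by (auto simp: coorbit_def)
qed

text \<open>On coefficient sequences of vectors the analysis operator is multiplication by the Gram
  matrix, which respects the limits that define the extension.\<close>

theorem analysis_ext_eq:
  assumes p: "1 \<le> p" and c: "c \<in> coorbit \<Psi> p w"
  shows "analysis_ext \<Psi> p w c = mat_vec (gram \<Psi>) c"
proof
  fix i
  have lim: "(\<lambda>n. analysis \<Psi> (f n) i) \<longlonglongrightarrow> mat_vec (gram \<Psi>) c i" if f: "represents \<Psi> p w f c" for f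
  proof -
    note pw = represents_pointwise[OF p f]
    obtain N K where K: "\<And>n. n \<ge> N \<Longrightarrow> wnorm \<infinity> w (analysis (dual_frame \<Psi>) (f n)) \<le> K" "K < \<infinity>"
      using pw(2) by blast
    from mat_vec_tendsto_in[OF gram_in pw(1) K, where i=i] show ?thesis unfolding gram_analysis_dual .
  qed
  obtain f where f: "represents \<Psi> p w f c" using c by (auto simp: coorbit_def)
  show "analysis_ext \<Psi> p w c i = mat_vec (gram \<Psi>) c i"
    unfolding analysis_ext_def
    by (rule the_equality) (use lim lim[OF f] f LIMSEQ_unique in blast)+
qed

lemma coorbit_mono: "1 \<le> p \<Longrightarrow> coorbit \<Psi> 1 w \<subseteq> coorbit \<Psi> p w"
  using order.strict_trans1[OF wnorm_le_wnorm_one[of p w]] by (auto simp: coorbit_eq)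

lemma dual_gram_gram: "wbounded w c \<Longrightarrow> mat_vec P c = c \<Longrightarrow> mat_vec dual_gram (mat_vec (gram \<Psi>) c) = c"
  using mat_vec_mat_vec_in[OF dual_gram_in gram_in] by (simp add: matrix_products)

lemma P_mat_vec_range: "wbounded w c \<Longrightarrow> mat_vec P (mat_vec P c) = mat_vec P c"
  "wbounded w c \<Longrightarrow> mat_vec P (mat_vec dual_gram c) = mat_vec dual_gram c"
  using mat_vec_mat_vec_in[OF P_in P_in] mat_vec_mat_vec_in[OF P_in dual_gram_in] by (simp_all add: matrix_products)

end

section \<open>Mixed norms and matrices with two indices\<close>

lemma mixed_norm_infty_le_iff:
  "mixed_norm r \<infinity> (tensor_weight u v) c \<le> M \<longleftrightarrow>
     (\<forall>j. lp_norm r (\<lambda>i. ennreal (cmod (c i j) * (u i * v j))) \<le> M)"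
  by (simp add: mixed_norm_def lp_norm_infty SUP_le_iff tensor_weight_def)

lemma mixed_norm_fr_swap:
  "mixed_norm_fr r s (tensor_weight u v) c = mixed_norm r s (tensor_weight v u) (\<lambda>j i. c i j)"
  by (simp add: mixed_norm_def mixed_norm_fr_def tensor_weight_def mult.commute[of "u _"])

lemma lp_norm_weight_factor:
  assumes "1 \<le> r" "\<And>i. u i > 0" "v > 0"
  shows "lp_norm r (\<lambda>i. ennreal (cmod (c i) * (u i * v))) = ennreal v * wnorm r u c"
proof -
  have "ennreal (cmod (c i) * (u i * v)) = ennreal v * ennreal (cmod (c i) * u i)" for i
    using assms(2)[of i] assms(3) by (simp add: mult_ac flip: ennreal_mult)
  then show ?thesis using assms(1,3) by (simp add: lp_norm_cmult wnorm_def)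
qed

lemma column_norm_le:
  assumes "1 \<le> r" "\<And>i. u i > 0" "\<And>j. v j > 0" "mixed_norm r \<infinity> (tensor_weight u v) K \<le> M"
  shows "wnorm r u (\<lambda>i. K i j) \<le> M * ennreal (1 / v j)"
proof -
  have "ennreal (v j) * wnorm r u (\<lambda>i. K i j) \<le> M"
    using assms(4)[unfolded mixed_norm_infty_le_iff, rule_format, of j]
      lp_norm_weight_factor[OF assms(1,2), of "v j" "\<lambda>i. K i j"] assms(3)[of j] by simp
  then have "ennreal (v j) * wnorm r u (\<lambda>i. K i j) * ennreal (1 / v j) \<le> M * ennreal (1 / v j)"
    by (rule mult_right_mono) simp
  moreover have "ennreal (v j) * ennreal (1 / v j) = 1"
    using assms(3)[of j] by (simp flip: ennreal_mult)
  then have "ennreal (v j) * x * ennreal (1 / v j) = x" for x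
    by (simp add: mult.commute mult.left_commute)
  ultimately show ?thesis by simp
qed

lemma mixed_norm_le_if_columns:
  assumes "1 \<le> r" "\<And>i. u i > 0" "\<And>j. v j > 0" "\<And>j. wnorm r u (\<lambda>i. K i j) \<le> M * ennreal (1 / v j)"
  shows "mixed_norm r \<infinity> (tensor_weight u v) K \<le> M"
  unfolding mixed_norm_infty_le_iff
proof
  fix j
  have "lp_norm r (\<lambda>i. ennreal (cmod (K i j) * (u i * v j))) = ennreal (v j) * wnorm r u (\<lambda>i. K i j)"
    by (rule lp_norm_weight_factor[OF assms(1,2,3)])
  also have "\<dots> \<le> ennreal (v j) * (M * ennreal (1 / v j))" by (intro mult_left_mono assms(4)) simp
  also have "\<dots> = M * (ennreal (v j) * ennreal (1 / v j))" by (simp only: mult_ac)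
  also have "ennreal (v j) * ennreal (1 / v j) = 1"
    using assms(3)[of j] by (simp flip: ennreal_mult)
  finally show "lp_norm r (\<lambda>i. ennreal (cmod (K i j) * (u i * v j))) \<le> M" by simp
qed

lemma mixed_norm_infty_swap:
  "mixed_norm \<infinity> \<infinity> (tensor_weight v u) (\<lambda>j i. c i j) = mixed_norm \<infinity> \<infinity> (tensor_weight u v) c"
  by (simp add: mixed_norm_def lp_norm_infty tensor_weight_def mult.commute[of "v _"]) (rule SUP_commute)

lemma mixed_norm_infty_le_mixed_norm:
  assumes "1 \<le> r"
  shows "mixed_norm \<infinity> \<infinity> (tensor_weight u v) K \<le> mixed_norm r \<infinity> (tensor_weight u v) K"
  unfolding mixed_norm_def tensor_weight_def
  by (rule lp_norm_mono) (simp, rule wnorm_infty_le_wnorm[OF assms, unfolded wnorm_def])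

lemma mixed_norm_le_pointwise_limit:
  fixes c :: "nat \<Rightarrow> 'i \<Rightarrow> 'j \<Rightarrow> complex"
  assumes "1 \<le> r" "\<And>i j. (\<lambda>n. c n i j) \<longlonglongrightarrow> K i j" "\<And>n. mixed_norm r \<infinity> w (c n) \<le> M"
  shows "mixed_norm r \<infinity> w K \<le> M"
proof -
  have "lp_norm r (\<lambda>i. ennreal (cmod (K i j) * w i j)) \<le> M" for j
  proof (rule wnorm_le_pointwise_limit[OF assms(1), of "\<lambda>n i. c n i j" "\<lambda>i. K i j" "\<lambda>i. w i j" M, unfolded wnorm_def])
    show "lp_norm r (\<lambda>i. ennreal (cmod (c n i j) * w i j)) \<le> M" for n
      using assms(3)[of n] by (simp add: mixed_norm_def lp_norm_infty SUP_le_iff)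
  qed (rule assms(2))
  then show ?thesis by (simp add: mixed_norm_def lp_norm_infty SUP_le_iff)
qed

lemma mixed_norm_fr_le_pointwise_limit:
  fixes c :: "nat \<Rightarrow> 'i \<Rightarrow> 'j \<Rightarrow> complex"
  assumes "1 \<le> r" "\<And>i j. (\<lambda>n. c n i j) \<longlonglongrightarrow> K i j" "\<And>n. mixed_norm_fr r \<infinity> w (c n) \<le> M"
  shows "mixed_norm_fr r \<infinity> w K \<le> M"
  using mixed_norm_le_pointwise_limit[OF assms(1), of "\<lambda>n j i. c n i j" "\<lambda>j i. K i j" "\<lambda>j i. w i j" M]
    assms(2,3) by (simp add: mixed_norm_def mixed_norm_fr_def)

text \<open>The tensor product of two matrices acting on the truncations of \<open>K\<close>. With \<open>M\<close> and \<open>N\<close>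
  the two projections these are the coefficients of partial sums of the tensor frame series.\<close>

definition truncated_action ::
  "'i::countable cmatrix \<Rightarrow> 'j::countable cmatrix \<Rightarrow> nat \<Rightarrow> ('i \<Rightarrow> 'j \<Rightarrow> complex) \<Rightarrow> 'i \<Rightarrow> 'j \<Rightarrow> complex" where
  "truncated_action M N n K i j = (\<Sum>a\<in>{a. to_nat a < n}. \<Sum>b\<in>{b. to_nat b < n}. M i a * N j b * K a b)"

lemma truncated_action_swap:
  "truncated_action M N n K i j = truncated_action N M n (\<lambda>b a. K a b) j i"
  unfolding truncated_action_def by (subst sum.swap) (simp add: mult_ac)

lemma mat_vec_truncate:
  fixes M :: "'i::countable cmatrix"
  shows "mat_vec M (truncate n c) i = (\<Sum>a\<in>{a. to_nat a < n}. M i a * c a)"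
  unfolding mat_vec_def
  by (rule infsumI, rule has_sum_finite_neutralI[OF finite_to_nat_less]) (auto simp: truncate_def)

lemma truncated_action_eq:
  "truncated_action M N n K i j = mat_vec M (truncate n (\<lambda>a. mat_vec N (truncate n (K a)) j)) i"
  unfolding truncated_action_def mat_vec_truncate sum_distrib_left by (simp add: mult_ac)

context
  fixes M :: "'i::countable cmatrix" and N :: "'j::countable cmatrix"
    and u :: "'i \<Rightarrow> real" and v :: "'j \<Rightarrow> real" and K :: "'i \<Rightarrow> 'j \<Rightarrow> complex" and C D :: real
  assumes u: "\<And>i. u i > 0" and v: "\<And>j. v j > 0"
    and D: "abs_bounded \<infinity> v N D"
begin

text \<open>Minkowski's inequality: acting with \<open>N\<close> on the second index superposes the columns of
  \<open>K\<close>, whose norms grow at most like \<open>1 / v\<close>, and \<open>N\<close> is bounded on sequences of this growth.\<close>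

lemma mat_vec_rows_norm_le:
  assumes r: "1 \<le> r" and K: "mixed_norm r \<infinity> (tensor_weight u v) K \<le> \<kappa>"
  shows "wnorm r u (\<lambda>a. mat_vec N (truncate n (K a)) j) \<le> ennreal D * \<kappa> * ennreal (1 / v j)"
proof -
  have "wnorm r u (\<lambda>a. mat_vec N (truncate n (K a)) j)
      \<le> lp_norm r (\<lambda>a. \<Sum>\<^sub>\<infinity>b. ennreal (cmod (N j b)) * ennreal (cmod (K a b) * u a))"
    unfolding wnorm_def
  proof (rule lp_norm_mono[OF r])
    fix a
    have "ennreal (cmod (mat_vec N (truncate n (K a)) j)) \<le> (\<Sum>\<^sub>\<infinity>b. ennreal (cmod (N j b * truncate n (K a) b)))"
      unfolding mat_vec_def by (rule cmod_infsum_le)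
    also have "\<dots> \<le> (\<Sum>\<^sub>\<infinity>b. ennreal (cmod (N j b) * cmod (K a b)))"
      by (intro infsum_ennreal_mono ennreal_leI) (auto simp: norm_mult truncate_def)
    finally have "ennreal (cmod (mat_vec N (truncate n (K a)) j)) * ennreal (u a)
        \<le> (\<Sum>\<^sub>\<infinity>b. ennreal (cmod (N j b) * cmod (K a b))) * ennreal (u a)"
      by (rule mult_right_mono) simp
    also have "\<dots> = (\<Sum>\<^sub>\<infinity>b. ennreal (cmod (N j b)) * ennreal (cmod (K a b) * u a))"
      unfolding infsum_ennreal_cmult_right[symmetric] using u[of a]
      by (intro infsum_cong) (simp add: mult.assoc flip: ennreal_mult)
    finally show "ennreal (cmod (mat_vec N (truncate n (K a)) j) * u a)
        \<le> (\<Sum>\<^sub>\<infinity>b. ennreal (cmod (N j b)) * ennreal (cmod (K a b) * u a))"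
      using u[of a] by (simp add: ennreal_mult)
  qed
  also have "\<dots> \<le> (\<Sum>\<^sub>\<infinity>b. ennreal (cmod (N j b)) * wnorm r u (\<lambda>a. K a b))"
    unfolding wnorm_def by (rule lp_norm_infsum_le[OF r])
  also have "\<dots> \<le> ennreal D * \<kappa> * ennreal (1 / v j)"
    by (rule row_sum_le[OF D v]) (rule column_norm_le[OF r u v K])
  finally show ?thesis .
qed

lemma mixed_norm_truncated_action_le:
  assumes r: "1 \<le> r" and K: "mixed_norm r \<infinity> (tensor_weight u v) K \<le> \<kappa>" and C: "abs_bounded r u M C"
  shows "mixed_norm r \<infinity> (tensor_weight u v) (truncated_action M N n K) \<le> ennreal C * (ennreal D * \<kappa>)"
proof (rule mixed_norm_le_if_columns[OF r u v])
  fix j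
  let ?L = "\<lambda>a. mat_vec N (truncate n (K a)) j"
  have "wnorm r u (\<lambda>i. truncated_action M N n K i j) = wnorm r u (mat_vec M (truncate n ?L))"
    unfolding truncated_action_eq by simp
  also have "\<dots> \<le> ennreal C * wnorm r u (truncate n ?L)" by (rule wnorm_mat_vec_le[OF C r u])
  also have "\<dots> \<le> ennreal C * wnorm r u ?L" by (intro mult_left_mono wnorm_truncate_le r u) simp
  also have "\<dots> \<le> ennreal C * (ennreal D * \<kappa> * ennreal (1 / v j))"
    by (intro mult_left_mono mat_vec_rows_norm_le[OF r K]) simp
  finally show "wnorm r u (\<lambda>i. truncated_action M N n K i j) \<le> ennreal C * (ennreal D * \<kappa>) * ennreal (1 / v j)"
    by (simp only: mult.assoc)
qed

text \<open>Two applications of dominated convergence, first in the second and then in the first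
  index. The norm bound for the intermediate matrix makes the second one possible, although
  the truncation occurs in both indices at once.\<close>

lemma truncated_action_tendsto:
  assumes K: "mixed_norm \<infinity> \<infinity> (tensor_weight u v) K < \<infinity>" and C: "abs_bounded \<infinity> u M C"
    and M: "\<And>j. mat_vec M (\<lambda>i. K i j) = (\<lambda>i. K i j)" and N: "\<And>i. mat_vec N (K i) = K i"
  shows "(\<lambda>n. truncated_action M N n K i j) \<longlonglongrightarrow> K i j"
proof -
  let ?\<kappa> = "mixed_norm \<infinity> \<infinity> (tensor_weight u v) K"
  have row: "wnorm \<infinity> v (K a) \<le> ?\<kappa> * ennreal (1 / u a)" for a
    by (rule column_norm_le[OF _ v u eq_refl[OF mixed_norm_infty_swap]]) simp
  let ?L = "\<lambda>n a. mat_vec N (truncate n (K a)) j"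
  have L: "(\<lambda>n. ?L n a) \<longlonglongrightarrow> K a j" for a
  proof -
    have "(\<lambda>n. ?L n a) \<longlonglongrightarrow> mat_vec N (K a) j"
    proof (rule mat_vec_tendsto[OF D v truncate_tendsto, where N=0 and K="?\<kappa> * ennreal (1 / u a)"])
      show "wnorm \<infinity> v (truncate n (K a)) \<le> ?\<kappa> * ennreal (1 / u a)" for n
        by (rule order.trans[OF wnorm_truncate_le row]) (use v in auto)
      show "?\<kappa> * ennreal (1 / u a) < \<infinity>" using K by (simp add: ennreal_mult_less_top less_top)
    qed
    then show ?thesis by (simp add: N)
  qed
  have "(\<lambda>n. mat_vec M (truncate n (?L n)) i) \<longlonglongrightarrow> mat_vec M (\<lambda>a. K a j) i"
  proof (rule mat_vec_tendsto[OF C u, where N=0 and K="ennreal D * ?\<kappa> * ennreal (1 / v j)"])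
    show "(\<lambda>n. truncate n (?L n) a) \<longlonglongrightarrow> K a j" for a
    proof (rule Lim_transform_eventually[OF L[of a]])
      show "\<forall>\<^sub>F n in sequentially. ?L n a = truncate n (?L n) a"
        by (rule eventually_sequentiallyI[of "Suc (to_nat a)"]) (simp add: truncate_def)
    qed
    show "wnorm \<infinity> u (truncate n (?L n)) \<le> ennreal D * ?\<kappa> * ennreal (1 / v j)" for n
      by (rule order.trans[OF wnorm_truncate_le mat_vec_rows_norm_le]) (use u in auto)
    show "ennreal D * ?\<kappa> * ennreal (1 / v j) < \<infinity>" using K by (simp add: ennreal_mult_less_top less_top)
  qed
  then show ?thesis by (simp add: truncated_action_eq M)
qed

end

section \<open>The tensor product of two localised frames\<close>

context framed
begin

text \<open>The frame expansion \<open>f = \<Sum> \<langle>f, \<psi>_a\<rangle> \<psi>~_a\<close>, seen through a functional.\<close>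

lemma dual_expansion:
  assumes "bounded_clinear \<phi>"
  shows "((\<lambda>a. cinner f (\<Psi> a) *\<^sub>C \<phi> (dual_frame \<Psi> a)) has_sum \<phi> f) UNIV"
proof -
  have "((\<lambda>a. analysis \<Psi> f a *\<^sub>C \<phi> (V 0 (\<Psi> a))) has_sum \<phi> (V 0 (synth (analysis \<Psi> f)))) UNIV"
    by (rule has_sum_clinear_synth[OF square_summable_analysis bounded_clinear_compose[OF assms V0(3)]])
  then show ?thesis
    unfolding frame_operator_eq[symmetric] V0(2) by (simp only: dual_frame_eq analysis_def)
qed

end

context
  fixes tens :: "'h1::complex_hilbert \<Rightarrow> 'h2::complex_hilbert \<Rightarrow> 't::complex_hilbert"
  assumes tens: "hilbert_tensor tens"
begin

lemma cinner_tens: "cinner (tens f1 f2) (tens g1 g2) = cnj (cinner f1 g1) * cinner f2 g2"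
  using tens by (simp add: hilbert_tensor_def)

text \<open>Additivity, like the other linearity properties of simple tensors, holds because the
  defect is orthogonal to all simple tensors, and it is itself a combination of simple
  tensors.\<close>

lemma tens_add_left: "tens (x + y) z = tens x z + tens y z"
proof -
  define d where "d = tens (x + y) z - (tens x z + tens y z)"
  have "cinner d (tens a b) = 0" for a b
    by (simp add: d_def cinner_diff_left cinner_add_left cinner_tens algebra_simps)
  then have "cinner d d = 0" by (subst (2) d_def) (simp add: cinner_diff_right cinner_add_right)
  then show ?thesis by (simp add: cinner_self d_def)
qed

lemma tens_scale_left: "tens (a *\<^sub>C x) z = cnj a *\<^sub>C tens x z"
proof -
  define d where "d = tens (a *\<^sub>C x) z - cnj a *\<^sub>C tens x z"
  have "cinner d (tens c b) = 0" for c b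
    by (simp add: d_def cinner_diff_left cinner_scaleC_left cinner_tens)
  then have "cinner d d = 0" by (subst (2) d_def) (simp add: cinner_diff_right cinner_scaleC_right)
  then show ?thesis by (simp add: cinner_self d_def)
qed

lemma tens_add_right: "tens z (x + y) = tens z x + tens z y"
proof -
  define d where "d = tens z (x + y) - (tens z x + tens z y)"
  have "cinner d (tens a b) = 0" for a b
    by (simp add: d_def cinner_diff_left cinner_add_left cinner_tens algebra_simps)
  then have "cinner d d = 0" by (subst (2) d_def) (simp add: cinner_diff_right cinner_add_right)
  then show ?thesis by (simp add: cinner_self d_def)
qed

lemma tens_scale_right: "tens z (a *\<^sub>C x) = a *\<^sub>C tens z x"
proof -
  define d where "d = tens z (a *\<^sub>C x) - a *\<^sub>C tens z x"
  have "cinner d (tens c b) = 0" for c b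
    by (simp add: d_def cinner_diff_left cinner_scaleC_left cinner_tens)
  then have "cinner d d = 0" by (subst (2) d_def) (simp add: cinner_diff_right cinner_scaleC_right)
  then show ?thesis by (simp add: cinner_self d_def)
qed

lemma tens_zero [simp]: "tens 0 z = 0" "tens z' 0 = 0"
  using tens_scale_left[of 0 0 z] tens_scale_right[of z' 0 0] by simp_all

lemma tens_sum: "tens (\<Sum>a\<in>X. f a) (\<Sum>b\<in>Y. g b) = (\<Sum>a\<in>X. \<Sum>b\<in>Y. tens (f a) (g b))"
proof -
  have "tens (\<Sum>a\<in>X. f a) z = (\<Sum>a\<in>X. tens (f a) z)" for z
    by (induction X rule: infinite_finite_induct) (simp_all add: tens_add_left)
  moreover have "tens z (\<Sum>b\<in>Y. g b) = (\<Sum>b\<in>Y. tens z (g b))" for z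
    by (induction Y rule: infinite_finite_induct) (simp_all add: tens_add_right)
  ultimately show ?thesis by simp (rule sum.swap)
qed

lemma norm_tens: "norm (tens x y) = norm x * norm y"
proof -
  have "complex_of_real ((norm (tens x y))\<^sup>2) = complex_of_real ((norm x * norm y)\<^sup>2)"
    unfolding cinner_self[symmetric] cinner_tens by (simp add: cinner_self power_mult_distrib)
  then have "(norm (tens x y))\<^sup>2 = (norm x * norm y)\<^sup>2" unfolding of_real_eq_iff .
  then show ?thesis by (simp add: power2_eq_iff_nonneg)
qed

lemma clinear_cinner_tens_left: "bounded_clinear (\<lambda>x. cinner F (tens x z))"
proof (rule bounded_clinearI[where K="norm F * norm z"])
  fix x y a
  show "cinner F (tens (x + y) z) = cinner F (tens x z) + cinner F (tens y z)"
    by (simp add: tens_add_left cinner_add_right)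
  show "cinner F (tens (a *\<^sub>C x) z) = a *\<^sub>C cinner F (tens x z)"
    by (simp add: tens_scale_left cinner_scaleC_right scaleC_complex_def)
  show "norm (cinner F (tens x z)) \<le> norm F * norm z * norm x"
    using cauchy_schwarz[of F "tens x z"] by (simp add: norm_tens mult_ac)
qed

lemma clinear_cinner_tens_right: "bounded_clinear (\<lambda>x. cinner (tens z x) F)"
proof (rule bounded_clinearI[where K="norm F * norm z"])
  fix x y a
  show "cinner (tens z (x + y)) F = cinner (tens z x) F + cinner (tens z y) F"
    by (simp add: tens_add_right cinner_add_left)
  show "cinner (tens z (a *\<^sub>C x)) F = a *\<^sub>C cinner (tens z x) F"
    by (simp add: tens_scale_right cinner_scaleC_left scaleC_complex_def)
  show "norm (cinner (tens z x) F) \<le> norm F * norm z * norm x"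
    using cauchy_schwarz[of "tens z x" F] by (simp add: norm_tens mult_ac)
qed

end

lemma good_weightD: "good_weight \<A> w \<Longrightarrow> M \<in> \<A> \<Longrightarrow> 1 \<le> p \<Longrightarrow> \<exists>B. abs_bounded p w M B"
  unfolding good_weight_def by blast

lemma recip2_tensor_weight: "recip2 (tensor_weight u v) = tensor_weight (recip u) (recip v)"
  by (simp add: recip2_def tensor_weight_def recip_def fun_eq_iff)

locale tensor_pair =
  F1: localised \<Psi>1 A1 B1 \<A>1 nA1 + F2: localised \<Psi>2 A2 B2 \<A>2 nA2
  for \<Psi>1 :: "'i::countable \<Rightarrow> 'h1::complex_hilbert" and A1 B1 :: real
    and \<A>1 :: "'i cmatrix set" and nA1 :: "'i cmatrix \<Rightarrow> real"
    and \<Psi>2 :: "'j::countable \<Rightarrow> 'h2::complex_hilbert" and A2 B2 :: real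
    and \<A>2 :: "'j cmatrix set" and nA2 :: "'j cmatrix \<Rightarrow> real" +
  fixes tens :: "'h1 \<Rightarrow> 'h2 \<Rightarrow> 't::complex_hilbert"
  assumes tens: "hilbert_tensor tens"
begin

text \<open>Simple tensors are antilinear in the first factor, so there the entrywise conjugate
  matrices act.\<close>

definition cP1 :: "'i cmatrix" where "cP1 = (\<lambda>i a. cnj (F1.P i a))"

definition cG1 :: "'i cmatrix" where "cG1 = (\<lambda>i a. cnj (gram \<Psi>1 i a))"

lemma conjugates_in: "cP1 \<in> \<A>1" "cG1 \<in> \<A>1"
  using spectral_solid[OF F1.algebra F1.P_in, of cP1] spectral_solid[OF F1.algebra F1.gram_in, of cG1]
  by (simp_all add: cP1_def cG1_def)

abbreviation coef :: "'t \<Rightarrow> 'i \<Rightarrow> 'j \<Rightarrow> complex" where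
  "coef \<equiv> coefficients2 tens \<Psi>1 \<Psi>2"

lemma coef_expand_left:
  "((\<lambda>a. cinner f (\<Psi>1 a) * coef F a j) has_sum cinner F (tens f (dual_frame \<Psi>2 j))) UNIV"
  using F1.dual_expansion[OF clinear_cinner_tens_left[OF tens], of f F "dual_frame \<Psi>2 j"]
  by (simp add: scaleC_complex_def analysis2_def)

lemma expand_right:
  "((\<lambda>b. cnj (cinner g (\<Psi>2 b)) * cinner F (tens f (dual_frame \<Psi>2 b))) has_sum cinner F (tens f g)) UNIV"
proof -
  have "((\<lambda>b. cinner g (\<Psi>2 b) * cinner (tens f (dual_frame \<Psi>2 b)) F) has_sum cinner (tens f g) F) UNIV"
    using F2.dual_expansion[OF clinear_cinner_tens_right[OF tens], of g f F] by (simp add: scaleC_complex_def)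
  then have "((\<lambda>b. cnj (cinner g (\<Psi>2 b) * cinner (tens f (dual_frame \<Psi>2 b)) F)) has_sum cnj (cinner (tens f g) F)) UNIV"
    by (simp only: has_sum_cnj_iff)
  then show ?thesis by (simp flip: cinner_commute)
qed

text \<open>Coefficients of tensors are reproduced by the projections of both frames: each frame is
  expanded in its slot of the functional \<open>\<langle>F, f \<otimes> g\<rangle>\<close>.\<close>

lemma coef_invariant:
  "mat_vec cP1 (\<lambda>a. coef F a j) = (\<lambda>i. coef F i j)"
  "mat_vec F2.P (coef F i) = coef F i"
proof -
  show "mat_vec cP1 (\<lambda>a. coef F a j) = (\<lambda>i. coef F i j)"
  proof
    fix i
    have "cinner (dual_frame \<Psi>1 i) (\<Psi>1 a) = cP1 i a" for a
      unfolding cP1_def F1.P_adjoint by (simp add: F1.P_def F1.opmat_def F1.dual_frame_eq)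
    with infsumI[OF coef_expand_left[of "dual_frame \<Psi>1 i" F j]]
    show "mat_vec cP1 (\<lambda>a. coef F a j) i = coef F i j" by (simp add: mat_vec_def analysis2_def)
  qed
  show "mat_vec F2.P (coef F i) = coef F i"
  proof
    fix j
    have "cnj (cinner (dual_frame \<Psi>2 j) (\<Psi>2 b)) = F2.P j b" for b
      unfolding F2.P_adjoint[of b j, symmetric] by (simp add: F2.P_def F2.opmat_def F2.dual_frame_eq)
    with infsumI[OF expand_right[of "dual_frame \<Psi>2 j" F "dual_frame \<Psi>1 i"]]
    show "mat_vec F2.P (coef F i) j = coef F i j" by (simp add: mat_vec_def analysis2_def)
  qed
qed

text \<open>Expanding both frame vectors in the dual frames. The iterated sum is meaningful for
  every vector \<open>F\<close> of the tensor product, whether or not the double sum converges absolutely.\<close>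

lemma analysis2_eq:
  "analysis2 tens \<Psi>1 \<Psi>2 F i j = (\<Sum>\<^sub>\<infinity>a. \<Sum>\<^sub>\<infinity>b. cG1 i a * gram \<Psi>2 j b * coef F a b)"
proof -
  have l: "cinner (\<Psi>1 i) (\<Psi>1 a) = cG1 i a" for a
    unfolding cG1_def F1.gram_adjoint by (simp add: gram_def)
  have r: "cnj (cinner (\<Psi>2 j) (\<Psi>2 b)) = gram \<Psi>2 j b" for b
    unfolding F2.gram_adjoint[of b j, symmetric] by (simp add: gram_def)
  have e1: "cinner F (tens (\<Psi>1 i) (\<Psi>2 j))
      = (\<Sum>\<^sub>\<infinity>a. cG1 i a * cinner F (tens (dual_frame \<Psi>1 a) (\<Psi>2 j)))"
    using infsumI[OF F1.dual_expansion[OF clinear_cinner_tens_left[OF tens], of "\<Psi>1 i" F "\<Psi>2 j"]]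
    by (simp add: scaleC_complex_def l)
  have e2: "cinner F (tens (dual_frame \<Psi>1 a) (\<Psi>2 j)) = (\<Sum>\<^sub>\<infinity>b. gram \<Psi>2 j b * coef F a b)" for a
    using infsumI[OF expand_right[of "\<Psi>2 j" F "dual_frame \<Psi>1 a"]] by (simp add: analysis2_def r)
  have "analysis2 tens \<Psi>1 \<Psi>2 F i j = (\<Sum>\<^sub>\<infinity>a. cG1 i a * (\<Sum>\<^sub>\<infinity>b. gram \<Psi>2 j b * coef F a b))"
    by (simp only: analysis2_def[of tens \<Psi>1] e1 e2)
  then show ?thesis by (simp add: mult.assoc infsum_cmult_right')
qed

text \<open>The analogue of \<open>P c = c\<close> for matrices of coefficients. The two invariances are kept
  separate, since only iterated sums are under control.\<close>

definition biinvariant :: "('i \<Rightarrow> 'j \<Rightarrow> complex) \<Rightarrow> bool" where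
  "biinvariant K \<longleftrightarrow> (\<forall>j. mat_vec cP1 (\<lambda>i. K i j) = (\<lambda>i. K i j)) \<and> (\<forall>i. mat_vec F2.P (K i) = K i)"

definition partial_tensor :: "nat \<Rightarrow> ('i \<Rightarrow> 'j \<Rightarrow> complex) \<Rightarrow> 't" where
  "partial_tensor n K = (\<Sum>a\<in>{a. to_nat a < n}. \<Sum>b\<in>{b. to_nat b < n}. K a b *\<^sub>C tens (\<Psi>1 a) (\<Psi>2 b))"

lemma coef_partial_tensor: "coef (partial_tensor n K) = truncated_action cP1 F2.P n K"
proof (intro ext)
  fix i j
  have "cnj (cinner (\<Psi>1 a) (dual_frame \<Psi>1 i)) = cP1 i a" for a
    unfolding cP1_def by (simp add: F1.P_def F1.opmat_def F1.dual_frame_eq F1.V0_selfadjoint)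
  moreover have "cinner (\<Psi>2 b) (dual_frame \<Psi>2 j) = F2.P j b" for b
    by (simp add: F2.P_def F2.opmat_def F2.dual_frame_eq F2.V0_selfadjoint)
  ultimately show "coef (partial_tensor n K) i j = truncated_action cP1 F2.P n K i j"
    by (simp add: analysis2_def partial_tensor_def truncated_action_def cinner_sum_left
        cinner_scaleC_left cinner_tens[OF tens] mult_ac)
qed

lemma coorbit2_inf_norm:
  assumes r: "1 \<le> r" and K: "K \<in> coorbit2_inf tens \<Psi>1 \<Psi>2 r w"
  shows "mixed_norm r \<infinity> w K < \<infinity>"
proof -
  obtain F where F: "\<And>i j. (\<lambda>n::nat. coef (F n) i j) \<longlonglongrightarrow> K i j" "(SUP n. mixed_norm r \<infinity> w (coef (F n))) < \<infinity>"
    using K by (auto simp: coorbit2_inf_def)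
  have "mixed_norm r \<infinity> w K \<le> (SUP n. mixed_norm r \<infinity> w (coef (F n)))"
    by (rule mixed_norm_le_pointwise_limit[OF r F(1)]) (auto intro: SUP_upper)
  then show ?thesis using F(2) by (rule order.strict_trans1)
qed

lemma coorbit2_inf_fr_norm:
  assumes r: "1 \<le> r" and K: "K \<in> coorbit2_inf_fr tens \<Psi>1 \<Psi>2 r w"
  shows "mixed_norm_fr r \<infinity> w K < \<infinity>"
proof -
  obtain F where F: "\<And>i j. (\<lambda>n::nat. coef (F n) i j) \<longlonglongrightarrow> K i j" "(SUP n. mixed_norm_fr r \<infinity> w (coef (F n))) < \<infinity>"
    using K by (auto simp: coorbit2_inf_fr_def)
  have "mixed_norm_fr r \<infinity> w K \<le> (SUP n. mixed_norm_fr r \<infinity> w (coef (F n)))"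
    by (rule mixed_norm_fr_le_pointwise_limit[OF r F(1)]) (auto intro: SUP_upper)
  then show ?thesis using F(2) by (rule order.strict_trans1)
qed

context
  fixes u v assumes u: "good_weight \<A>1 u" and v: "good_weight \<A>2 v"
begin

lemma weights_pos: "u i > 0" "v j > 0"
  using good_weight_pos[OF u] good_weight_pos[OF v] by auto

text \<open>The invariance of coefficients of tensors passes to the limits that define the space.\<close>

lemma coorbit2_inf_biinvariant:
  assumes K: "K \<in> coorbit2_inf tens \<Psi>1 \<Psi>2 \<infinity> (tensor_weight u v)"
  shows "biinvariant K"
proof -
  obtain F where F: "\<And>i j. (\<lambda>n::nat. coef (F n) i j) \<longlonglongrightarrow> K i j"
    and fin: "(SUP n. mixed_norm \<infinity> \<infinity> (tensor_weight u v) (coef (F n))) < \<infinity>"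
    using K by (auto simp: coorbit2_inf_def)
  define \<kappa> where "\<kappa> = (SUP n. mixed_norm \<infinity> \<infinity> (tensor_weight u v) (coef (F n)))"
  have le: "mixed_norm \<infinity> \<infinity> (tensor_weight u v) (coef (F n)) \<le> \<kappa>" for n
    unfolding \<kappa>_def by (rule SUP_upper) simp
  have fin': "\<kappa> * ennreal x < \<infinity>" for x using fin by (simp add: \<kappa>_def ennreal_mult_less_top less_top)
  obtain C where C: "abs_bounded \<infinity> u cP1 C"
    using good_weightD[OF u conjugates_in(1), of \<infinity>] by auto
  obtain D where D: "abs_bounded \<infinity> v F2.P D"
    using good_weightD[OF v F2.P_in, of \<infinity>] by auto
  have "mat_vec cP1 (\<lambda>a. K a j) i = K i j" for i j
  proof -
    have "(\<lambda>n. mat_vec cP1 (\<lambda>a. coef (F n) a j) i) \<longlonglongrightarrow> mat_vec cP1 (\<lambda>a. K a j) i"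
      by (rule mat_vec_tendsto[OF C weights_pos(1) F, where N=0 and K="\<kappa> * ennreal (1 / v j)"])
        (use column_norm_le[OF _ weights_pos le, where j=j] fin' in auto)
    then show ?thesis unfolding coef_invariant using F LIMSEQ_unique by blast
  qed
  moreover have "mat_vec F2.P (K i) j = K i j" for i j
  proof -
    have b: "wnorm \<infinity> v (coef (F n) i) \<le> \<kappa> * ennreal (1 / u i)" for n
      by (rule column_norm_le[OF _ weights_pos(2,1) order.trans[OF eq_refl[OF mixed_norm_infty_swap] le]]) simp
    have "(\<lambda>n. mat_vec F2.P (coef (F n) i) j) \<longlonglongrightarrow> mat_vec F2.P (K i) j"
      by (rule mat_vec_tendsto[OF D weights_pos(2) F, where N=0 and K="\<kappa> * ennreal (1 / u i)"])
        (use b fin' in auto)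
    then show ?thesis unfolding coef_invariant using F LIMSEQ_unique by blast
  qed
  ultimately show ?thesis by (auto simp: biinvariant_def)
qed

lemma partial_tensor_tendsto:
  assumes K: "biinvariant K" "mixed_norm \<infinity> \<infinity> (tensor_weight u v) K < \<infinity>"
  shows "(\<lambda>n. coef (partial_tensor n K) i j) \<longlonglongrightarrow> K i j"
proof -
  obtain C where C: "abs_bounded \<infinity> u cP1 C"
    using good_weightD[OF u conjugates_in(1), of \<infinity>] by auto
  obtain D where D: "abs_bounded \<infinity> v F2.P D"
    using good_weightD[OF v F2.P_in, of \<infinity>] by auto
  show ?thesis
    unfolding coef_partial_tensor using K
    by (intro truncated_action_tendsto[OF weights_pos D _ C]) (auto simp: biinvariant_def)
qed

text \<open>The partial sums of the tensor frame series represent \<open>K\<close>; their coefficients are the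
  truncated actions of the two projections, whose mixed norms are uniformly bounded.\<close>

lemma coorbit2_infI:
  assumes r: "1 \<le> r" and K: "biinvariant K" and fin: "mixed_norm r \<infinity> (tensor_weight u v) K < \<infinity>"
  shows "K \<in> coorbit2_inf tens \<Psi>1 \<Psi>2 r (tensor_weight u v)"
proof -
  obtain C where C: "abs_bounded r u cP1 C"
    using u conjugates_in(1) r unfolding good_weight_def by blast
  obtain D where D: "abs_bounded \<infinity> v F2.P D"
    using good_weightD[OF v F2.P_in, of \<infinity>] by auto
  have "(SUP n. mixed_norm r \<infinity> (tensor_weight u v) (coef (partial_tensor n K)))
      \<le> ennreal C * (ennreal D * mixed_norm r \<infinity> (tensor_weight u v) K)"
    unfolding coef_partial_tensor
    by (intro SUP_least mixed_norm_truncated_action_le[OF weights_pos D r _ C]) simp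
  also have "\<dots> < \<infinity>" using fin by (simp add: ennreal_mult_less_top less_top)
  finally have "(SUP n. mixed_norm r \<infinity> (tensor_weight u v) (coef (partial_tensor n K))) < \<infinity>" .
  moreover have "mixed_norm \<infinity> \<infinity> (tensor_weight u v) K < \<infinity>"
    using mixed_norm_infty_le_mixed_norm[OF r] fin by (rule order.strict_trans1)
  ultimately show ?thesis
    using partial_tensor_tendsto[OF K] unfolding coorbit2_inf_def mem_Collect_eq
    by (intro exI[of _ "\<lambda>n. partial_tensor n K"] conjI allI)
qed

lemma coorbit2_inf_frI:
  assumes r: "1 \<le> r" and K: "biinvariant K" and fin: "mixed_norm_fr r \<infinity> (tensor_weight u v) K < \<infinity>"
  shows "K \<in> coorbit2_inf_fr tens \<Psi>1 \<Psi>2 r (tensor_weight u v)"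
proof -
  obtain C where C: "abs_bounded \<infinity> u cP1 C"
    using good_weightD[OF u conjugates_in(1), of \<infinity>] by auto
  obtain D where D: "abs_bounded r v F2.P D"
    using v F2.P_in r unfolding good_weight_def by blast
  have "(\<lambda>j i. truncated_action cP1 F2.P n K i j) = truncated_action F2.P cP1 n (\<lambda>b a. K a b)" for n
    by (intro ext) (rule truncated_action_swap)
  then have "mixed_norm_fr r \<infinity> (tensor_weight u v) (coef (partial_tensor n K))
      \<le> ennreal D * (ennreal C * mixed_norm_fr r \<infinity> (tensor_weight u v) K)" for n
    unfolding coef_partial_tensor mixed_norm_fr_swap
    by (simp only: mixed_norm_truncated_action_le[OF weights_pos(2,1) C r order_refl D])
  then have "(SUP n. mixed_norm_fr r \<infinity> (tensor_weight u v) (coef (partial_tensor n K)))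
      \<le> ennreal D * (ennreal C * mixed_norm_fr r \<infinity> (tensor_weight u v) K)" by (rule SUP_least)
  also have "\<dots> < \<infinity>" using fin by (simp add: ennreal_mult_less_top less_top)
  finally have "(SUP n. mixed_norm_fr r \<infinity> (tensor_weight u v) (coef (partial_tensor n K))) < \<infinity>" .
  moreover have "mixed_norm \<infinity> \<infinity> (tensor_weight u v) K < \<infinity>"
    by (rule order.strict_trans1[OF order.trans[OF eq_refl[OF mixed_norm_infty_swap[symmetric]]
          mixed_norm_infty_le_mixed_norm[OF r]] fin[unfolded mixed_norm_fr_swap]])
  ultimately show ?thesis
    using partial_tensor_tendsto[OF K] unfolding coorbit2_inf_fr_def mem_Collect_eq
    by (intro exI[of _ "\<lambda>n. partial_tensor n K"] conjI allI)
qed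

end

end

text \<open>A matrix dominated by the weight defines a bounded functional on the weighted \<open>l^{1,1}\<close>
  space, written as an iterated sum. The entries of the extended analysis operator of the
  tensor frame are such functionals.\<close>

lemma double_infsum_tendsto:
  fixes c :: "nat \<Rightarrow> 'a \<Rightarrow> 'b \<Rightarrow> complex"
  assumes m: "\<And>a b. ennreal (cmod (m a b)) \<le> ennreal C * ennreal (w a b)" and w: "\<And>a b. w a b \<ge> 0"
    and g: "mixed_norm 1 1 w g < \<infinity>"
    and lim: "(\<lambda>n. mixed_norm 1 1 w (\<lambda>a b. c n a b - g a b)) \<longlonglongrightarrow> 0"
  shows "(\<lambda>n. \<Sum>\<^sub>\<infinity>a. \<Sum>\<^sub>\<infinity>b. m a b * c n a b) \<longlonglongrightarrow> (\<Sum>\<^sub>\<infinity>a. \<Sum>\<^sub>\<infinity>b. m a b * g a b)"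
proof -
  have norm: "mixed_norm 1 1 w d = (\<Sum>\<^sub>\<infinity>a. \<Sum>\<^sub>\<infinity>b. ennreal (cmod (d a b) * w a b))" for d
    unfolding mixed_norm_def lp_norm_one by (rule infsum_ennreal_swap)
  have bound: "(\<Sum>\<^sub>\<infinity>a. \<Sum>\<^sub>\<infinity>b. ennreal (cmod (m a b * d a b))) \<le> ennreal C * mixed_norm 1 1 w d" for d
  proof -
    have "ennreal (cmod (m a b * d a b)) \<le> ennreal C * ennreal (cmod (d a b) * w a b)" for a b
    proof -
      have "ennreal (cmod (m a b * d a b)) = ennreal (cmod (m a b)) * ennreal (cmod (d a b))"
        by (simp add: norm_mult ennreal_mult)
      also have "\<dots> \<le> ennreal C * ennreal (w a b) * ennreal (cmod (d a b))"
        by (intro mult_right_mono m) simp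
      also have "\<dots> = ennreal C * ennreal (cmod (d a b) * w a b)"
        using w[of a b] by (simp add: ennreal_mult mult_ac)
      finally show ?thesis .
    qed
    then have "(\<Sum>\<^sub>\<infinity>a. \<Sum>\<^sub>\<infinity>b. ennreal (cmod (m a b * d a b)))
        \<le> (\<Sum>\<^sub>\<infinity>a. \<Sum>\<^sub>\<infinity>b. ennreal C * ennreal (cmod (d a b) * w a b))"
      by (intro infsum_ennreal_mono)
    then show ?thesis by (simp add: norm infsum_ennreal_cmult)
  qed
  have fin: "(\<Sum>\<^sub>\<infinity>a. \<Sum>\<^sub>\<infinity>b. ennreal (cmod (m a b * d a b))) < \<infinity>" if "mixed_norm 1 1 w d < \<infinity>" for d
    using bound[of d] that by (auto simp: ennreal_mult_less_top less_top elim!: order.strict_trans1)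
  let ?\<Phi> = "\<lambda>d. \<Sum>\<^sub>\<infinity>a. \<Sum>\<^sub>\<infinity>b. m a b * d a b"
  have pair: "?\<Phi> d = (\<Sum>\<^sub>\<infinity>(a,b). m a b * d a b)" "(\<lambda>(a,b). m a b * d a b) summable_on UNIV"
    if "mixed_norm 1 1 w d < \<infinity>" for d
    using infsum_complex_pair[of "\<lambda>a b. m a b * d a b"] summable_on_pair_iff_ennreal[of "\<lambda>a b. m a b * d a b"]
      fin[OF that] by auto
  have diff: "?\<Phi> (c n) = ?\<Phi> (\<lambda>a b. c n a b - g a b) + ?\<Phi> g"
    if n: "mixed_norm 1 1 w (\<lambda>a b. c n a b - g a b) < \<infinity>" for n
  proof -
    have eq: "(\<lambda>(a,b). m a b * c n a b) = (\<lambda>x. (\<lambda>(a,b). m a b * (c n a b - g a b)) x + (\<lambda>(a,b). m a b * g a b) x)"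
      by (auto simp: fun_eq_iff algebra_simps)
    have "mixed_norm 1 1 w (c n) \<le> mixed_norm 1 1 w (\<lambda>a b. c n a b - g a b) + mixed_norm 1 1 w g"
    proof -
      have "ennreal (cmod (c n a b) * w a b) \<le> ennreal (cmod (c n a b - g a b) * w a b) + ennreal (cmod (g a b) * w a b)" for a b
      proof -
        have "cmod (c n a b) * w a b \<le> (cmod (c n a b - g a b) + cmod (g a b)) * w a b"
          using norm_triangle_sub[of "c n a b" "g a b"] w[of a b] by (intro mult_right_mono) auto
        then show ?thesis using w[of a b] by (simp add: distrib_right ennreal_leI flip: ennreal_plus)
      qed
      then have "mixed_norm 1 1 w (c n) \<le> (\<Sum>\<^sub>\<infinity>a. \<Sum>\<^sub>\<infinity>b. ennreal (cmod (c n a b - g a b) * w a b) + ennreal (cmod (g a b) * w a b))"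
        unfolding norm by (intro infsum_ennreal_mono)
      then show ?thesis by (simp add: norm infsum_ennreal_add)
    qed
    also have "\<dots> < \<infinity>" using n g by (simp add: less_top)
    finally have cn: "mixed_norm 1 1 w (c n) < \<infinity>" .
    show ?thesis
      unfolding pair(1)[OF cn] pair(1)[OF n] pair(1)[OF g] eq
      by (rule infsum_add[OF pair(2)[OF n] pair(2)[OF g]])
  qed
  have "(\<lambda>n. ?\<Phi> (c n) - ?\<Phi> g) \<longlonglongrightarrow> 0"
  proof (rule tendsto_norm_zero_cancel)
    have "(\<lambda>n. ennreal C * mixed_norm 1 1 w (\<lambda>a b. c n a b - g a b)) \<longlonglongrightarrow> ennreal C * 0"
      by (intro tendsto_mult_ennreal tendsto_const lim) auto
    then have l0: "(\<lambda>n. ennreal C * mixed_norm 1 1 w (\<lambda>a b. c n a b - g a b)) \<longlonglongrightarrow> 0" by simp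
    have "eventually (\<lambda>n. mixed_norm 1 1 w (\<lambda>a b. c n a b - g a b) < \<infinity>) sequentially"
      by (rule order_tendstoD(2)[OF lim]) simp
    then have ev: "eventually (\<lambda>n. ennreal (norm (?\<Phi> (c n) - ?\<Phi> g)) \<le> ennreal C * mixed_norm 1 1 w (\<lambda>a b. c n a b - g a b)) sequentially"
    proof eventually_elim
      case (elim n)
      have "ennreal (norm (?\<Phi> (c n) - ?\<Phi> g)) = ennreal (cmod (?\<Phi> (\<lambda>a b. c n a b - g a b)))"
        using diff[OF elim] by simp
      also have "\<dots> \<le> (\<Sum>\<^sub>\<infinity>a. ennreal (cmod (\<Sum>\<^sub>\<infinity>b. m a b * (c n a b - g a b))))" by (rule cmod_infsum_le)
      also have "\<dots> \<le> (\<Sum>\<^sub>\<infinity>a. \<Sum>\<^sub>\<infinity>b. ennreal (cmod (m a b * (c n a b - g a b))))"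
        by (intro infsum_ennreal_mono cmod_infsum_le)
      also have "\<dots> \<le> ennreal C * mixed_norm 1 1 w (\<lambda>a b. c n a b - g a b)" by (rule bound)
      finally show ?case .
    qed
    have "(\<lambda>n. ennreal (norm (?\<Phi> (c n) - ?\<Phi> g))) \<longlonglongrightarrow> 0"
      by (rule tendsto_sandwich[OF _ ev tendsto_const l0]) simp
    then have "(\<lambda>n. ennreal (norm (?\<Phi> (c n) - ?\<Phi> g))) \<longlonglongrightarrow> ennreal 0" by simp
    then show "(\<lambda>n. norm (?\<Phi> (c n) - ?\<Phi> g)) \<longlonglongrightarrow> 0" by (rule tendsto_ennrealD) auto
  qed
  then show ?thesis by (rule LIM_zero_cancel)
qed

section \<open>Kernels\<close>

lemma recip_recip [simp]: "recip (recip w) = w"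
  by (simp add: recip_def)

lemma one_div_recip: "1 / recip w i = w i"
  by (simp add: recip_def)

text \<open>The columns of a matrix that is bounded on the weighted \<open>l^1\<close> space are the images of
  the unit sequences, and an entry is dominated by the norm of its column.\<close>

lemma matrix_entry_le:
  fixes M :: "'a cmatrix"
  assumes w: "\<And>a. w a > 0" and M: "abs_bounded 1 w M C"
  shows "\<exists>C. \<forall>a. ennreal (cmod (M i a)) \<le> ennreal C * ennreal (w a) \<and> C \<ge> 0"
proof (intro exI[of _ "C / w i"] allI conjI)
  fix a :: 'a
  have C: "C > 0" using M by (simp add: abs_bounded_def)
  then show "C / w i \<ge> 0" using w[of i] by simp
  define x :: "'a \<Rightarrow> ennreal" where "x j = (if j = a then 1 else 0 :: ennreal)" for j
  have e: "(\<Sum>\<^sub>\<infinity>j. f j * x j) = f a" for f :: "'a \<Rightarrow> ennreal"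
    by (subst infsum_ennreal_finite_support[of "{a}"]) (auto simp: x_def)
  have "lp_norm 1 (\<lambda>k. ennreal (w k) * (\<Sum>\<^sub>\<infinity>j. ennreal (cmod (M k j)) * x j)) \<le> ennreal C * lp_norm 1 (\<lambda>j. ennreal (w j) * x j)"
    by (rule abs_boundedD[OF M])
  then have "(\<Sum>\<^sub>\<infinity>k. ennreal (w k) * ennreal (cmod (M k a))) \<le> ennreal C * ennreal (w a)"
    by (simp only: e lp_norm_one)
  with term_le_infsum_ennreal[of "\<lambda>k. ennreal (w k) * ennreal (cmod (M k a))" i]
  have "ennreal (w i) * ennreal (cmod (M i a)) \<le> ennreal C * ennreal (w a)" by (rule order.trans)
  then have "ennreal (w i * cmod (M i a)) \<le> ennreal (C * w a)"
    using w C by (simp add: ennreal_mult less_imp_le)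
  then have "w i * cmod (M i a) \<le> C * w a"
    using w[of a] C by (subst (asm) ennreal_le_iff) auto
  then have "cmod (M i a) \<le> C / w i * w a" using w[of i] by (simp add: field_simps)
  then show "ennreal (cmod (M i a)) \<le> ennreal (C / w i) * ennreal (w a)"
    using w[of a] w[of i] C by (simp add: ennreal_leI flip: ennreal_mult)
qed

locale kernel_setting =
  tensor_pair \<Psi>1 A1 B1 \<A>1 nA1 \<Psi>2 A2 B2 \<A>2 nA2 tens
  for \<Psi>1 :: "'i::countable \<Rightarrow> 'h1::complex_hilbert" and A1 B1 :: real
    and \<A>1 :: "'i cmatrix set" and nA1 :: "'i cmatrix \<Rightarrow> real"
    and \<Psi>2 :: "'j::countable \<Rightarrow> 'h2::complex_hilbert" and A2 B2 :: real
    and \<A>2 :: "'j cmatrix set" and nA2 :: "'j cmatrix \<Rightarrow> real"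
    and tens :: "'h1 \<Rightarrow> 'h2 \<Rightarrow> 't::complex_hilbert" +
  fixes w1 :: "'i \<Rightarrow> real" and w2 :: "'j \<Rightarrow> real"
  assumes good1: "good_weight \<A>1 w1" and good2: "good_weight \<A>2 w2"
begin

lemma good1r: "good_weight \<A>1 (recip w1)" and good2r: "good_weight \<A>2 (recip w2)"
  by (rule good_weight_recip[OF F1.algebra good1], rule good_weight_recip[OF F2.algebra good2])

sublocale W1: weighted \<Psi>1 A1 B1 \<A>1 nA1 w1
  by unfold_locales (rule good1)

sublocale W2: weighted \<Psi>2 A2 B2 \<A>2 nA2 w2
  by unfold_locales (rule good2)

sublocale R2: weighted \<Psi>2 A2 B2 \<A>2 nA2 "recip w2"
  by unfold_locales (rule good2r)

abbreviation G1 :: "('i \<Rightarrow> complex) \<Rightarrow> 'i \<Rightarrow> complex" where "G1 \<equiv> mat_vec (gram \<Psi>1)"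
abbreviation G2 :: "('j \<Rightarrow> complex) \<Rightarrow> 'j \<Rightarrow> complex" where "G2 \<equiv> mat_vec (gram \<Psi>2)"

abbreviation kernel_weight :: "'i \<Rightarrow> 'j \<Rightarrow> real" where
  "kernel_weight \<equiv> tensor_weight (recip w1) (recip w2)"

lemma gram_entry_le:
  "\<exists>C. \<forall>a. ennreal (cmod (gram \<Psi>1 i a)) \<le> ennreal C * ennreal (w1 a) \<and> C \<ge> 0"
  "\<exists>C. \<forall>b. ennreal (cmod (gram \<Psi>2 j b)) \<le> ennreal C * ennreal (w2 b) \<and> C \<ge> 0"
proof -
  obtain C where "abs_bounded 1 w1 (gram \<Psi>1) C" using good_weightD[OF good1 F1.gram_in, of 1] by auto
  from matrix_entry_le[OF W1.w_pos this] show "\<exists>C. \<forall>a. ennreal (cmod (gram \<Psi>1 i a)) \<le> ennreal C * ennreal (w1 a) \<and> C \<ge> 0" .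
  obtain C where "abs_bounded 1 w2 (gram \<Psi>2) C" using good_weightD[OF good2 F2.gram_in, of 1] by auto
  from matrix_entry_le[OF W2.w_pos this] show "\<exists>C. \<forall>b. ennreal (cmod (gram \<Psi>2 j b)) \<le> ennreal C * ennreal (w2 b) \<and> C \<ge> 0" .
qed

lemma mixed_norm_simple:
  "mixed_norm 1 1 (tensor_weight w1 w2) (\<lambda>i j. x i * y j) = wnorm 1 w1 x * wnorm 1 w2 y"
proof -
  have "ennreal (cmod (x i * y j) * (w1 i * w2 j)) = ennreal (cmod (x i) * w1 i) * ennreal (cmod (y j) * w2 j)" for i j
    using W1.w_pos[of i] W2.w_pos[of j] by (simp add: norm_mult mult_ac flip: ennreal_mult)
  then show ?thesis
    unfolding mixed_norm_def lp_norm_one tensor_weight_def wnorm_one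
    by (simp add: infsum_ennreal_cmult_right infsum_ennreal_cmult)
qed

lemma mixed_norm_triangle:
  assumes "\<And>i j. cmod (c i j) \<le> cmod (d i j) + cmod (e i j)"
  shows "mixed_norm 1 1 (tensor_weight w1 w2) c
    \<le> mixed_norm 1 1 (tensor_weight w1 w2) d + mixed_norm 1 1 (tensor_weight w1 w2) e"
proof -
  have "ennreal (cmod (c i j) * (w1 i * w2 j))
      \<le> ennreal (cmod (d i j) * (w1 i * w2 j)) + ennreal (cmod (e i j) * (w1 i * w2 j))" for i j
  proof -
    have pos: "w1 i * w2 j \<ge> 0" using W1.w_pos[of i] W2.w_pos[of j] by simp
    have "cmod (c i j) * (w1 i * w2 j) \<le> (cmod (d i j) + cmod (e i j)) * (w1 i * w2 j)"
      by (intro mult_right_mono assms pos)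
    then show ?thesis using pos by (simp add: distrib_right ennreal_leI flip: ennreal_plus)
  qed
  then show ?thesis
    unfolding mixed_norm_def lp_norm_one tensor_weight_def
    by (simp only: infsum_ennreal_add[symmetric]) (intro infsum_ennreal_mono)
qed

text \<open>The tensor product of the partial sums works: the error splits as
  \<open>x \<otimes> y - f1 \<otimes> f2 = (x - f1) \<otimes> y + f1 \<otimes> (y - f2)\<close>, and \<open>l^{1,1}\<close> norms of simple tensors
  factor.\<close>

lemma simple_tensor_represented:
  assumes f1: "f1 \<in> coorbit \<Psi>1 1 w1" and f2: "f2 \<in> coorbit \<Psi>2 1 w2"
  shows "represents2_1 tens \<Psi>1 \<Psi>2 (tensor_weight w1 w2)
    (\<lambda>n. tens (F1.partial_synth n f1) (F2.partial_synth n f2)) (simple_tensor f1 f2)"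
proof -
  have f1': "wnorm 1 w1 f1 < \<infinity>" "mat_vec F1.P f1 = f1" using f1 by (simp_all add: W1.coorbit_eq)
  have f2': "wnorm 1 w2 f2 < \<infinity>" "mat_vec F2.P f2 = f2" using f2 by (simp_all add: W2.coorbit_eq)
  define x where "x n = analysis (dual_frame \<Psi>1) (F1.partial_synth n f1)" for n
  define y where "y n = analysis (dual_frame \<Psi>2) (F2.partial_synth n f2)" for n
  have xlim: "(\<lambda>n. wnorm 1 w1 (\<lambda>i. x n i - f1 i)) \<longlonglongrightarrow> 0"
    using W1.represents_partial_synth[OF _ f1'] by (simp add: represents_def x_def)
  have ylim: "(\<lambda>n. wnorm 1 w2 (\<lambda>j. y n j - f2 j)) \<longlonglongrightarrow> 0"
    using W2.represents_partial_synth[OF _ f2'] by (simp add: represents_def y_def)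
  obtain D where D: "abs_bounded 1 w2 F2.P D" using good_weightD[OF good2 F2.P_in, of 1] by auto
  have ybound: "wnorm 1 w2 (y n) \<le> ennreal D * wnorm 1 w2 f2" for n
  proof -
    have "wnorm 1 w2 (y n) \<le> ennreal D * wnorm 1 w2 (truncate n f2)"
      unfolding y_def F2.analysis_dual_partial_synth by (rule wnorm_mat_vec_le[OF D order_refl W2.w_pos])
    also have "\<dots> \<le> ennreal D * wnorm 1 w2 f2"
      by (intro mult_left_mono wnorm_truncate_le order_refl W2.w_pos) simp
    finally show ?thesis .
  qed
  have coef: "coef (tens (F1.partial_synth n f1) (F2.partial_synth n f2)) i j = cnj (x n i) * y n j" for n i j
    by (simp add: analysis2_def cinner_tens[OF tens] x_def y_def analysis_def)
  have wc: "wnorm p w (\<lambda>i. cnj (c i)) = wnorm p w c" for p w and c :: "'i \<Rightarrow> complex" by (simp add: wnorm_def)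
  have le: "mixed_norm 1 1 (tensor_weight w1 w2) (\<lambda>i j. cnj (x n i) * y n j - simple_tensor f1 f2 i j)
      \<le> wnorm 1 w1 (\<lambda>i. x n i - f1 i) * (ennreal D * wnorm 1 w2 f2)
        + wnorm 1 w1 f1 * wnorm 1 w2 (\<lambda>j. y n j - f2 j)" for n
  proof -
    have "mixed_norm 1 1 (tensor_weight w1 w2) (\<lambda>i j. cnj (x n i) * y n j - simple_tensor f1 f2 i j)
        \<le> mixed_norm 1 1 (tensor_weight w1 w2) (\<lambda>i j. cnj (x n i - f1 i) * y n j)
          + mixed_norm 1 1 (tensor_weight w1 w2) (\<lambda>i j. cnj (f1 i) * (y n j - f2 j))"
    proof (rule mixed_norm_triangle)
      fix i j
      have "cnj (x n i) * y n j - simple_tensor f1 f2 i j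
          = cnj (x n i - f1 i) * y n j + cnj (f1 i) * (y n j - f2 j)"
        by (simp add: simple_tensor_def algebra_simps)
      then show "cmod (cnj (x n i) * y n j - simple_tensor f1 f2 i j)
          \<le> cmod (cnj (x n i - f1 i) * y n j) + cmod (cnj (f1 i) * (y n j - f2 j))"
        by (simp only: norm_triangle_ineq)
    qed
    also have "\<dots> = wnorm 1 w1 (\<lambda>i. x n i - f1 i) * wnorm 1 w2 (y n)
        + wnorm 1 w1 f1 * wnorm 1 w2 (\<lambda>j. y n j - f2 j)"
      by (simp only: mixed_norm_simple wc)
    also have "\<dots> \<le> wnorm 1 w1 (\<lambda>i. x n i - f1 i) * (ennreal D * wnorm 1 w2 f2)
        + wnorm 1 w1 f1 * wnorm 1 w2 (\<lambda>j. y n j - f2 j)"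
      by (intro add_right_mono mult_left_mono ybound) simp
    finally show ?thesis .
  qed
  have fin: "ennreal D * wnorm 1 w2 f2 < \<infinity>" using f2' by (simp add: ennreal_mult_less_top less_top)
  have "(\<lambda>n. wnorm 1 w1 (\<lambda>i. x n i - f1 i) * (ennreal D * wnorm 1 w2 f2)
      + wnorm 1 w1 f1 * wnorm 1 w2 (\<lambda>j. y n j - f2 j))
      \<longlonglongrightarrow> 0 * (ennreal D * wnorm 1 w2 f2) + wnorm 1 w1 f1 * 0"
    using fin f1'(1) by (intro tendsto_add tendsto_mult_ennreal xlim ylim tendsto_const) auto
  then have lim0: "(\<lambda>n. wnorm 1 w1 (\<lambda>i. x n i - f1 i) * (ennreal D * wnorm 1 w2 f2)
      + wnorm 1 w1 f1 * wnorm 1 w2 (\<lambda>j. y n j - f2 j)) \<longlonglongrightarrow> 0" by simp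
  have lim: "(\<lambda>n. mixed_norm 1 1 (tensor_weight w1 w2)
      (\<lambda>i j. cnj (x n i) * y n j - simple_tensor f1 f2 i j)) \<longlonglongrightarrow> 0"
    by (rule ennreal_tendsto_0_mono[OF le lim0])
  have comb: "tens (F1.partial_synth n f1) (F2.partial_synth n f2)
      \<in> finite_combinations (\<lambda>(i, j). tens (\<Psi>1 i) (\<Psi>2 j))" for n
  proof -
    let ?X = "{k::'i. to_nat k < n}" and ?Y = "{k::'j. to_nat k < n}"
    have "tens (F1.partial_synth n f1) (F2.partial_synth n f2)
        = (\<Sum>a\<in>?X. \<Sum>b\<in>?Y. (cnj (f1 a) * f2 b) *\<^sub>C tens (\<Psi>1 a) (\<Psi>2 b))"
      unfolding F1.partial_synth_def F2.partial_synth_def tens_sum[OF tens]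
      by (simp add: tens_scale_left[OF tens] tens_scale_right[OF tens] scaleC_scaleC mult.commute)
    also have "\<dots> = (\<Sum>k\<in>?X \<times> ?Y. (cnj (f1 (fst k)) * f2 (snd k)) *\<^sub>C (\<lambda>(i, j). tens (\<Psi>1 i) (\<Psi>2 j)) k)"
      by (simp add: sum.cartesian_product case_prod_unfold)
    finally show ?thesis
      unfolding finite_combinations_def
      by (intro CollectI exI[of _ "?X \<times> ?Y"] exI[of _ "\<lambda>k. cnj (f1 (fst k)) * f2 (snd k)"] conjI)
        (auto simp: finite_to_nat_less)
  qed
  have "mixed_norm 1 1 (tensor_weight w1 w2) (simple_tensor f1 f2) = wnorm 1 w1 f1 * wnorm 1 w2 f2"
    unfolding simple_tensor_def mixed_norm_simple wc ..
  then have "mixed_norm 1 1 (tensor_weight w1 w2) (simple_tensor f1 f2) < \<infinity>"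
    using f1' f2' by (simp add: ennreal_mult_less_top less_top)
  then show ?thesis unfolding represents2_1_def coef using comb lim by blast
qed

text \<open>The limits exist along every representing sequence, because a row of the two Gram
  matrices is dominated by the weight, and they agree with the double sum, which factors on
  simple tensors.\<close>

lemma analysis_ext2_simple_tensor:
  assumes f1: "f1 \<in> coorbit \<Psi>1 1 w1" and f2: "f2 \<in> coorbit \<Psi>2 1 w2"
  shows "analysis_ext2 tens \<Psi>1 \<Psi>2 (tensor_weight w1 w2) (simple_tensor f1 f2) i j = cnj (G1 f1 i) * G2 f2 j"
proof -
  obtain C1 where C1: "\<And>a. ennreal (cmod (gram \<Psi>1 i a)) \<le> ennreal C1 * ennreal (w1 a)" "C1 \<ge> 0"
    using gram_entry_le(1)[of i] by blast
  obtain C2 where C2: "\<And>b. ennreal (cmod (gram \<Psi>2 j b)) \<le> ennreal C2 * ennreal (w2 b)" "C2 \<ge> 0"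
    using gram_entry_le(2)[of j] by blast
  have m: "ennreal (cmod (cG1 i a * gram \<Psi>2 j b)) \<le> ennreal (C1 * C2) * ennreal (tensor_weight w1 w2 a b)" for a b
  proof -
    have "ennreal (cmod (cG1 i a * gram \<Psi>2 j b)) = ennreal (cmod (gram \<Psi>1 i a)) * ennreal (cmod (gram \<Psi>2 j b))"
      by (simp add: cG1_def norm_mult ennreal_mult)
    also have "\<dots> \<le> (ennreal C1 * ennreal (w1 a)) * (ennreal C2 * ennreal (w2 b))"
      by (intro mult_mono C1 C2) auto
    also have "\<dots> = ennreal (C1 * C2) * ennreal (tensor_weight w1 w2 a b)"
      using C1(2) C2(2) W1.w_pos[of a] W2.w_pos[of b]
      by (simp add: tensor_weight_def ennreal_mult mult_ac)
    finally show ?thesis .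
  qed
  have w0: "tensor_weight w1 w2 a b \<ge> 0" for a b
    using W1.w_pos[of a] W2.w_pos[of b] by (simp add: tensor_weight_def)
  have lim: "(\<lambda>n. analysis2 tens \<Psi>1 \<Psi>2 (F n) i j) \<longlonglongrightarrow> cnj (G1 f1 i) * G2 f2 j"
    if F: "represents2_1 tens \<Psi>1 \<Psi>2 (tensor_weight w1 w2) F (simple_tensor f1 f2)" for F
  proof -
    have "(\<lambda>n. \<Sum>\<^sub>\<infinity>a. \<Sum>\<^sub>\<infinity>b. cG1 i a * gram \<Psi>2 j b * coef (F n) a b)
        \<longlonglongrightarrow> (\<Sum>\<^sub>\<infinity>a. \<Sum>\<^sub>\<infinity>b. cG1 i a * gram \<Psi>2 j b * simple_tensor f1 f2 a b)"
      by (rule double_infsum_tendsto[OF m w0]) (use F in \<open>auto simp: represents2_1_def\<close>)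
    also have "(\<Sum>\<^sub>\<infinity>a. \<Sum>\<^sub>\<infinity>b. cG1 i a * gram \<Psi>2 j b * simple_tensor f1 f2 a b)
        = (\<Sum>\<^sub>\<infinity>a. \<Sum>\<^sub>\<infinity>b. cnj (gram \<Psi>1 i a * f1 a) * (gram \<Psi>2 j b * f2 b))"
      by (simp add: cG1_def simple_tensor_def mult_ac)
    also have "\<dots> = cnj (G1 f1 i) * G2 f2 j"
      unfolding infsum_cmult_right' infsum_cmult_left' infsum_cnj mat_vec_def ..
    finally show ?thesis unfolding analysis2_eq .
  qed
  show ?thesis
    unfolding analysis_ext2_def
    by (rule the_equality) (use lim lim[OF simple_tensor_represented[OF f1 f2]]
        simple_tensor_represented[OF f1 f2] LIMSEQ_unique in blast)+
qed

lemma pairing_eq: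
  "f2 \<in> coorbit \<Psi>2 1 w2 \<Longrightarrow> pairing \<Psi>2 1 w2 c f2 = (\<Sum>\<^sub>\<infinity>j. c j * cnj (G2 f2 j))"
  by (simp add: pairing_def W2.analysis_ext_eq)

lemma kernel_entry_le:
  assumes "mixed_norm \<infinity> \<infinity> kernel_weight K \<le> \<kappa>"
  shows "ennreal (cmod (K i j)) \<le> \<kappa> * (ennreal (w1 i) * ennreal (w2 j))"
proof -
  have r: "recip w1 i > 0" "recip w2 j > 0" for i j using W1.w_pos W2.w_pos by (auto simp: recip_def)
  have "ennreal (cmod (K i j)) \<le> wnorm \<infinity> (recip w1) (\<lambda>i. K i j) * ennreal (1 / recip w1 i)"
    using entry_le_of_wnorm[OF r(1), of "\<lambda>i. K i j" i] .
  also have "\<dots> \<le> \<kappa> * ennreal (1 / recip w2 j) * ennreal (1 / recip w1 i)"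
    by (intro mult_right_mono column_norm_le[OF _ r assms]) auto
  finally show ?thesis by (simp add: one_div_recip mult_ac)
qed

text \<open>The double series of the pairing converges absolutely, so it may be summed in either
  order: summing over \<open>j\<close> first is used for a given kernel, summing over \<open>i\<close> first for the
  construction of one.\<close>

lemma pairing2_eq:
  assumes K: "mixed_norm \<infinity> \<infinity> kernel_weight K < \<infinity>"
    and f1: "f1 \<in> coorbit \<Psi>1 1 w1" and f2: "f2 \<in> coorbit \<Psi>2 1 w2"
  shows "pairing2 tens \<Psi>1 \<Psi>2 (tensor_weight w1 w2) K (simple_tensor f1 f2)
      = (\<Sum>\<^sub>\<infinity>i. G1 f1 i * (\<Sum>\<^sub>\<infinity>j. K i j * cnj (G2 f2 j)))" (is "?p = ?l")
    and "pairing2 tens \<Psi>1 \<Psi>2 (tensor_weight w1 w2) K (simple_tensor f1 f2)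
      = (\<Sum>\<^sub>\<infinity>j. (\<Sum>\<^sub>\<infinity>i. G1 f1 i * K i j) * cnj (G2 f2 j))"
proof -
  let ?\<kappa> = "mixed_norm \<infinity> \<infinity> kernel_weight K"
  have g1: "wnorm 1 w1 (G1 f1) < \<infinity>"
    using W1.wnorm_mat_vec_finite[OF F1.gram_in, of 1 f1] f1 by (simp add: W1.coorbit_eq)
  have g2: "wnorm 1 w2 (G2 f2) < \<infinity>"
    using W2.wnorm_mat_vec_finite[OF F2.gram_in, of 1 f2] f2 by (simp add: W2.coorbit_eq)
  let ?t = "\<lambda>i j. G1 f1 i * (K i j * cnj (G2 f2 j))"
  have le: "ennreal (cmod (?t i j)) \<le> ?\<kappa> * (ennreal (cmod (G1 f1 i) * w1 i) * ennreal (cmod (G2 f2 j) * w2 j))" for i j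
  proof -
    have "ennreal (cmod (?t i j)) = ennreal (cmod (K i j)) * (ennreal (cmod (G1 f1 i)) * ennreal (cmod (G2 f2 j)))"
      by (simp add: norm_mult ennreal_mult mult_ac)
    also have "\<dots> \<le> ?\<kappa> * (ennreal (w1 i) * ennreal (w2 j)) * (ennreal (cmod (G1 f1 i)) * ennreal (cmod (G2 f2 j)))"
      by (intro mult_right_mono kernel_entry_le) auto
    also have "\<dots> = ?\<kappa> * (ennreal (cmod (G1 f1 i) * w1 i) * ennreal (cmod (G2 f2 j) * w2 j))"
      using W1.w_pos[of i] W2.w_pos[of j] by (simp add: ennreal_mult mult_ac)
    finally show ?thesis .
  qed
  have "(\<Sum>\<^sub>\<infinity>i. \<Sum>\<^sub>\<infinity>j. ennreal (cmod (?t i j)))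
      \<le> (\<Sum>\<^sub>\<infinity>i. \<Sum>\<^sub>\<infinity>j. ?\<kappa> * (ennreal (cmod (G1 f1 i) * w1 i) * ennreal (cmod (G2 f2 j) * w2 j)))"
    by (intro infsum_ennreal_mono le)
  also have "\<dots> = ?\<kappa> * (wnorm 1 w1 (G1 f1) * wnorm 1 w2 (G2 f2))"
    by (simp add: infsum_ennreal_cmult infsum_ennreal_cmult_right wnorm_one)
  also have "\<dots> < \<infinity>" using g1 g2 K by (simp add: ennreal_mult_less_top less_top)
  finally have fin: "(\<Sum>\<^sub>\<infinity>i. \<Sum>\<^sub>\<infinity>j. ennreal (cmod (?t i j))) < \<infinity>" .
  have "?p = (\<Sum>\<^sub>\<infinity>(i,j). ?t i j)"
    unfolding pairing2_def analysis_ext2_simple_tensor[OF f1 f2]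
    by (intro infsum_cong) (auto simp: mult_ac)
  also have "\<dots> = (\<Sum>\<^sub>\<infinity>i. \<Sum>\<^sub>\<infinity>j. ?t i j)" by (rule infsum_complex_pair[OF fin])
  finally have p: "?p = (\<Sum>\<^sub>\<infinity>i. \<Sum>\<^sub>\<infinity>j. ?t i j)" .
  show "?p = ?l" unfolding p by (simp only: infsum_cmult_right')
  show "?p = (\<Sum>\<^sub>\<infinity>j. (\<Sum>\<^sub>\<infinity>i. G1 f1 i * K i j) * cnj (G2 f2 j))"
    unfolding p infsum_complex_swap[OF fin] by (simp only: mult.assoc[symmetric] infsum_cmult_left')
qed

lemma coorbit1: "1 \<le> p \<Longrightarrow> f \<in> coorbit \<Psi>1 p w1 \<longleftrightarrow> wnorm p w1 f < \<infinity> \<and> mat_vec F1.P f = f"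
  by (simp add: W1.coorbit_eq)

lemma coorbit2: "1 \<le> p \<Longrightarrow> f \<in> coorbit \<Psi>2 p (recip w2) \<longleftrightarrow> wnorm p (recip w2) f < \<infinity> \<and> mat_vec F2.P f = f"
  by (simp add: R2.coorbit_eq)

lemma recip_pos: "recip w1 i > 0" "recip w2 j > 0"
  using W1.w_pos W2.w_pos by (auto simp: recip_def)

text \<open>The atoms: the dual frame vectors, as elements of the co-orbit spaces.\<close>

definition atom1 :: "'i \<Rightarrow> 'i \<Rightarrow> complex" where "atom1 i = (\<lambda>l. F1.dual_gram l i)"

text \<open>The coefficients of \<open>\<Sum> c_i \<psi>~_i\<close>, a left inverse of the extended analysis operator.\<close>

definition combine :: "('i \<Rightarrow> complex) \<Rightarrow> 'i \<Rightarrow> complex" where "combine = mat_vec F1.dual_gram"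

lemma mat_vec_unit: "mat_vec M (\<lambda>k. if k = i then 1 else 0) = (\<lambda>l. M l i)"
proof
  fix l show "mat_vec M (\<lambda>k. if k = i then 1 else 0) l = M l i"
    unfolding mat_vec_def by (rule infsumI, rule has_sum_finite_neutralI[of "{i}"]) auto
qed

lemma wnorm_unit_le:
  assumes "1 \<le> p"
  shows "wnorm p w (\<lambda>k. if k = i then 1 else 0) \<le> ennreal (w i)"
proof -
  have "wnorm p w (\<lambda>k. if k = i then 1 else 0) \<le> wnorm 1 w (\<lambda>k. if k = i then 1 else 0)"
    by (rule wnorm_le_wnorm_one[OF assms])
  also have "\<dots> = ennreal (w i)"
    unfolding wnorm_one by (subst infsum_ennreal_finite_support[of "{i}"]) auto
  finally show ?thesis .
qed

lemma combine_in:
  assumes "1 \<le> p" "wnorm p w1 c < \<infinity>"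
  shows "combine c \<in> coorbit \<Psi>1 p w1"
  unfolding coorbit1[OF assms(1)] combine_def
  using W1.wnorm_mat_vec_finite[OF F1.dual_gram_in assms]
    W1.P_mat_vec_range(2)[OF wbounded_if_wnorm_finite[OF assms]] by simp

lemma combine_gram:
  assumes "1 \<le> p" "f \<in> coorbit \<Psi>1 p w1"
  shows "combine (G1 f) = f" "wnorm p w1 (G1 f) < \<infinity>"
  using W1.dual_gram_gram[OF wbounded_if_wnorm_finite[OF assms(1)], of f]
    W1.wnorm_mat_vec_finite[OF F1.gram_in assms(1), of f] assms(2)
  by (simp_all add: coorbit1[OF assms(1)] combine_def)

lemma atom1_eq: "atom1 i = combine (\<lambda>k. if k = i then 1 else 0)"
  unfolding atom1_def combine_def mat_vec_unit ..

lemma atom1_in: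
  assumes "1 \<le> p"
  shows "atom1 i \<in> coorbit \<Psi>1 p w1"
  unfolding atom1_eq using wnorm_unit_le[OF assms, of w1 i]
  by (intro combine_in assms) (auto elim!: order.strict_trans1)

lemma gram_atom1: "G1 (atom1 i) = (\<lambda>l. F1.P l i)"
proof -
  have "wbounded w1 (\<lambda>k. if k = i then 1 else 0)"
    using wnorm_unit_le[of \<infinity> w1 i] unfolding wbounded_def by (auto elim!: order.strict_trans1)
  from W1.mat_vec_mat_vec_in[OF F1.gram_in F1.dual_gram_in this]
  show ?thesis unfolding atom1_eq combine_def F1.matrix_products mat_vec_unit .
qed

lemma analysis_dual1: "analysis (dual_frame \<Psi>1) (dual_frame \<Psi>1 i) = atom1 i"
  by (simp add: F1.analysis_dual_dual atom1_def)

lemma dual_atom2: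
  shows "analysis (dual_frame \<Psi>2) (dual_frame \<Psi>2 j) \<in> coorbit \<Psi>2 1 w2"
    and "G2 (analysis (dual_frame \<Psi>2) (dual_frame \<Psi>2 j)) = (\<lambda>l. F2.P l j)"
proof -
  let ?e = "\<lambda>k. if k = j then 1 else 0 :: complex"
  have e: "wnorm 1 w2 ?e < \<infinity>" using wnorm_unit_le[of 1 w2 j] by (auto elim!: order.strict_trans1)
  then have b: "wbounded w2 ?e" by (rule wbounded_if_wnorm_finite[OF order_refl])
  have eq: "analysis (dual_frame \<Psi>2) (dual_frame \<Psi>2 j) = mat_vec F2.dual_gram ?e"
    unfolding F2.analysis_dual_dual mat_vec_unit ..
  show "analysis (dual_frame \<Psi>2) (dual_frame \<Psi>2 j) \<in> coorbit \<Psi>2 1 w2"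
    unfolding eq W2.coorbit_eq[OF order_refl]
    using W2.wnorm_mat_vec_finite[OF F2.dual_gram_in order_refl e] W2.P_mat_vec_range(2)[OF b] by simp
  from W2.mat_vec_mat_vec_in[OF F2.gram_in F2.dual_gram_in b]
  show "G2 (analysis (dual_frame \<Psi>2) (dual_frame \<Psi>2 j)) = (\<lambda>l. F2.P l j)"
    unfolding eq F2.matrix_products mat_vec_unit .
qed

text \<open>The extended analysis operator takes the dual frame vectors to the columns of \<open>P\<close>, so
  pairing with them reads off coefficients.\<close>

lemma infsum_P2: "(\<Sum>\<^sub>\<infinity>l. c l * cnj (F2.P l j)) = mat_vec F2.P c j"
  unfolding mat_vec_def F2.P_adjoint by (simp add: mult.commute)

lemma galerkin_eq:
  assumes S: "linear_between (coorbit \<Psi>1 1 w1) (coorbit \<Psi>2 \<infinity> (recip w2)) S"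
  shows "galerkin \<Psi>1 \<Psi>2 w2 S = (\<lambda>i j. S (atom1 i) j)"
proof (intro ext)
  fix i j
  have "S (atom1 i) \<in> coorbit \<Psi>2 \<infinity> (recip w2)"
    using S atom1_in[of 1 i] by (simp add: linear_between_def)
  then have "mat_vec F2.P (S (atom1 i)) = S (atom1 i)" by (simp add: R2.coorbit_eq)
  then show "galerkin \<Psi>1 \<Psi>2 w2 S i j = S (atom1 i) j"
    unfolding galerkin_def analysis_dual1 pairing_eq[OF dual_atom2(1)] dual_atom2(2) infsum_P2 by simp
qed

text \<open>The operator with kernel \<open>K\<close>, in coordinates.\<close>

definition kernel_action :: "('i \<Rightarrow> 'j \<Rightarrow> complex) \<Rightarrow> ('i \<Rightarrow> complex) \<Rightarrow> 'j \<Rightarrow> complex" where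
  "kernel_action K f j = (\<Sum>\<^sub>\<infinity>i. G1 f i * K i j)"

lemma recip2_kernel_weight: "recip2 (tensor_weight w1 w2) = kernel_weight"
  by (rule recip2_tensor_weight)

lemma is_kernelD:
  assumes "is_kernel tens \<Psi>1 w1 \<Psi>2 w2 S K"
  shows "biinvariant K" "mixed_norm \<infinity> \<infinity> kernel_weight K < \<infinity>"
    "f1 \<in> coorbit \<Psi>1 1 w1 \<Longrightarrow> f2 \<in> coorbit \<Psi>2 1 w2 \<Longrightarrow> pairing \<Psi>2 1 w2 (S f1) f2
          = pairing2 tens \<Psi>1 \<Psi>2 (tensor_weight w1 w2) K (simple_tensor f1 f2)"
proof -
  have K: "K \<in> coorbit2_inf tens \<Psi>1 \<Psi>2 \<infinity> kernel_weight"
    using assms unfolding is_kernel_def recip2_kernel_weight by blast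
  show "biinvariant K" by (rule coorbit2_inf_biinvariant[OF good1r good2r K])
  show "mixed_norm \<infinity> \<infinity> kernel_weight K < \<infinity>" by (rule coorbit2_inf_norm[OF _ K]) simp
  show "f1 \<in> coorbit \<Psi>1 1 w1 \<Longrightarrow> f2 \<in> coorbit \<Psi>2 1 w2 \<Longrightarrow> pairing \<Psi>2 1 w2 (S f1) f2
          = pairing2 tens \<Psi>1 \<Psi>2 (tensor_weight w1 w2) K (simple_tensor f1 f2)"
    using assms unfolding is_kernel_def by blast
qed

lemma kernel_action_atom:
  assumes K: "biinvariant K"
  shows "kernel_action K (atom1 i) j = K i j"
proof -
  have "kernel_action K (atom1 i) j = mat_vec cP1 (\<lambda>a. K a j) i"
    unfolding kernel_action_def gram_atom1 unfolding mat_vec_def cP1_def F1.P_adjoint ..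
  then show ?thesis using K by (simp add: biinvariant_def)
qed

text \<open>Testing the kernel identity with the dual frame vectors of \<open>\<Psi>2\<close> applies \<open>P\<close> to \<open>S f\<close> on
  one side and to the rows of \<open>K\<close> on the other, and both are fixed by it.\<close>

lemma operator_eq_kernel_action:
  assumes S: "linear_between (coorbit \<Psi>1 1 w1) (coorbit \<Psi>2 \<infinity> (recip w2)) S"
    and K: "is_kernel tens \<Psi>1 w1 \<Psi>2 w2 S K" and f: "f \<in> coorbit \<Psi>1 1 w1"
  shows "S f = kernel_action K f"
proof
  fix j
  note kd = is_kernelD[OF K]
  have "S f \<in> coorbit \<Psi>2 \<infinity> (recip w2)" using S f by (simp add: linear_between_def)
  then have "S f j = pairing \<Psi>2 1 w2 (S f) (analysis (dual_frame \<Psi>2) (dual_frame \<Psi>2 j))"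
    unfolding pairing_eq[OF dual_atom2(1)] dual_atom2(2) infsum_P2 by (simp add: R2.coorbit_eq)
  also have "\<dots> = (\<Sum>\<^sub>\<infinity>i. G1 f i * (\<Sum>\<^sub>\<infinity>l. K i l * cnj (F2.P l j)))"
    unfolding kd(3)[OF f dual_atom2(1)] pairing2_eq(1)[OF kd(2) f dual_atom2(1)] dual_atom2(2) ..
  also have "\<dots> = kernel_action K f j"
    unfolding infsum_P2 kernel_action_def using kd(1) by (simp add: biinvariant_def)
  finally show "S f j = kernel_action K f j" .
qed

text \<open>Applied to dual frame vectors, summation against the kernel returns the rows of the
  kernel. In particular kernels are unique.\<close>

lemma kernel_eq_galerkin:
  assumes S: "linear_between (coorbit \<Psi>1 1 w1) (coorbit \<Psi>2 \<infinity> (recip w2)) S"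
    and K: "is_kernel tens \<Psi>1 w1 \<Psi>2 w2 S K"
  shows "K = galerkin \<Psi>1 \<Psi>2 w2 S"
  unfolding galerkin_eq[OF S] operator_eq_kernel_action[OF S K atom1_in[OF order_refl]]
  by (intro ext) (simp add: kernel_action_atom[OF is_kernelD(1)[OF K]])

lemma wnorm_finite_support:
  assumes p: "1 \<le> p" and F: "finite F"
  shows "wnorm p w1 (\<lambda>i. if i \<in> F then c i else 0) < \<infinity>"
proof -
  have "wnorm 1 w1 (\<lambda>i. if i \<in> F then c i else 0) = (\<Sum>i\<in>F. ennreal (cmod (c i) * w1 i))"
    unfolding wnorm_one by (subst infsum_ennreal_finite_support[OF F]) auto
  also have "\<dots> < \<infinity>" using F by (simp add: less_top)
  finally show ?thesis by (rule order.strict_trans1[OF wnorm_le_wnorm_one[OF p]])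
qed

lemma truncate_if: "truncate n c = (\<lambda>i. if i \<in> {k. to_nat k < n} then c i else 0)"
  by (auto simp: truncate_def)

lemma wnorm_truncate_finite: "1 \<le> p \<Longrightarrow> wnorm p w1 (truncate n c) < \<infinity>"
  unfolding truncate_if by (intro wnorm_finite_support finite_to_nat_less)

text \<open>Finite combinations of dual frame vectors are where every linear extension can be
  computed; the tests in the converse of Hoelder's inequality are of this kind.\<close>

lemma linear_finite:
  assumes p: "1 \<le> p" and T: "linear_between (coorbit \<Psi>1 p w1) Y T" and F: "finite F"
  shows "T (combine (\<lambda>i. if i \<in> F then c i else 0)) j = (\<Sum>i\<in>F. c i * T (atom1 i) j)"
proof -
  note fin = wnorm_finite_support[OF p]
  have lin: "T (\<lambda>i. a * f i + b * g i) = (\<lambda>j. a * T f j + b * T g j)"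
    if "f \<in> coorbit \<Psi>1 p w1" "g \<in> coorbit \<Psi>1 p w1" for f g a b
    using T that unfolding linear_between_def by blast
  show "T (combine (\<lambda>i. if i \<in> F then c i else 0)) j = (\<Sum>i\<in>F. c i * T (atom1 i) j)"
    using F
  proof (induction F)
    case empty
    have "combine (\<lambda>i. 0) = (\<lambda>i. 0)" by (simp add: combine_def mat_vec_def)
    moreover have "T (\<lambda>i. 0) = (\<lambda>j. 0)"
      using lin[OF atom1_in[OF p] atom1_in[OF p], where a=0 and b=0] by simp
    ultimately show ?case by simp
  next
    case (insert x F)
    let ?c = "\<lambda>i. if i \<in> F then c i else 0" and ?e = "\<lambda>k. if k = x then 1 else 0 :: complex"
    have e: "wnorm p w1 ?e < \<infinity>" using wnorm_unit_le[OF p, of w1 x] by (auto elim!: order.strict_trans1)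
    have "(\<lambda>i. if i \<in> insert x F then c i else 0) = (\<lambda>i. 1 * ?c i + c x * ?e i)"
      using insert.hyps by auto
    then have "combine (\<lambda>i. if i \<in> insert x F then c i else 0) = (\<lambda>i. 1 * combine ?c i + c x * atom1 x i)"
      unfolding atom1_eq combine_def
      by (simp only: W1.mat_vec_linear_in[OF F1.dual_gram_in wbounded_if_wnorm_finite[OF p fin[OF insert.hyps(1)]]
            wbounded_if_wnorm_finite[OF p e]])
    then have "T (combine (\<lambda>i. if i \<in> insert x F then c i else 0)) = (\<lambda>j. 1 * T (combine ?c) j + c x * T (atom1 x) j)"
      by (simp only: lin[OF combine_in[OF p fin[OF insert.hyps(1)]] atom1_in[OF p]])
    then show ?case using insert by simp
  qed
qed

lemma linear_truncate:
  assumes p: "1 \<le> p" and T: "linear_between (coorbit \<Psi>1 p w1) Y T"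
  shows "T (combine (truncate n c)) j = (\<Sum>\<^sub>\<infinity>i. truncate n c i * T (atom1 i) j)"
proof -
  let ?F = "{k::'i. to_nat k < n}"
  have "(\<Sum>\<^sub>\<infinity>i. truncate n c i * T (atom1 i) j) = (\<Sum>i\<in>?F. c i * T (atom1 i) j)"
    by (rule infsumI, rule has_sum_finite_neutralI[OF finite_to_nat_less]) (auto simp: truncate_def)
  then show ?thesis unfolding truncate_if[of n c] using linear_finite[OF p T finite_to_nat_less] by simp
qed

lemma operator_norm_scaled:
  assumes p: "1 \<le> p" and r: "1 \<le> r" and T: "linear_between (coorbit \<Psi>1 p w1) Y T"
    and f: "f \<in> coorbit \<Psi>1 p w1" and b: "wnorm p w1 f \<le> ennreal b" "b > 0"
  shows "wnorm r v (T f) \<le> ennreal b * operator_norm \<Psi>1 p w1 r v T"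
proof -
  define a where "a = complex_of_real (1 / b)"
  have "T (\<lambda>i. a * f i + 0 * f i) = (\<lambda>j. a * T f j + 0 * T f j)"
    using T f unfolding linear_between_def by blast
  then have eq: "T (\<lambda>i. a * f i) = (\<lambda>j. a * T f j)" by simp
  have ca: "ennreal (cmod a) = ennreal (1 / b)" using b by (simp add: a_def norm_divide)
  have bb: "ennreal b * ennreal (1 / b) = 1" using b by (simp flip: ennreal_mult)
  have "wnorm p w1 (\<lambda>i. a * f i) \<le> ennreal (1 / b) * ennreal b"
    unfolding wnorm_cmult[OF p] ca by (intro mult_left_mono b) simp
  then have le: "wnorm p w1 (\<lambda>i. a * f i) \<le> 1" using bb by (simp add: mult.commute)
  have "mat_vec F1.P (\<lambda>i. a * f i) = (\<lambda>i. a * mat_vec F1.P f i)"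
    unfolding mat_vec_def by (simp add: mult.left_commute[of _ a] infsum_cmult_right')
  then have "(\<lambda>i. a * f i) \<in> coorbit \<Psi>1 p w1"
    using f le unfolding coorbit1[OF p] by (auto elim!: order.strict_trans1)
  then have "wnorm r v (T (\<lambda>i. a * f i)) \<le> operator_norm \<Psi>1 p w1 r v T"
    unfolding operator_norm_def using le by (intro SUP_upper) auto
  then have "ennreal b * (ennreal (1 / b) * wnorm r v (T f)) \<le> ennreal b * operator_norm \<Psi>1 p w1 r v T"
    unfolding eq wnorm_cmult[OF r] ca by (intro mult_left_mono) auto
  then show ?thesis by (simp add: mult.assoc[symmetric] bb)
qed

lemma operator_norm_finite:
  assumes "bounded_between \<Psi>1 p w1 \<Psi>2 r v T"
  shows "operator_norm \<Psi>1 p w1 r v T < \<infinity>"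
proof -
  obtain C where C: "\<And>f. f \<in> coorbit \<Psi>1 p w1 \<Longrightarrow> wnorm r v (T f) \<le> ennreal C * wnorm p w1 f"
    using assms unfolding bounded_between_def by blast
  have "operator_norm \<Psi>1 p w1 r v T \<le> ennreal C * 1"
    unfolding operator_norm_def
  proof (rule SUP_least)
    fix f assume f: "f \<in> {f \<in> coorbit \<Psi>1 p w1. wnorm p w1 f \<le> 1}"
    then have "wnorm r v (T f) \<le> ennreal C * wnorm p w1 f" using C by blast
    also have "\<dots> \<le> ennreal C * 1" using f by (intro mult_left_mono) auto
    finally show "wnorm r v (T f) \<le> ennreal C * 1" .
  qed
  also have "\<dots> < \<infinity>" by simp
  finally show ?thesis .
qed

lemma bounded_entry_le:
  assumes "wnorm \<infinity> (recip w2) g \<le> K"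
  shows "ennreal (cmod (g j)) \<le> K * ennreal (w2 j)"
proof -
  have "ennreal (cmod (g j)) \<le> wnorm \<infinity> (recip w2) g * ennreal (1 / recip w2 j)"
    by (rule entry_le_of_wnorm[OF recip_pos(2)])
  also have "\<dots> \<le> K * ennreal (w2 j)"
    unfolding one_div_recip by (intro mult_right_mono assms) simp
  finally show ?thesis .
qed

text \<open>Truncations converge in norm when the exponent is finite.\<close>

lemma bounded_truncate_tendsto:
  assumes p: "1 \<le> p" "p \<noteq> \<infinity>" and T: "bounded_between \<Psi>1 p w1 \<Psi>2 \<infinity> (recip w2) T"
    and c: "wnorm p w1 c < \<infinity>"
  shows "(\<lambda>n. T (combine (truncate n c)) j) \<longlonglongrightarrow> T (combine c) j"
proof (rule LIM_zero_cancel, rule tendsto_norm_zero_cancel)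
  have lin: "linear_between (coorbit \<Psi>1 p w1) (coorbit \<Psi>2 \<infinity> (recip w2)) T"
    using T unfolding bounded_between_def by blast
  obtain C0 where C0: "\<And>f. f \<in> coorbit \<Psi>1 p w1 \<Longrightarrow> wnorm \<infinity> (recip w2) (T f) \<le> ennreal C0 * wnorm p w1 f"
    using T unfolding bounded_between_def by blast
  obtain B where B: "abs_bounded p w1 F1.dual_gram B" using good_weightD[OF good1 F1.dual_gram_in p(1)] by auto
  have tr: "wnorm p w1 (truncate n c) < \<infinity>" for n by (rule wnorm_truncate_finite[OF p(1)])
  have dc: "wnorm p w1 (\<lambda>i. truncate n c i - c i) < \<infinity>" for n
  proof -
    have "wnorm p w1 (\<lambda>i. truncate n c i - c i) \<le> wnorm p w1 c"
      unfolding wnorm_def by (rule lp_norm_mono[OF p(1)]) (auto simp: truncate_def)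
    then show ?thesis using c by (rule order.strict_trans1)
  qed
  have le: "ennreal (cmod (T (combine (truncate n c)) j - T (combine c) j))
      \<le> ennreal C0 * (ennreal B * wnorm p w1 (\<lambda>i. truncate n c i - c i)) * ennreal (w2 j)" for n
  proof -
    have "T (\<lambda>i. 1 * combine (truncate n c) i + (-1) * combine c i)
        = (\<lambda>j. 1 * T (combine (truncate n c)) j + (-1) * T (combine c) j)"
      using lin combine_in[OF p(1) tr[of n]] combine_in[OF p(1) c] unfolding linear_between_def by blast
    moreover have "combine (\<lambda>i. 1 * truncate n c i + (-1) * c i) = (\<lambda>i. 1 * combine (truncate n c) i + (-1) * combine c i)"
      unfolding combine_def
      by (rule W1.mat_vec_linear_in[OF F1.dual_gram_in wbounded_if_wnorm_finite[OF p(1) tr]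
            wbounded_if_wnorm_finite[OF p(1) c]])
    ultimately have "T (combine (truncate n c)) j - T (combine c) j = T (combine (\<lambda>i. truncate n c i - c i)) j"
      by simp
    then have "ennreal (cmod (T (combine (truncate n c)) j - T (combine c) j))
        \<le> ennreal C0 * wnorm p w1 (combine (\<lambda>i. truncate n c i - c i)) * ennreal (w2 j)"
      using bounded_entry_le[OF C0[OF combine_in[OF p(1) dc]]] by simp
    also have "\<dots> \<le> ennreal C0 * (ennreal B * wnorm p w1 (\<lambda>i. truncate n c i - c i)) * ennreal (w2 j)"
      unfolding combine_def
      by (intro mult_right_mono mult_left_mono wnorm_mat_vec_le[OF B p(1) W1.w_pos]) auto
    finally show ?thesis .
  qed
  have "(\<lambda>n. ennreal C0 * (ennreal B * wnorm p w1 (\<lambda>i. truncate n c i - c i)) * ennreal (w2 j))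
      \<longlonglongrightarrow> ennreal C0 * (ennreal B * 0) * ennreal (w2 j)"
    by (intro tendsto_mult_ennreal tendsto_const wnorm_truncate_tendsto p c) auto
  then have "(\<lambda>n. ennreal C0 * (ennreal B * wnorm p w1 (\<lambda>i. truncate n c i - c i)) * ennreal (w2 j)) \<longlonglongrightarrow> 0"
    by simp
  from ennreal_tendsto_0_mono[OF le this]
  have "(\<lambda>n. ennreal (cmod (T (combine (truncate n c)) j - T (combine c) j))) \<longlonglongrightarrow> ennreal 0" by simp
  then show "(\<lambda>n. cmod (T (combine (truncate n c)) j - T (combine c) j)) \<longlonglongrightarrow> 0"
    by (rule tendsto_ennrealD) auto
qed

text \<open>Both sides are limits of the values at truncations, the left one by continuity of \<open>S\<close>,
  the right one by dominated convergence.\<close>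

lemma bounded_expansion:
  assumes S: "bounded_between \<Psi>1 1 w1 \<Psi>2 \<infinity> (recip w2) S" and c: "wnorm 1 w1 c < \<infinity>"
  shows "S (combine c) j = (\<Sum>\<^sub>\<infinity>i. c i * S (atom1 i) j)"
proof -
  have lin: "linear_between (coorbit \<Psi>1 1 w1) (coorbit \<Psi>2 \<infinity> (recip w2)) S"
    using S unfolding bounded_between_def by blast
  obtain C0 where C0: "\<And>f. f \<in> coorbit \<Psi>1 1 w1 \<Longrightarrow> wnorm \<infinity> (recip w2) (S f) \<le> ennreal C0 * wnorm 1 w1 f"
    using S unfolding bounded_between_def by blast
  obtain B where B: "abs_bounded 1 w1 F1.dual_gram B" using good_weightD[OF good1 F1.dual_gram_in, of 1] by auto
  have "(\<lambda>n. S (combine (truncate n c)) j) \<longlonglongrightarrow> S (combine c) j"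
    by (rule bounded_truncate_tendsto[OF _ _ S c]) auto
  moreover have "(\<lambda>n. \<Sum>\<^sub>\<infinity>i. truncate n c i * S (atom1 i) j) \<longlonglongrightarrow> (\<Sum>\<^sub>\<infinity>i. c i * S (atom1 i) j)"
  proof (rule infsum_dominated_convergence)
    show "(\<lambda>n. truncate n c i * S (atom1 i) j) \<longlonglongrightarrow> c i * S (atom1 i) j" for i
      by (intro tendsto_mult truncate_tendsto tendsto_const)
    have at: "wnorm 1 w1 (atom1 i) \<le> ennreal B * ennreal (w1 i)" for i
      unfolding atom1_eq combine_def
      by (rule order.trans[OF wnorm_mat_vec_le[OF B order_refl W1.w_pos] mult_left_mono[OF wnorm_unit_le]]) auto
    show "ennreal (cmod (truncate n c i * S (atom1 i) j))
        \<le> (ennreal C0 * ennreal B * ennreal (w2 j)) * ennreal (cmod (c i) * w1 i)" for n i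
    proof -
      have "ennreal (cmod (truncate n c i * S (atom1 i) j)) \<le> ennreal (cmod (c i)) * ennreal (cmod (S (atom1 i) j))"
        by (simp add: truncate_def norm_mult ennreal_mult)
      also have "\<dots> \<le> ennreal (cmod (c i)) * (ennreal C0 * (ennreal B * ennreal (w1 i)) * ennreal (w2 j))"
        by (intro mult_left_mono order.trans[OF bounded_entry_le[OF C0[OF atom1_in[OF order_refl]]]] mult_right_mono at) auto
      also have "\<dots> = (ennreal C0 * ennreal B * ennreal (w2 j)) * ennreal (cmod (c i) * w1 i)"
        using W1.w_pos[of i] by (simp add: ennreal_mult mult_ac)
      finally show ?thesis .
    qed
    have "(\<Sum>\<^sub>\<infinity>i. (ennreal C0 * ennreal B * ennreal (w2 j)) * ennreal (cmod (c i) * w1 i))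
        = (ennreal C0 * ennreal B * ennreal (w2 j)) * wnorm 1 w1 c"
      by (simp only: infsum_ennreal_cmult wnorm_one)
    also have "\<dots> < \<infinity>" using c by (simp add: ennreal_mult_less_top less_top)
    finally show "(\<Sum>\<^sub>\<infinity>i. (ennreal C0 * ennreal B * ennreal (w2 j)) * ennreal (cmod (c i) * w1 i)) < \<infinity>" .
  qed
  ultimately show ?thesis
    unfolding linear_truncate[OF order_refl lin] by (rule LIMSEQ_unique)
qed

text \<open>The kernel is the matrix of the images of the dual frame vectors. Its rows are fixed by
  the projection of \<open>\<Psi>2\<close>, as coefficient sequences; its columns are fixed by the conjugate
  projection of \<open>\<Psi>1\<close>, since the expansion of a dual frame vector in the dual frame itself has
  the coefficients \<open>P\<close>.\<close>

lemma kernel_exists_unique: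
  assumes S: "bounded_between \<Psi>1 1 w1 \<Psi>2 \<infinity> (recip w2) S"
  shows "\<exists>!K. is_kernel tens \<Psi>1 w1 \<Psi>2 w2 S K"
proof -
  have lin: "linear_between (coorbit \<Psi>1 1 w1) (coorbit \<Psi>2 \<infinity> (recip w2)) S"
    using S unfolding bounded_between_def by blast
  define K where "K i j = S (atom1 i) j" for i j
  have inv: "biinvariant K"
    unfolding biinvariant_def
  proof (intro conjI allI)
    fix i
    have "S (atom1 i) \<in> coorbit \<Psi>2 \<infinity> (recip w2)" using lin atom1_in[of 1 i] by (simp add: linear_between_def)
    then show "mat_vec F2.P (K i) = K i" by (simp add: K_def[abs_def] R2.coorbit_eq)
  next
    fix j
    show "mat_vec cP1 (\<lambda>i. K i j) = (\<lambda>i. K i j)"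
    proof
      fix i
      have "mat_vec cP1 (\<lambda>i. K i j) i = (\<Sum>\<^sub>\<infinity>a. G1 (atom1 i) a * S (atom1 a) j)"
        unfolding mat_vec_def[of cP1] gram_atom1 unfolding cP1_def F1.P_adjoint K_def ..
      also have "\<dots> = S (combine (G1 (atom1 i))) j"
        by (rule bounded_expansion[OF S combine_gram(2)[OF order_refl atom1_in[OF order_refl]], symmetric])
      also have "\<dots> = K i j" by (simp add: combine_gram(1)[OF order_refl atom1_in[OF order_refl]] K_def)
      finally show "mat_vec cP1 (\<lambda>i. K i j) i = K i j" .
    qed
  qed
  obtain B where B: "abs_bounded 1 w1 F1.dual_gram B" "B > 0"
    using good_weightD[OF good1 F1.dual_gram_in, of 1] by (auto simp: abs_bounded_def)
  have norm: "mixed_norm \<infinity> \<infinity> kernel_weight K < \<infinity>"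
  proof -
    have "mixed_norm \<infinity> \<infinity> (tensor_weight (recip w2) (recip w1)) (\<lambda>j i. K i j)
        \<le> ennreal B * operator_norm \<Psi>1 1 w1 \<infinity> (recip w2) S"
    proof (rule mixed_norm_le_if_columns[OF _ recip_pos(2,1)])
      fix i
      have "wnorm 1 w1 (atom1 i) \<le> ennreal B * ennreal (w1 i)"
        unfolding atom1_eq combine_def
        by (rule order.trans[OF wnorm_mat_vec_le[OF B(1) order_refl W1.w_pos] mult_left_mono[OF wnorm_unit_le]]) auto
      also have "\<dots> = ennreal (B * w1 i)" using B W1.w_pos[of i] by (simp add: ennreal_mult)
      finally have at: "wnorm 1 w1 (atom1 i) \<le> ennreal (B * w1 i)" .
      have "wnorm \<infinity> (recip w2) (S (atom1 i)) \<le> ennreal (B * w1 i) * operator_norm \<Psi>1 1 w1 \<infinity> (recip w2) S"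
        by (rule operator_norm_scaled[OF order_refl _ lin atom1_in[OF order_refl] at]) (use B W1.w_pos in auto)
      then show "wnorm \<infinity> (recip w2) (\<lambda>j. K i j)
          \<le> ennreal B * operator_norm \<Psi>1 1 w1 \<infinity> (recip w2) S * ennreal (1 / recip w1 i)"
        using B W1.w_pos[of i] by (simp add: one_div_recip K_def ennreal_mult mult_ac)
    qed simp
    also have "\<dots> < \<infinity>" using operator_norm_finite[OF S] by (simp add: ennreal_mult_less_top less_top)
    finally show ?thesis unfolding mixed_norm_infty_swap[of "recip w2" "recip w1" K] .
  qed
  have "is_kernel tens \<Psi>1 w1 \<Psi>2 w2 S K"
    unfolding is_kernel_def recip2_kernel_weight
  proof (intro conjI ballI)
    show "K \<in> coorbit2_inf tens \<Psi>1 \<Psi>2 \<infinity> kernel_weight"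
      by (rule coorbit2_infI[OF good1r good2r _ inv norm]) simp
    fix f1 f2 assume f1: "f1 \<in> coorbit \<Psi>1 1 w1" and f2: "f2 \<in> coorbit \<Psi>2 1 w2"
    have "(\<Sum>\<^sub>\<infinity>i. G1 f1 i * K i j) = S f1 j" for j
      using bounded_expansion[OF S combine_gram(2)[OF order_refl f1], of j]
      by (simp add: combine_gram(1)[OF order_refl f1] K_def)
    then show "pairing \<Psi>2 1 w2 (S f1) f2 = pairing2 tens \<Psi>1 \<Psi>2 (tensor_weight w1 w2) K (simple_tensor f1 f2)"
      unfolding pairing_eq[OF f2] pairing2_eq(2)[OF norm f1 f2] by simp
  qed
  moreover have "L = K" if "is_kernel tens \<Psi>1 w1 \<Psi>2 w2 S L" for L
    using kernel_eq_galerkin[OF lin that] galerkin_eq[OF lin] by (simp add: K_def fun_eq_iff)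
  ultimately show ?thesis by blast
qed

end

section \<open>Operators from and into the extreme spaces\<close>

context kernel_setting
begin

lemma atom1_norm_le:
  assumes "1 \<le> p" "abs_bounded p w1 F1.dual_gram B"
  shows "wnorm p w1 (atom1 i) \<le> ennreal (B * w1 i)"
proof -
  have "B > 0" using assms(2) by (simp add: abs_bounded_def)
  then have "ennreal (B * w1 i) = ennreal B * ennreal (w1 i)" using W1.w_pos[of i] by (simp add: ennreal_mult)
  then show ?thesis
    unfolding atom1_eq combine_def
    using order.trans[OF wnorm_mat_vec_le[OF assms(2,1) W1.w_pos] mult_left_mono[OF wnorm_unit_le[OF assms(1)]]]
    by simp
qed

text \<open>The rows of the kernel are the images of the dual frame vectors, which are uniformly
  bounded up to the weight.\<close>

lemma row_norm_le_operator_norm: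
  assumes p: "1 \<le> p" and S: "linear_between (coorbit \<Psi>1 1 w1) Y S"
    and K: "\<And>i. K i = S (atom1 i)" and B: "abs_bounded 1 w1 F1.dual_gram B"
  shows "mixed_norm_fr p \<infinity> kernel_weight K \<le> ennreal B * operator_norm \<Psi>1 1 w1 p (recip w2) S"
  unfolding mixed_norm_fr_swap
proof (rule mixed_norm_le_if_columns[OF p recip_pos(2,1)])
  fix i
  have B0: "B > 0" using B by (simp add: abs_bounded_def)
  have "wnorm p (recip w2) (S (atom1 i)) \<le> ennreal (B * w1 i) * operator_norm \<Psi>1 1 w1 p (recip w2) S"
    by (rule operator_norm_scaled[OF order_refl p S atom1_in[OF order_refl] atom1_norm_le[OF order_refl B]])
      (use B0 W1.w_pos in auto)
  then show "wnorm p (recip w2) (\<lambda>j. K i j)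
      \<le> ennreal B * operator_norm \<Psi>1 1 w1 p (recip w2) S * ennreal (1 / recip w1 i)"
    using B0 W1.w_pos[of i] by (simp add: one_div_recip K ennreal_mult mult_ac)
qed

text \<open>Minkowski's inequality for the superposition of the rows.\<close>

lemma kernel_action_norm_le_rows:
  assumes p: "1 \<le> p" and B: "abs_bounded 1 w1 (gram \<Psi>1) B"
  shows "wnorm p (recip w2) (kernel_action K f)
    \<le> ennreal B * mixed_norm_fr p \<infinity> kernel_weight K * wnorm 1 w1 f"
proof -
  let ?\<kappa> = "mixed_norm_fr p \<infinity> kernel_weight K"
  have row: "wnorm p (recip w2) (K i) \<le> ?\<kappa> * ennreal (w1 i)" for i
    using column_norm_le[OF p recip_pos(2,1) order_refl, where K="\<lambda>j i. K i j" and j=i]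
    unfolding mixed_norm_fr_swap[symmetric] one_div_recip .
  have "wnorm p (recip w2) (kernel_action K f)
      \<le> lp_norm p (\<lambda>j. \<Sum>\<^sub>\<infinity>i. ennreal (cmod (G1 f i)) * ennreal (cmod (K i j) * recip w2 j))"
    unfolding wnorm_def
  proof (rule lp_norm_mono[OF p])
    fix j
    have "ennreal (cmod (kernel_action K f j)) * ennreal (recip w2 j)
        \<le> (\<Sum>\<^sub>\<infinity>i. ennreal (cmod (G1 f i * K i j))) * ennreal (recip w2 j)"
      unfolding kernel_action_def by (intro mult_right_mono cmod_infsum_le) simp
    also have "\<dots> = (\<Sum>\<^sub>\<infinity>i. ennreal (cmod (G1 f i)) * ennreal (cmod (K i j) * recip w2 j))"
      unfolding infsum_ennreal_cmult_right[symmetric] using recip_pos(2)[of j]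
      by (intro infsum_cong) (simp add: norm_mult mult.assoc flip: ennreal_mult)
    finally show "ennreal (cmod (kernel_action K f j) * recip w2 j)
        \<le> (\<Sum>\<^sub>\<infinity>i. ennreal (cmod (G1 f i)) * ennreal (cmod (K i j) * recip w2 j))"
      using recip_pos(2)[of j] by (simp add: ennreal_mult)
  qed
  also have "\<dots> \<le> (\<Sum>\<^sub>\<infinity>i. ennreal (cmod (G1 f i)) * wnorm p (recip w2) (K i))"
    unfolding wnorm_def by (rule lp_norm_infsum_le[OF p])
  also have "\<dots> \<le> (\<Sum>\<^sub>\<infinity>i. ennreal (cmod (G1 f i)) * (?\<kappa> * ennreal (w1 i)))"
    by (intro infsum_ennreal_mono mult_left_mono row) simp
  also have "\<dots> = (\<Sum>\<^sub>\<infinity>i. ?\<kappa> * ennreal (cmod (G1 f i) * w1 i))"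
    using W1.w_pos by (intro infsum_cong) (simp add: ennreal_mult less_imp_le mult_ac)
  also have "\<dots> = ?\<kappa> * wnorm 1 w1 (G1 f)" by (simp only: infsum_ennreal_cmult wnorm_one)
  also have "\<dots> \<le> ?\<kappa> * (ennreal B * wnorm 1 w1 f)"
    by (intro mult_left_mono wnorm_mat_vec_le[OF B order_refl W1.w_pos]) simp
  finally show ?thesis by (simp add: mult_ac)
qed

lemma bounded_into_infty:
  assumes p: "1 \<le> p" and S: "bounded_between \<Psi>1 r w1 \<Psi>2 p (recip w2) S"
  shows "bounded_between \<Psi>1 r w1 \<Psi>2 \<infinity> (recip w2) S"
proof -
  have "coorbit \<Psi>2 p (recip w2) \<subseteq> coorbit \<Psi>2 \<infinity> (recip w2)"
    using order.strict_trans1[OF wnorm_infty_le_wnorm[OF p, of "recip w2"]] by (auto simp: coorbit2[OF p] R2.coorbit_eq)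
  moreover obtain C where "\<And>f. f \<in> coorbit \<Psi>1 r w1 \<Longrightarrow> wnorm p (recip w2) (S f) \<le> ennreal C * wnorm r w1 f"
    using S unfolding bounded_between_def by blast
  then have "\<And>f. f \<in> coorbit \<Psi>1 r w1 \<Longrightarrow> wnorm \<infinity> (recip w2) (S f) \<le> ennreal C * wnorm r w1 f"
    using order.trans[OF wnorm_infty_le_wnorm[OF p, of "recip w2"]] by blast
  ultimately show ?thesis using S unfolding bounded_between_def linear_between_def by blast
qed

text \<open>The right hand side forces the values of \<open>S\<close>, which a priori lie in the space with
  exponent \<open>\<infinity>\<close>, into the smaller space.\<close>

lemma bounded_iff_rows:
  assumes p: "1 \<le> p" and S: "linear_between (coorbit \<Psi>1 1 w1) (coorbit \<Psi>2 \<infinity> (recip w2)) S"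
    and K: "is_kernel tens \<Psi>1 w1 \<Psi>2 w2 S K"
  shows "bounded_between \<Psi>1 1 w1 \<Psi>2 p (recip w2) S \<longleftrightarrow> mixed_norm_fr p \<infinity> kernel_weight K < \<infinity>"
proof
  assume bounded: "bounded_between \<Psi>1 1 w1 \<Psi>2 p (recip w2) S"
  obtain B where B: "abs_bounded 1 w1 F1.dual_gram B" using good_weightD[OF good1 F1.dual_gram_in, of 1] by auto
  have "mixed_norm_fr p \<infinity> kernel_weight K \<le> ennreal B * operator_norm \<Psi>1 1 w1 p (recip w2) S"
    by (rule row_norm_le_operator_norm[OF p S _ B]) (simp add: kernel_eq_galerkin[OF S K] galerkin_eq[OF S])
  also have "\<dots> < \<infinity>" using operator_norm_finite[OF bounded] by (simp add: ennreal_mult_less_top less_top)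
  finally show "mixed_norm_fr p \<infinity> kernel_weight K < \<infinity>" .
next
  assume fin: "mixed_norm_fr p \<infinity> kernel_weight K < \<infinity>"
  obtain B where B: "abs_bounded 1 w1 (gram \<Psi>1) B" using good_weightD[OF good1 F1.gram_in, of 1] by auto
  obtain C where C: "ennreal B * mixed_norm_fr p \<infinity> kernel_weight K = ennreal C"
    using fin by (cases "ennreal B * mixed_norm_fr p \<infinity> kernel_weight K") (auto simp: ennreal_mult_eq_top_iff)
  have le: "wnorm p (recip w2) (S f) \<le> ennreal C * wnorm 1 w1 f" if "f \<in> coorbit \<Psi>1 1 w1" for f
    unfolding operator_eq_kernel_action[OF S K that] C[symmetric] by (rule kernel_action_norm_le_rows[OF p B])
  have "S f \<in> coorbit \<Psi>2 p (recip w2)" if f: "f \<in> coorbit \<Psi>1 1 w1" for f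
  proof -
    have "ennreal C * wnorm 1 w1 f < \<infinity>" using f by (simp add: coorbit1 ennreal_mult_less_top less_top)
    moreover have "mat_vec F2.P (S f) = S f" using S f by (simp add: linear_between_def R2.coorbit_eq)
    ultimately show ?thesis unfolding coorbit2[OF p] using le[OF f] by (auto elim!: order.strict_trans1)
  qed
  then show "bounded_between \<Psi>1 1 w1 \<Psi>2 p (recip w2) S"
    using S le unfolding bounded_between_def linear_between_def by blast
qed

text \<open>The columns of the kernel: by the converse of Hoelder's inequality it suffices to test
  with finitely supported sequences, for which only linearity is used.\<close>

lemma column_norm_le_operator_norm:
  assumes pq: "conjugate p q" and T: "linear_between (coorbit \<Psi>1 p w1) Y T"
    and K: "\<And>i. K i = T (atom1 i)" and B: "abs_bounded p w1 F1.dual_gram B"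
  shows "mixed_norm q \<infinity> kernel_weight K \<le> ennreal B * operator_norm \<Psi>1 p w1 \<infinity> (recip w2) T"
proof (rule mixed_norm_le_if_columns[OF _ recip_pos])
  have p: "1 \<le> p" and q: "1 \<le> q" using pq by (auto simp: conjugate_def)
  show "1 \<le> q" by (rule q)
  have B0: "B > 0" using B by (simp add: abs_bounded_def)
  fix j
  let ?M = "ennreal B * operator_norm \<Psi>1 p w1 \<infinity> (recip w2) T * ennreal (1 / recip w2 j)"
  show "wnorm q (recip w1) (\<lambda>i. K i j) \<le> ?M"
    unfolding wnorm_def
  proof (rule lp_norm_le_by_duality[OF conjugate_sym[OF pq]])
    fix b :: "'i \<Rightarrow> real"
    assume fb: "finite {k. b k \<noteq> 0}" and b0: "\<And>k. 0 \<le> b k" and b1: "lp_norm p (\<lambda>k. ennreal (b k)) \<le> 1"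
    define F where "F = {k. b k \<noteq> 0}"
    have F: "finite F" using fb by (simp add: F_def)
    \<comment> \<open>the phases turn the value of \<open>T\<close> at this combination into the tested sum\<close>
    define c where "c i = complex_of_real (b i * recip w1 i) * cnj (sgn (K i j))" for i
    let ?c = "\<lambda>i. if i \<in> F then c i else 0"
    have cb: "cmod (c i) * w1 i \<le> b i" for i
    proof -
      have "cmod (c i) = b i * recip w1 i * cmod (sgn (K i j))"
        unfolding c_def using b0[of i] recip_pos(1)[of i] by (simp add: norm_mult)
      also have "\<dots> \<le> b i * recip w1 i * 1"
        using b0[of i] recip_pos(1)[of i] by (intro mult_left_mono) (auto simp: norm_sgn)
      finally have "cmod (c i) * w1 i \<le> b i * recip w1 i * w1 i"
        using W1.w_pos[of i] by (intro mult_right_mono) auto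
      then show ?thesis using W1.w_pos[of i] by (simp add: recip_def)
    qed
    have "wnorm p w1 ?c \<le> lp_norm p (\<lambda>k. ennreal (b k))"
      unfolding wnorm_def using cb b0 by (intro lp_norm_mono[OF p] ennreal_leI) auto
    also have "\<dots> \<le> 1" by (rule b1)
    finally have c1: "wnorm p w1 ?c \<le> 1" .
    have "wnorm p w1 (combine ?c) \<le> ennreal B * wnorm p w1 ?c"
      unfolding combine_def by (rule wnorm_mat_vec_le[OF B p W1.w_pos])
    also have "\<dots> \<le> ennreal B * 1" by (intro mult_left_mono c1) simp
    finally have combine: "wnorm p w1 (combine ?c) \<le> ennreal B" by simp
    have "wnorm \<infinity> (recip w2) (T (combine ?c)) \<le> ennreal B * operator_norm \<Psi>1 p w1 \<infinity> (recip w2) T"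
      by (rule operator_norm_scaled[OF p _ T combine_in[OF p wnorm_finite_support[OF p F]] combine B0]) simp
    from bounded_entry_le[OF this, of j] have entry: "ennreal (cmod (T (combine ?c) j)) \<le> ?M"
      by (simp add: one_div_recip)
    have "c i * K i j = complex_of_real (cmod (K i j) * recip w1 i * b i)" for i
    proof -
      have "cnj (sgn (K i j)) * K i j = complex_of_real (cmod (K i j))"
      proof (cases "K i j = 0")
        case False
        have "cnj (sgn (K i j)) * K i j = K i j * cnj (K i j) / complex_of_real (cmod (K i j))"
          by (simp add: sgn_eq)
        also have "\<dots> = complex_of_real (cmod (K i j))"
          using False by (simp add: power2_eq_square flip: complex_norm_square)
        finally show ?thesis .
      qed simp
      then show ?thesis by (simp add: c_def mult_ac)
    qed
    then have "T (combine ?c) j = complex_of_real (\<Sum>i\<in>F. cmod (K i j) * recip w1 i * b i)"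
      unfolding linear_finite[OF p T F] by (simp add: K)
    moreover have "0 \<le> (\<Sum>i\<in>F. cmod (K i j) * recip w1 i * b i)"
      using b0 recip_pos(1) by (intro sum_nonneg) (simp add: less_imp_le)
    ultimately have "ennreal (cmod (T (combine ?c) j)) = ennreal (\<Sum>i\<in>F. cmod (K i j) * recip w1 i * b i)"
      by (simp only: norm_of_real abs_of_nonneg)
    also have "\<dots> = (\<Sum>i\<in>F. ennreal (cmod (K i j) * recip w1 i) * ennreal (b i))"
      using b0 recip_pos(1) by (subst sum_ennreal[symmetric]) (auto simp: less_imp_le ennreal_mult)
    also have "\<dots> = (\<Sum>\<^sub>\<infinity>i. ennreal (cmod (K i j) * recip w1 i) * ennreal (b i))"
      by (rule infsum_ennreal_finite_support[OF F, symmetric]) (simp add: F_def)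
    finally show "(\<Sum>\<^sub>\<infinity>i. ennreal (cmod (K i j) * recip w1 i) * ennreal (b i)) \<le> ?M" using entry by simp
  qed
qed

context
  fixes p q K
  assumes pq: "conjugate p q" and K: "biinvariant K"
    and fin: "mixed_norm q \<infinity> kernel_weight K < \<infinity>"
begin

lemma exponents: "1 \<le> p" "1 \<le> q"
  using pq by (auto simp: conjugate_def)

lemma kernel_column_le: "wnorm q (recip w1) (\<lambda>i. K i j) \<le> mixed_norm q \<infinity> kernel_weight K * ennreal (w2 j)"
  using column_norm_le[OF exponents(2) recip_pos order_refl, where K=K and j=j] by (simp add: one_div_recip)

text \<open>Hoelder's inequality, the weight being divided between the two factors.\<close>

lemma kernel_action_abs_le:
  "(\<Sum>\<^sub>\<infinity>i. ennreal (cmod (g i * K i j))) \<le> wnorm p w1 g * mixed_norm q \<infinity> kernel_weight K * ennreal (w2 j)"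
proof -
  have "(\<Sum>\<^sub>\<infinity>i. ennreal (cmod (g i * K i j)))
      = (\<Sum>\<^sub>\<infinity>i. ennreal (cmod (g i) * w1 i) * ennreal (cmod (K i j) * recip w1 i))"
  proof (intro infsum_cong)
    fix i
    have "cmod (g i * K i j) = (cmod (g i) * w1 i) * (cmod (K i j) * recip w1 i)"
      using W1.w_pos[of i] by (simp add: norm_mult recip_def)
    then show "ennreal (cmod (g i * K i j)) = ennreal (cmod (g i) * w1 i) * ennreal (cmod (K i j) * recip w1 i)"
      using W1.w_pos[of i] recip_pos(1)[of i] by (simp add: ennreal_mult)
  qed
  also have "\<dots> \<le> wnorm p w1 g * wnorm q (recip w1) (\<lambda>i. K i j)"
    unfolding wnorm_def by (rule hoelder[OF pq])
  also have "\<dots> \<le> wnorm p w1 g * (mixed_norm q \<infinity> kernel_weight K * ennreal (w2 j))"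
    by (intro mult_left_mono kernel_column_le) simp
  finally show ?thesis by (simp add: mult.assoc)
qed

lemma kernel_action_norm_le_columns:
  assumes B: "abs_bounded p w1 (gram \<Psi>1) B"
  shows "wnorm \<infinity> (recip w2) (kernel_action K f) \<le> ennreal B * mixed_norm q \<infinity> kernel_weight K * wnorm p w1 f"
  unfolding wnorm_infty_le_iff
proof
  fix j
  have "ennreal (cmod (kernel_action K f j)) \<le> (\<Sum>\<^sub>\<infinity>i. ennreal (cmod (G1 f i * K i j)))"
    unfolding kernel_action_def by (rule cmod_infsum_le)
  also have "\<dots> \<le> wnorm p w1 (G1 f) * mixed_norm q \<infinity> kernel_weight K * ennreal (w2 j)"
    by (rule kernel_action_abs_le)
  also have "\<dots> \<le> (ennreal B * wnorm p w1 f) * mixed_norm q \<infinity> kernel_weight K * ennreal (w2 j)"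
    by (intro mult_right_mono wnorm_mat_vec_le[OF B exponents(1) W1.w_pos]) auto
  finally have "ennreal (cmod (kernel_action K f j)) * ennreal (recip w2 j)
      \<le> (ennreal B * wnorm p w1 f) * mixed_norm q \<infinity> kernel_weight K * ennreal (w2 j) * ennreal (recip w2 j)"
    by (rule mult_right_mono) simp
  also have "\<dots> = ennreal B * mixed_norm q \<infinity> kernel_weight K * wnorm p w1 f * (ennreal (w2 j) * ennreal (recip w2 j))"
    by (simp only: mult_ac)
  also have "ennreal (w2 j) * ennreal (recip w2 j) = 1"
    using W2.w_pos[of j] by (simp add: recip_def flip: ennreal_mult)
  finally show "ennreal (cmod (kernel_action K f j) * recip w2 j)
      \<le> ennreal B * mixed_norm q \<infinity> kernel_weight K * wnorm p w1 f"
    using recip_pos(2)[of j] by (simp add: ennreal_mult)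
qed

text \<open>The range is fixed by the projection of \<open>\<Psi>2\<close>, as the rows of \<open>K\<close> are; interchanging the
  sums requires absolute convergence, which is Hoelder's inequality once more.\<close>

lemma kernel_action_in:
  assumes f: "f \<in> coorbit \<Psi>1 p w1"
  shows "kernel_action K f \<in> coorbit \<Psi>2 \<infinity> (recip w2)"
proof -
  note p = exponents(1)
  obtain B where B: "abs_bounded p w1 (gram \<Psi>1) B" using good_weightD[OF good1 F1.gram_in p] by auto
  have fn: "wnorm p w1 f < \<infinity>" using f by (simp add: coorbit1[OF p])
  have "ennreal B * mixed_norm q \<infinity> kernel_weight K * wnorm p w1 f < \<infinity>"
    using fin fn by (simp add: ennreal_mult_less_top less_top)
  then have norm: "wnorm \<infinity> (recip w2) (kernel_action K f) < \<infinity>"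
    using kernel_action_norm_le_columns[OF B, of f] by (auto elim!: order.strict_trans1)
  obtain D where D: "abs_bounded \<infinity> (recip w2) F2.P D" using good_weightD[OF good2r F2.P_in, of \<infinity>] by auto
  let ?x = "\<lambda>l. \<Sum>\<^sub>\<infinity>i. ennreal (cmod (G1 f i * K i l))"
  have "mat_vec F2.P (kernel_action K f) j = kernel_action K f j" for j
  proof -
    have "(\<Sum>\<^sub>\<infinity>l. \<Sum>\<^sub>\<infinity>i. ennreal (cmod (F2.P j l * (G1 f i * K i l)))) = (\<Sum>\<^sub>\<infinity>l. ennreal (cmod (F2.P j l)) * ?x l)"
      by (simp add: norm_mult ennreal_mult mult.assoc infsum_ennreal_cmult)
    also have "\<dots> \<le> ennreal D * (wnorm p w1 (G1 f) * mixed_norm q \<infinity> kernel_weight K) * ennreal (1 / recip w2 j)"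
      by (rule row_sum_le[OF D recip_pos(2)]) (use kernel_action_abs_le in \<open>simp add: one_div_recip\<close>)
    also have "\<dots> < \<infinity>"
      using fin W1.wnorm_mat_vec_finite[OF F1.gram_in p fn] by (simp add: ennreal_mult_less_top less_top)
    finally have abs: "(\<Sum>\<^sub>\<infinity>l. \<Sum>\<^sub>\<infinity>i. ennreal (cmod (F2.P j l * (G1 f i * K i l)))) < \<infinity>" .
    have "mat_vec F2.P (kernel_action K f) j = (\<Sum>\<^sub>\<infinity>l. \<Sum>\<^sub>\<infinity>i. F2.P j l * (G1 f i * K i l))"
      unfolding mat_vec_def[of F2.P] kernel_action_def by (simp only: infsum_cmult_right')
    also have "\<dots> = (\<Sum>\<^sub>\<infinity>i. \<Sum>\<^sub>\<infinity>l. F2.P j l * (G1 f i * K i l))" by (rule infsum_complex_swap[OF abs])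
    also have "\<dots> = (\<Sum>\<^sub>\<infinity>i. G1 f i * mat_vec F2.P (K i) j)"
      unfolding mat_vec_def[of F2.P] by (simp only: mult.left_commute[of "F2.P j _"] infsum_cmult_right')
    finally show ?thesis using K by (simp add: biinvariant_def kernel_action_def)
  qed
  then show ?thesis using norm by (auto simp: R2.coorbit_eq)
qed

lemma kernel_action_linear:
  assumes f: "f \<in> coorbit \<Psi>1 p w1" and g: "g \<in> coorbit \<Psi>1 p w1"
  shows "kernel_action K (\<lambda>i. a * f i + b * g i) = (\<lambda>j. a * kernel_action K f j + b * kernel_action K g j)"
proof
  fix j
  note p = exponents(1)
  have fg: "wnorm p w1 f < \<infinity>" "wnorm p w1 g < \<infinity>" using f g by (simp_all add: coorbit1[OF p])
  have s: "(\<lambda>i. G1 h i * K i j) summable_on UNIV" if "wnorm p w1 h < \<infinity>" for h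
  proof -
    have "wnorm p w1 (G1 h) * mixed_norm q \<infinity> kernel_weight K * ennreal (w2 j) < \<infinity>"
      using fin W1.wnorm_mat_vec_finite[OF F1.gram_in p that] by (simp add: ennreal_mult_less_top less_top)
    then show ?thesis
      unfolding complex_summable_iff_ennreal using kernel_action_abs_le by (rule order.strict_trans1[rotated])
  qed
  have "G1 (\<lambda>i. a * f i + b * g i) = (\<lambda>i. a * G1 f i + b * G1 g i)"
    by (rule W1.mat_vec_linear_in[OF F1.gram_in wbounded_if_wnorm_finite[OF p fg(1)] wbounded_if_wnorm_finite[OF p fg(2)]])
  then have "kernel_action K (\<lambda>i. a * f i + b * g i) j = (\<Sum>\<^sub>\<infinity>i. a * (G1 f i * K i j) + b * (G1 g i * K i j))"
    unfolding kernel_action_def by (intro infsum_cong) (simp add: algebra_simps)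
  also have "\<dots> = a * kernel_action K f j + b * kernel_action K g j"
    unfolding kernel_action_def using s[OF fg(1)] s[OF fg(2)]
    by (simp add: infsum_add summable_on_cmult_right infsum_cmult_right')
  finally show "kernel_action K (\<lambda>i. a * f i + b * g i) j = a * kernel_action K f j + b * kernel_action K g j" .
qed

lemma kernel_action_bounded: "bounded_between \<Psi>1 p w1 \<Psi>2 \<infinity> (recip w2) (kernel_action K)"
proof -
  obtain B where B: "abs_bounded p w1 (gram \<Psi>1) B" using good_weightD[OF good1 F1.gram_in exponents(1)] by auto
  obtain C where C: "ennreal B * mixed_norm q \<infinity> kernel_weight K = ennreal C"
    using fin by (cases "ennreal B * mixed_norm q \<infinity> kernel_weight K") (auto simp: ennreal_mult_eq_top_iff)
  show ?thesis
    unfolding bounded_between_def linear_between_def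
    using kernel_action_in kernel_action_linear kernel_action_norm_le_columns[OF B, unfolded C] by blast
qed

text \<open>For \<open>p = \<infinity>\<close> the columns of the kernel are weighted \<open>l^1\<close> sequences, so bounded
  coefficientwise convergence is dominated convergence.\<close>

lemma kernel_action_preserves_limits:
  assumes "p = \<infinity>"
  shows "preserves_limits \<Psi>1 w1 (kernel_action K)"
  unfolding preserves_limits_def
proof (intro allI impI, elim conjE)
  fix f :: "nat \<Rightarrow> 'i \<Rightarrow> complex" and g j
  assume sup: "(SUP n. wnorm \<infinity> w1 (f n)) < \<infinity>" and lim: "\<forall>i. (\<lambda>n. f n i) \<longlonglongrightarrow> g i"
  have q: "q = 1" using pq assms by (cases rule: conjugate_cases) auto
  let ?M = "SUP n. wnorm \<infinity> w1 (f n)"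
  have le: "wnorm \<infinity> w1 (f n) \<le> ?M" for n by (rule SUP_upper) simp
  obtain B where B: "abs_bounded \<infinity> w1 (gram \<Psi>1) B" using good_weightD[OF good1 F1.gram_in, of \<infinity>] by auto
  show "(\<lambda>n. kernel_action K (f n) j) \<longlonglongrightarrow> kernel_action K g j"
    unfolding kernel_action_def
  proof (rule infsum_dominated_convergence)
    show "(\<lambda>n. G1 (f n) i * K i j) \<longlonglongrightarrow> G1 g i * K i j" for i
      by (intro tendsto_mult tendsto_const W1.mat_vec_tendsto_in[OF F1.gram_in _ le sup]) (use lim in auto)
    show "ennreal (cmod (G1 (f n) i * K i j)) \<le> ennreal B * ?M * ennreal (cmod (K i j) * recip w1 i)" for n i
    proof -
      have "ennreal (cmod (G1 (f n) i)) \<le> wnorm \<infinity> w1 (G1 (f n)) * ennreal (1 / w1 i)"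
        by (rule entry_le_of_wnorm[OF W1.w_pos])
      also have "\<dots> \<le> (ennreal B * ?M) * ennreal (1 / w1 i)"
        using order.trans[OF wnorm_mat_vec_le[OF B _ W1.w_pos] mult_left_mono[OF le]]
        by (intro mult_right_mono) auto
      finally have "ennreal (cmod (G1 (f n) i)) * ennreal (cmod (K i j))
          \<le> (ennreal B * ?M) * ennreal (1 / w1 i) * ennreal (cmod (K i j))"
        by (rule mult_right_mono) simp
      then show ?thesis
        using W1.w_pos[of i] by (simp add: norm_mult ennreal_mult recip_def mult_ac divide_inverse)
    qed
    have "(\<Sum>\<^sub>\<infinity>i. ennreal B * ?M * ennreal (cmod (K i j) * recip w1 i))
        = ennreal B * ?M * wnorm 1 (recip w1) (\<lambda>i. K i j)"
      by (simp only: infsum_ennreal_cmult wnorm_one)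
    also have "\<dots> \<le> ennreal B * ?M * (mixed_norm q \<infinity> kernel_weight K * ennreal (w2 j))"
      using kernel_column_le[of j] unfolding q by (intro mult_left_mono) auto
    also have "\<dots> < \<infinity>" using fin sup by (simp add: ennreal_mult_less_top less_top)
    finally show "(\<Sum>\<^sub>\<infinity>i. ennreal B * ?M * ennreal (cmod (K i j) * recip w1 i)) < \<infinity>" .
  qed
qed

text \<open>Both operators agree on the finite combinations of dual frame vectors. These approximate
  every \<open>f\<close>, in norm for finite \<open>p\<close> and boundedly and coefficientwise for \<open>p = \<infinity>\<close>, and both
  operators respect the respective convergence.\<close>

lemma limit_extension_eq:
  assumes S: "\<And>f. f \<in> coorbit \<Psi>1 1 w1 \<Longrightarrow> S f = kernel_action K f"
    and T: "limit_extension \<Psi>1 p w1 \<Psi>2 \<infinity> (recip w2) S T" and f: "f \<in> coorbit \<Psi>1 p w1"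
  shows "T f = kernel_action K f"
proof
  fix j
  note p = exponents(1)
  let ?f = "\<lambda>n. combine (truncate n (G1 f))"
  have bT: "bounded_between \<Psi>1 p w1 \<Psi>2 \<infinity> (recip w2) T" and TS: "\<And>f. f \<in> coorbit \<Psi>1 1 w1 \<Longrightarrow> T f = S f"
    and pT: "p = \<infinity> \<Longrightarrow> preserves_limits \<Psi>1 w1 T"
    using T unfolding limit_extension_def bounded_extension_def by auto
  have g: "wnorm p w1 (G1 f) < \<infinity>" "combine (G1 f) = f" using combine_gram[OF p f] by auto
  have lim: "(\<lambda>n. R (?f n) j) \<longlonglongrightarrow> R f j"
    if bR: "bounded_between \<Psi>1 p w1 \<Psi>2 \<infinity> (recip w2) R" and pR: "p = \<infinity> \<Longrightarrow> preserves_limits \<Psi>1 w1 R" for R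
  proof (cases "p = \<infinity>")
    case False
    from bounded_truncate_tendsto[OF p False bR g(1), of j] show ?thesis unfolding g(2) .
  next
    case True
    have gb: "wnorm \<infinity> w1 (G1 f) < \<infinity>" using g(1) by (simp only: True)
    obtain B where B: "abs_bounded \<infinity> w1 F1.dual_gram B" using good_weightD[OF good1 F1.dual_gram_in, of \<infinity>] by auto
    have in1: "?f n \<in> coorbit \<Psi>1 \<infinity> w1" for n by (rule combine_in[OF _ wnorm_truncate_finite]) auto
    have "(SUP n. wnorm \<infinity> w1 (?f n)) \<le> ennreal B * wnorm \<infinity> w1 (G1 f)"
    proof (rule SUP_least)
      fix n
      have "wnorm \<infinity> w1 (?f n) \<le> ennreal B * wnorm \<infinity> w1 (truncate n (G1 f))"
        unfolding combine_def by (rule wnorm_mat_vec_le[OF B _ W1.w_pos]) simp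
      also have "\<dots> \<le> ennreal B * wnorm \<infinity> w1 (G1 f)"
        by (intro mult_left_mono wnorm_truncate_le W1.w_pos) auto
      finally show "wnorm \<infinity> w1 (?f n) \<le> ennreal B * wnorm \<infinity> w1 (G1 f)" .
    qed
    also have "\<dots> < \<infinity>" using gb by (simp add: ennreal_mult_less_top less_top)
    finally have sup: "(SUP n. wnorm \<infinity> w1 (?f n)) < \<infinity>" .
    have pw: "(\<lambda>n. ?f n i) \<longlonglongrightarrow> f i" for i
    proof -
      have "(\<lambda>n. ?f n i) \<longlonglongrightarrow> combine (G1 f) i"
        unfolding combine_def
        by (rule W1.mat_vec_tendsto_in[OF F1.dual_gram_in truncate_tendsto, where N=0 and K="wnorm \<infinity> w1 (G1 f)"])
          (use gb wnorm_truncate_le[of \<infinity> w1 _ "G1 f"] W1.w_pos in auto)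
      then show ?thesis by (simp only: g(2))
    qed
    have "f \<in> coorbit \<Psi>1 \<infinity> w1" using f by (simp only: True)
    then show ?thesis
      using pR[OF True, unfolded preserves_limits_def, THEN spec[of _ ?f], THEN spec[of _ f]] in1 sup pw by blast
  qed
  have "T (?f n) = kernel_action K (?f n)" for n
    using TS S combine_in[OF order_refl wnorm_truncate_finite[OF order_refl]] by simp
  then show "T f j = kernel_action K f j"
    using lim[OF bT pT] lim[OF kernel_action_bounded kernel_action_preserves_limits]
    by (simp add: LIMSEQ_unique)
qed

end

end

theorem theorem4p4:
  fixes p q :: ennreal
    and \<Psi>1 :: "'i::countable \<Rightarrow> 'h1::{complex_hilbert, second_countable_topology}"
    and \<Psi>2 :: "'j::countable \<Rightarrow> 'h2::{complex_hilbert, second_countable_topology}"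
    and tens :: "'h1 \<Rightarrow> 'h2 \<Rightarrow> 't::complex_hilbert"
    and \<A>1 :: "'i cmatrix set" and nA1 :: "'i cmatrix \<Rightarrow> real"
    and \<A>2 :: "'j cmatrix set" and nA2 :: "'j cmatrix \<Rightarrow> real"
    and w1 :: "'i \<Rightarrow> real" and w2 :: "'j \<Rightarrow> real"
  assumes "1 \<le> p" and "1 \<le> q" and "1 / p + 1 / q = 1"
    and "hilbert_tensor tens"
    and "spectral_matrix_algebra \<A>1 nA1" and "spectral_matrix_algebra \<A>2 nA2"
    and "localised_frame \<A>1 \<Psi>1" and "localised_frame \<A>2 \<Psi>2"
    and "admissible_weight \<A>1 w1" and "admissible_weight \<A>2 w2"
  shows
    "(\<comment> \<open>(i)\<close> \<exists>C\<ge>1::real. \<forall>S.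
       linear_between (coorbit \<Psi>1 1 w1) (coorbit \<Psi>2 \<infinity> (recip w2)) S \<longrightarrow>
       (bounded_between \<Psi>1 1 w1 \<Psi>2 p (recip w2) S \<longrightarrow>
          (\<exists>!K. is_kernel tens \<Psi>1 w1 \<Psi>2 w2 S K)) \<and>
       (\<forall>K k. is_kernel tens \<Psi>1 w1 \<Psi>2 w2 S K \<and> k = galerkin \<Psi>1 \<Psi>2 w2 S \<longrightarrow>
          (bounded_between \<Psi>1 1 w1 \<Psi>2 p (recip w2) S \<longleftrightarrow>
             K \<in> coorbit2_inf_fr tens \<Psi>1 \<Psi>2 p (recip2 (tensor_weight w1 w2))) \<and>
          (bounded_between \<Psi>1 1 w1 \<Psi>2 p (recip w2) S \<longleftrightarrow>
             k \<in> lpq_fr p \<infinity> (recip2 (tensor_weight w1 w2))) \<and>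
          (bounded_between \<Psi>1 1 w1 \<Psi>2 p (recip w2) S \<longrightarrow>
             ennreal (1 / C) * mixed_norm_fr p \<infinity> (recip2 (tensor_weight w1 w2)) K
               \<le> operator_norm \<Psi>1 1 w1 p (recip w2) S \<and>
             operator_norm \<Psi>1 1 w1 p (recip w2) S
               \<le> ennreal C * mixed_norm_fr p \<infinity> (recip2 (tensor_weight w1 w2)) K \<and>
             mixed_norm_fr p \<infinity> (recip2 (tensor_weight w1 w2)) K
               = mixed_norm_fr p \<infinity> (recip2 (tensor_weight w1 w2)) k)))
     \<and>
     (\<comment> \<open>(ii)\<close> \<exists>C\<ge>1::real. \<forall>S.
       linear_between (coorbit \<Psi>1 1 w1) (coorbit \<Psi>2 \<infinity> (recip w2)) S \<longrightarrow>
       ((\<exists>T. bounded_extension \<Psi>1 p w1 \<Psi>2 \<infinity> (recip w2) S T) \<longrightarrow>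
          (\<exists>!K. is_kernel tens \<Psi>1 w1 \<Psi>2 w2 S K) \<and>
          (\<exists>T. limit_extension \<Psi>1 p w1 \<Psi>2 \<infinity> (recip w2) S T)) \<and>
       (\<forall>K k. is_kernel tens \<Psi>1 w1 \<Psi>2 w2 S K \<and> k = galerkin \<Psi>1 \<Psi>2 w2 S \<longrightarrow>
          ((\<exists>T. bounded_extension \<Psi>1 p w1 \<Psi>2 \<infinity> (recip w2) S T) \<longleftrightarrow>
             K \<in> coorbit2_inf tens \<Psi>1 \<Psi>2 q (recip2 (tensor_weight w1 w2))) \<and>
          ((\<exists>T. bounded_extension \<Psi>1 p w1 \<Psi>2 \<infinity> (recip w2) S T) \<longleftrightarrow>
             k \<in> lpq q \<infinity> (recip2 (tensor_weight w1 w2))) \<and>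
          (\<forall>T. bounded_extension \<Psi>1 p w1 \<Psi>2 \<infinity> (recip w2) S T \<longrightarrow>
             ennreal (1 / C) * mixed_norm q \<infinity> (recip2 (tensor_weight w1 w2)) K
               \<le> operator_norm \<Psi>1 p w1 \<infinity> (recip w2) T \<and>
             mixed_norm q \<infinity> (recip2 (tensor_weight w1 w2)) K
               = mixed_norm q \<infinity> (recip2 (tensor_weight w1 w2)) k) \<and>
          (\<forall>T. limit_extension \<Psi>1 p w1 \<Psi>2 \<infinity> (recip w2) S T \<longrightarrow>
             operator_norm \<Psi>1 p w1 \<infinity> (recip w2) T
               \<le> ennreal C * mixed_norm q \<infinity> (recip2 (tensor_weight w1 w2)) K)))"
proof -
  have pq: "conjugate p q" using assms(1-3) by (simp add: conjugate_def)
  have p: "1 \<le> p" and q: "1 \<le> q" by (rule assms(1), rule assms(2))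
  have frame: "\<exists>A B. framed \<Psi> A B" if "localised_frame \<A> \<Psi>" for \<A> and \<Psi> :: "'k::countable \<Rightarrow> 'h::complex_hilbert"
    using that unfolding localised_frame_def frame_def framed_def by blast
  obtain A1 B1 where f1: "framed \<Psi>1 A1 B1" using frame[OF assms(7)] by blast
  obtain A2 B2 where f2: "framed \<Psi>2 A2 B2" using frame[OF assms(8)] by blast
  interpret kernel_setting \<Psi>1 A1 B1 \<A>1 nA1 \<Psi>2 A2 B2 \<A>2 nA2 tens w1 w2
    unfolding kernel_setting_def kernel_setting_axioms_def tensor_pair_def tensor_pair_axioms_def
      localised_def localised_axioms_def
    using f1 f2 assms(4-10) admissible_weight_good[OF assms(5,9)] admissible_weight_good[OF assms(6,10)]
    by (auto simp: localised_frame_def)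
  have r: "recip2 (tensor_weight w1 w2) = kernel_weight" by (rule recip2_kernel_weight)
  \<comment> \<open>passing from one-sided estimates to the constant of the theorem\<close>
  have lower: "ennreal (1 / C) * x \<le> y" if "x \<le> ennreal b * y" "b \<le> C" "1 \<le> C" for b C :: real and x y :: ennreal
  proof -
    have "ennreal (1 / C) * x \<le> ennreal (1 / C) * (ennreal C * y)"
      using that by (intro mult_left_mono order.trans[OF that(1)] mult_right_mono ennreal_leI) auto
    also have "\<dots> = y" using that(3) by (simp add: mult.assoc[symmetric] flip: ennreal_mult)
    finally show ?thesis .
  qed
  have upper: "operator_norm \<Psi>1 s w1 t (recip w2) T \<le> ennreal C * \<kappa>"
    if "\<And>f. f \<in> coorbit \<Psi>1 s w1 \<Longrightarrow> wnorm t (recip w2) (T f) \<le> ennreal b * \<kappa> * wnorm s w1 f" "b \<le> C"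
    for s t T b C \<kappa>
    unfolding operator_norm_def
  proof (rule SUP_least)
    fix f assume f: "f \<in> {f \<in> coorbit \<Psi>1 s w1. wnorm s w1 f \<le> 1}"
    have "wnorm t (recip w2) (T f) \<le> ennreal b * \<kappa> * wnorm s w1 f" using that(1) f by blast
    also have "\<dots> \<le> ennreal C * \<kappa> * 1" using f that(2) by (intro mult_mono ennreal_leI) auto
    finally show "wnorm t (recip w2) (T f) \<le> ennreal C * \<kappa>" by simp
  qed
  obtain D where D: "abs_bounded 1 w1 F1.dual_gram D" using good_weightD[OF good1 F1.dual_gram_in, of 1] by auto
  obtain E where E: "abs_bounded 1 w1 (gram \<Psi>1) E" using good_weightD[OF good1 F1.gram_in, of 1] by auto
  obtain D' where D': "abs_bounded p w1 F1.dual_gram D'" using good_weightD[OF good1 F1.dual_gram_in p] by auto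
  obtain E' where E': "abs_bounded p w1 (gram \<Psi>1) E'" using good_weightD[OF good1 F1.gram_in p] by auto
  \<comment> \<open>one constant that dominates the bounds of the Gram matrices of frame and dual frame in both parts\<close>
  define C where "C = Max {1, D, E, D', E'}"
  have C: "1 \<le> C" "D \<le> C" "E \<le> C" "D' \<le> C" "E' \<le> C" unfolding C_def by auto
  show ?thesis
    unfolding r
  proof (intro conjI exI[of _ C] allI impI C(1))
    \<comment> \<open>operators on \<open>coorbit \<Psi>1 1 w1\<close>\<close>
    fix S
    assume S: "linear_between (coorbit \<Psi>1 1 w1) (coorbit \<Psi>2 \<infinity> (recip w2)) S"
    show "\<exists>!K. is_kernel tens \<Psi>1 w1 \<Psi>2 w2 S K" if "bounded_between \<Psi>1 1 w1 \<Psi>2 p (recip w2) S"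
      by (rule kernel_exists_unique[OF bounded_into_infty[OF p that]])
    fix K k assume Kk: "is_kernel tens \<Psi>1 w1 \<Psi>2 w2 S K \<and> k = galerkin \<Psi>1 \<Psi>2 w2 S"
    then have K: "is_kernel tens \<Psi>1 w1 \<Psi>2 w2 S K" and k: "k = K" using kernel_eq_galerkin[OF S] by auto
    have bounded: "bounded_between \<Psi>1 1 w1 \<Psi>2 p (recip w2) S \<longleftrightarrow> mixed_norm_fr p \<infinity> kernel_weight K < \<infinity>"
      by (rule bounded_iff_rows[OF p S K])
    show "bounded_between \<Psi>1 1 w1 \<Psi>2 p (recip w2) S \<longleftrightarrow> K \<in> coorbit2_inf_fr tens \<Psi>1 \<Psi>2 p kernel_weight"
      unfolding bounded using coorbit2_inf_frI[OF good1r good2r p is_kernelD(1)[OF K]] coorbit2_inf_fr_norm[OF p] by blast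
    show "bounded_between \<Psi>1 1 w1 \<Psi>2 p (recip w2) S \<longleftrightarrow> k \<in> lpq_fr p \<infinity> kernel_weight"
      unfolding bounded k lpq_fr_def by simp
    show "mixed_norm_fr p \<infinity> kernel_weight K = mixed_norm_fr p \<infinity> kernel_weight k" by (simp only: k)
    have "mixed_norm_fr p \<infinity> kernel_weight K \<le> ennreal D * operator_norm \<Psi>1 1 w1 p (recip w2) S"
      by (rule row_norm_le_operator_norm[OF p S _ D]) (simp add: kernel_eq_galerkin[OF S K] galerkin_eq[OF S])
    then show "ennreal (1 / C) * mixed_norm_fr p \<infinity> kernel_weight K \<le> operator_norm \<Psi>1 1 w1 p (recip w2) S"
      by (rule lower[OF _ C(2,1)])
    show "operator_norm \<Psi>1 1 w1 p (recip w2) S \<le> ennreal C * mixed_norm_fr p \<infinity> kernel_weight K"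
      by (rule upper[OF _ C(3)]) (simp only: operator_eq_kernel_action[OF S K] kernel_action_norm_le_rows[OF p E])
  next
    \<comment> \<open>operators into \<open>coorbit \<Psi>2 \<infinity> (recip w2)\<close>\<close>
    fix S
    assume S: "linear_between (coorbit \<Psi>1 1 w1) (coorbit \<Psi>2 \<infinity> (recip w2)) S"
    have lin: "linear_between (coorbit \<Psi>1 p w1) (coorbit \<Psi>2 \<infinity> (recip w2)) T" "\<And>f. f \<in> coorbit \<Psi>1 1 w1 \<Longrightarrow> T f = S f"
      if "bounded_extension \<Psi>1 p w1 \<Psi>2 \<infinity> (recip w2) S T" for T
      using that unfolding bounded_extension_def bounded_between_def by auto
    have columns: "mixed_norm q \<infinity> kernel_weight K \<le> ennreal D' * operator_norm \<Psi>1 p w1 \<infinity> (recip w2) T"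
      if K: "is_kernel tens \<Psi>1 w1 \<Psi>2 w2 S K" and T: "bounded_extension \<Psi>1 p w1 \<Psi>2 \<infinity> (recip w2) S T" for K T
      by (rule column_norm_le_operator_norm[OF pq lin(1)[OF T] _ D'])
        (simp add: kernel_eq_galerkin[OF S K] galerkin_eq[OF S] lin(2)[OF T atom1_in[OF order_refl]])
    have finite_columns: "mixed_norm q \<infinity> kernel_weight K < \<infinity>"
      if K: "is_kernel tens \<Psi>1 w1 \<Psi>2 w2 S K" and T: "bounded_extension \<Psi>1 p w1 \<Psi>2 \<infinity> (recip w2) S T" for K T
    proof -
      have "bounded_between \<Psi>1 p w1 \<Psi>2 \<infinity> (recip w2) T" using T by (simp add: bounded_extension_def)
      then have "ennreal D' * operator_norm \<Psi>1 p w1 \<infinity> (recip w2) T < \<infinity>"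
        using operator_norm_finite by (auto simp: ennreal_mult_less_top less_top)
      with columns[OF K T] show ?thesis by (rule order.strict_trans1)
    qed
    have extension: "limit_extension \<Psi>1 p w1 \<Psi>2 \<infinity> (recip w2) S (kernel_action K)"
      if K: "is_kernel tens \<Psi>1 w1 \<Psi>2 w2 S K" and fin: "mixed_norm q \<infinity> kernel_weight K < \<infinity>" for K
      unfolding limit_extension_def bounded_extension_def
      using kernel_action_bounded[OF pq is_kernelD(1)[OF K] fin] operator_eq_kernel_action[OF S K]
        kernel_action_preserves_limits[OF pq is_kernelD(1)[OF K] fin] by simp
    {
      assume "\<exists>T. bounded_extension \<Psi>1 p w1 \<Psi>2 \<infinity> (recip w2) S T"
      then obtain T where T: "bounded_extension \<Psi>1 p w1 \<Psi>2 \<infinity> (recip w2) S T" by blast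
      then obtain b where b: "\<And>f. f \<in> coorbit \<Psi>1 p w1 \<Longrightarrow> wnorm \<infinity> (recip w2) (T f) \<le> ennreal b * wnorm p w1 f"
        unfolding bounded_extension_def bounded_between_def by blast
      have "wnorm \<infinity> (recip w2) (S f) \<le> ennreal b * wnorm 1 w1 f" if f: "f \<in> coorbit \<Psi>1 1 w1" for f
      proof -
        have "f \<in> coorbit \<Psi>1 p w1" using f W1.coorbit_mono[OF p] by blast
        then have "wnorm \<infinity> (recip w2) (S f) \<le> ennreal b * wnorm p w1 f" using b lin(2)[OF T f] by metis
        also have "\<dots> \<le> ennreal b * wnorm 1 w1 f" by (intro mult_left_mono wnorm_le_wnorm_one[OF p]) simp
        finally show ?thesis .
      qed
      then have "bounded_between \<Psi>1 1 w1 \<Psi>2 \<infinity> (recip w2) S" using S unfolding bounded_between_def by blast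
      then show ex: "\<exists>!K. is_kernel tens \<Psi>1 w1 \<Psi>2 w2 S K" by (rule kernel_exists_unique)
      then show "\<exists>T. limit_extension \<Psi>1 p w1 \<Psi>2 \<infinity> (recip w2) S T"
        using extension finite_columns[OF _ T] by blast
    }
    fix K k assume Kk: "is_kernel tens \<Psi>1 w1 \<Psi>2 w2 S K \<and> k = galerkin \<Psi>1 \<Psi>2 w2 S"
    then have K: "is_kernel tens \<Psi>1 w1 \<Psi>2 w2 S K" and k: "k = K" using kernel_eq_galerkin[OF S] by auto
    have bounded: "(\<exists>T. bounded_extension \<Psi>1 p w1 \<Psi>2 \<infinity> (recip w2) S T) \<longleftrightarrow> mixed_norm q \<infinity> kernel_weight K < \<infinity>"
      using finite_columns[OF K] extension[OF K] unfolding limit_extension_def by blast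
    show "(\<exists>T. bounded_extension \<Psi>1 p w1 \<Psi>2 \<infinity> (recip w2) S T) \<longleftrightarrow> K \<in> coorbit2_inf tens \<Psi>1 \<Psi>2 q kernel_weight"
      unfolding bounded using coorbit2_infI[OF good1r good2r q is_kernelD(1)[OF K]] coorbit2_inf_norm[OF q] by blast
    show "(\<exists>T. bounded_extension \<Psi>1 p w1 \<Psi>2 \<infinity> (recip w2) S T) \<longleftrightarrow> k \<in> lpq q \<infinity> kernel_weight"
      unfolding bounded k lpq_def by simp
    show "mixed_norm q \<infinity> kernel_weight K = mixed_norm q \<infinity> kernel_weight k" by (simp only: k)
    show "ennreal (1 / C) * mixed_norm q \<infinity> kernel_weight K \<le> operator_norm \<Psi>1 p w1 \<infinity> (recip w2) T"
      if "bounded_extension \<Psi>1 p w1 \<Psi>2 \<infinity> (recip w2) S T" for T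
      by (rule lower[OF columns[OF K that] C(4,1)])
    show "operator_norm \<Psi>1 p w1 \<infinity> (recip w2) T \<le> ennreal C * mixed_norm q \<infinity> kernel_weight K"
      if T: "limit_extension \<Psi>1 p w1 \<Psi>2 \<infinity> (recip w2) S T" for T
    proof (rule upper[OF _ C(5)])
      fix f assume f: "f \<in> coorbit \<Psi>1 p w1"
      have fin: "mixed_norm q \<infinity> kernel_weight K < \<infinity>"
        using finite_columns[OF K] T unfolding limit_extension_def by blast
      have "T f = kernel_action K f"
        by (rule limit_extension_eq[OF pq is_kernelD(1)[OF K] fin _ T f]) (rule operator_eq_kernel_action[OF S K])
      then show "wnorm \<infinity> (recip w2) (T f) \<le> ennreal E' * mixed_norm q \<infinity> kernel_weight K * wnorm p w1 f"
        by (simp only: kernel_action_norm_le_columns[OF pq is_kernelD(1)[OF K] fin E'])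
    qed
  qed
qed

end
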